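(* Let $\mathbb{D}=\mathbb{D}(I;\mathbb{R}^d)$ be endowed with a regular topology that is weaker than Jakubowski's $S$-topology and stronger than the Meyer-Zheng topology. Let $\mathcal{M}$ be a set of supermartingale measures on $\mathbb{D}$ satisfying the condition (UI), that is, $$\sup_{Q\in\mathcal{M}}\sup_{t\in I}\Big(E_Q[|X_t|]+\sup_{H\in\mathcal{E}(Q)}E_Q[(H\bullet X)_t]\Big)<\infty$$ and $$\lim_{c\rightarrow\infty}\sup_{Q\in\mathcal{M}}E_Q\big[X^{-}_t\mathbf{1}_{\{X^{-}_t>c\}}\big]=0\quad\text{for all }t\in I.$$ Then the sequential closure $[\mathcal{M}]_{seq}$ of $\mathcal{M}$ in the weak${}^*$ topology is a weak${}^*$ compact and sequentially weak${}^*$ compact set of supermartingale measures.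
   Context: Canonical space. $I$ is $[0,T]$ with $0<T\le\infty$, or $I=[0,\infty)$; $d\in\mathbb{N}$; $T:=\sup I$. $\mathbb{D}(I;\mathbb{R}^d)$ is the set of c\`adl\`ag functions $\omega=(\omega^1,\dots,\omega^d):I\to\mathbb{R}^d$; $\mathbb{D}([0,\infty];\mathbb{R}^d)$ is regarded as the product $\mathbb{D}([0,\infty);\mathbb{R}^d)\times\mathbb{R}^d$ (and topologies on it as product topologies with the Euclidean topology on $\mathbb{R}^d$). $X$ is the canonical process, $X_t(\omega)=\omega(t)$, with coordinates $X^i$. For $x\in\mathbb{R}^d$, $|x|=|x_1|+\dots+|x_d|$ and $x^-=x_1^-+\dots+x_d^-$ with $x_i^-=-(x_i\wedge 0)$. $\mathcal{F}^o_t=\sigma(X_s:s\le t)$, $\mathcal{F}_t=\bigcap_{\varepsilon>0}\mathcal{F}^o_{t+\varepsilon}$ is its right-continuous version, and $\mathcal{F}_T=\bigvee_{t\in I}\mathcal{F}^o_t$. A probability measure $Q$ on $(\mathbb{D},\mathcal{F}_T)$ is a supermartingale measure if $X$ (i.e. each coordinate $X^i$) is a supermartingale on $(\mathbb{D},\mathcal{F}_T,(\mathcal{F}_t)_{t\in I},Q)$. Elementary integrands. $\mathcal{E}(Q)$ is the family of $H=(H^1,\dots,H^d)$ with $H^i=H^i_0\mathbf{1}_{\{0\}}+\sum_{k=1}^n H^i_{t^i_{k-1}}\mathbf{1}_{(t^i_{k-1},t^i_k]}$, where $n\in\mathbb{N}$, $0=t^i_0\le t^i_1\le\dots\le t^i_n$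 in $I$, and each $H^i_{t^i_k}$ is an $\mathcal{F}_{t^i_k}$-measurable random variable in $L^\infty(Q)$ with $|H^i_{t^i_k}|\le 1$. $(H\bullet X)_t=\sum_{i=1}^d\big(H^i_0X^i_0+\sum_{k=1}^n H^i_{t^i_{k-1}}(X^i_{t^i_k\wedge t}-X^i_{t^i_{k-1}\wedge t})\big)$. Topologies. "Weaker"/"stronger" are meant in the wide sense (equality allowed); regular means Hausdorff and $T_3$. $S$-topology: on $\mathbb{D}([0,T];\mathbb{R}^d)$, $T<\infty$, write $\omega_n\to_S\omega_0$ if for every $i\le d$ and $\varepsilon>0$ there are functions $(\nu_n^{i,\varepsilon})_{n\ge 0}$ of finite variation on $[0,T]$ with $\|\omega_n^i-\nu_n^{i,\varepsilon}\|_\infty\le\varepsilon$ for all $n\ge0$ and $\nu_n^{i,\varepsilon}\to\nu_0^{i,\varepsilon}$ in the weak${}^*$ topology obtained by identifying finite-variation functions on $[0,T]$ with the Banach dual of $C([0,T])$. On $\mathbb{D}([0,\infty);\mathbb{R}^d)$, write $\omega_n\to_S\omega_0$ if for every $i\le d$ there are positive reals $T^r\uparrow\infty$ such that the restrictions of $\omega^i_n$ to $[0,T^r]$ $S$-converge to the restriction of $\omega_0^i$ for every $r$. The $S$-topology is the sequential topology generated by subsequential $S$-convergence: a set is closed iff it contains the limit $\omega_0$ of every sequence of its elements such that each subsequence has a further subsequence $S$-converging to $\omega_0$. Meyer-Zheng topology: the topology of the convergence $\int_I f(t,\omega_n^i(t))e^{-t}dt\to\int_I f(t,\omega^i(t))e^{-t}dt$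 for all bounded continuous $f$ on $I\times\mathbb{R}$ and all $i\le d$, together with $\omega_n(T)\to\omega(T)$ if $I=[0,T]$. Measures. When $\mathbb{D}$ is endowed with a regular topology that is weaker than the $S$-topology and stronger than the Meyer-Zheng topology, the Borel $\sigma$-algebra of $\mathbb{D}$ equals $\mathcal{F}_T$. $\mathbb{M}(\mathbb{D})$ is the space of countably additive (signed) Borel measures of finite total variation, $\mathbb{P}(\mathbb{D})$ the subset of probability measures. The weak${}^*$ topology on $\mathbb{M}(\mathbb{D})$ is generated by the seminorms $\mu\mapsto|\int f\,d\mu|$, $f$ bounded continuous on $\mathbb{D}$. The sequential closure $[Z]_{seq}$ of $Z$ is the set of all limits of weak${}^*$ convergent sequences of elements of $Z$. Sequentially compact: every sequence in the set has a subsequence converging to an element of the set. *)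

theory Defs
  imports "HOL-Probability.Probability"
begin

section \<open>Signed measures and the weak* topology\<close>

text \<open>
  A signed measure on the sigma-algebra of \<open>M\<close> is a real-valued set function, normalised to vanish
  outside \<open>sets M\<close>.  For a finite measure \<open>Q\<close> the set function \<^term>\<open>measure Q\<close> follows the same
  convention.  Only the sigma-algebra of \<open>M\<close> matters.
\<close>

definition signed_measures :: "'a measure \<Rightarrow> ('a set \<Rightarrow> real) set" where
  "signed_measures M = {\<mu>.
     (\<forall>A. A \<notin> sets M \<longrightarrow> \<mu> A = 0) \<and>
     (\<forall>A::nat \<Rightarrow> 'a set. range A \<subseteq> sets M \<and> disjoint_family A \<longrightarrow> (\<lambda>n. \<mu> (A n)) sums \<mu> (\<Union>n. A n)) \<and>
     bdd_above {\<Sum>A\<in>P. \<bar>\<mu> A\<bar> | P. finite P \<and> P \<subseteq> sets M \<and> disjoint P}}"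

text \<open>
  Positive part of the Jordan decomposition, $\mu^+(A) = \sup_{B \subseteq A} \mu(B)$; the truncation
  by \<^const>\<open>ennreal\<close> is harmless because \<open>B = {}\<close> is allowed.  The negative part is the positive
  part of \<open>-\<mu>\<close>.
\<close>

definition positive_part :: "'a measure \<Rightarrow> ('a set \<Rightarrow> real) \<Rightarrow> 'a measure" where
  "positive_part M \<mu> =
     measure_of (space M) (sets M) (\<lambda>A. SUP B\<in>{B \<in> sets M. B \<subseteq> A}. ennreal (\<mu> B))"

definition signed_integral :: "'a measure \<Rightarrow> ('a set \<Rightarrow> real) \<Rightarrow> ('a \<Rightarrow> real) \<Rightarrow> real" where
  "signed_integral M \<mu> f =
     (\<integral>x. f x \<partial>positive_part M \<mu>) - (\<integral>x. f x \<partial>positive_part M (\<lambda>A. - \<mu> A))"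

definition borel_of :: "'a topology \<Rightarrow> 'a measure" where
  "borel_of \<tau> = sigma (topspace \<tau>) {U. openin \<tau> U}"

definition bounded_continuous :: "'a topology \<Rightarrow> ('a \<Rightarrow> real) set" where
  "bounded_continuous \<tau> = {f. continuous_map \<tau> euclideanreal f \<and> bounded (f ` topspace \<tau>)}"

text \<open>
  The seminorm \<open>\<mu> \<mapsto> \<bar>\<integral>f d\<mu>\<bar>\<close>, evaluated at a difference, is \<open>\<bar>\<integral>f d\<mu> - \<integral>f d\<nu>\<bar>\<close>; the subbasic
  sets are its open balls.
\<close>

definition weak_star :: "'a topology \<Rightarrow> ('a set \<Rightarrow> real) topology" where
  "weak_star \<tau> = topology_generated_by
     {{\<mu> \<in> signed_measures (borel_of \<tau>).
        \<bar>signed_integral (borel_of \<tau>) \<mu> f - signed_integral (borel_of \<tau>) \<nu> f\<bar> < \<epsilon>} | f \<nu> \<epsilon>.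
        f \<in> bounded_continuous \<tau> \<and> \<nu> \<in> signed_measures (borel_of \<tau>) \<and> 0 < \<epsilon>}"

definition seq_closure :: "'a topology \<Rightarrow> 'a set \<Rightarrow> 'a set" where
  "seq_closure \<tau> Z = {x. \<exists>s. range s \<subseteq> Z \<and> limitin \<tau> s x sequentially}"

definition seq_compactin :: "'a topology \<Rightarrow> 'a set \<Rightarrow> bool" where
  "seq_compactin \<tau> K \<longleftrightarrow> K \<subseteq> topspace \<tau> \<and>
     (\<forall>s. range s \<subseteq> K \<longrightarrow>
        (\<exists>x\<in>K. \<exists>r::nat \<Rightarrow> nat. strict_mono r \<and> limitin \<tau> (s \<circ> r) x sequentially))"


section \<open>The path space\<close>

text \<open>
  Time is extended-real valued, so that \<open>[0,T]\<close>, \<open>[0,\<infinity>]\<close> and \<open>[0,\<infinity>)\<close> are treated together.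
  Paths are extensional: they take the value \<^const>\<open>undefined\<close> outside \<open>I\<close>.
\<close>

type_synonym 'd path = "ereal \<Rightarrow> real^'d"

definition time_interval :: "ereal set \<Rightarrow> bool" where
  "time_interval I \<longleftrightarrow> (\<exists>T>0. I = {0..T}) \<or> I = {0..<\<infinity>}"

text \<open>
  The space over \<open>[0,\<infinity>]\<close> is the product of the space over \<open>[0,\<infinity>)\<close> with \<open>\<real>\<^sup>d\<close>,
  hence no left limit is required at \<open>\<infinity>\<close>.
\<close>

definition cadlag_paths :: "ereal set \<Rightarrow> ('d::finite) path set" where
  "cadlag_paths I = {\<omega> \<in> extensional I.
     (\<forall>t\<in>I. (\<omega> \<longlongrightarrow> \<omega> t) (at t within I \<inter> {t<..})) \<and>
     (\<forall>t\<in>I. t \<noteq> \<infinity> \<longrightarrow> (\<exists>l. (\<omega> \<longlongrightarrow> l) (at t within I \<inter> {..<t})))}"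


section \<open>The S-topology\<close>

definition finite_variation :: "real \<Rightarrow> (real \<Rightarrow> real) \<Rightarrow> bool" where
  "finite_variation T \<nu> \<longleftrightarrow>
     (\<exists>C. \<forall>(t::nat \<Rightarrow> real) n. incseq t \<and> range t \<subseteq> {0..T} \<longrightarrow>
        (\<Sum>j<n. \<bar>\<nu> (t (Suc j)) - \<nu> (t j)\<bar>) \<le> C)"

text \<open>
  The identification of finite-variation functions with $C([0,T])^*$: \<open>\<nu>\<close> is normalised to be
  right-continuous and corresponds to the unique signed measure \<open>m\<close> with \<open>m [0,t] = \<nu> t\<close>, which
  has the atom \<open>\<nu> 0\<close> at \<open>0\<close>.
\<close>

definition represents :: "real \<Rightarrow> (real set \<Rightarrow> real) \<Rightarrow> (real \<Rightarrow> real) \<Rightarrow> bool" where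
  "represents T m \<nu> \<longleftrightarrow>
     m \<in> signed_measures (restrict_space borel {0..T}) \<and> (\<forall>t\<in>{0..T}. m {0..t} = \<nu> t)"

definition fv_weak_star_conv :: "real \<Rightarrow> (nat \<Rightarrow> real \<Rightarrow> real) \<Rightarrow> (real \<Rightarrow> real) \<Rightarrow> bool" where
  "fv_weak_star_conv T \<nu> \<nu>\<^sub>0 \<longleftrightarrow>
     (\<exists>m m\<^sub>0. (\<forall>n. represents T (m n) (\<nu> n)) \<and> represents T m\<^sub>0 \<nu>\<^sub>0 \<and>
       (\<forall>f. continuous_on {0..T} f \<longrightarrow>
          (\<lambda>n. signed_integral (restrict_space borel {0..T}) (m n) f)
            \<longlonglongrightarrow> signed_integral (restrict_space borel {0..T}) m\<^sub>0 f))"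

definition S_conv_real :: "real \<Rightarrow> (nat \<Rightarrow> real \<Rightarrow> real) \<Rightarrow> (real \<Rightarrow> real) \<Rightarrow> bool" where
  "S_conv_real T x x\<^sub>0 \<longleftrightarrow>
     (\<forall>\<epsilon>>0. \<exists>\<nu> \<nu>\<^sub>0.
        (\<forall>n. finite_variation T (\<nu> n)) \<and> finite_variation T \<nu>\<^sub>0 \<and>
        (\<forall>n. \<forall>t\<in>{0..T}. \<bar>x n t - \<nu> n t\<bar> \<le> \<epsilon>) \<and> (\<forall>t\<in>{0..T}. \<bar>x\<^sub>0 t - \<nu>\<^sub>0 t\<bar> \<le> \<epsilon>) \<and>
        fv_weak_star_conv T \<nu> \<nu>\<^sub>0)"

definition component :: "'d \<Rightarrow> ('d::finite) path \<Rightarrow> real \<Rightarrow> real" where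
  "component i \<omega> t = \<omega> (ereal t) $ i"

text \<open>Convergence in the sense of S for \<open>I = [0,\<infinity>)\<close> and for \<open>I = [0,T]\<close> with \<open>T < \<infinity>\<close>.\<close>

definition S_conv :: "ereal set \<Rightarrow> (nat \<Rightarrow> ('d::finite) path) \<Rightarrow> 'd path \<Rightarrow> bool" where
  "S_conv I \<omega> \<omega>\<^sub>0 \<longleftrightarrow>
     (if I = {0..<\<infinity>}
      then \<forall>i. \<exists>R::nat \<Rightarrow> real. (\<forall>r. 0 < R r) \<and> incseq R \<and> filterlim R at_top sequentially \<and>
             (\<forall>r. S_conv_real (R r) (\<lambda>n. component i (\<omega> n)) (component i \<omega>\<^sub>0))
      else \<forall>i. S_conv_real (real_of_ereal (Sup I)) (\<lambda>n. component i (\<omega> n)) (component i \<omega>\<^sub>0))"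

definition S_conv_subseq :: "ereal set \<Rightarrow> (nat \<Rightarrow> ('d::finite) path) \<Rightarrow> 'd path \<Rightarrow> bool" where
  "S_conv_subseq I \<omega> \<omega>\<^sub>0 \<longleftrightarrow>
     (\<forall>r::nat \<Rightarrow> nat. strict_mono r \<longrightarrow>
        (\<exists>q::nat \<Rightarrow> nat. strict_mono q \<and> S_conv I (\<omega> \<circ> r \<circ> q) \<omega>\<^sub>0))"

definition S_closed :: "ereal set \<Rightarrow> ('d::finite) path set \<Rightarrow> bool" where
  "S_closed I F \<longleftrightarrow> F \<subseteq> cadlag_paths I \<and>
     (\<forall>\<omega> \<omega>\<^sub>0. range \<omega> \<subseteq> F \<and> \<omega>\<^sub>0 \<in> cadlag_paths I \<and> S_conv_subseq I \<omega> \<omega>\<^sub>0 \<longrightarrow> \<omega>\<^sub>0 \<in> F)"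

definition S_seq_topology :: "ereal set \<Rightarrow> ('d::finite) path topology" where
  "S_seq_topology I =
     topology (\<lambda>U. U \<subseteq> cadlag_paths I \<and> S_closed I (cadlag_paths I - U))"

lemma istopology_S:
  "istopology (\<lambda>U::('d::finite) path set. U \<subseteq> cadlag_paths I \<and> S_closed I (cadlag_paths I - U))"
  unfolding istopology_def
proof (intro conjI allI impI)
  fix U V :: "'d path set"
  assume U: "U \<subseteq> cadlag_paths I \<and> S_closed I (cadlag_paths I - U)"
    and V: "V \<subseteq> cadlag_paths I \<and> S_closed I (cadlag_paths I - V)"
  show "U \<inter> V \<subseteq> cadlag_paths I" using U by blast
  have *: "\<omega>\<^sub>0 \<notin> W"
    if W: "S_closed I (cadlag_paths I - W)" and inf: "infinite {n. \<omega> n \<notin> W}"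
      and \<omega>: "range \<omega> \<subseteq> cadlag_paths I" "\<omega>\<^sub>0 \<in> cadlag_paths I" "S_conv_subseq I \<omega> \<omega>\<^sub>0"
    for W and \<omega> :: "nat \<Rightarrow> 'd path" and \<omega>\<^sub>0
  proof -
    define r where "r = enumerate {n. \<omega> n \<notin> W}"
    have r: "strict_mono r"
      using inf by (simp add: r_def strict_mono_enumerate)
    have "r n \<in> {n. \<omega> n \<notin> W}" for n
      unfolding r_def by (rule enumerate_in_set[OF inf])
    then have "range (\<omega> \<circ> r) \<subseteq> cadlag_paths I - W"
      using \<omega>(1) by auto
    moreover have "S_conv_subseq I (\<omega> \<circ> r) \<omega>\<^sub>0"
      unfolding S_conv_subseq_def
    proof (intro allI impI)
      fix s :: "nat \<Rightarrow> nat" assume "strict_mono s"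
      then have "strict_mono (r \<circ> s)" using r by (simp add: strict_mono_o)
      then show "\<exists>q. strict_mono q \<and> S_conv I (\<omega> \<circ> r \<circ> s \<circ> q) \<omega>\<^sub>0"
        using \<omega>(3) unfolding S_conv_subseq_def by (metis comp_assoc)
    qed
    ultimately show ?thesis
      using W \<omega>(2) unfolding S_closed_def by blast
  qed
  show "S_closed I (cadlag_paths I - U \<inter> V)"
    unfolding S_closed_def
  proof (intro conjI allI impI)
    fix \<omega> :: "nat \<Rightarrow> 'd path" and \<omega>\<^sub>0
    assume A: "range \<omega> \<subseteq> cadlag_paths I - U \<inter> V \<and> \<omega>\<^sub>0 \<in> cadlag_paths I \<and> S_conv_subseq I \<omega> \<omega>\<^sub>0"
    then have "{n. \<omega> n \<notin> U} \<union> {n. \<omega> n \<notin> V} = UNIV" by blast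
    then have "infinite {n. \<omega> n \<notin> U} \<or> infinite {n. \<omega> n \<notin> V}"
      by (metis finite_Un infinite_UNIV_nat)
    moreover have "range \<omega> \<subseteq> cadlag_paths I" using A by blast
    ultimately show "\<omega>\<^sub>0 \<in> cadlag_paths I - U \<inter> V"
      using *[of U \<omega> \<omega>\<^sub>0] *[of V \<omega> \<omega>\<^sub>0] U V A by blast
  qed blast
next
  fix K :: "'d path set set"
  assume K: "\<forall>U\<in>K. U \<subseteq> cadlag_paths I \<and> S_closed I (cadlag_paths I - U)"
  then show "\<Union>K \<subseteq> cadlag_paths I" by blast
  show "S_closed I (cadlag_paths I - \<Union>K)"
    unfolding S_closed_def
  proof (intro conjI allI impI)
    fix \<omega> :: "nat \<Rightarrow> 'd path" and \<omega>\<^sub>0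
    assume A: "range \<omega> \<subseteq> cadlag_paths I - \<Union>K \<and> \<omega>\<^sub>0 \<in> cadlag_paths I \<and> S_conv_subseq I \<omega> \<omega>\<^sub>0"
    have "\<omega>\<^sub>0 \<notin> U" if "U \<in> K" for U
    proof -
      have "range \<omega> \<subseteq> cadlag_paths I - U" using A that by blast
      then show ?thesis using A K that unfolding S_closed_def by blast
    qed
    then show "\<omega>\<^sub>0 \<in> cadlag_paths I - \<Union>K" using A by blast
  qed blast
qed

lemma openin_S_seq_topology:
  "openin (S_seq_topology I) U \<longleftrightarrow> U \<subseteq> cadlag_paths I \<and> S_closed I (cadlag_paths I - U)"
  unfolding S_seq_topology_def by (simp add: topology_inverse'[OF istopology_S])

text \<open>
  Over \<open>[0,\<infinity>]\<close> topologies are transported from the product of the path space over \<open>[0,\<infinity>)\<close>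
  with \<open>\<real>\<^sup>d\<close> along the bijection \<open>\<omega> \<mapsto> (\<omega>|[0,\<infinity>), \<omega>(\<infinity>))\<close>.
\<close>

definition product_with_infinity :: "('d::finite) path topology \<Rightarrow> 'd path topology" where
  "product_with_infinity \<tau> =
     pullback_topology (cadlag_paths {0..\<infinity>}) (\<lambda>\<omega>. (restrict \<omega> {0..<\<infinity>}, \<omega> \<infinity>))
       (prod_topology \<tau> euclidean)"

definition S_topology :: "ereal set \<Rightarrow> ('d::finite) path topology" where
  "S_topology I =
     (if I = {0..\<infinity>} then product_with_infinity (S_seq_topology {0..<\<infinity>}) else S_seq_topology I)"


section \<open>The Meyer-Zheng topology\<close>

text \<open>The initial topology of the maps in question, for \<open>I = [0,\<infinity>)\<close> and \<open>I = [0,T]\<close>, \<open>T < \<infinity>\<close>.\<close>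

definition MZ_init_topology :: "ereal set \<Rightarrow> ('d::finite) path topology" where
  "MZ_init_topology I = topology_generated_by
     ({{\<omega> \<in> cadlag_paths I.
         (LINT t:{t. ereal t \<in> I}|lborel. f (t, component i \<omega> t) * exp (- t)) \<in> U} | f i U.
         continuous_on ({t. ereal t \<in> I} \<times> UNIV) f \<and>
         bounded (f ` ({t. ereal t \<in> I} \<times> UNIV)) \<and> open (U :: real set)}
      \<union> {{\<omega> \<in> cadlag_paths I. \<omega> (Sup I) \<in> V} | V. Sup I \<in> I \<and> open V})"

definition MZ_topology :: "ereal set \<Rightarrow> ('d::finite) path topology" where
  "MZ_topology I =
     (if I = {0..\<infinity>} then product_with_infinity (MZ_init_topology {0..<\<infinity>}) else MZ_init_topology I)"

definition weaker_topology :: "'a topology \<Rightarrow> 'a topology \<Rightarrow> bool" where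
  "weaker_topology \<tau> \<sigma> \<longleftrightarrow> topspace \<tau> = topspace \<sigma> \<and> (\<forall>U. openin \<tau> U \<longrightarrow> openin \<sigma> U)"


section \<open>Supermartingale measures\<close>

text \<open>\<open>raw_filtration\<close> is $\mathcal{F}^o$, \<open>rc_filtration\<close> is its right-continuous version, and
  \<open>terminal_sigma\<close> is $\mathcal{F}_T$.\<close>

definition raw_filtration :: "ereal set \<Rightarrow> ereal \<Rightarrow> ('d::finite) path measure" where
  "raw_filtration I t = sigma (cadlag_paths I)
     {{\<omega> \<in> cadlag_paths I. \<omega> s \<in> A} | s A. s \<in> I \<and> s \<le> t \<and> A \<in> sets borel}"

definition rc_filtration :: "ereal set \<Rightarrow> ereal \<Rightarrow> ('d::finite) path measure" where
  "rc_filtration I t = sigma (cadlag_paths I)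
     (\<Inter>\<epsilon>\<in>{0<..}. sets (raw_filtration I (t + ereal \<epsilon>)))"

definition terminal_sigma :: "ereal set \<Rightarrow> ('d::finite) path measure" where
  "terminal_sigma I = sigma (cadlag_paths I) (\<Union>t\<in>I. sets (raw_filtration I t))"

definition supermartingale ::
  "'t::order set \<Rightarrow> 'a measure \<Rightarrow> ('t \<Rightarrow> 'a measure) \<Rightarrow> ('t \<Rightarrow> 'a \<Rightarrow> real) \<Rightarrow> bool" where
  "supermartingale I Q F Y \<longleftrightarrow>
     (\<forall>t\<in>I. Y t \<in> borel_measurable (F t) \<and> integrable Q (Y t)) \<and>
     (\<forall>s\<in>I. \<forall>t\<in>I. s \<le> t \<longrightarrow> (AE \<omega> in Q. real_cond_exp Q (F s) (Y t) \<omega> \<le> Y s \<omega>))"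

definition supermartingale_measure :: "ereal set \<Rightarrow> ('d::finite) path measure \<Rightarrow> bool" where
  "supermartingale_measure I Q \<longleftrightarrow>
     prob_space Q \<and> space Q = cadlag_paths I \<and> sets Q = sets (terminal_sigma I) \<and>
     (\<forall>i. supermartingale I Q (rc_filtration I) (\<lambda>t \<omega>. \<omega> t $ i))"


section \<open>Elementary integrands and the condition (UI)\<close>

definition l1_norm :: "real^'d::finite \<Rightarrow> real" where
  "l1_norm x = (\<Sum>i\<in>UNIV. \<bar>x $ i\<bar>)"

definition neg_part :: "real^'d::finite \<Rightarrow> real" where
  "neg_part x = (\<Sum>i\<in>UNIV. - min (x $ i) 0)"

text \<open>
  An integrand is given by the number \<open>n\<close> of intervals, the times \<open>t i k\<close>, and the values \<open>h i k\<close>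
  at these times; the value on \<open>{0}\<close> is \<open>h i 0\<close>.
\<close>

type_synonym 'd integrand = "nat \<times> ('d \<Rightarrow> nat \<Rightarrow> ereal) \<times> ('d \<Rightarrow> nat \<Rightarrow> 'd path \<Rightarrow> real)"

definition elementary_integrands :: "ereal set \<Rightarrow> ('d::finite) path measure \<Rightarrow> 'd integrand set" where
  "elementary_integrands I Q = {(n, t, h).
     \<forall>i. t i 0 = 0 \<and> (\<forall>k<n. t i k \<le> t i (Suc k)) \<and>
         (\<forall>k\<le>n. t i k \<in> I \<and> h i k \<in> borel_measurable (rc_filtration I (t i k)) \<and>
                 (AE \<omega> in Q. \<bar>h i k \<omega>\<bar> \<le> 1))}"

definition elementary_integral :: "('d::finite) integrand \<Rightarrow> ereal \<Rightarrow> 'd path \<Rightarrow> real" where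
  "elementary_integral = (\<lambda>(n, t, h) s \<omega>.
     \<Sum>i\<in>UNIV. h i 0 \<omega> * \<omega> 0 $ i +
       (\<Sum>k=1..n. h i (k - 1) \<omega> * (\<omega> (min (t i k) s) $ i - \<omega> (min (t i (k - 1)) s) $ i)))"

definition UI_condition :: "ereal set \<Rightarrow> ('d::finite) path measure set \<Rightarrow> bool" where
  "UI_condition I \<M> \<longleftrightarrow>
     (SUP Q\<in>\<M>. SUP t\<in>I. ereal (\<integral>\<omega>. l1_norm (\<omega> t) \<partial>Q) +
        (SUP H\<in>elementary_integrands I Q. ereal (\<integral>\<omega>. elementary_integral H t \<omega> \<partial>Q))) < \<infinity> \<and>
     (\<forall>t\<in>I. ((\<lambda>c::real. SUP Q\<in>\<M>.
        \<integral>\<^sup>+\<omega>. ennreal (neg_part (\<omega> t) * indicator {\<omega>. neg_part (\<omega> t) > c} \<omega>) \<partial>Q) \<longlongrightarrow> 0) at_top)"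

end

theory Submission
  imports Defs "HOL-Library.Diagonal_Subsequence"
begin

text \<open>
  Prokhorov's theorem fails to apply directly because the topology need not be metrizable.  What
  replaces it is a countable family of continuous functions, namely averages of the coordinates
  over short time intervals, that generates the \<open>\<sigma>\<close>-algebra and separates paths, together with the
  sets of paths whose supremum and number of oscillations on bounded intervals are controlled.  By
  a Helly argument, a sequence of paths with uniform such controls has an S-convergent subsequence,
  hence the countable family embeds these sets injectively into a compact metric space, where
  Prokhorov's theorem is available.

  The condition (UI) makes \<open>\<M>\<close> uniformly tight with respect to these sets.  Along a dyadic time grid,
  the elementary integrand that bets against the sign of the first exceedance of a level bounds
  the probability of exceeding it, and the integrand that bets against the last recorded value
  (updated whenever the path has moved by \<open>\<epsilon>\<close>) gains at least \<open>\<epsilon>\<^sup>2 / 2\<close> per oscillation.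

  A limit \<open>Q\<close> of \<open>Q\<^sub>n \<in> \<M>\<close> is a supermartingale measure because the coordinates truncated at \<open>\<plusminus>C\<close>
  satisfy the supermartingale inequality under \<open>Q\<^sub>n\<close> up to an error that, by the uniform
  integrability of the negative parts, vanishes as \<open>C \<rightarrow> \<infinity>\<close> uniformly in \<open>n\<close>.  The inequality
  passes to \<open>Q\<close> for averaged coordinates and continuous weights depending on the past, then for
  indicators by regularity, and right-continuity of the paths removes the averages.
\<close>

section \<open>Signed measures\<close>

text \<open>Three obstacles shape the argument. The topology is known only through its two bounds,
  so little but sequences can be controlled: compactness comes from the S-topology in sequential
  form, continuity from the Meyer-Zheng topology, and the countable tests mediate between them. They
  also show that the Borel sets are exactly the terminal \<sigma>-algebra. Second, the weak*
  topology lives on all signed measures, so a sequential limit has first to be recognised as a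
  probability measure. Countably many integrals determine a signed measure, and the resulting
  injection into a sequence space makes the tight family metrizable; a single passage to sequential
  limits then already gives a compact set. Third, averages over \<open>(t, t + \<delta>)\<close>
  look into the future. Hence the strict inequalities between times: weights known at
  \<open>u\<close> are compared with values after \<open>u\<close>, events of the right-continuous
  past of \<open>s\<close> are tested at times \<open>u > s\<close>, and both shifts vanish only in
  the limit. The terminal time has no room on its right, but there the value itself is
  continuous.\<close>

lemma signed_measures_empty:
  assumes "\<mu> \<in> signed_measures M"
  shows "\<mu> {} = 0"
proof -
  have "(\<lambda>n::nat. \<mu> {}) sums \<mu> (\<Union>n::nat. {})"
    using assms unfolding signed_measures_def
    by (elim CollectE conjE allE[of _ "\<lambda>n. {}"]) (auto simp: disjoint_family_on_def)
  then have "summable (\<lambda>n::nat. \<mu> {})" by (rule sums_summable)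
  then show ?thesis by (simp add: summable_const_iff)
qed

lemma signed_measures_sums:
  assumes "\<mu> \<in> signed_measures M" "range A \<subseteq> sets M" "disjoint_family A"
  shows "(\<lambda>n::nat. \<mu> (A n)) sums \<mu> (\<Union>n. A n)"
  using assms unfolding signed_measures_def by blast

lemma signed_measures_Un:
  assumes "\<mu> \<in> signed_measures M" "A \<in> sets M" "B \<in> sets M" "A \<inter> B = {}"
  shows "\<mu> (A \<union> B) = \<mu> A + \<mu> B"
proof -
  have "(\<lambda>n. \<mu> (binaryset A B n)) sums \<mu> (\<Union>n. binaryset A B n)"
    using assms by (intro signed_measures_sums[OF assms(1)])
      (auto simp: range_binaryset_eq disjoint_family_on_def binaryset_def)
  moreover have "(\<lambda>n. \<mu> (binaryset A B n)) sums (\<mu> A + \<mu> B)"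
    by (rule binaryset_sums) (rule signed_measures_empty[OF assms(1)])
  ultimately show ?thesis
    by (metis UN_binaryset_eq sums_unique2)
qed

lemma signed_measures_minus:
  assumes "\<mu> \<in> signed_measures M"
  shows "(\<lambda>A. - \<mu> A) \<in> signed_measures M"
  using assms unfolding signed_measures_def by (auto intro!: sums_minus)

lemma signed_measures_bounded:
  assumes "\<mu> \<in> signed_measures M"
  obtains C where "\<And>A. A \<in> sets M \<Longrightarrow> \<bar>\<mu> A\<bar> \<le> C"
proof -
  have "bdd_above {\<Sum>A\<in>P. \<bar>\<mu> A\<bar> | P. finite P \<and> P \<subseteq> sets M \<and> disjoint P}"
    using assms by (simp add: signed_measures_def)
  then obtain C where C: "\<And>x. x \<in> {\<Sum>A\<in>P. \<bar>\<mu> A\<bar> | P. finite P \<and> P \<subseteq> sets M \<and> disjoint P} \<Longrightarrow> x \<le> C"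
    unfolding bdd_above_def by blast
  have "\<bar>\<mu> A\<bar> \<le> C" if "A \<in> sets M" for A
    by (rule C) (use that in \<open>auto intro!: exI[of _ "{A}"]\<close>)
  then show ?thesis by (rule that)
qed

lemma sets_positive_part [simp]: "sets (positive_part M \<mu>) = sets M"
  unfolding positive_part_def by (metis sets.sets_measure_of_eq)

lemma space_positive_part [simp]: "space (positive_part M \<mu>) = space M"
  unfolding positive_part_def by simp

text \<open>\<open>measure_of\<close> returns the given set function only if that is countably
  additive. Superadditivity adds competitors for disjoint sets; for the converse a competitor
  \<open>B\<close> for the union is cut into the pieces \<open>B \<inter> A i\<close>, whose values
  sum to \<open>\<mu> B\<close>.\<close>

lemma emeasure_positive_part:
  assumes \<mu>: "\<mu> \<in> signed_measures M" and "A \<in> sets M"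
  shows "emeasure (positive_part M \<mu>) A = (SUP B\<in>{B \<in> sets M. B \<subseteq> A}. ennreal (\<mu> B))"
proof -
  define f where "f A = (SUP B\<in>{B \<in> sets M. B \<subseteq> A}. ennreal (\<mu> B))" for A
  have f_upper: "ennreal (\<mu> B) \<le> f A" if "B \<in> sets M" "B \<subseteq> A" for A B
    unfolding f_def using that by (auto intro!: SUP_upper)
  have f_mono: "f A \<le> f B" if "A \<subseteq> B" for A B
    unfolding f_def using that by (auto intro!: SUP_subset_mono)
  have f_empty: "f {} = 0"
  proof -
    have "{B \<in> sets M. B \<subseteq> {}} = {{}}" by auto
    then show ?thesis unfolding f_def using signed_measures_empty[OF \<mu>] by simp
  qed
  have f_add: "f A + f B \<le> f (A \<union> B)" if AB: "A \<in> sets M" "B \<in> sets M" "A \<inter> B = {}" for A B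
  proof -
    have *: "ennreal (\<mu> X) + ennreal (\<mu> Y) \<le> f (A \<union> B)"
      if X: "X \<in> sets M" "X \<subseteq> A" and Y: "Y \<in> sets M" "Y \<subseteq> B" for X Y
    proof (cases "\<mu> X \<ge> 0 \<and> \<mu> Y \<ge> 0")
      case True
      have "X \<inter> Y = {}" using AB X Y by blast
      then have "ennreal (\<mu> X) + ennreal (\<mu> Y) = ennreal (\<mu> (X \<union> Y))"
        using signed_measures_Un[OF \<mu>] X Y True by (simp add: ennreal_plus)
      also have "\<dots> \<le> f (A \<union> B)"
        using X Y by (intro f_upper) auto
      finally show ?thesis .
    next
      case False
      \<comment> \<open>A negative value is truncated to 0, so the sum does not exceed the larger of
        the two terms, and \<open>X\<close> or \<open>Y\<close> alone is a competitor for the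
        union.\<close>
      then have "ennreal (\<mu> X) + ennreal (\<mu> Y) \<le> max (ennreal (\<mu> X)) (ennreal (\<mu> Y))"
        by (auto simp: ennreal_neg max_def)
      also have "\<dots> \<le> f (A \<union> B)"
        using X Y by (auto intro!: f_upper)
      finally show ?thesis .
    qed
    have ne: "{B' \<in> sets M. B' \<subseteq> C} \<noteq> {}" for C by auto
    have "f A + f B = (SUP X\<in>{X \<in> sets M. X \<subseteq> A}. ennreal (\<mu> X) + f B)"
      unfolding f_def[of A] by (rule ennreal_SUP_add_left[OF ne, symmetric])
    also have "\<dots> \<le> f (A \<union> B)"
    proof (rule SUP_least)
      fix X assume X: "X \<in> {X \<in> sets M. X \<subseteq> A}"
      have "ennreal (\<mu> X) + f B = (SUP Y\<in>{Y \<in> sets M. Y \<subseteq> B}. ennreal (\<mu> X) + ennreal (\<mu> Y))"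
        unfolding f_def by (rule ennreal_SUP_add_right[OF ne])
      also have "\<dots> \<le> f (A \<union> B)"
        using X * by (auto intro!: SUP_least)
      finally show "ennreal (\<mu> X) + f B \<le> f (A \<union> B)" .
    qed
    finally show ?thesis .
  qed
  have ca: "countably_additive (sets M) f"
    unfolding countably_additive_def
  proof (intro allI impI)
    fix A :: "nat \<Rightarrow> 'a set"
    assume A: "range A \<subseteq> sets M" "disjoint_family A" "(\<Union>i. A i) \<in> sets M"
    have "(\<Sum>i. f (A i)) \<le> f (\<Union>i. A i)"
    proof (rule suminf_le_const)
      fix n
      have "(\<Sum>i<n. f (A i)) \<le> f (\<Union>i<n. A i)"
      proof (induction n)
        case (Suc n)
        have "A i \<inter> A n = {}" if "i < n" for i
          using A(2) that by (auto simp: disjoint_family_on_def)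
        then have "(\<Union>i<n. A i) \<inter> A n = {}" by blast
        then have "f (\<Union>i<n. A i) + f (A n) \<le> f ((\<Union>i<n. A i) \<union> A n)"
          using A(1) by (intro f_add) auto
        with add_right_mono[OF Suc, of "f (A n)"]
        have "(\<Sum>i<Suc n. f (A i)) \<le> f ((\<Union>i<n. A i) \<union> A n)"
          by (simp only: sum.lessThan_Suc order_trans)
        also have "(\<Union>i<n. A i) \<union> A n = (\<Union>i<Suc n. A i)"
          by (auto simp: lessThan_Suc)
        finally show ?case .
      qed (simp add: f_empty)
      also have "\<dots> \<le> f (\<Union>i. A i)" by (rule f_mono) auto
      finally show "(\<Sum>i<n. f (A i)) \<le> f (\<Union>i. A i)" .
    qed simp
    moreover have "f (\<Union>i. A i) \<le> (\<Sum>i. f (A i))"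
      unfolding f_def[of "\<Union>i. A i"]
    proof (rule SUP_least)
      fix B assume B: "B \<in> {B \<in> sets M. B \<subseteq> (\<Union>i. A i)}"
      have "(\<lambda>i. \<mu> (B \<inter> A i)) sums \<mu> (\<Union>i. B \<inter> A i)"
        using A B by (intro signed_measures_sums[OF \<mu>]) (auto simp: disjoint_family_on_def)
      moreover have "(\<Union>i. B \<inter> A i) = B" using B by auto
      ultimately have s: "(\<lambda>i. \<mu> (B \<inter> A i)) sums \<mu> B" by simp
      have "(\<lambda>n. ennreal (\<Sum>i<n. \<mu> (B \<inter> A i))) \<longlonglongrightarrow> ennreal (\<mu> B)"
        using s unfolding sums_def by (intro tendsto_ennrealI)
      moreover have "ennreal (\<Sum>i<n. \<mu> (B \<inter> A i)) \<le> (\<Sum>i. f (A i))" for n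
      proof -
        have "ennreal (\<Sum>i<n. \<mu> (B \<inter> A i)) \<le> ennreal (\<Sum>i<n. max 0 (\<mu> (B \<inter> A i)))"
          by (intro ennreal_leI sum_mono) auto
        also have "\<dots> = (\<Sum>i<n. ennreal (max 0 (\<mu> (B \<inter> A i))))"
          by (subst sum_ennreal) auto
        also have "\<dots> \<le> (\<Sum>i<n. f (A i))"
          using A B by (intro sum_mono) (auto simp: max_def intro!: f_upper)
        also have "\<dots> \<le> (\<Sum>i. f (A i))"
          by (rule sum_le_suminf) auto
        finally show ?thesis .
      qed
      ultimately show "ennreal (\<mu> B) \<le> (\<Sum>i. f (A i))"
        by (intro LIMSEQ_le_const2) auto
    qed
    ultimately show "(\<Sum>i. f (A i)) = f (\<Union>i. A i)" by simp
  qed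
  have "emeasure (measure_of (space M) (sets M) f) A = f A"
    using ca assms(2) f_empty sets.sigma_algebra_axioms
    by (intro emeasure_measure_of_sigma) (auto simp: positive_def)
  then show ?thesis
    unfolding positive_part_def f_def[abs_def] .
qed

lemma finite_measure_positive_part:
  assumes "\<mu> \<in> signed_measures M"
  shows "finite_measure (positive_part M \<mu>)"
proof (rule finite_measureI)
  obtain C where C: "\<And>A. A \<in> sets M \<Longrightarrow> \<bar>\<mu> A\<bar> \<le> C"
    using signed_measures_bounded[OF assms] by blast
  have "emeasure (positive_part M \<mu>) (space M) \<le> ennreal C"
    unfolding emeasure_positive_part[OF assms sets.top]
  proof (intro SUP_least ennreal_leI)
    fix B assume "B \<in> {B \<in> sets M. B \<subseteq> space M}"
    then show "\<mu> B \<le> C" using C[of B] by auto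
  qed
  then have "emeasure (positive_part M \<mu>) (space M) < \<infinity>"
    by (rule order.strict_trans1) simp
  then show "emeasure (positive_part M \<mu>) (space (positive_part M \<mu>)) \<noteq> \<infinity>" by simp
qed

lemma measure_positive_part:
  assumes \<mu>: "\<mu> \<in> signed_measures M" and A: "A \<in> sets M"
  shows "measure (positive_part M \<mu>) A = (SUP B\<in>{B \<in> sets M. B \<subseteq> A}. \<mu> B)"
    and "bdd_above (\<mu> ` {B \<in> sets M. B \<subseteq> A})"
proof -
  obtain C where C: "\<And>A. A \<in> sets M \<Longrightarrow> \<bar>\<mu> A\<bar> \<le> C"
    using signed_measures_bounded[OF \<mu>] by blast
  show bdd: "bdd_above (\<mu> ` {B \<in> sets M. B \<subseteq> A})"
  proof (rule bdd_aboveI)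
    fix x assume "x \<in> \<mu> ` {B \<in> sets M. B \<subseteq> A}"
    then show "x \<le> C" using C abs_le_D1 by blast
  qed
  let ?p = "SUP B\<in>{B \<in> sets M. B \<subseteq> A}. \<mu> B"
  have p0: "?p \<ge> 0"
    using signed_measures_empty[OF \<mu>] by (intro cSUP_upper2[OF bdd, of "{}"]) auto
  have "(SUP B\<in>{B \<in> sets M. B \<subseteq> A}. ennreal (\<mu> B)) = ennreal ?p"
  proof (rule antisym)
    show "(SUP B\<in>{B \<in> sets M. B \<subseteq> A}. ennreal (\<mu> B)) \<le> ennreal ?p"
      using bdd by (intro SUP_least ennreal_leI cSUP_upper) auto
    let ?s = "SUP B\<in>{B \<in> sets M. B \<subseteq> A}. ennreal (\<mu> B)"
    have fin: "?s \<noteq> \<infinity>"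
      using finite_measure.emeasure_finite[OF finite_measure_positive_part[OF \<mu>], of A]
      by (simp add: emeasure_positive_part[OF \<mu> A])
    then have lt: "?s < top" by (simp only: top.not_eq_extremum infinity_ennreal_def not_False_eq_True)
    have "?p \<le> enn2real ?s"
    proof (rule cSUP_least)
      fix B assume "B \<in> {B \<in> sets M. B \<subseteq> A}"
      then have "ennreal (\<mu> B) \<le> ?s" by (rule SUP_upper)
      then have "enn2real (ennreal (\<mu> B)) \<le> enn2real ?s"
        using lt by (intro enn2real_mono)
      moreover have "\<mu> B \<le> enn2real (ennreal (\<mu> B))"
        by (cases "\<mu> B \<ge> 0") (simp_all add: ennreal_neg)
      ultimately show "\<mu> B \<le> enn2real ?s" by linarith
    qed auto
    then have "ennreal ?p \<le> ennreal (enn2real ?s)" by (rule ennreal_leI)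
    also have "\<dots> = ?s" using lt by (rule ennreal_enn2real)
    finally show "ennreal ?p \<le> ?s" .
  qed
  then show "measure (positive_part M \<mu>) A = ?p"
    unfolding measure_def emeasure_positive_part[OF \<mu> A] using p0 by simp
qed

text \<open>Additivity gives \<open>\<mu> B - \<mu> A = - \<mu> (A - B)\<close>, so passing from
  \<open>B\<close> to \<open>A - B\<close> turns competitors of one supremum into competitors of the
  other, shifted by \<open>\<mu> A\<close>.\<close>

lemma Jordan_decomposition:
  assumes \<mu>: "\<mu> \<in> signed_measures M" and A: "A \<in> sets M"
  shows "\<mu> A = measure (positive_part M \<mu>) A - measure (positive_part M (\<lambda>A. - \<mu> A)) A"
proof -
  note \<mu>' = signed_measures_minus[OF \<mu>]
  let ?p = "SUP B\<in>{B \<in> sets M. B \<subseteq> A}. \<mu> B" and ?n = "SUP B\<in>{B \<in> sets M. B \<subseteq> A}. - \<mu> B"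
  have split: "\<mu> A = \<mu> B + \<mu> (A - B)" if "B \<in> sets M" "B \<subseteq> A" for B
  proof -
    have "B \<union> (A - B) = A" using that by auto
    then show ?thesis
      using signed_measures_Un[OF \<mu>, of B "A - B"] that A by (metis Diff_disjoint sets.Diff)
  qed
  have "?p \<le> \<mu> A + ?n"
  proof (rule cSUP_least)
    fix B assume B: "B \<in> {B \<in> sets M. B \<subseteq> A}"
    have "- \<mu> (A - B) \<le> ?n"
      using B A by (intro cSUP_upper measure_positive_part(2)[OF \<mu>' A]) auto
    then show "\<mu> B \<le> \<mu> A + ?n" using split[of B] B by simp
  qed auto
  moreover have "?n \<le> ?p - \<mu> A"
  proof (rule cSUP_least)
    fix B assume B: "B \<in> {B \<in> sets M. B \<subseteq> A}"
    have "\<mu> (A - B) \<le> ?p"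
      using B A by (intro cSUP_upper measure_positive_part(2)[OF \<mu> A]) auto
    then show "- \<mu> B \<le> ?p - \<mu> A" using split[of B] B by simp
  qed auto
  ultimately show ?thesis
    using measure_positive_part(1)[OF \<mu> A] measure_positive_part(1)[OF \<mu>' A] by simp
qed

text \<open>The signed integral is defined through the Jordan parts, while integrals are computed
  from whatever difference of finite measures is at hand. Two differences \<open>P - N\<close> and
  \<open>P' - N'\<close> with the same values become the equality \<open>P + N' = P' + N\<close> of
  measures.\<close>

lemma integral_bounded_add_measures:
  fixes f :: "'a \<Rightarrow> real"
  assumes "finite_measure P" "finite_measure N" "finite_measure P'" "finite_measure N'"
    and sets: "sets P = sets M" "sets N = sets M" "sets P' = sets M" "sets N' = sets M"
    and eq: "\<And>A. A \<in> sets M \<Longrightarrow> measure P A + measure N' A = measure P' A + measure N A"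
    and f: "f \<in> borel_measurable M" and bd: "\<And>x. x \<in> space M \<Longrightarrow> \<bar>f x\<bar> \<le> B"
  shows "(\<integral>x. f x \<partial>P) - (\<integral>x. f x \<partial>N) = (\<integral>x. f x \<partial>P') - (\<integral>x. f x \<partial>N')"
proof -
  define comb where "comb R R' = measure_of (space M) (sets M) (\<lambda>A. emeasure R A + emeasure R' A)" for R R' :: "'a measure"
  have em: "emeasure (comb R R') A = emeasure R A + emeasure R' A"
    if "sets R = sets M" "sets R' = sets M" "A \<in> sets M" for R R' A
    unfolding comb_def
  proof (rule emeasure_measure_of_sigma)
    show "sigma_algebra (space M) (sets M)" by (rule sets.sigma_algebra_axioms)
    show "positive (sets M) (\<lambda>A. emeasure R A + emeasure R' A)" by (simp add: positive_def)
    show "countably_additive (sets M) (\<lambda>A. emeasure R A + emeasure R' A)"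
      unfolding countably_additive_def using that
      by (auto simp: suminf_add[symmetric] suminf_emeasure)
  qed (rule that(3))
  have sets_comb [simp, measurable_cong]: "sets (comb R R') = sets M" for R R'
    unfolding comb_def by (metis sets.sets_measure_of_eq)
  have space_comb: "space (comb R R') = space M" for R R'
    unfolding comb_def by simp
  have integrable: "integrable R f" if "finite_measure R" "sets R = sets M" for R
  proof -
    interpret finite_measure R by fact
    show ?thesis
      using bd f sets_eq_imp_space_eq[OF that(2)]
      by (intro integrable_const_bound[of _ B]) (auto simp: measurable_cong_sets[OF that(2) refl])
  qed
  \<comment> \<open>Additivity of the integral in the measure goes by induction over nonnegative
    measurable functions and reaches \<open>f\<close> through its positive and negative parts, whose
    integrals are finite because \<open>f\<close> is bounded.\<close>
  have nn: "(\<integral>\<^sup>+x. g x \<partial>comb R R') = (\<integral>\<^sup>+x. g x \<partial>R) + (\<integral>\<^sup>+x. g x \<partial>R')"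
    if R: "sets R = sets M" "sets R' = sets M" and "g \<in> borel_measurable M" for R R' and g :: "'a \<Rightarrow> ennreal"
    using that(3)
  proof (induction rule: borel_measurable_induct)
    case (cong f g)
    have "(\<integral>\<^sup>+x. f x \<partial>S) = (\<integral>\<^sup>+x. g x \<partial>S)" if "space S = space M" for S
      using cong(3) that by (auto intro!: nn_integral_cong)
    with cong show ?case
      using R[THEN sets_eq_imp_space_eq] space_comb by metis
  next
    case (set A)
    then show ?case using R em[OF R] by simp
  next
    case (mult u c)
    have [measurable]: "u \<in> borel_measurable R" "u \<in> borel_measurable R'"
      using R mult(2) by (auto simp: measurable_cong_sets[OF R(1) refl] measurable_cong_sets[OF R(2) refl])
    show ?case using mult by (simp add: nn_integral_cmult distrib_left)
  next
    case (add u v)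
    have [measurable]: "u \<in> borel_measurable R" "u \<in> borel_measurable R'"
         "v \<in> borel_measurable R" "v \<in> borel_measurable R'"
      using R add by (auto simp: measurable_cong_sets[OF R(1) refl] measurable_cong_sets[OF R(2) refl])
    show ?case using add by (simp add: nn_integral_add ac_simps)
  next
    case (seq U)
    have [measurable]: "\<And>i. U i \<in> borel_measurable R" "\<And>i. U i \<in> borel_measurable R'"
      using R seq by (auto simp: measurable_cong_sets[OF R(1) refl] measurable_cong_sets[OF R(2) refl])
    have inc: "incseq (\<lambda>i. \<integral>\<^sup>+x. U i x \<partial>S)" for S
      using seq(3) by (auto simp: incseq_def le_fun_def intro!: nn_integral_mono)
    have 1: "(\<integral>\<^sup>+x. (SUP i. U i) x \<partial>S) = (SUP i. \<integral>\<^sup>+x. U i x \<partial>S)" if "\<And>i. U i \<in> borel_measurable S" for S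
      using nn_integral_monotone_convergence_SUP[OF seq(3) that] by (simp add: image_comp)
    have "(\<integral>\<^sup>+x. (SUP i. U i) x \<partial>comb R R') = (SUP i. (\<integral>\<^sup>+x. U i x \<partial>R) + (\<integral>\<^sup>+x. U i x \<partial>R'))"
      using seq by (subst 1) (auto simp: image_comp)
    also have "\<dots> = (SUP i. \<integral>\<^sup>+x. U i x \<partial>R) + (SUP i. \<integral>\<^sup>+x. U i x \<partial>R')"
      by (rule ennreal_SUP_add[OF inc inc])
    also have "\<dots> = (\<integral>\<^sup>+x. (SUP i. U i) x \<partial>R) + (\<integral>\<^sup>+x. (SUP i. U i) x \<partial>R')"
      by (subst (1 2) 1) auto
    finally show ?case .
  qed
  have fin: "finite_measure (comb R R')"
    if "finite_measure R" "finite_measure R'" "sets R = sets M" "sets R' = sets M" for R R'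
  proof (rule finite_measureI)
    show "emeasure (comb R R') (space (comb R R')) \<noteq> \<infinity>"
      using em[OF that(3,4) sets.top] finite_measure.emeasure_finite[OF that(1)] finite_measure.emeasure_finite[OF that(2)]
      by (auto simp: space_comb)
  qed
  have int: "(\<integral>x. f x \<partial>comb R R') = (\<integral>x. f x \<partial>R) + (\<integral>x. f x \<partial>R')"
    if "finite_measure R" "finite_measure R'" "sets R = sets M" "sets R' = sets M" for R R'
  proof -
    have lt: "(\<integral>\<^sup>+x. ennreal (g x) \<partial>S) < \<infinity>" if "integrable S g" for S and g :: "'a \<Rightarrow> real"
    proof -
      have "(\<integral>\<^sup>+x. ennreal (g x) \<partial>S) \<le> (\<integral>\<^sup>+x. ennreal (norm (g x)) \<partial>S)"
        by (intro nn_integral_mono ennreal_leI) auto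
      then show ?thesis using that by (auto simp: integrable_iff_bounded)
    qed
    have i: "integrable R f" "integrable R' f" "integrable (comb R R') f"
      using integrable[OF that(1,3)] integrable[OF that(2,4)] integrable[OF fin[OF that] sets_comb] by blast+
    have i': "integrable R (\<lambda>x. - f x)" "integrable R' (\<lambda>x. - f x)"
      using integrable_minus[OF i(1)] integrable_minus[OF i(2)] by blast+
    have nn': "(\<integral>\<^sup>+x. ennreal (f x) \<partial>comb R R') = (\<integral>\<^sup>+x. ennreal (f x) \<partial>R) + (\<integral>\<^sup>+x. ennreal (f x) \<partial>R')"
      "(\<integral>\<^sup>+x. ennreal (- f x) \<partial>comb R R') = (\<integral>\<^sup>+x. ennreal (- f x) \<partial>R) + (\<integral>\<^sup>+x. ennreal (- f x) \<partial>R')"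
      using f by (auto intro!: nn[OF that(3,4)])
    show ?thesis
      unfolding real_lebesgue_integral_def[OF i(1)] real_lebesgue_integral_def[OF i(2)] real_lebesgue_integral_def[OF i(3)]
      unfolding nn'
      using lt[OF i(1)] lt[OF i(2)] lt[OF i'(1)] lt[OF i'(2)] by (simp add: enn2real_plus)
  qed
  have "comb P N' = comb P' N"
  proof (rule measure_eqI)
    fix A assume "A \<in> sets (comb P N')"
    then have A: "A \<in> sets M" by simp
    note fe = finite_measure.emeasure_eq_measure
    show "emeasure (comb P N') A = emeasure (comb P' N) A"
      unfolding em[OF sets(1,4) A] em[OF sets(3,2) A]
        fe[OF assms(1)] fe[OF assms(2)] fe[OF assms(3)] fe[OF assms(4)]
      using eq[OF A] by (simp only: measure_nonneg ennreal_plus[symmetric])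
  qed simp
  then have "(\<integral>x. f x \<partial>comb P N') = (\<integral>x. f x \<partial>comb P' N)" by simp
  then show ?thesis
    using int[OF assms(1,4) sets(1,4)] int[OF assms(3,2) sets(3,2)] by simp
qed

lemma diff_in_signed_measures:
  assumes "finite_measure P" "finite_measure N" "sets P = sets M" "sets N = sets M"
  shows "(\<lambda>A. measure P A - measure N A) \<in> signed_measures M"
proof -
  interpret P: finite_measure P by fact
  interpret N: finite_measure N by fact
  have "(\<Sum>A\<in>F. \<bar>measure P A - measure N A\<bar>) \<le> measure P (space P) + measure N (space N)"
    if F: "finite F" "F \<subseteq> sets M" "disjoint F" for F
  proof -
    have "(\<Sum>A\<in>F. \<bar>measure P A - measure N A\<bar>) \<le> (\<Sum>A\<in>F. measure P A + measure N A)"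
    proof (rule sum_mono)
      fix A show "\<bar>measure P A - measure N A\<bar> \<le> measure P A + measure N A"
        using measure_nonneg[of P A] measure_nonneg[of N A] by linarith
    qed
    also have "\<dots> = (\<Sum>A\<in>F. measure P A) + (\<Sum>A\<in>F. measure N A)" by (rule sum.distrib)
    also have "(\<Sum>A\<in>F. measure P A) = measure P (\<Union>F)"
      using F assms P.finite_measure_finite_Union[of F "\<lambda>x. x"] by (auto simp: disjoint_image_disjoint_family_on disjoint_def disjoint_family_on_def)
    also have "(\<Sum>A\<in>F. measure N A) = measure N (\<Union>F)"
      using F assms N.finite_measure_finite_Union[of F "\<lambda>x. x"] by (auto simp: disjoint_def disjoint_family_on_def)
    also have "measure P (\<Union>F) + measure N (\<Union>F) \<le> measure P (space P) + measure N (space N)"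
      by (intro add_mono P.bounded_measure N.bounded_measure)
    finally show ?thesis .
  qed
  then have bdd: "bdd_above {\<Sum>A\<in>F. \<bar>measure P A - measure N A\<bar> | F. finite F \<and> F \<subseteq> sets M \<and> disjoint F}"
    by (intro bdd_aboveI[of _ "measure P (space P) + measure N (space N)"]) auto
  have "(\<lambda>n. measure P (A n) - measure N (A n)) sums (measure P (\<Union>n. A n) - measure N (\<Union>n. A n))"
    if "range A \<subseteq> sets M \<and> disjoint_family A" for A :: "nat \<Rightarrow> _"
    using that assms by (intro sums_diff P.finite_measure_UNION N.finite_measure_UNION) auto
  then show ?thesis
    unfolding signed_measures_def using bdd assms(3,4) by (auto simp: measure_notin_sets)
qed

text \<open>The Jordan parts are compared with the given pair \<open>P\<close>, \<open>N\<close>,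
  which need not be mutually singular.\<close>

lemma signed_integral_diff:
  fixes f :: "'a \<Rightarrow> real"
  assumes P: "finite_measure P" "sets P = sets M" and N: "finite_measure N" "sets N = sets M"
    and f: "f \<in> borel_measurable M" "\<And>x. x \<in> space M \<Longrightarrow> \<bar>f x\<bar> \<le> B"
  shows "signed_integral M (\<lambda>A. measure P A - measure N A) f = (\<integral>x. f x \<partial>P) - (\<integral>x. f x \<partial>N)"
proof -
  let ?\<mu> = "\<lambda>A. measure P A - measure N A"
  have \<mu>: "?\<mu> \<in> signed_measures M"
    using P N by (intro diff_in_signed_measures) auto
  show ?thesis
    unfolding signed_integral_def
  proof (rule integral_bounded_add_measures[where M = M and B = B])
    fix A assume "A \<in> sets M"
    from Jordan_decomposition[OF \<mu> this]
    show "measure (positive_part M ?\<mu>) A + measure N A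
        = measure P A + measure (positive_part M (\<lambda>A. - ?\<mu> A)) A" by linarith
  qed (use P N f finite_measure_positive_part[OF \<mu>]
      finite_measure_positive_part[OF signed_measures_minus[OF \<mu>]] in auto)
qed

lemma finite_measure_null_measure: "finite_measure (null_measure M)"
  by (rule finite_measureI) simp

lemma measure_in_signed_measures:
  assumes "finite_measure Q" "sets Q = sets M"
  shows "measure Q \<in> signed_measures M"
  using diff_in_signed_measures[OF assms(1) finite_measure_null_measure[of M] assms(2)]
  by simp

lemma signed_integral_measure:
  fixes f :: "'a \<Rightarrow> real"
  assumes "finite_measure Q" "sets Q = sets M"
    and "f \<in> borel_measurable M" "\<And>x. x \<in> space M \<Longrightarrow> \<bar>f x\<bar> \<le> B"
  shows "signed_integral M (measure Q) f = (\<integral>x. f x \<partial>Q)"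
proof -
  have "signed_integral M (\<lambda>A. measure Q A - measure (null_measure M) A) f
      = (\<integral>x. f x \<partial>Q) - (\<integral>x. f x \<partial>null_measure M)"
    using assms by (intro signed_integral_diff finite_measure_null_measure) auto
  then show ?thesis by simp
qed

section \<open>The weak* topology\<close>

lemma topspace_weak_star [simp]: "topspace (weak_star \<tau>) = signed_measures (borel_of \<tau>)"
proof -
  have "\<mu> \<in> \<Union>{{\<mu> \<in> signed_measures (borel_of \<tau>).
        \<bar>signed_integral (borel_of \<tau>) \<mu> f - signed_integral (borel_of \<tau>) \<nu> f\<bar> < \<epsilon>} | f \<nu> \<epsilon>.
        f \<in> bounded_continuous \<tau> \<and> \<nu> \<in> signed_measures (borel_of \<tau>) \<and> 0 < \<epsilon>}"
    if "\<mu> \<in> signed_measures (borel_of \<tau>)" for \<mu>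
  proof (rule UnionI[OF CollectI])
    \<comment> \<open>The zero function has integral zero against every signed measure, so its unit
      ball is the whole space.\<close>
    have "(\<lambda>x. 0) \<in> bounded_continuous \<tau>"
      by (auto simp: bounded_continuous_def image_constant_conv)
    then show "\<exists>f \<nu> \<epsilon>. {\<mu>' \<in> signed_measures (borel_of \<tau>).
        \<bar>signed_integral (borel_of \<tau>) \<mu>' (\<lambda>x. 0) - signed_integral (borel_of \<tau>) \<mu> (\<lambda>x. 0)\<bar> < 1} =
      {\<mu> \<in> signed_measures (borel_of \<tau>).
        \<bar>signed_integral (borel_of \<tau>) \<mu> f - signed_integral (borel_of \<tau>) \<nu> f\<bar> < \<epsilon>} \<and>
        f \<in> bounded_continuous \<tau> \<and> \<nu> \<in> signed_measures (borel_of \<tau>) \<and> 0 < \<epsilon>"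
      using that by (intro exI[of _ "\<lambda>x. 0"] exI[of _ \<mu>] exI[of _ "1::real"]) auto
  qed (use that in simp)
  then show ?thesis
    unfolding weak_star_def topology_generated_by_topspace by auto
qed

lemma continuous_map_weak_star:
  assumes "f \<in> bounded_continuous \<tau>"
  shows "continuous_map (weak_star \<tau>) euclideanreal (\<lambda>\<mu>. signed_integral (borel_of \<tau>) \<mu> f)"
  unfolding continuous_map_def
proof (intro conjI allI impI)
  fix U :: "real set" assume "openin euclideanreal U"
  then have U: "open U" by simp
  let ?I = "\<lambda>\<mu>. signed_integral (borel_of \<tau>) \<mu> f" and ?S = "signed_measures (borel_of \<tau>)"
  show "openin (weak_star \<tau>) {\<mu> \<in> topspace (weak_star \<tau>). ?I \<mu> \<in> U}"
  proof (subst openin_subopen, intro ballI)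
    fix \<nu> assume \<nu>: "\<nu> \<in> {\<mu> \<in> topspace (weak_star \<tau>). ?I \<mu> \<in> U}"
    then obtain \<epsilon> where \<epsilon>: "\<epsilon> > 0" "ball (?I \<nu>) \<epsilon> \<subseteq> U"
      using U openE by blast
    let ?V = "{\<mu> \<in> ?S. \<bar>?I \<mu> - ?I \<nu>\<bar> < \<epsilon>}"
    have "openin (weak_star \<tau>) ?V"
      unfolding weak_star_def using assms \<epsilon> \<nu> by (intro topology_generated_by_Basis) auto
    moreover have "?V \<subseteq> {\<mu> \<in> topspace (weak_star \<tau>). ?I \<mu> \<in> U}"
      using \<epsilon> by (auto simp: dist_real_def abs_minus_commute)
    ultimately show "\<exists>T. openin (weak_star \<tau>) T \<and> \<nu> \<in> T \<and> T \<subseteq> {\<mu> \<in> topspace (weak_star \<tau>). ?I \<mu> \<in> U}"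
      using \<nu> \<epsilon>(1) by (intro exI[of _ ?V]) auto
  qed
qed auto

text \<open>The sets that \<open>s\<close> finally stays in, or that miss \<open>\<mu>\<close>, are
  closed under finite intersections and arbitrary unions, so convergence has to be tested on the
  subbasic balls only. A ball may be centred at some \<open>\<nu>\<close> other than
  \<open>\<mu>\<close>, but its strict inequality holds in the limit and hence eventually.\<close>

lemma limitin_weak_star_iff:
  "limitin (weak_star \<tau>) s \<mu> F \<longleftrightarrow>
     \<mu> \<in> signed_measures (borel_of \<tau>) \<and> (\<forall>\<^sub>F n in F. s n \<in> signed_measures (borel_of \<tau>)) \<and>
     (\<forall>f \<in> bounded_continuous \<tau>.
       ((\<lambda>n. signed_integral (borel_of \<tau>) (s n) f) \<longlongrightarrow> signed_integral (borel_of \<tau>) \<mu> f) F)"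
  (is "?lhs \<longleftrightarrow> ?rhs")
proof
  assume L: ?lhs
  show ?rhs
  proof (intro conjI ballI)
    show "\<mu> \<in> signed_measures (borel_of \<tau>)" using L limitin_topspace by fastforce
    show "\<forall>\<^sub>F n in F. s n \<in> signed_measures (borel_of \<tau>)"
      using L unfolding limitin_def by (metis openin_topspace topspace_weak_star)
    fix f assume "f \<in> bounded_continuous \<tau>"
    from continuous_map_limit[OF continuous_map_weak_star[OF this] L]
    show "((\<lambda>n. signed_integral (borel_of \<tau>) (s n) f) \<longlongrightarrow> signed_integral (borel_of \<tau>) \<mu> f) F"
      by (simp add: o_def)
  qed
next
  assume R: ?rhs
  show ?lhs
    unfolding limitin_def
  proof (intro conjI allI impI)
    show "\<mu> \<in> topspace (weak_star \<tau>)" using R by simp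
    fix U assume U: "openin (weak_star \<tau>) U \<and> \<mu> \<in> U"
    then have "generate_topology_on {{\<mu> \<in> signed_measures (borel_of \<tau>).
        \<bar>signed_integral (borel_of \<tau>) \<mu> f - signed_integral (borel_of \<tau>) \<nu> f\<bar> < \<epsilon>} | f \<nu> \<epsilon>.
        f \<in> bounded_continuous \<tau> \<and> \<nu> \<in> signed_measures (borel_of \<tau>) \<and> 0 < \<epsilon>} U"
      unfolding weak_star_def by (simp add: openin_topology_generated_by)
    then have "\<mu> \<in> U \<longrightarrow> (\<forall>\<^sub>F n in F. s n \<in> U)"
    proof (induction rule: generate_topology_on.induct)
      case (Int a b)
      then show ?case by (auto intro: eventually_conj)
    next
      case (UN K)
      show ?case
      proof
        assume "\<mu> \<in> \<Union>K"
        then obtain V where V: "V \<in> K" "\<mu> \<in> V" by blast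
        with UN.IH have "\<forall>\<^sub>F n in F. s n \<in> V" by blast
        then show "\<forall>\<^sub>F n in F. s n \<in> \<Union>K" by eventually_elim (use V in blast)
      qed
    next
      case (Basis V)
      then obtain f \<nu> \<epsilon> where V: "V = {\<mu> \<in> signed_measures (borel_of \<tau>).
        \<bar>signed_integral (borel_of \<tau>) \<mu> f - signed_integral (borel_of \<tau>) \<nu> f\<bar> < \<epsilon>}"
        and f: "f \<in> bounded_continuous \<tau>" by blast
      show ?case
      proof
        assume "\<mu> \<in> V"
        have "((\<lambda>n. \<bar>signed_integral (borel_of \<tau>) (s n) f - signed_integral (borel_of \<tau>) \<nu> f\<bar>) \<longlongrightarrow>
           \<bar>signed_integral (borel_of \<tau>) \<mu> f - signed_integral (borel_of \<tau>) \<nu> f\<bar>) F"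
          using R f by (intro tendsto_intros) auto
        then have "\<forall>\<^sub>F n in F. \<bar>signed_integral (borel_of \<tau>) (s n) f - signed_integral (borel_of \<tau>) \<nu> f\<bar> < \<epsilon>"
          using \<open>\<mu> \<in> V\<close> V by (intro order_tendstoD(2)) auto
        then show "\<forall>\<^sub>F n in F. s n \<in> V"
          using R V by (auto elim: eventually_elim2)
      qed
    qed auto
    then show "\<forall>\<^sub>F n in F. s n \<in> U" using U by simp
  qed
qed

lemma space_borel_of [simp]: "space (borel_of \<tau>) = topspace \<tau>"
  unfolding borel_of_def by (simp add: space_measure_of_conv)

lemma openin_in_sets_borel_of: "openin \<tau> U \<Longrightarrow> U \<in> sets (borel_of \<tau>)"
  unfolding borel_of_def by (subst sets_measure_of) (auto dest: openin_subset)

lemma continuous_map_measurable_borel_of: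
  assumes "continuous_map \<tau> (euclidean :: 'b::topological_space topology) f"
  shows "f \<in> borel_measurable (borel_of \<tau>)"
proof (rule borel_measurableI)
  fix S :: "'b set" assume "open S"
  then have "openin \<tau> {x \<in> topspace \<tau>. f x \<in> S}"
    using assms by (auto simp: continuous_map_def)
  moreover have "f -` S \<inter> space (borel_of \<tau>) = {x \<in> topspace \<tau>. f x \<in> S}" by auto
  ultimately show "f -` S \<inter> space (borel_of \<tau>) \<in> sets (borel_of \<tau>)"
    using openin_in_sets_borel_of by metis
qed

section \<open>Compactness through a continuous injection into a metric space\<close>

text \<open>A continuous injection into a metric space makes a sequentially compact set
  \<open>K\<close> homeomorphic to its image: relatively closed subsets of \<open>K\<close> have
  sequentially compact images, which in a metric space are compact and closed, so the inverse is
  continuous. The sequential closure of \<open>Z\<close> is the part of \<open>K\<close> lying over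
  the closure of the image of \<open>Z\<close>; taking limits of sequences once therefore already
  gives a compact set.\<close>

lemma seq_compactin_injective_closure:
  fixes \<Psi> :: "'a \<Rightarrow> 'b::metric_space"
  assumes K: "seq_compactin X K" and cont: "continuous_map X euclidean \<Psi>"
    and inj: "inj_on \<Psi> (topspace X)" and Z: "Z \<subseteq> K"
  shows "seq_closure X Z \<subseteq> K" "compactin X (seq_closure X Z)" "seq_compactin X (seq_closure X Z)"
proof -
  let ?N = "seq_closure X Z"
  have KX: "K \<subseteq> topspace X" using K by (simp add: seq_compactin_def)
  have sub: "\<exists>x\<in>K. \<exists>r::nat \<Rightarrow> nat. strict_mono r \<and> limitin X (s \<circ> r) x sequentially"
    if "range s \<subseteq> K" for s
    using K that by (simp add: seq_compactin_def)
  have lim: "(\<lambda>n. \<Psi> (s n)) \<longlonglongrightarrow> \<Psi> x" if "limitin X s x sequentially" for s x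
    using continuous_map_limit[OF cont that] by (simp add: o_def)
  show NK: "?N \<subseteq> K"
  proof
    fix x assume "x \<in> ?N"
    then obtain s where s: "range s \<subseteq> Z" "limitin X s x sequentially"
      by (auto simp: seq_closure_def)
    obtain y r where y: "y \<in> K" "strict_mono r" "limitin X (s \<circ> r) y sequentially"
      using sub[of s] s(1) Z by blast
    have "(\<lambda>n. \<Psi> (s (r n))) \<longlonglongrightarrow> \<Psi> x"
      using LIMSEQ_subseq_LIMSEQ[OF lim[OF s(2)] y(2)] by (simp add: o_def)
    moreover have "(\<lambda>n. \<Psi> (s (r n))) \<longlonglongrightarrow> \<Psi> y"
      using lim[OF y(3)] by simp
    ultimately have "\<Psi> x = \<Psi> y" by (rule LIMSEQ_unique)
    moreover have "x \<in> topspace X" using limitin_topspace[OF s(2)] .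
    ultimately have "x = y" using inj y(1) KX by (auto simp: inj_on_def)
    then show "x \<in> K" using y(1) by simp
  qed
  have inj_K: "inj_on \<Psi> K" using inj KX by (rule inj_on_subset)
  \<comment> \<open>A sequence in \<open>Z\<close> whose images converge to \<open>\<Psi> x\<close>
    subconverges in \<open>K\<close>; injectivity identifies its limit with
    \<open>x\<close>.\<close>
  have N_eq: "?N = {x \<in> K. \<Psi> x \<in> closure (\<Psi> ` Z)}"
  proof (intro set_eqI iffI CollectI conjI)
    fix x assume x: "x \<in> ?N"
    then show "x \<in> K" using NK by blast
    from x obtain s where s: "range s \<subseteq> Z" "limitin X s x sequentially"
      by (auto simp: seq_closure_def)
    have "\<Psi> (s n) \<in> closure (\<Psi> ` Z)" for n
      using s(1) closure_subset[of "\<Psi> ` Z"] by blast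
    then show "\<Psi> x \<in> closure (\<Psi> ` Z)"
      using closed_sequentially[OF closed_closure _ lim[OF s(2)]] by blast
  next
    fix x assume x: "x \<in> {x \<in> K. \<Psi> x \<in> closure (\<Psi> ` Z)}"
    then obtain f where f: "\<And>n. f n \<in> \<Psi> ` Z" "f \<longlonglongrightarrow> \<Psi> x"
      unfolding closure_sequential by blast
    have "\<forall>n. \<exists>z. z \<in> Z \<and> f n = \<Psi> z" using f(1) by blast
    then obtain s where s: "\<And>n. s n \<in> Z" "\<And>n. f n = \<Psi> (s n)" by metis
    obtain y r where y: "y \<in> K" "strict_mono r" "limitin X (s \<circ> r) y sequentially"
      using sub[of s] s(1) Z by blast
    have "(\<lambda>n. \<Psi> (s (r n))) \<longlonglongrightarrow> \<Psi> x"
      using LIMSEQ_subseq_LIMSEQ[OF f(2) y(2)] s(2) by (simp add: o_def)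
    moreover have "(\<lambda>n. \<Psi> (s (r n))) \<longlonglongrightarrow> \<Psi> y"
      using lim[OF y(3)] by simp
    ultimately have "\<Psi> x = \<Psi> y" by (rule LIMSEQ_unique)
    then have "x = y" using inj_K x y(1) by (auto simp: inj_on_def)
    then show "x \<in> ?N"
      unfolding seq_closure_def using y(3) s(1) by (intro CollectI exI[of _ "s \<circ> r"]) auto
  qed
  have compact_image: "compact (\<Psi> ` (K \<inter> C))" if C: "closedin X C" for C
    unfolding compact_eq_seq_compact_metric seq_compact_def
  proof (intro allI impI)
    fix f :: "nat \<Rightarrow> 'b" assume "\<forall>n. f n \<in> \<Psi> ` (K \<inter> C)"
    then have "\<forall>n. \<exists>z. z \<in> K \<inter> C \<and> f n = \<Psi> z" by blast
    then obtain s where s: "\<And>n. s n \<in> K \<inter> C" "\<And>n. f n = \<Psi> (s n)" by metis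
    obtain y r where y: "y \<in> K" "strict_mono r" "limitin X (s \<circ> r) y sequentially"
      using sub[of s] s(1) by blast
    have "y \<in> C"
      using limitin_closedin[OF y(3) C] s(1) by (simp add: o_def)
    then show "\<exists>l\<in>\<Psi> ` (K \<inter> C). \<exists>r. strict_mono r \<and> (f \<circ> r) \<longlonglongrightarrow> l"
      using y lim[OF y(3)] s(2) by (intro bexI[of _ "\<Psi> y"] exI[of _ r]) (auto simp: o_def)
  qed
  define g where "g = inv_into K \<Psi>"
  have g: "g (\<Psi> x) = x" if "x \<in> K" for x
    unfolding g_def using inj_K that by simp
  have g_cont: "continuous_map (top_of_set (\<Psi> ` K)) X g"
    unfolding continuous_map_closedin
  proof (intro conjI allI impI)
    show "g \<in> topspace (top_of_set (\<Psi> ` K)) \<rightarrow> topspace X" using g KX by auto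
    fix C assume C: "closedin X C"
    have "{y \<in> topspace (top_of_set (\<Psi> ` K)). g y \<in> C} = \<Psi> ` (K \<inter> C)"
      using g by auto
    then show "closedin (top_of_set (\<Psi> ` K)) {y \<in> topspace (top_of_set (\<Psi> ` K)). g y \<in> C}"
      using compact_imp_closed[OF compact_image[OF C]] by (auto intro!: closed_subset)
  qed
  have "compact (\<Psi> ` K)"
    using compact_image[OF closedin_topspace] KX by (simp add: Int_absorb2)
  then have "compact (\<Psi> ` K \<inter> closure (\<Psi> ` Z))" by auto
  then have "compactin (top_of_set (\<Psi> ` K)) (\<Psi> ` K \<inter> closure (\<Psi> ` Z))"
    by (simp add: compactin_subtopology)
  moreover have "g ` (\<Psi> ` K \<inter> closure (\<Psi> ` Z)) = ?N"
  proof (intro set_eqI iffI)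
    fix x assume "x \<in> g ` (\<Psi> ` K \<inter> closure (\<Psi> ` Z))"
    then show "x \<in> ?N" unfolding N_eq using g by auto
  next
    fix x assume "x \<in> ?N"
    then have "x \<in> K" "\<Psi> x \<in> closure (\<Psi> ` Z)" unfolding N_eq by auto
    then show "x \<in> g ` (\<Psi> ` K \<inter> closure (\<Psi> ` Z))"
      using g by (intro image_eqI[of _ _ "\<Psi> x"]) auto
  qed
  ultimately show "compactin X ?N"
    using image_compactin[OF _ g_cont] by metis
  show "seq_compactin X ?N"
    unfolding seq_compactin_def
  proof (intro conjI allI impI)
    show "?N \<subseteq> topspace X" using NK KX by blast
    fix s :: "nat \<Rightarrow> 'a" assume s: "range s \<subseteq> ?N"
    then obtain y r where y: "y \<in> K" "strict_mono r" "limitin X (s \<circ> r) y sequentially"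
      using sub[of s] NK by blast
    have "\<Psi> y \<in> closure (\<Psi> ` Z)"
      using closed_sequentially[OF closed_closure _ lim[OF y(3)], of "\<Psi> ` Z"] s N_eq by auto
    then have "y \<in> ?N" using y(1) N_eq by simp
    then show "\<exists>x\<in>?N. \<exists>r. strict_mono r \<and> limitin X (s \<circ> r) x sequentially"
      using y by blast
  qed
qed


section \<open>A Cantor coding of the Hilbert cube\<close>

text \<open>The profile of Schoenberg's space-filling curve, with a clipped cosine in place of the
  usual piecewise linear function: even, 2-periodic, 0 on [0,1/3] and 1 on [2/3,1]. It reads off a
  ternary digit 0 or 2 in a continuous way.\<close>

definition schoenberg_wave :: "real \<Rightarrow> real" where
  "schoenberg_wave t = max 0 (min 1 (1/2 - cos (pi * t)))"

definition binary_digit :: "real \<Rightarrow> nat \<Rightarrow> real" where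
  "binary_digit x j = real_of_int (\<lfloor>2 ^ Suc j * x\<rfloor> mod 2)"

definition cantor_point :: "(nat \<Rightarrow> real) \<Rightarrow> real" where
  "cantor_point b = (\<Sum>k. 2 * b k / 3 ^ Suc k)"

text \<open>The pairing hands the ternary place \<open>prod_encode (l, j)\<close> to binary digit
  \<open>j\<close> of coordinate \<open>l\<close>. Decoding is continuous, whereas coding is used
  only as a measurable map; this asymmetry suits weak limits, which need continuity of the way back
  from the line.\<close>

definition schoenberg_curve :: "nat \<Rightarrow> real \<Rightarrow> real" where
  "schoenberg_curve l x = (\<Sum>j. schoenberg_wave (3 ^ prod_encode (l, j) * x) / 2 ^ Suc j)"

definition cantor_code :: "(nat \<Rightarrow> real) \<Rightarrow> real" where
  "cantor_code z = cantor_point (\<lambda>k. case prod_decode k of (l, j) \<Rightarrow> binary_digit (z l) j)"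

lemma schoenberg_wave_range: "0 \<le> schoenberg_wave t" "schoenberg_wave t \<le> 1"
  by (auto simp: schoenberg_wave_def)

lemma schoenberg_wave_periodic:
  assumes "m \<in> \<int>"
  shows "schoenberg_wave (2 * m + t) = schoenberg_wave t"
proof -
  obtain n where "m = of_int n" using assms by (rule Ints_cases)
  then have "cos (pi * (2 * m + t)) = cos (2 * pi * of_int n + pi * t)"
    by (simp add: algebra_simps)
  also have "\<dots> = cos (pi * t)"
    by (simp add: cos_add)
  finally show ?thesis by (simp add: schoenberg_wave_def)
qed

lemma schoenberg_wave_eq_0:
  assumes "0 \<le> t" "t \<le> 1/3"
  shows "schoenberg_wave t = 0"
proof -
  have "cos (pi / 3) \<le> cos (pi * t)"
    using assms by (intro cos_monotone_0_pi_le) (auto simp: field_simps)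
  then show ?thesis by (simp add: cos_60 schoenberg_wave_def)
qed

lemma schoenberg_wave_eq_1:
  assumes "2/3 \<le> t" "t \<le> 1"
  shows "schoenberg_wave t = 1"
proof -
  have "pi * (2/3) \<le> pi * t" using assms by (intro mult_left_mono) auto
  then have "cos (pi / 3) \<le> cos (pi - pi * t)"
    using assms by (intro cos_monotone_0_pi_le) auto
  then show ?thesis by (simp add: cos_60 schoenberg_wave_def cos_diff)
qed

lemma binary_digit_cases: "binary_digit x j = 0 \<or> binary_digit x j = 1"
  unfolding binary_digit_def by (metis of_int_0 of_int_1 parity_cases)

lemma binary_digit_sums:
  assumes "0 \<le> x" "x < 1"
  shows "(\<lambda>j. binary_digit x j / 2 ^ Suc j) sums x"
proof -
  \<comment> \<open>The partial sums are the dyadic truncations of \<open>x\<close>; the empty one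
    is 0 because \<open>x\<close> has integer part 0.\<close>
  have partial: "(\<Sum>j<n. binary_digit x j / 2 ^ Suc j) = \<lfloor>2 ^ n * x\<rfloor> / 2 ^ n" for n
  proof (induction n)
    case 0
    then show ?case using assms by (simp add: floor_eq_iff)
  next
    case (Suc n)
    have "\<lfloor>2 ^ n * x\<rfloor> = \<lfloor>2 ^ Suc n * x / real_of_int 2\<rfloor>" by simp
    also have "\<dots> = \<lfloor>2 ^ Suc n * x\<rfloor> div 2" by (rule floor_divide_real_eq_div) simp
    finally have "\<lfloor>2 ^ Suc n * x\<rfloor> = 2 * \<lfloor>2 ^ n * x\<rfloor> + \<lfloor>2 ^ Suc n * x\<rfloor> mod 2" by simp
    then have "real_of_int \<lfloor>2 ^ Suc n * x\<rfloor> = 2 * real_of_int \<lfloor>2 ^ n * x\<rfloor> + binary_digit x n"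
      unfolding binary_digit_def by (metis of_int_add of_int_mult of_int_numeral)
    then show ?case using Suc by (simp add: field_simps)
  qed
  have "(\<lambda>n. real_of_int \<lfloor>2 ^ n * x\<rfloor> / 2 ^ n) \<longlonglongrightarrow> x"
  proof (rule LIM_zero_cancel, rule Lim_null_comparison)
    show "\<forall>\<^sub>F n in sequentially. norm (real_of_int \<lfloor>2 ^ n * x\<rfloor> / 2 ^ n - x) \<le> (1/2) ^ n"
    proof (rule always_eventually, rule allI)
      fix n
      have "\<bar>real_of_int \<lfloor>2 ^ n * x\<rfloor> - 2 ^ n * x\<bar> \<le> 1" by linarith
      then have "\<bar>real_of_int \<lfloor>2 ^ n * x\<rfloor> - 2 ^ n * x\<bar> / 2 ^ n \<le> 1 / 2 ^ n"
        by (rule divide_right_mono) simp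
      moreover have "real_of_int \<lfloor>2 ^ n * x\<rfloor> / 2 ^ n - x = (real_of_int \<lfloor>2 ^ n * x\<rfloor> - 2 ^ n * x) / 2 ^ n"
        by (simp add: field_simps)
      ultimately show "norm (real_of_int \<lfloor>2 ^ n * x\<rfloor> / 2 ^ n - x) \<le> (1/2) ^ n"
        by (simp add: abs_divide power_one_over)
    qed
    show "(\<lambda>n. (1/2::real) ^ n) \<longlonglongrightarrow> 0" by (rule LIMSEQ_realpow_zero) auto
  qed
  then show ?thesis unfolding sums_def partial .
qed

lemma geometric_third_sums: "(\<lambda>k. 2 / 3 ^ Suc k :: real) sums 1"
proof -
  have "(\<lambda>k. (2/3) * (1/3::real) ^ k) sums ((2/3) * (1 / (1 - 1/3)))"
    by (intro sums_mult geometric_sums) simp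
  then show ?thesis by (simp add: power_one_over field_simps)
qed

lemma summable_cantor:
  assumes "\<And>k. b k = 0 \<or> b k = 1"
  shows "summable (\<lambda>k. 2 * b k / 3 ^ Suc k :: real)"
  using assms
  by (intro summable_comparison_test'[OF sums_summable[OF geometric_third_sums], of 0])
     (metis (no_types, lifting) abs_of_nonneg divide_nonneg_nonneg div_0 mult_cancel_left2 mult_zero_right
       norm_zero order_refl real_norm_def zero_le_numeral zero_le_power)

lemma cantor_point_range:
  assumes "\<And>k. b k = 0 \<or> b k = 1"
  shows "0 \<le> cantor_point b" "cantor_point b \<le> 1"
proof -
  have b: "0 \<le> b k" "b k \<le> 1" for k using assms[of k] by auto
  show "0 \<le> cantor_point b"
    unfolding cantor_point_def using b by (intro suminf_nonneg summable_cantor assms) auto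
  have "cantor_point b \<le> (\<Sum>k. 2 / 3 ^ Suc k)"
    unfolding cantor_point_def using b
    by (intro suminf_le summable_cantor assms sums_summable[OF geometric_third_sums])
       (auto intro!: divide_right_mono)
  then show "cantor_point b \<le> 1" using sums_unique[OF geometric_third_sums] by simp
qed

text \<open>Multiplication by \<open>3 ^ k\<close> turns the earlier digits, all 0 or 2, into an
  even integer, which the period 2 absorbs. What remains lies in [0,1/3] or in [2/3,1] according to
  digit \<open>k\<close>.\<close>

lemma schoenberg_wave_cantor_point:
  assumes b: "\<And>k. b k = 0 \<or> b k = 1"
  shows "schoenberg_wave (3 ^ k * cantor_point b) = b k"
proof -
  define c where "c i = b (i + Suc k)" for i
  have c: "c i = 0 \<or> c i = 1" for i unfolding c_def by (rule b)
  have "cantor_point b = (\<Sum>i. 2 * b (i + Suc k) / 3 ^ Suc (i + Suc k)) + (\<Sum>i<Suc k. 2 * b i / 3 ^ Suc i)"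
    unfolding cantor_point_def by (rule suminf_split_initial_segment[OF summable_cantor[OF b]])
  also have "(\<Sum>i. 2 * b (i + Suc k) / 3 ^ Suc (i + Suc k)) = (\<Sum>i. (1 / 3 ^ Suc k) * (2 * c i / 3 ^ Suc i))"
    by (simp add: c_def power_add field_simps)
  also have "\<dots> = (1 / 3 ^ Suc k) * cantor_point c"
    unfolding cantor_point_def by (rule suminf_mult[OF summable_cantor[OF c]])
  finally have eq: "3 ^ k * cantor_point b = cantor_point c / 3 + (\<Sum>i<k. 3 ^ k * (2 * b i / 3 ^ Suc i)) + 2 * b k / 3"
    by (simp add: algebra_simps sum_distrib_left)
  have int: "b i * 3 ^ (k - Suc i) \<in> \<int>" for i using b[of i] by auto
  have "(\<Sum>i<k. 3 ^ k * (2 * b i / 3 ^ Suc i)) = (\<Sum>i<k. 2 * (b i * 3 ^ (k - Suc i)))"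
  proof (rule sum.cong)
    fix i assume "i \<in> {..<k}"
    then have "(3::real) ^ k = 3 ^ (k - Suc i) * 3 ^ Suc i"
      by (metis Suc_leI add.commute le_add_diff_inverse lessThan_iff power_add)
    then show "3 ^ k * (2 * b i / 3 ^ Suc i) = 2 * (b i * 3 ^ (k - Suc i))" by simp
  qed simp
  also have "\<dots> = 2 * (\<Sum>i<k. b i * 3 ^ (k - Suc i))" by (simp add: sum_distrib_left)
  finally have "3 ^ k * cantor_point b = 2 * (\<Sum>i<k. b i * 3 ^ (k - Suc i)) + (2 * b k / 3 + cantor_point c / 3)"
    using eq by simp
  moreover have "(\<Sum>i<k. b i * 3 ^ (k - Suc i)) \<in> \<int>" using int by (intro Ints_sum)
  ultimately have "schoenberg_wave (3 ^ k * cantor_point b) = schoenberg_wave (2 * b k / 3 + cantor_point c / 3)"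
    by (simp add: schoenberg_wave_periodic)
  also have "\<dots> = b k"
    using b[of k] cantor_point_range[of c] c
    by (elim disjE) (simp_all add: schoenberg_wave_eq_0 schoenberg_wave_eq_1)
  finally show ?thesis .
qed

lemma cantor_code_range: "0 \<le> cantor_code z" "cantor_code z \<le> 1"
  unfolding cantor_code_def
  by (rule cantor_point_range; simp add: binary_digit_cases split: prod.split)+

text \<open>Binary digits see only the fractional part, hence the restriction to [0,1); the tests
  used later are normalised to take values there.\<close>

lemma schoenberg_curve_cantor_code:
  assumes "0 \<le> z l" "z l < 1"
  shows "schoenberg_curve l (cantor_code z) = z l"
proof -
  have "schoenberg_wave (3 ^ prod_encode (l, j) * cantor_code z) = binary_digit (z l) j" for j
    unfolding cantor_code_def
    by (subst schoenberg_wave_cantor_point) (auto simp: binary_digit_cases split: prod.split)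
  then show ?thesis
    unfolding schoenberg_curve_def using sums_unique[OF binary_digit_sums[OF assms]] by simp
qed

lemma continuous_on_schoenberg_curve: "continuous_on UNIV (schoenberg_curve l)"
proof -
  have lim: "uniform_limit UNIV (\<lambda>n x. \<Sum>j<n. schoenberg_wave (3 ^ prod_encode (l, j) * x) / 2 ^ Suc j)
     (\<lambda>x. \<Sum>j. schoenberg_wave (3 ^ prod_encode (l, j) * x) / 2 ^ Suc j) sequentially"
  proof (rule Weierstrass_m_test)
    show "norm (schoenberg_wave (3 ^ prod_encode (l, j) * x) / 2 ^ Suc j) \<le> (1/2) ^ Suc j" for j x
      using schoenberg_wave_range[of "3 ^ prod_encode (l, j) * x"]
      by (simp add: power_one_over divide_right_mono)
    show "summable (\<lambda>j. (1/2::real) ^ Suc j)" by (simp add: summable_mult)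
  qed
  have "continuous_on UNIV (\<lambda>x. \<Sum>j. schoenberg_wave (3 ^ prod_encode (l, j) * x) / 2 ^ Suc j)"
    by (rule uniform_limit_theorem[OF _ lim])
       (auto simp: schoenberg_wave_def intro!: always_eventually continuous_intros)
  then show ?thesis by (simp add: schoenberg_curve_def[abs_def])
qed

lemma borel_measurable_cantor_code:
  assumes "\<And>l. (\<lambda>x. z l x) \<in> borel_measurable M"
  shows "(\<lambda>x. cantor_code (\<lambda>l. z l x)) \<in> borel_measurable M"
proof -
  note [measurable] = assms
  have [measurable]: "(\<lambda>x. binary_digit (z l x) j) \<in> borel_measurable M" for l j
    unfolding binary_digit_def by measurable
  show ?thesis
    unfolding cantor_code_def cantor_point_def
    by (intro borel_measurable_suminf) (auto split: prod.split)
qed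

text \<open>The closed-set half of the portmanteau theorem: the continuous cut-offs
  \<open>g k\<close> lie above the indicator of \<open>L\<close> and decrease to it. The empty set
  is separate, since \<open>infdist\<close> to it is 0.\<close>

lemma weak_conv_m_closed_ge:
  assumes \<mu>: "\<And>n. real_distribution (\<mu> n)" "real_distribution \<mu>0" "weak_conv_m \<mu> \<mu>0"
    and L: "closed L" and c: "\<And>n. c \<le> measure (\<mu> n) L"
  shows "c \<le> measure \<mu>0 L"
proof (cases "L = {}")
  case True
  then show ?thesis using c[of 0] by simp
next
  case False
  interpret \<mu>0: real_distribution \<mu>0 by fact
  define g where "g k x = max 0 (1 - real k * infdist x L)" for k and x :: real
  have g_cont: "continuous_on UNIV (g k)" for k
    unfolding g_def by (intro continuous_intros)
  have g_range: "0 \<le> g k x" "g k x \<le> 1" for k x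
    unfolding g_def by (auto simp: infdist_nonneg)
  have [measurable]: "g k \<in> borel_measurable borel" "L \<in> sets borel" for k
    using g_cont L by (auto intro: borel_measurable_continuous_onI)
  have "c \<le> (\<integral>x. g k x \<partial>\<mu>0)" for k
  proof (rule LIMSEQ_le_const)
    show "(\<lambda>n. \<integral>x. g k x \<partial>\<mu> n) \<longlonglongrightarrow> (\<integral>x. g k x \<partial>\<mu>0)"
      using g_range g_cont \<mu>
      by (intro weak_conv_imp_integral_bdd_continuous_conv[where B = 1])
         (auto simp: continuous_on_eq_continuous_at)
    have "c \<le> (\<integral>x. g k x \<partial>\<mu> n)" for n
    proof -
      interpret real_distribution "\<mu> n" by (rule \<mu>)
      have "c \<le> (\<integral>x. indicator L x \<partial>\<mu> n)" using c[of n] by simp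
      also have "\<dots> \<le> (\<integral>x. g k x \<partial>\<mu> n)"
      proof (rule integral_mono)
        show "integrable (\<mu> n) (indicator L :: real \<Rightarrow> real)"
          by (rule integrable_const_bound[of _ 1]) (auto simp: indicator_def)
        show "integrable (\<mu> n) (g k)"
          by (rule integrable_const_bound[of _ 1]) (auto simp: g_range)
        show "indicator L x \<le> g k x" for x
          using g_range(1)[of k x] by (cases "x \<in> L") (auto simp: g_def)
      qed
      finally show ?thesis .
    qed
    then show "\<exists>N. \<forall>n\<ge>N. c \<le> (\<integral>x. g k x \<partial>\<mu> n)" by blast
  qed
  moreover have "(\<lambda>k. \<integral>x. g k x \<partial>\<mu>0) \<longlonglongrightarrow> (\<integral>x. indicator L x \<partial>\<mu>0)"
  proof (rule integral_dominated_convergence[where w = "\<lambda>_. 1"])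
    show "AE x in \<mu>0. (\<lambda>k. g k x) \<longlonglongrightarrow> indicator L x"
    proof (rule AE_I2)
      fix x
      show "(\<lambda>k. g k x) \<longlonglongrightarrow> indicator L x"
      proof (cases "x \<in> L")
        case True
        then show ?thesis by (simp add: g_def)
      next
        case False
        then have pos: "infdist x L > 0"
          using infdist_pos_not_in_closed[OF L \<open>L \<noteq> {}\<close>] by simp
        obtain k0 :: nat where k0: "1 / infdist x L \<le> real k0" using real_arch_simple by blast
        have "g k x = 0" if "k \<ge> k0" for k
        proof -
          have "1 / infdist x L \<le> real k" using k0 that by linarith
          then have "1 \<le> real k * infdist x L" using pos by (simp add: field_simps)
          then show ?thesis by (simp add: g_def)
        qed
        then have "eventually (\<lambda>k. g k x = 0) sequentially"
          by (auto simp: eventually_sequentially)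
        then show ?thesis using False by (simp add: tendsto_eventually)
      qed
    qed
  qed (auto simp: g_range)
  ultimately show ?thesis
    using LIMSEQ_le_const[of "\<lambda>k. \<integral>x. g k x \<partial>\<mu>0" "\<integral>x. indicator L x \<partial>\<mu>0" c] by simp
qed

lemma (in prob_space) abs_integral_le_of_null_on:
  fixes u :: "'a \<Rightarrow> real"
  assumes [measurable]: "u \<in> borel_measurable M" "A \<in> sets M"
    and "\<And>x. x \<in> space M \<Longrightarrow> \<bar>u x\<bar> \<le> C" "\<And>x. x \<in> A \<Longrightarrow> u x = 0" and A: "1 - \<epsilon> \<le> prob A"
  shows "\<bar>\<integral>x. u x \<partial>M\<bar> \<le> C * \<epsilon>"
proof -
  have C: "C \<ge> 0" using assms(3) not_empty by (metis abs_ge_zero ex_in_conv order_trans)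
  have int: "integrable M u"
    using assms by (intro integrable_const_bound[of _ C]) auto
  have "\<bar>\<integral>x. u x \<partial>M\<bar> \<le> (\<integral>x. \<bar>u x\<bar> \<partial>M)" by (rule integral_abs_bound)
  also have "\<dots> \<le> (\<integral>x. C * indicator (space M - A) x \<partial>M)"
  proof (rule integral_mono)
    show "integrable M (\<lambda>x. C * indicator (space M - A) x)"
      by (intro integrable_mult_right integrable_const_bound[of _ 1]) auto
    show "\<bar>u x\<bar> \<le> C * indicator (space M - A) x" if "x \<in> space M" for x
      using assms(3,4) that by (auto simp: indicator_def)
  qed (use int in simp)
  also have "\<dots> = C * prob (space M - A)" by simp
  also have "\<dots> \<le> C * \<epsilon>"
    using A C prob_compl[of A] by (intro mult_left_mono) auto
  finally show ?thesis .
qed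

section \<open>Tight families over a countably tested space\<close>

text \<open>The compactness at hand is sequential, so test functions enter limit arguments only
  along convergent sequences.\<close>

definition seq_continuous :: "'a topology \<Rightarrow> ('a \<Rightarrow> real) \<Rightarrow> bool" where
  "seq_continuous \<tau> f \<longleftrightarrow>
     (\<forall>s x. range s \<subseteq> topspace \<tau> \<longrightarrow> limitin \<tau> s x sequentially \<longrightarrow> (\<lambda>n. f (s n)) \<longlonglongrightarrow> f x)"

lemma seq_continuousD:
  "seq_continuous \<tau> f \<Longrightarrow> range s \<subseteq> topspace \<tau> \<Longrightarrow> limitin \<tau> s x sequentially \<Longrightarrow> (\<lambda>n. f (s n)) \<longlonglongrightarrow> f x"
  by (simp add: seq_continuous_def)

lemma continuous_map_imp_seq_continuous:
  "continuous_map \<tau> euclideanreal f \<Longrightarrow> seq_continuous \<tau> f"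
  unfolding seq_continuous_def using continuous_map_limit[of \<tau> euclideanreal f] by (auto simp: o_def)

text \<open>
  No \<open>G l k\<close> needs to be compact by itself: the sequentially compact sets are the intersections
  \<open>\<Inter>l. G l (\<phi> l)\<close>.
\<close>

locale countably_tested_space =
  fixes \<tau> :: "'a topology" and F :: "'a measure"
    and e :: "nat \<Rightarrow> 'a \<Rightarrow> real" and G :: "nat \<Rightarrow> nat \<Rightarrow> 'a set"
  assumes space_F: "space F = topspace \<tau>"
    and e_cont: "continuous_map \<tau> euclideanreal (e l)"
    and e_range: "x \<in> topspace \<tau> \<Longrightarrow> 0 \<le> e l x \<and> e l x < 1"
    and e_measurable: "e l \<in> borel_measurable F"
    and e_generates: "sets F \<subseteq> sigma_sets (topspace \<tau>) (\<Union>l. {e l -` A \<inter> topspace \<tau> | A. A \<in> sets borel})"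
    and e_separates: "x \<in> topspace \<tau> \<Longrightarrow> y \<in> topspace \<tau> \<Longrightarrow> (\<And>l. e l x = e l y) \<Longrightarrow> x = y"
    and G_sets: "G l k \<in> sets F"
    and G_mono: "k \<le> k' \<Longrightarrow> G l k \<subseteq> G l k'"
    and G_exhausts: "x \<in> topspace \<tau> \<Longrightarrow> \<exists>k. x \<in> G l k"
    and G_compact: "range s \<subseteq> topspace \<tau> \<Longrightarrow> (\<And>l. \<exists>k. \<forall>n. s n \<in> G l k) \<Longrightarrow>
          \<exists>x r. x \<in> topspace \<tau> \<and> strict_mono (r::nat \<Rightarrow> nat) \<and> limitin \<tau> (s \<circ> r) x sequentially \<and>
            (\<forall>l k. (\<forall>n. s n \<in> G l k) \<longrightarrow> x \<in> G l k)"
begin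

lemma e_limit: "limitin \<tau> s x sequentially \<Longrightarrow> (\<lambda>n. e l (s n)) \<longlonglongrightarrow> e l x"
  using continuous_map_limit[OF e_cont] by (simp add: o_def)

text \<open>Lets a map into the space, such as the decoding map in \<open>Prokhorov\<close>, be
  checked test by test.\<close>

lemma measurable_into_F:
  assumes f: "f \<in> space N \<rightarrow> topspace \<tau>" and e: "\<And>l. (\<lambda>x. e l (f x)) \<in> borel_measurable N"
  shows "f \<in> measurable N F"
proof (rule measurableI)
  fix A assume "A \<in> sets F"
  then have "A \<in> sigma_sets (topspace \<tau>) (\<Union>l. {e l -` A \<inter> topspace \<tau> | A. A \<in> sets borel})"
    using e_generates by blast
  then show "f -` A \<inter> space N \<in> sets N"
  proof induction
    case (Basic a)
    then obtain l B where a: "a = e l -` B \<inter> topspace \<tau>" "B \<in> sets borel" by blast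
    have "f -` a \<inter> space N = (\<lambda>x. e l (f x)) -` B \<inter> space N" using f a by auto
    then show ?case using measurable_sets[OF e a(2)] by simp
  next
    case (Compl a)
    have "f -` (topspace \<tau> - a) \<inter> space N = space N - (f -` a \<inter> space N)" using f by auto
    then show ?case using Compl by auto
  next
    case (Union a)
    have "f -` (\<Union>i. a i) \<inter> space N = (\<Union>i. f -` a i \<inter> space N)" by auto
    also have "\<dots> \<in> sets N" using Union by (intro sets.countable_UN) auto
    finally show ?case .
  qed simp
qed (use f space_F in auto)

text \<open>Finitely many levels and rational bounds, so the indices form a countable type and
  unions over them stay in \<open>F\<close>. The sets are not claimed to be open; they serve as a
  network of the topology.\<close>

definition neighbourhood :: "nat list \<times> (rat \<times> rat) list \<Rightarrow> 'a set" where
  "neighbourhood p = {x \<in> topspace \<tau>. (\<forall>l<length (fst p). x \<in> G l (fst p ! l)) \<and>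
     (\<forall>l<length (snd p). of_rat (fst (snd p ! l)) < e l x \<and> e l x < of_rat (snd (snd p ! l)))}"

lemma neighbourhood_sets: "neighbourhood p \<in> sets F"
proof -
  note [measurable] = e_measurable G_sets
  have "neighbourhood p = {x \<in> space F. (\<forall>l<length (fst p). x \<in> G l (fst p ! l)) \<and>
     (\<forall>l<length (snd p). of_rat (fst (snd p ! l)) < e l x \<and> e l x < of_rat (snd (snd p ! l)))}"
    unfolding neighbourhood_def space_F ..
  also have "\<dots> \<in> sets F" by measurable
  finally show ?thesis .
qed

text \<open>If every such set around \<open>x\<close> leaves \<open>U\<close>, choosing points
  \<open>s j\<close> outside \<open>U\<close> under more and more constraints gives a sequence along
  which all tests converge to those of \<open>x\<close>. Its levels are bounded for each
  \<open>l\<close>, so it subconverges to a point that the tests do not separate from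
  \<open>x\<close>; hence it enters \<open>U\<close> after all.\<close>

lemma neighbourhood_base:
  assumes U: "openin \<tau> U" and x: "x \<in> U"
  shows "\<exists>p. x \<in> neighbourhood p \<and> neighbourhood p \<subseteq> U"
proof (rule ccontr)
  assume contra: "\<not> ?thesis"
  have xt: "x \<in> topspace \<tau>" using U x openin_subset by blast
  then obtain k where k: "\<And>l. x \<in> G l (k l)" using G_exhausts by metis
  have "\<exists>q. of_rat q < e l x \<and> e l x - 1 / Suc j < of_rat q" for l j
    using of_rat_dense[of "e l x - 1 / Suc j" "e l x"] by auto
  then obtain q where q: "\<And>l j. of_rat (q l j) < e l x" "\<And>l j. e l x - 1 / Suc j < of_rat (q l j)" by metis
  have "\<exists>q. e l x < of_rat q \<and> of_rat q < e l x + 1 / Suc j" for l j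
    using of_rat_dense[of "e l x" "e l x + 1 / Suc j"] by auto
  then obtain q' where q': "\<And>l j. e l x < of_rat (q' l j)" "\<And>l j. of_rat (q' l j) < e l x + 1 / Suc j" by metis
  define p where "p j = (map k [0..<j], map (\<lambda>l. (q l j, q' l j)) [0..<j])" for j
  have "x \<in> neighbourhood (p j)" for j
    unfolding neighbourhood_def p_def using xt k q q' by auto
  then have "\<exists>y. y \<in> neighbourhood (p j) - U" for j using contra by blast
  then obtain s where s: "\<And>j. s j \<in> neighbourhood (p j)" "\<And>j. s j \<notin> U" by (metis Diff_iff)
  have st: "range s \<subseteq> topspace \<tau>" using s(1) by (auto simp: neighbourhood_def)
  have sG: "s j \<in> G l (k l)" if "l < j" for l j
    using s(1)[of j] that by (auto simp: neighbourhood_def p_def)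
  have se: "\<bar>e l (s j) - e l x\<bar> < 1 / Suc j" if "l < j" for l j
  proof -
    have "of_rat (q l j) < e l (s j)" "e l (s j) < of_rat (q' l j)"
      using s(1)[of j] that by (auto simp: neighbourhood_def p_def)
    then show ?thesis using q(2)[of l j] q'(2)[of l j] by linarith
  qed
  have bd: "\<exists>k. \<forall>n. s n \<in> G l k" for l
  proof -
    have "\<exists>k. s n \<in> G l k" for n using st by (intro G_exhausts) auto
    then obtain k' where k': "\<And>n. s n \<in> G l (k' n)" by metis
    \<comment> \<open>The constraint with index \<open>l\<close> binds from \<open>j = l + 1\<close>
      on; the \<open>l + 1\<close> points before have levels of their own, and \<open>G_mono\<close>
      merges them all.\<close>
    define K where "K = Max (insert (k l) (k' ` {..l}))"
    have "s n \<in> G l K" for n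
    proof (cases "n \<le> l")
      case True
      then have "k' n \<le> K" unfolding K_def by (intro Max_ge) auto
      then show ?thesis using k' G_mono by blast
    next
      case False
      have "k l \<le> K" unfolding K_def by (intro Max_ge) auto
      then show ?thesis using sG[of l n] G_mono False by (meson not_le subsetD)
    qed
    then show ?thesis by blast
  qed
  obtain y r where y: "y \<in> topspace \<tau>" "strict_mono r" "limitin \<tau> (s \<circ> r) y sequentially"
    using G_compact[OF st bd] by blast
  have "e l x = e l y" for l
  proof -
    have "(\<lambda>j. e l (s j)) \<longlonglongrightarrow> e l x"
    proof (rule LIM_zero_cancel, rule Lim_null_comparison)
      show "\<forall>\<^sub>F j in sequentially. norm (e l (s j) - e l x) \<le> 1 / Suc j"
        using eventually_gt_at_top[of l] by eventually_elim (use se less_imp_le in auto)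
      show "(\<lambda>j. 1 / real (Suc j)) \<longlonglongrightarrow> 0" using LIMSEQ_inverse_real_of_nat by (simp add: inverse_eq_divide)
    qed
    then have "(\<lambda>j. e l (s (r j))) \<longlonglongrightarrow> e l x"
      using LIMSEQ_subseq_LIMSEQ[OF _ y(2)] by (auto simp: o_def)
    moreover have "(\<lambda>j. e l (s (r j))) \<longlonglongrightarrow> e l y" using e_limit[OF y(3)] by (simp add: o_def)
    ultimately show ?thesis by (rule LIMSEQ_unique)
  qed
  then have "x = y" using e_separates xt y(1) by blast
  then have "\<forall>\<^sub>F n in sequentially. (s \<circ> r) n \<in> U" using y(3) U x by (auto simp: limitin_def)
  then show False using s(2) by (auto simp: eventually_sequentially)
qed

text \<open>One inclusion writes an open set as a countable union of neighbourhoods; the other uses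
  that the generating tests are continuous.\<close>

lemma sets_borel_of: "sets (borel_of \<tau>) = sets F"
proof (rule antisym)
  have "U \<in> sets F" if "openin \<tau> U" for U
  proof -
    have "U = (\<Union>p\<in>{p. neighbourhood p \<subseteq> U}. neighbourhood p)"
      using neighbourhood_base[OF that] by blast
    moreover have "(\<Union>p\<in>{p. neighbourhood p \<subseteq> U}. neighbourhood p) \<in> sets F"
      using neighbourhood_sets by (intro sets.countable_UN') auto
    ultimately show ?thesis by simp
  qed
  then have "{U. openin \<tau> U} \<subseteq> sets F" by auto
  then have "sigma_sets (space F) {U. openin \<tau> U} \<subseteq> sets F" by (rule sets.sigma_sets_subset)
  then show "sets (borel_of \<tau>) \<subseteq> sets F"
    unfolding borel_of_def space_F by (subst sets_measure_of) (auto dest: openin_subset)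
  have "(\<lambda>x. x) \<in> measurable (borel_of \<tau>) F"
    using continuous_map_measurable_borel_of[OF e_cont] by (intro measurable_into_F) auto
  then have "A \<inter> topspace \<tau> \<in> sets (borel_of \<tau>)" if "A \<in> sets F" for A
    using measurable_sets[of "\<lambda>x. x" "borel_of \<tau>" F A] that by simp
  then show "sets F \<subseteq> sets (borel_of \<tau>)"
    using sets.sets_into_space space_F by (metis Int_absorb2 subsetI)
qed

definition core :: "(nat \<Rightarrow> nat \<Rightarrow> nat) \<Rightarrow> nat \<Rightarrow> 'a set" where
  "core \<phi> m = {x \<in> topspace \<tau>. \<forall>l. x \<in> G l (\<phi> m l)}"

text \<open>A single \<open>\<phi>\<close> fixes, for every precision \<open>m\<close>, all levels
  at once. Tightness with a fixed witness is a condition that limits inherit.\<close>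

definition tight_family :: "(nat \<Rightarrow> nat \<Rightarrow> nat) \<Rightarrow> 'a measure set" where
  "tight_family \<phi> = {Q. prob_space Q \<and> sets Q = sets F \<and> (\<forall>m. 1 - 1 / Suc m \<le> measure Q (core \<phi> m))}"

lemma core_sets: "core \<phi> m \<in> sets F"
proof -
  note [measurable] = G_sets
  have "core \<phi> m = {x \<in> space F. \<forall>l. x \<in> G l (\<phi> m l)}" by (simp add: core_def space_F)
  also have "\<dots> \<in> sets F" by measurable
  finally show ?thesis .
qed

lemma core_seq_compact:
  assumes "\<And>n. s n \<in> core \<phi> m"
  shows "\<exists>x r. x \<in> core \<phi> m \<and> strict_mono (r::nat \<Rightarrow> nat) \<and> limitin \<tau> (s \<circ> r) x sequentially"
proof -
  have "range s \<subseteq> topspace \<tau>" "\<And>l. \<exists>k. \<forall>n. s n \<in> G l k"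
    using assms by (auto simp: core_def)
  from G_compact[OF this] obtain x r where x: "x \<in> topspace \<tau>" "strict_mono r" "limitin \<tau> (s \<circ> r) x sequentially"
    "\<forall>l k. (\<forall>n. s n \<in> G l k) \<longrightarrow> x \<in> G l k" by blast
  then have "x \<in> core \<phi> m" using assms by (auto simp: core_def)
  then show ?thesis using x by blast
qed

text \<open>Codes carry the measures to the line, where Helly's theorem applies, and a decoding map
  \<open>\<kappa>\<close> carries the limit back. Decoding makes sense only on the sets
  \<open>L m\<close>, but these are closed, so the portmanteau inequality preserves their mass. On
  each of them \<open>f \<circ> \<kappa>\<close> is continuous, and a Tietze extension makes
  integrals of \<open>f\<close> comparable with integrals of a continuous function on the
  line.\<close>

theorem Prokhorov:
  fixes Q :: "nat \<Rightarrow> 'a measure"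
  assumes Q: "\<And>n. Q n \<in> tight_family \<phi>"
  shows "\<exists>r Q0. strict_mono r \<and> Q0 \<in> tight_family \<phi> \<and>
    (\<forall>f. f \<in> borel_measurable F \<longrightarrow> seq_continuous \<tau> f \<longrightarrow> (\<exists>B. \<forall>x\<in>topspace \<tau>. \<bar>f x\<bar> \<le> B) \<longrightarrow>
      (\<lambda>n. \<integral>x. f x \<partial>Q (r n)) \<longlonglongrightarrow> (\<integral>x. f x \<partial>Q0))"
proof -
  have Qp: "prob_space (Q n)" and Qs[measurable_cong, simp]: "sets (Q n) = sets F"
    and Qk: "1 - 1 / Suc m \<le> measure (Q n) (core \<phi> m)" for n m
    using Q[of n] by (auto simp: tight_family_def)
  have Qspace [simp]: "space (Q n) = topspace \<tau>" for n
    using sets_eq_imp_space_eq[OF Qs] space_F by simp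
  note [measurable] = e_measurable core_sets
  define S where "S x = cantor_code (\<lambda>l. e l x)" for x
  have S_meas [measurable]: "S \<in> borel_measurable F"
    unfolding S_def by (rule borel_measurable_cantor_code) measurable
  have S_range: "0 \<le> S x" "S x \<le> 1" for x
    unfolding S_def using cantor_code_range by auto
  have curve_S: "schoenberg_curve l (S x) = e l x" if "x \<in> topspace \<tau>" for l x
    unfolding S_def using e_range[OF that] by (subst schoenberg_curve_cantor_code) auto
  note curve_cont = continuous_on_schoenberg_curve
  have [measurable]: "schoenberg_curve l \<in> borel_measurable borel" for l
    by (rule borel_measurable_continuous_onI[OF curve_cont])
  define \<mu> where "\<mu> n = distr (Q n) borel S" for n
  have \<mu>: "real_distribution (\<mu> n)" for n
    unfolding \<mu>_def using prob_space.real_distribution_distr[OF Qp, of S] by simp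
  \<comment> \<open>All codes lie in [0,1], which makes tightness on the line automatic.\<close>
  have tight: "tight \<mu>"
    unfolding tight_def
  proof (intro conjI allI impI \<mu>)
    fix \<epsilon> :: real assume "\<epsilon> > 0"
    have "measure (\<mu> n) {-1<..2} = 1" for n
    proof -
      interpret prob_space "Q n" by (rule Qp)
      have "S -` {-1<..2} \<inter> space (Q n) = space (Q n)"
      proof (intro equalityI subsetI IntI vimageI2)
        fix x show "S x \<in> {-1<..2}" using S_range[of x] by (simp only: greaterThanAtMost_iff) linarith
      qed auto
      then show ?thesis unfolding \<mu>_def using prob_space by (subst measure_distr) auto
    qed
    then show "\<exists>a b. a < b \<and> (\<forall>n. 1 - \<epsilon> < measure (\<mu> n) {a<..b})"
      using \<open>\<epsilon> > 0\<close> by (intro exI[of _ "-1"] exI[of _ 2]) auto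
  qed
  obtain r \<mu>0 where r: "strict_mono r" and \<mu>0: "real_distribution \<mu>0" and conv: "weak_conv_m (\<mu> \<circ> id \<circ> r) \<mu>0"
    using tight_imp_convergent_subsubsequence[OF tight, of id] by (auto simp: strict_mono_def)
  interpret \<mu>0: real_distribution \<mu>0 by fact
  \<comment> \<open>All parameters at which the curve shows the tests of a point of the core, not
    only the codes of such points: this larger set is closed, because a limit parameter belongs to a
    limit point in the core.\<close>
  define L where "L m = {t. \<exists>x\<in>core \<phi> m. \<forall>l. schoenberg_curve l t = e l x}" for m
  have L_seq: "\<exists>x\<in>core \<phi> m. \<exists>q. strict_mono (q::nat \<Rightarrow> nat) \<and> limitin \<tau> (s \<circ> q) x sequentially \<and>
       (\<forall>l. schoenberg_curve l t0 = e l x)"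
    if s: "\<And>n. s n \<in> core \<phi> m" "\<And>n l. schoenberg_curve l (t n) = e l (s n)" and t: "t \<longlonglongrightarrow> t0" for s t t0 m
  proof -
    obtain x q where x: "x \<in> core \<phi> m" "strict_mono q" "limitin \<tau> (s \<circ> q) x sequentially"
      using core_seq_compact[of s \<phi> m] s(1) by blast
    have "schoenberg_curve l t0 = e l x" for l
    proof (rule LIMSEQ_unique)
      have "(\<lambda>n. schoenberg_curve l (t n)) \<longlonglongrightarrow> schoenberg_curve l t0"
        using curve_cont[of l] t by (auto simp: continuous_on_eq_continuous_at intro: isCont_tendsto_compose)
      then show "(\<lambda>n. e l (s (q n))) \<longlonglongrightarrow> schoenberg_curve l t0"
        using LIMSEQ_subseq_LIMSEQ[OF _ x(2)] s(2) by (auto simp: o_def)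
      show "(\<lambda>n. e l (s (q n))) \<longlonglongrightarrow> e l x" using e_limit[OF x(3)] by (simp add: o_def)
    qed
    then show ?thesis using x by blast
  qed
  have L_closed: "closed (L m)" for m
    unfolding closed_sequential_limits
  proof (intro allI impI, elim conjE)
    fix t t0 assume t: "\<forall>n. t n \<in> L m" "t \<longlonglongrightarrow> t0"
    then obtain s where "\<And>n. s n \<in> core \<phi> m" "\<And>n l. schoenberg_curve l (t n) = e l (s n)"
      unfolding L_def by (auto, metis)
    from L_seq[OF this t(2)] show "t0 \<in> L m" unfolding L_def by blast
  qed
  then have [measurable]: "L m \<in> sets borel" for m by simp
  have S_L: "S x \<in> L m" if "x \<in> core \<phi> m" for x m
    unfolding L_def using that curve_S by (auto simp: core_def)
  have L_ge: "1 - 1 / Suc m \<le> measure (\<mu> n) (L m)" for n m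
  proof -
    interpret prob_space "Q n" by (rule Qp)
    have "1 - 1 / Suc m \<le> measure (Q n) (core \<phi> m)" by (rule Qk)
    also have "\<dots> \<le> measure (Q n) (S -` L m \<inter> space (Q n))"
    proof (rule finite_measure_mono)
      show "core \<phi> m \<subseteq> S -` L m \<inter> space (Q n)" using S_L by (auto simp: core_def)
      show "S -` L m \<inter> space (Q n) \<in> sets (Q n)" by measurable
    qed
    also have "\<dots> = measure (\<mu> n) (L m)" unfolding \<mu>_def by (subst measure_distr) auto
    finally show ?thesis .
  qed
  have L_ge0: "1 - 1 / Suc m \<le> measure \<mu>0 (L m)" for m
  proof (rule weak_conv_m_closed_ge[OF _ \<mu>0 conv L_closed])
    show "real_distribution ((\<mu> \<circ> id \<circ> r) n)" for n using \<mu> by simp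
    show "1 - 1 / Suc m \<le> measure ((\<mu> \<circ> id \<circ> r) n) (L m)" for n using L_ge[of m "r n"] by simp
  qed
  obtain x0 where x0: "x0 \<in> topspace \<tau>"
    using prob_space.not_empty[OF Qp[of 0]] unfolding Qspace by blast
  \<comment> \<open>The tests separate points, so the choice is unique on the union of the
    \<open>L m\<close>, a set of full \<open>\<mu>0\<close>-measure; elsewhere \<open>x0\<close> is
    an arbitrary default.\<close>
  define \<kappa> where "\<kappa> t = (if t \<in> (\<Union>m. L m) then SOME x. x \<in> topspace \<tau> \<and> (\<forall>l. schoenberg_curve l t = e l x) else x0)" for t
  have \<kappa>_unique: "\<kappa> t = x" if "t \<in> L m" "x \<in> topspace \<tau>" "\<forall>l. schoenberg_curve l t = e l x" for t m x
  proof -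
    have "(SOME x. x \<in> topspace \<tau> \<and> (\<forall>l. schoenberg_curve l t = e l x)) = x"
    proof (rule some_equality)
      fix y assume "y \<in> topspace \<tau> \<and> (\<forall>l. schoenberg_curve l t = e l y)"
      then show "y = x" using that by (intro e_separates) auto
    qed (use that in auto)
    then show ?thesis unfolding \<kappa>_def using that(1) by auto
  qed
  have \<kappa>_core: "\<kappa> t \<in> core \<phi> m" "schoenberg_curve l t = e l (\<kappa> t)" if "t \<in> L m" for t m l
  proof -
    obtain x where x: "x \<in> core \<phi> m" "\<forall>l. schoenberg_curve l t = e l x" using \<open>t \<in> L m\<close> unfolding L_def by blast
    moreover have "x \<in> topspace \<tau>" using x by (simp add: core_def)
    ultimately have "\<kappa> t = x" using \<kappa>_unique[OF that] by blast
    then show "\<kappa> t \<in> core \<phi> m" "schoenberg_curve l t = e l (\<kappa> t)" using x by auto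
  qed
  have \<kappa>_top: "\<kappa> t \<in> topspace \<tau>" for t
  proof (cases "t \<in> (\<Union>m. L m)")
    case True
    then obtain m where "t \<in> L m" by blast
    then show ?thesis using \<kappa>_core(1)[of t m] by (simp add: core_def)
  qed (simp add: \<kappa>_def x0)
  have e_\<kappa>: "e l (\<kappa> t) = (if t \<in> (\<Union>m. L m) then schoenberg_curve l t else e l x0)" for l t
  proof (cases "t \<in> (\<Union>m. L m)")
    case True
    then obtain m where "t \<in> L m" by blast
    then show ?thesis using \<kappa>_core(2) True by metis
  next
    case False
    then have "\<kappa> t = x0" by (simp only: \<kappa>_def if_False)
    then show ?thesis using False by (simp only: if_False)
  qed
  have \<kappa>_meas [measurable]: "\<kappa> \<in> measurable borel F"
  proof (rule measurable_into_F)
    show "\<kappa> \<in> space borel \<rightarrow> topspace \<tau>" using \<kappa>_top by blast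
    show "(\<lambda>t. e l (\<kappa> t)) \<in> borel_measurable borel" for l
      unfolding e_\<kappa> by measurable
  qed
  define Q0 where "Q0 = distr \<mu>0 F \<kappa>"
  have Q0p: "prob_space Q0" unfolding Q0_def by (rule \<mu>0.prob_space_distr) simp
  have "1 - 1 / Suc m \<le> measure Q0 (core \<phi> m)" for m
  proof -
    have "1 - 1 / Suc m \<le> measure \<mu>0 (L m)" by (rule L_ge0)
    also have "\<dots> \<le> measure \<mu>0 (\<kappa> -` core \<phi> m \<inter> space \<mu>0)"
    proof (rule \<mu>0.finite_measure_mono)
      show "L m \<subseteq> \<kappa> -` core \<phi> m \<inter> space \<mu>0" using \<kappa>_core(1) by auto
      show "\<kappa> -` core \<phi> m \<inter> space \<mu>0 \<in> sets \<mu>0" by measurable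
    qed
    also have "\<dots> = measure Q0 (core \<phi> m)" unfolding Q0_def by (subst measure_distr) auto
    finally show ?thesis .
  qed
  then have Q0: "Q0 \<in> tight_family \<phi>"
    using Q0p by (auto simp: tight_family_def Q0_def)
  have conv_f: "(\<lambda>n. \<integral>x. f x \<partial>Q (r n)) \<longlonglongrightarrow> (\<integral>x. f x \<partial>Q0)"
    if f_meas [measurable]: "f \<in> borel_measurable F" and f_cont: "seq_continuous \<tau> f"
      and B: "\<And>x. x \<in> topspace \<tau> \<Longrightarrow> \<bar>f x\<bar> \<le> B" for f B
  proof (rule LIMSEQ_I)
    fix \<epsilon> :: real assume \<epsilon>: "\<epsilon> > 0"
    have B0: "B \<ge> 0" using B[OF x0] by linarith
    \<comment> \<open>Replacing \<open>f\<close> by \<open>g\<close> costs at most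
      \<open>2 * B / (m + 1)\<close>, once for \<open>Q n\<close> and once for \<open>Q0\<close>;
      each cost is to stay below a third of \<open>\<epsilon>\<close>.\<close>
    obtain m :: nat where m: "6 * B / \<epsilon> < real m" using reals_Archimedean2 by blast
    have mB: "2 * B * (1 / Suc m) < \<epsilon> / 3"
    proof -
      have "6 * B < real m * \<epsilon>" using m \<epsilon> by (simp add: field_simps)
      also have "\<dots> \<le> real (Suc m) * \<epsilon>" using \<epsilon> by (intro mult_right_mono) auto
      finally show ?thesis by (simp add: field_simps)
    qed
    have h_cont: "continuous_on (L m) (\<lambda>t. f (\<kappa> t))"
      unfolding continuous_on_sequentially
    proof (intro allI ballI impI, elim conjE)
      fix t t0 assume t0: "t0 \<in> L m" and t: "\<forall>n. t n \<in> L m" "t \<longlonglongrightarrow> t0"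
      show "((\<lambda>t. f (\<kappa> t)) \<circ> t) \<longlonglongrightarrow> f (\<kappa> t0)"
        unfolding o_def
      \<comment> \<open>A subsequence keeping the values \<open>\<delta>\<close> apart would
        subconverge after decoding, by \<open>L_seq\<close>, to the point whose tests are seen at
        \<open>t0\<close>. That point is \<open>\<kappa> t0\<close>, against the sequential
        continuity of \<open>f\<close>.\<close>
      proof (rule ccontr)
        assume "\<not> (\<lambda>n. f (\<kappa> (t n))) \<longlonglongrightarrow> f (\<kappa> t0)"
        then obtain \<delta> where \<delta>: "\<delta> > 0" "\<And>N. \<exists>n\<ge>N. \<delta> \<le> dist (f (\<kappa> (t n))) (f (\<kappa> t0))"
          unfolding lim_sequentially by (metis not_le)
        define A where "A = {n. \<delta> \<le> dist (f (\<kappa> (t n))) (f (\<kappa> t0))}"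
        have "infinite A" unfolding infinite_nat_iff_unbounded_le A_def using \<delta>(2) by auto
        then have en: "strict_mono (enumerate A)" "\<And>n. enumerate A n \<in> A"
          by (auto simp: strict_mono_enumerate enumerate_in_set)
        let ?t = "t \<circ> enumerate A"
        have "?t \<longlonglongrightarrow> t0" using t(2) en(1) by (rule LIMSEQ_subseq_LIMSEQ)
        then obtain x q where x: "x \<in> core \<phi> m" "strict_mono q"
            "limitin \<tau> ((\<lambda>n. \<kappa> (?t n)) \<circ> q) x sequentially" "\<forall>l. schoenberg_curve l t0 = e l x"
        proof -
          have "?t n \<in> L m" for n using t(1) by simp
          from L_seq[of "\<lambda>n. \<kappa> (?t n)" m ?t t0, OF \<kappa>_core(1)[OF this] \<kappa>_core(2)[OF this] \<open>?t \<longlonglongrightarrow> t0\<close>]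
          show ?thesis using that by blast
        qed
        have "\<kappa> t0 = x" using \<kappa>_unique[OF t0 _ x(4)] x(1) by (simp add: core_def)
        have "(\<lambda>n. f (((\<lambda>n. \<kappa> (?t n)) \<circ> q) n)) \<longlonglongrightarrow> f x"
          using \<kappa>_top by (intro seq_continuousD[OF f_cont _ x(3)]) auto
        then have "(\<lambda>n. f (\<kappa> (?t (q n)))) \<longlonglongrightarrow> f (\<kappa> t0)"
          unfolding \<open>\<kappa> t0 = x\<close> by (simp only: o_def)
        then have "(\<lambda>n. dist (f (\<kappa> (?t (q n)))) (f (\<kappa> t0))) \<longlonglongrightarrow> 0"
          using tendsto_dist_iff[THEN iffD1] by metis
        moreover have "\<delta> \<le> dist (f (\<kappa> (?t (q n)))) (f (\<kappa> t0))" for n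
          using en(2)[of "q n"] by (simp add: A_def)
        ultimately have "\<delta> \<le> 0" by (intro LIMSEQ_le_const) auto
        then show False using \<delta>(1) by simp
      qed
    qed
    \<comment> \<open>The extension keeps the bound \<open>B\<close>, which controls the error off
      \<open>L m\<close>.\<close>
    obtain g where g: "continuous_on UNIV g" "\<And>t. t \<in> L m \<Longrightarrow> g t = f (\<kappa> t)" "\<And>t. norm (g t) \<le> B"
      using Tietze[OF h_cont, of UNIV B] L_closed B[OF \<kappa>_top] B0 by auto
    have [measurable]: "g \<in> borel_measurable borel" by (rule borel_measurable_continuous_onI[OF g(1)])
    have 1: "\<bar>(\<integral>x. f x \<partial>Q n) - (\<integral>t. g t \<partial>\<mu> n)\<bar> \<le> 2 * B * (1 / Suc m)" for n
    proof -
      interpret prob_space "Q n" by (rule Qp)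
      have i: "integrable (Q n) f" "integrable (Q n) (\<lambda>x. g (S x))"
        using B g(3) by (auto intro!: integrable_const_bound[of _ B])
      have "(\<integral>t. g t \<partial>\<mu> n) = (\<integral>x. g (S x) \<partial>Q n)"
        unfolding \<mu>_def by (rule integral_distr) auto
      then have "(\<integral>x. f x \<partial>Q n) - (\<integral>t. g t \<partial>\<mu> n) = (\<integral>x. f x - g (S x) \<partial>Q n)"
        using i by simp
      moreover have "\<bar>\<integral>x. f x - g (S x) \<partial>Q n\<bar> \<le> 2 * B * (1 / Suc m)"
      proof (rule abs_integral_le_of_null_on[where A = "core \<phi> m"])
        show "\<bar>f x - g (S x)\<bar> \<le> 2 * B" if "x \<in> space (Q n)" for x
          using B[of x] g(3)[of "S x"] that by auto
        show "f x - g (S x) = 0" if x: "x \<in> core \<phi> m" for x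
        proof -
          have "\<kappa> (S x) = x" using x S_L[OF x] curve_S by (intro \<kappa>_unique[of _ m]) (auto simp: core_def)
          then show ?thesis using g(2)[OF S_L[OF x]] by simp
        qed
      qed (use Qk in auto)
      ultimately show ?thesis by simp
    qed
    have 2: "\<bar>(\<integral>x. f x \<partial>Q0) - (\<integral>t. g t \<partial>\<mu>0)\<bar> \<le> 2 * B * (1 / Suc m)"
    proof -
      have i: "integrable \<mu>0 (\<lambda>t. f (\<kappa> t))" "integrable \<mu>0 g"
        using B[OF \<kappa>_top] g(3) by (auto intro!: \<mu>0.integrable_const_bound[of _ B])
      have "(\<integral>x. f x \<partial>Q0) = (\<integral>t. f (\<kappa> t) \<partial>\<mu>0)"
        unfolding Q0_def by (rule integral_distr) auto
      then have "(\<integral>x. f x \<partial>Q0) - (\<integral>t. g t \<partial>\<mu>0) = (\<integral>t. f (\<kappa> t) - g t \<partial>\<mu>0)"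
        using i by simp
      moreover have "\<bar>\<integral>t. f (\<kappa> t) - g t \<partial>\<mu>0\<bar> \<le> 2 * B * (1 / Suc m)"
      proof (rule \<mu>0.abs_integral_le_of_null_on[where A = "L m"])
        show "\<bar>f (\<kappa> t) - g t\<bar> \<le> 2 * B" for t
          using B[OF \<kappa>_top, of t] g(3)[of t] by auto
      qed (use g(2) L_ge0 in auto)
      ultimately show ?thesis by simp
    qed
    have "(\<lambda>n. \<integral>t. g t \<partial>\<mu> (r n)) \<longlonglongrightarrow> (\<integral>t. g t \<partial>\<mu>0)"
      using weak_conv_imp_integral_bdd_continuous_conv[of "\<mu> \<circ> id \<circ> r" \<mu>0 g B] \<mu> \<mu>0 conv g
      by (simp add: continuous_on_eq_continuous_at o_def)
    then obtain N where N: "\<And>n. n \<ge> N \<Longrightarrow> \<bar>(\<integral>t. g t \<partial>\<mu> (r n)) - (\<integral>t. g t \<partial>\<mu>0)\<bar> < \<epsilon> / 3"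
      using LIMSEQ_D[of _ _ "\<epsilon> / 3"] \<epsilon> by (metis divide_pos_pos real_norm_def zero_less_numeral)
    have "norm ((\<integral>x. f x \<partial>Q (r n)) - (\<integral>x. f x \<partial>Q0)) < \<epsilon>" if "n \<ge> N" for n
      using 1[of "r n"] 2 N[OF that] mB unfolding real_norm_def by linarith
    then show "\<exists>N. \<forall>n\<ge>N. norm ((\<integral>x. f x \<partial>Q (r n)) - (\<integral>x. f x \<partial>Q0)) < \<epsilon>" by blast
  qed
  show ?thesis
    using r Q0 conv_f by (intro exI[of _ r] exI[of _ Q0]) blast
qed

end

section \<open>Continuous tests that determine a signed measure\<close>

context countably_tested_space
begin

text \<open>Products of ramps of slope \<open>snd p\<close>: continuous minorants that increase to
  the indicator of \<open>test_set (fst p)\<close>. The index type is countable.\<close>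

definition test_fun :: "(nat \<times> rat) list \<times> nat \<Rightarrow> 'a \<Rightarrow> real" where
  "test_fun p x = (\<Prod>q\<in>set (fst p). min 1 (max 0 (real (snd p) * (e (fst q) x - of_rat (snd q)))))"

definition test_set :: "(nat \<times> rat) list \<Rightarrow> 'a set" where
  "test_set xs = {x \<in> topspace \<tau>. \<forall>q\<in>set xs. of_rat (snd q) < e (fst q) x}"

lemma test_fun_range: "0 \<le> test_fun p x" "test_fun p x \<le> 1"
  unfolding test_fun_def by (auto intro!: prod_nonneg prod_le_1)

lemma test_fun_bounded_continuous: "test_fun p \<in> bounded_continuous \<tau>"
proof -
  have "continuous_map \<tau> euclideanreal (test_fun p)"
    unfolding test_fun_def[abs_def]
    by (intro continuous_intros continuous_map_real_mult_left e_cont) auto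
  moreover have "\<bar>test_fun p x\<bar> \<le> 1" for x
    using test_fun_range[of p x] by simp
  then have "bounded (test_fun p ` topspace \<tau>)"
    by (intro boundedI[of _ 1]) auto
  ultimately show ?thesis by (simp add: bounded_continuous_def)
qed

lemma test_fun_measurable: "test_fun p \<in> borel_measurable F"
  using continuous_map_measurable_borel_of[of \<tau> "test_fun p"] test_fun_bounded_continuous
  by (auto simp: bounded_continuous_def measurable_cong_sets[OF sets_borel_of refl])

lemma test_fun_tendsto: 
  assumes "x \<in> topspace \<tau>"
  shows "(\<lambda>m. test_fun (xs, m) x) \<longlonglongrightarrow> indicator (test_set xs) x"
proof -
  have *: "(\<lambda>m. min 1 (max 0 (real m * y))) \<longlonglongrightarrow> (if 0 < y then 1 else 0)" for y :: real
  proof (cases "0 < y")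
    case True
    obtain m0 :: nat where m0: "1 / y \<le> real m0" using real_arch_simple by blast
    have "min 1 (max 0 (real m * y)) = 1" if "m \<ge> m0" for m
    proof -
      have "1 / y \<le> real m" using m0 that by linarith
      then have "1 \<le> real m * y" using True by (simp add: field_simps)
      then show ?thesis by simp
    qed
    then have "\<forall>\<^sub>F m in sequentially. min 1 (max 0 (real m * y)) = 1"
      by (auto simp: eventually_sequentially)
    then show ?thesis using True by (simp add: tendsto_eventually)
  next
    case False
    then have "min 1 (max 0 (real m * y)) = 0" for m
      by (simp add: mult_nonneg_nonpos)
    then show ?thesis using False by simp
  qed
  have "(\<lambda>m. test_fun (xs, m) x) \<longlonglongrightarrow> (\<Prod>q\<in>set xs. if 0 < e (fst q) x - of_rat (snd q) then 1 else 0)"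
    unfolding test_fun_def by (simp only: fst_conv snd_conv) (intro tendsto_prod *)
  also have "(\<Prod>q\<in>set xs. if 0 < e (fst q) x - of_rat (snd q) then 1 else 0) = (indicator (test_set xs) x :: real)"
  proof (cases "x \<in> test_set xs")
    case True
    then show ?thesis by (auto simp: test_set_def intro!: prod.neutral)
  next
    case False
    then obtain q where "q \<in> set xs" "\<not> 0 < e (fst q) x - of_rat (snd q)"
      using assms by (auto simp: test_set_def)
    then have "(\<Prod>q\<in>set xs. if 0 < e (fst q) x - of_rat (snd q) then 1 else 0) = (0::real)"
      by (intro prod_zero) auto
    then show ?thesis using False by simp
  qed
  finally show ?thesis .
qed

lemma test_set_generates: "sets F = sigma_sets (topspace \<tau>) (range test_set)"
proof (rule antisym)
  let ?N = "sigma (topspace \<tau>) (range test_set)"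
  have sN: "sets ?N = sigma_sets (topspace \<tau>) (range test_set)"
    by (subst sets_measure_of) (auto simp: test_set_def)
  have spN: "space ?N = topspace \<tau>" by (simp add: space_measure_of_conv)
  have "(\<lambda>x. x) \<in> measurable ?N F"
  proof (rule measurable_into_F)
    show "(\<lambda>x. x) \<in> space ?N \<rightarrow> topspace \<tau>" by (simp add: spN)
    fix l
    show "(\<lambda>x. e l x) \<in> borel_measurable ?N"
    proof (rule borel_measurableI_greater)
      fix a :: real
      have "{x \<in> space ?N. a < e l x} = (\<Union>q\<in>{q. a < of_rat q}. test_set [(l, q)])"
        unfolding spN using of_rat_dense[of a] by (auto simp: test_set_def)
      also have "\<dots> \<in> sets ?N" unfolding sN by (intro sigma_sets_UNION countable_image) auto
      finally show "{x \<in> space ?N. a < e l x} \<in> sets ?N" .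
    qed
  qed
  then have "A \<inter> topspace \<tau> \<in> sets ?N" if "A \<in> sets F" for A
    using measurable_sets[of "\<lambda>x. x" ?N F A] that spN by simp
  then show "sets F \<subseteq> sigma_sets (topspace \<tau>) (range test_set)"
    using sets.sets_into_space space_F sN by (metis Int_absorb2 subsetI)
  have "test_set xs \<in> sets F" for xs
  proof -
    note [measurable] = e_measurable
    have "test_set xs = {x \<in> space F. \<forall>q\<in>set xs. of_rat (snd q) < e (fst q) x}"
      by (simp add: test_set_def space_F)
    also have "\<dots> \<in> sets F" by measurable
    finally show ?thesis .
  qed
  then have "sigma_sets (space F) (range test_set) \<subseteq> sets F"
    by (intro sets.sigma_sets_subset) auto
  then show "sigma_sets (topspace \<tau>) (range test_set) \<subseteq> sets F" by (simp add: space_F)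
qed

lemma signed_integral_test_fun_tendsto:
  assumes \<mu>: "\<mu> \<in> signed_measures (borel_of \<tau>)"
  shows "(\<lambda>m. signed_integral (borel_of \<tau>) \<mu> (test_fun (xs, m))) \<longlonglongrightarrow> \<mu> (test_set xs)"
proof -
  have A: "test_set xs \<in> sets F" unfolding test_set_generates by auto
  have lim: "(\<lambda>m. \<integral>x. test_fun (xs, m) x \<partial>P) \<longlonglongrightarrow> measure P (test_set xs)"
    if "finite_measure P" and sets: "sets P = sets F" for P
  proof -
    interpret finite_measure P by fact
    note [measurable_cong] = sets
    have sp: "space P = topspace \<tau>" using sets_eq_imp_space_eq[OF sets] space_F by simp
    have "(\<lambda>m. \<integral>x. test_fun (xs, m) x \<partial>P) \<longlonglongrightarrow> (\<integral>x. indicator (test_set xs) x \<partial>P)"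
    proof (rule integral_dominated_convergence[where w = "\<lambda>_. 1"])
      show "indicator (test_set xs) \<in> borel_measurable P" using A sets by simp
      show "test_fun (xs, m) \<in> borel_measurable P" for m
        using test_fun_measurable by (simp add: measurable_cong_sets[OF sets refl])
      show "AE x in P. (\<lambda>m. test_fun (xs, m) x) \<longlonglongrightarrow> indicator (test_set xs) x"
        using test_fun_tendsto sp by (intro AE_I2) auto
    qed (auto simp: test_fun_range)
    then show ?thesis using A sets by (simp add: Int_absorb2 sets.sets_into_space)
  qed
  have "(\<lambda>m. signed_integral (borel_of \<tau>) \<mu> (test_fun (xs, m))) \<longlonglongrightarrow>
     measure (positive_part (borel_of \<tau>) \<mu>) (test_set xs) - measure (positive_part (borel_of \<tau>) (\<lambda>A. - \<mu> A)) (test_set xs)"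
    unfolding signed_integral_def
    by (intro tendsto_diff lim finite_measure_positive_part \<mu> signed_measures_minus) (simp_all add: sets_borel_of)
  then show ?thesis
    using Jordan_decomposition[OF \<mu>, of "test_set xs"] A by (simp add: sets_borel_of)
qed

text \<open>Test sets are stable under intersection, by concatenating lists, so Dynkin's argument
  applies. Total masses might differ a priori; the complement step gets their equality from the
  empty list.\<close>

lemma signed_measures_eqI:
  assumes \<mu>: "\<mu> \<in> signed_measures (borel_of \<tau>)" and \<nu>: "\<nu> \<in> signed_measures (borel_of \<tau>)"
    and eq: "\<And>p. signed_integral (borel_of \<tau>) \<mu> (test_fun p) = signed_integral (borel_of \<tau>) \<nu> (test_fun p)"
  shows "\<mu> = \<nu>"
proof
  fix A
  have basic: "\<mu> (test_set xs) = \<nu> (test_set xs)" for xs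
    using signed_integral_test_fun_tendsto[OF \<mu>, of xs] signed_integral_test_fun_tendsto[OF \<nu>, of xs]
    unfolding eq by (rule LIMSEQ_unique)
  have sF: "sets (borel_of \<tau>) = sigma_sets (topspace \<tau>) (range test_set)"
    by (simp add: sets_borel_of test_set_generates)
  have top: "test_set [] = topspace \<tau>" by (simp add: test_set_def)
  show "\<mu> A = \<nu> A"
  proof (cases "A \<in> sets (borel_of \<tau>)")
    case False
    then show ?thesis using \<mu> \<nu> by (simp add: signed_measures_def)
  next
    case True
    have "Int_stable (range test_set)"
    proof (rule Int_stableI)
      fix a b assume "a \<in> range test_set" "b \<in> range test_set"
      then obtain xs ys where "a = test_set xs" "b = test_set ys" by blast
      then have "a \<inter> b = test_set (xs @ ys)" by (auto simp: test_set_def)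
      then show "a \<inter> b \<in> range test_set" by blast
    qed
    moreover have "range test_set \<subseteq> Pow (topspace \<tau>)" by (auto simp: test_set_def)
    moreover have "A \<in> sigma_sets (topspace \<tau>) (range test_set)" using True sF by simp
    ultimately show ?thesis
    proof (induction rule: sigma_sets_induct_disjoint)
      case (basic A)
      then show ?case using \<open>\<And>xs. \<mu> (test_set xs) = \<nu> (test_set xs)\<close> by blast
    next
      case empty
      show ?case using signed_measures_empty[OF \<mu>] signed_measures_empty[OF \<nu>] by simp
    next
      case (compl A)
      have A: "A \<in> sets (borel_of \<tau>)" "topspace \<tau> - A \<in> sets (borel_of \<tau>)"
        using compl(1) sF sets.compl_sets[of A "borel_of \<tau>"] by auto
      have "A \<union> (topspace \<tau> - A) = topspace \<tau>"
        using sets.sets_into_space[OF A(1)] by auto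
      then have "\<mu> (topspace \<tau>) = \<mu> A + \<mu> (topspace \<tau> - A)" "\<nu> (topspace \<tau>) = \<nu> A + \<nu> (topspace \<tau> - A)"
        using signed_measures_Un[OF \<mu> A] signed_measures_Un[OF \<nu> A] by auto
      then show ?case using compl(2) \<open>\<And>xs. \<mu> (test_set xs) = \<nu> (test_set xs)\<close>[of "[]"] top by simp
    next
      case (union A)
      have "range A \<subseteq> sets (borel_of \<tau>)" using union(2) sF by simp
      from signed_measures_sums[OF \<mu> this union(1)] signed_measures_sums[OF \<nu> this union(1)]
      show ?case using union(3) by (simp add: sums_unique2)
    qed
  qed
qed

lemma tight_family_measure:
  assumes "Q \<in> tight_family \<phi>"
  shows "measure Q \<in> signed_measures (borel_of \<tau>)"
    and "f \<in> bounded_continuous \<tau> \<Longrightarrow> signed_integral (borel_of \<tau>) (measure Q) f = (\<integral>x. f x \<partial>Q)"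
proof -
  have Q: "finite_measure Q" "sets Q = sets (borel_of \<tau>)"
    using assms prob_space.finite_measure by (auto simp: tight_family_def sets_borel_of)
  show "measure Q \<in> signed_measures (borel_of \<tau>)" using Q by (rule measure_in_signed_measures)
  assume f: "f \<in> bounded_continuous \<tau>"
  then obtain B where B: "\<And>x. x \<in> topspace \<tau> \<Longrightarrow> \<bar>f x\<bar> \<le> B"
    unfolding bounded_continuous_def bounded_iff by auto
  have "f \<in> borel_measurable (borel_of \<tau>)"
    using f by (intro continuous_map_measurable_borel_of) (simp add: bounded_continuous_def)
  then show "signed_integral (borel_of \<tau>) (measure Q) f = (\<integral>x. f x \<partial>Q)"
    using Q B by (intro signed_integral_measure) auto
qed

lemma bounded_continuousD:
  assumes "f \<in> bounded_continuous \<tau>"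
  shows "f \<in> borel_measurable F" "seq_continuous \<tau> f" "\<exists>B. \<forall>x\<in>topspace \<tau>. \<bar>f x\<bar> \<le> B"
proof -
  have f: "continuous_map \<tau> euclideanreal f" using assms by (simp add: bounded_continuous_def)
  show "f \<in> borel_measurable F"
    using continuous_map_measurable_borel_of[OF f] by (simp add: measurable_cong_sets[OF sets_borel_of refl])
  show "seq_continuous \<tau> f" by (rule continuous_map_imp_seq_continuous[OF f])
  show "\<exists>B. \<forall>x\<in>topspace \<tau>. \<bar>f x\<bar> \<le> B"
    using assms unfolding bounded_continuous_def bounded_iff by auto
qed

lemma tight_sequence_limit:
  fixes Q :: "nat \<Rightarrow> 'a measure"
  assumes Q: "\<And>n. Q n \<in> tight_family \<phi>"
  obtains r Q0 where "strict_mono r" "Q0 \<in> tight_family \<phi>"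
    "limitin (weak_star \<tau>) (\<lambda>n. measure (Q (r n))) (measure Q0) sequentially"
    "\<And>f. f \<in> borel_measurable F \<Longrightarrow> seq_continuous \<tau> f \<Longrightarrow> \<exists>B. \<forall>x\<in>topspace \<tau>. \<bar>f x\<bar> \<le> B \<Longrightarrow>
       (\<lambda>n. \<integral>x. f x \<partial>Q (r n)) \<longlonglongrightarrow> (\<integral>x. f x \<partial>Q0)"
proof -
  obtain r Q0 where r: "strict_mono r" and Q0: "Q0 \<in> tight_family \<phi>"
    and conv: "\<And>f. f \<in> borel_measurable F \<Longrightarrow> seq_continuous \<tau> f \<Longrightarrow> \<exists>B. \<forall>x\<in>topspace \<tau>. \<bar>f x\<bar> \<le> B \<Longrightarrow>
       (\<lambda>n. \<integral>x. f x \<partial>Q (r n)) \<longlonglongrightarrow> (\<integral>x. f x \<partial>Q0)"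
    using Prokhorov[of Q \<phi>] Q by blast
  have "limitin (weak_star \<tau>) (\<lambda>n. measure (Q (r n))) (measure Q0) sequentially"
    unfolding limitin_weak_star_iff
  proof (intro conjI ballI always_eventually allI)
    fix f assume f: "f \<in> bounded_continuous \<tau>"
    show "(\<lambda>n. signed_integral (borel_of \<tau>) (measure (Q (r n))) f) \<longlonglongrightarrow> signed_integral (borel_of \<tau>) (measure Q0) f"
      unfolding tight_family_measure(2)[OF Q f] tight_family_measure(2)[OF Q0 f]
      by (rule conv[OF bounded_continuousD[OF f]])
  qed (rule tight_family_measure(1)[OF Q] tight_family_measure(1)[OF Q0])+
  then show ?thesis using conv by (rule that[OF r Q0])
qed

text \<open>The integrals of countably many test functions map the weak* space injectively into a
  metrizable sequence space, so the sequentially compact tight family falls under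
  \<open>seq_compactin_injective_closure\<close>. The third claim also returns an approximating
  sequence along which the integrals of all bounded, measurable, sequentially continuous functions
  converge; the supermartingale property is read off from it.\<close>

theorem weak_star_seq_closure_tight:
  assumes Z: "Z \<subseteq> tight_family \<phi>"
  defines "N \<equiv> seq_closure (weak_star \<tau>) (measure ` Z)"
  shows "compactin (weak_star \<tau>) N" and "seq_compactin (weak_star \<tau>) N"
    and "\<And>\<mu>. \<mu> \<in> N \<Longrightarrow> \<exists>Q q. Q \<in> tight_family \<phi> \<and> \<mu> = measure Q \<and> range q \<subseteq> Z \<and>
       (\<forall>f. f \<in> borel_measurable F \<longrightarrow> seq_continuous \<tau> f \<longrightarrow> (\<exists>B. \<forall>x\<in>topspace \<tau>. \<bar>f x\<bar> \<le> B) \<longrightarrow>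
          (\<lambda>n. \<integral>x. f x \<partial>q n) \<longlonglongrightarrow> (\<integral>x. f x \<partial>Q))"
proof -
  let ?T = "measure ` tight_family \<phi>"
  have K: "seq_compactin (weak_star \<tau>) ?T"
    unfolding seq_compactin_def
  proof (intro conjI allI impI)
    show "?T \<subseteq> topspace (weak_star \<tau>)" using tight_family_measure(1) by auto
    fix s :: "nat \<Rightarrow> 'a set \<Rightarrow> real" assume "range s \<subseteq> ?T"
    then have "\<forall>n. \<exists>Q. Q \<in> tight_family \<phi> \<and> s n = measure Q" by blast
    then obtain Q where Q: "\<And>n. Q n \<in> tight_family \<phi>" "\<And>n. s n = measure (Q n)" by metis
    obtain r Q0 where r: "strict_mono r" and Q0: "Q0 \<in> tight_family \<phi>"
      and lim: "limitin (weak_star \<tau>) (\<lambda>n. measure (Q (r n))) (measure Q0) sequentially"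
      by (rule tight_sequence_limit[OF Q(1)])
    have "s \<circ> r = (\<lambda>n. measure (Q (r n)))" using Q(2) by (simp add: o_def)
    with lim have "limitin (weak_star \<tau>) (s \<circ> r) (measure Q0) sequentially" by simp
    with r have "\<exists>r. strict_mono r \<and> limitin (weak_star \<tau>) (s \<circ> r) (measure Q0) sequentially" by blast
    with imageI[OF Q0, of measure] show "\<exists>x\<in>?T. \<exists>r. strict_mono r \<and> limitin (weak_star \<tau>) (s \<circ> r) x sequentially"
      by (rule rev_bexI[where x = "measure Q0"])
  qed
  define \<Psi> where "\<Psi> \<mu> = (\<lambda>n. signed_integral (borel_of \<tau>) \<mu> (test_fun (from_nat n)))" for \<mu>
  have cont: "continuous_map (weak_star \<tau>) euclidean \<Psi>"
    unfolding euclidean_product_topology[symmetric] continuous_map_componentwise_UNIV \<Psi>_def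
    using continuous_map_weak_star[OF test_fun_bounded_continuous] by blast
  \<comment> \<open>Injectivity is shown on all signed measures: a sequential limit is not known
    beforehand to come from a probability measure.\<close>
  have inj: "inj_on \<Psi> (topspace (weak_star \<tau>))"
  proof (rule inj_onI)
    fix \<mu> \<nu> assume \<mu>: "\<mu> \<in> topspace (weak_star \<tau>)" "\<nu> \<in> topspace (weak_star \<tau>)" and eq: "\<Psi> \<mu> = \<Psi> \<nu>"
    have "signed_integral (borel_of \<tau>) \<mu> (test_fun p) = signed_integral (borel_of \<tau>) \<nu> (test_fun p)" for p
      using fun_cong[OF eq, of "to_nat p"] by (simp add: \<Psi>_def)
    then show "\<mu> = \<nu>" using \<mu> by (intro signed_measures_eqI) auto
  qed
  have ZT: "measure ` Z \<subseteq> ?T" using Z by blast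
  note * = seq_compactin_injective_closure[OF K cont inj ZT, folded N_def]
  show "compactin (weak_star \<tau>) N" "seq_compactin (weak_star \<tau>) N" using * by auto
  fix \<mu> assume "\<mu> \<in> N"
  then obtain s where s: "range s \<subseteq> measure ` Z" "limitin (weak_star \<tau>) s \<mu> sequentially"
    by (auto simp: N_def seq_closure_def)
  then have "\<forall>n. \<exists>Q. Q \<in> Z \<and> s n = measure Q" by blast
  then obtain Q where Q: "\<And>n. Q n \<in> Z" "\<And>n. s n = measure (Q n)" by metis
  then have QT: "\<And>n. Q n \<in> tight_family \<phi>" using Z by blast
  obtain r Q0 where r: "strict_mono r" and Q0: "Q0 \<in> tight_family \<phi>"
    and lim: "limitin (weak_star \<tau>) (\<lambda>n. measure (Q (r n))) (measure Q0) sequentially"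
    and conv: "\<And>f. f \<in> borel_measurable F \<Longrightarrow> seq_continuous \<tau> f \<Longrightarrow> \<exists>B. \<forall>x\<in>topspace \<tau>. \<bar>f x\<bar> \<le> B \<Longrightarrow>
       (\<lambda>n. \<integral>x. f x \<partial>Q (r n)) \<longlonglongrightarrow> (\<integral>x. f x \<partial>Q0)"
    using tight_sequence_limit[of Q \<phi>, OF QT] by metis
  \<comment> \<open>Both are limits of the same subsequence, so they agree on all test
    functions.\<close>
  have "\<mu> = measure Q0"
  proof (rule signed_measures_eqI)
    show "\<mu> \<in> signed_measures (borel_of \<tau>)" using limitin_topspace[OF s(2)] by simp
    show "measure Q0 \<in> signed_measures (borel_of \<tau>)" by (rule tight_family_measure(1)[OF Q0])
    fix p
    have "(\<lambda>n. signed_integral (borel_of \<tau>) (s n) (test_fun p)) \<longlonglongrightarrow> signed_integral (borel_of \<tau>) \<mu> (test_fun p)"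
      using s(2) test_fun_bounded_continuous unfolding limitin_weak_star_iff by blast
    then have "(\<lambda>n. signed_integral (borel_of \<tau>) (measure (Q (r n))) (test_fun p)) \<longlonglongrightarrow> signed_integral (borel_of \<tau>) \<mu> (test_fun p)"
      unfolding Q(2) using r by (rule LIMSEQ_subseq_LIMSEQ[unfolded o_def])
    moreover have "(\<lambda>n. signed_integral (borel_of \<tau>) (measure (Q (r n))) (test_fun p)) \<longlonglongrightarrow>
        signed_integral (borel_of \<tau>) (measure Q0) (test_fun p)"
      using lim test_fun_bounded_continuous unfolding limitin_weak_star_iff by blast
    ultimately show "signed_integral (borel_of \<tau>) \<mu> (test_fun p) = signed_integral (borel_of \<tau>) (measure Q0) (test_fun p)"
      by (rule LIMSEQ_unique)
  qed
  then show "\<exists>Q q. Q \<in> tight_family \<phi> \<and> \<mu> = measure Q \<and> range q \<subseteq> Z \<and>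
       (\<forall>f. f \<in> borel_measurable F \<longrightarrow> seq_continuous \<tau> f \<longrightarrow> (\<exists>B. \<forall>x\<in>topspace \<tau>. \<bar>f x\<bar> \<le> B) \<longrightarrow>
          (\<lambda>n. \<integral>x. f x \<partial>q n) \<longlonglongrightarrow> (\<integral>x. f x \<partial>Q))"
    using Q0 Q(1) conv by (intro exI[of _ Q0] exI[of _ "\<lambda>n. Q (r n)"]) auto
qed

end

section \<open>Oscillations and the S-topology\<close>

text \<open>The diagonal sequence is a subsequence of the \<open>i\<close>-th selected sequence only
  from some index on; \<open>sub\<close> and \<open>tail\<close> bridge this gap.\<close>

lemma diagonal_subsequence:
  fixes P :: "nat \<Rightarrow> (nat \<Rightarrow> nat) \<Rightarrow> bool"
  assumes ex: "\<And>i (s :: nat \<Rightarrow> nat). strict_mono s \<Longrightarrow> \<exists>r. strict_mono r \<and> P i (s \<circ> r)"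
    and sub: "\<And>i s (r :: nat \<Rightarrow> nat). strict_mono r \<Longrightarrow> P i s \<Longrightarrow> P i (s \<circ> r)"
    and tail: "\<And>i s k. P i (s \<circ> (+) k) \<Longrightarrow> P i s"
  obtains q where "strict_mono q" "\<And>i. P i q"
proof -
  interpret subseqs P
  proof
    fix n and s :: "nat \<Rightarrow> nat" assume "strict_mono s"
    then show "\<exists>r'. strict_mono r' \<and> P n (s \<circ> r')" by (rule ex)
  qed
  show ?thesis
  proof (rule that)
    show "strict_mono diagseq" by (rule subseq_diagseq)
    show "P i diagseq" for i
      by (rule tail) (rule diagseq_holds[OF sub])
  qed
qed

lemma convergent_diagonal_subsequence:
  fixes a :: "nat \<Rightarrow> nat \<Rightarrow> real"
  assumes "\<And>i. \<exists>B. \<forall>n. \<bar>a i n\<bar> \<le> B"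
  obtains q where "strict_mono q" "\<And>i. convergent (\<lambda>n. a i (q n))"
proof (rule diagonal_subsequence[where P = "\<lambda>i q. convergent (\<lambda>n. a i (q n))"])
  fix i and s :: "nat \<Rightarrow> nat"
  obtain B where "\<And>n. \<bar>a i n\<bar> \<le> B" using assms by blast
  then have "bounded (range (\<lambda>n. a i (s n)))" by (intro boundedI[of _ B]) auto
  then obtain l r where "strict_mono (r::nat \<Rightarrow> nat)" "((\<lambda>n. a i (s n)) \<circ> r) \<longlonglongrightarrow> l"
    using bounded_imp_convergent_subsequence by blast
  then show "\<exists>r. strict_mono r \<and> convergent (\<lambda>n. a i ((s \<circ> r) n))"
    by (auto simp: o_def convergent_def)
next
  fix i and s r :: "nat \<Rightarrow> nat" assume "strict_mono r" "convergent (\<lambda>n. a i (s n))"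
  then show "convergent (\<lambda>n. a i ((s \<circ> r) n))"
    using convergent_subseq_convergent[of "\<lambda>n. a i (s n)" r] by (simp add: o_def)
next
  fix i and s :: "nat \<Rightarrow> nat" and k assume "convergent (\<lambda>n. a i ((s \<circ> (+) k) n))"
  then show "convergent (\<lambda>n. a i (s n))"
    using convergent_ignore_initial_segment[of "\<lambda>n. a i (s n)" k] by (simp add: o_def add.commute)
qed (use that in blast)

text \<open>Oscillation numbers as in tightness criteria for the S-topology. Times increase only
  weakly, so consecutive oscillations may share an endpoint; the increments exceed
  \<open>\<epsilon>\<close> strictly, so an oscillation persists under small changes and its absence
  passes to limits.\<close>

definition oscillates :: "(real \<Rightarrow> real) \<Rightarrow> real \<Rightarrow> real set \<Rightarrow> nat \<Rightarrow> bool" where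
  "oscillates x \<epsilon> J k \<longleftrightarrow> (\<exists>t::nat \<Rightarrow> real. (\<forall>i j. i \<le> j \<longrightarrow> j < 2 * k \<longrightarrow> t i \<le> t j) \<and> (\<forall>j<2 * k. t j \<in> J) \<and>
     (\<forall>j<k. \<epsilon> < \<bar>x (t (2 * j + 1)) - x (t (2 * j))\<bar>))"

lemma oscillatesE:
  assumes "oscillates x \<epsilon> J k"
  obtains t where "\<forall>i j. i \<le> j \<longrightarrow> j < 2 * k \<longrightarrow> t i \<le> t j" "\<forall>j<2 * k. t j \<in> J"
    "\<forall>j<k. \<epsilon> < \<bar>x (t (2 * j + 1)) - x (t (2 * j))\<bar>"
  using assms unfolding oscillates_def by (elim exE conjE) (rule that)

lemma oscillatesI:
  assumes "\<And>i j. i \<le> j \<Longrightarrow> j < 2 * k \<Longrightarrow> t i \<le> t j" "\<And>j. j < 2 * k \<Longrightarrow> t j \<in> J"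
    "\<And>j. j < k \<Longrightarrow> \<epsilon> < \<bar>x (t (2 * j + 1)) - x (t (2 * j))\<bar>"
  shows "oscillates x \<epsilon> J k"
  unfolding oscillates_def using assms by (intro exI[of _ t] conjI allI impI)

lemma oscillates_mono:
  assumes "oscillates x \<epsilon> J k" "J \<subseteq> J'" "k' \<le> k" "\<epsilon>' \<le> \<epsilon>"
  shows "oscillates x \<epsilon>' J' k'"
proof -
  obtain t where t: "\<forall>i j. i \<le> j \<longrightarrow> j < 2 * k \<longrightarrow> t i \<le> t j" "\<forall>j<2 * k. t j \<in> J"
    "\<forall>j<k. \<epsilon> < \<bar>x (t (2 * j + 1)) - x (t (2 * j))\<bar>"
    by (rule oscillatesE[OF assms(1)])
  have le: "j < 2 * k" if "j < 2 * k'" for j using that assms(3) by simp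
  show ?thesis
  proof (rule oscillatesI)
    show "t i \<le> t j" if "i \<le> j" "j < 2 * k'" for i j using t(1) le that by simp
    show "t j \<in> J'" if "j < 2 * k'" for j using t(2) assms(2) le that by blast
    show "\<epsilon>' < \<bar>x (t (2 * j + 1)) - x (t (2 * j))\<bar>" if "j < k'" for j
      using t(3) assms(3,4) that by (metis order.strict_trans1 order.strict_trans2)
  qed
qed

definition next_oscillation :: "(real \<Rightarrow> real) \<Rightarrow> real \<Rightarrow> real \<Rightarrow> real \<Rightarrow> real" where
  "next_oscillation x \<epsilon> R u =
     (if \<exists>t\<in>{u<..R}. \<epsilon> \<le> \<bar>x t - x u\<bar> then Inf {t\<in>{u<..R}. \<epsilon> \<le> \<bar>x t - x u\<bar>} else R)"

text \<open>If the infimum is not attained, points of the set accumulate at it from the right, and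
  right-continuity carries the inequality over to \<open>v\<close>; in particular \<open>v\<close>
  differs from \<open>u\<close>.\<close>

lemma next_oscillation:
  fixes x :: "real \<Rightarrow> real"
  assumes u: "0 \<le> u" "u \<le> R" and \<epsilon>: "\<epsilon> > 0"
    and rc: "\<And>t. 0 \<le> t \<Longrightarrow> t < R \<Longrightarrow> (x \<longlongrightarrow> x t) (at_right t)"
  defines "v \<equiv> next_oscillation x \<epsilon> R u"
  shows "u \<le> v" "v \<le> R" "\<And>t. t \<in> {u..<v} \<Longrightarrow> \<bar>x t - x u\<bar> \<le> \<epsilon>"
    and "v < R \<Longrightarrow> u < v \<and> \<epsilon> \<le> \<bar>x v - x u\<bar>"
proof -
  let ?A = "{t\<in>{u<..R}. \<epsilon> \<le> \<bar>x t - x u\<bar>}"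
  have "u \<le> v \<and> v \<le> R \<and> (\<forall>t\<in>{u..<v}. \<bar>x t - x u\<bar> \<le> \<epsilon>) \<and> (v < R \<longrightarrow> u < v \<and> \<epsilon> \<le> \<bar>x v - x u\<bar>)"
  proof (cases "?A = {}")
    case True
    then have "\<not> (\<exists>t\<in>{u<..R}. \<epsilon> \<le> \<bar>x t - x u\<bar>)" by blast
    then have "v = R" unfolding v_def next_oscillation_def by (simp only: if_False)
    moreover have "\<bar>x t - x u\<bar> \<le> \<epsilon>" if "t \<in> {u..<R}" for t
    proof (cases "t = u")
      case False
      then have "t \<in> {u<..R}" using that by auto
      then have "\<not> \<epsilon> \<le> \<bar>x t - x u\<bar>" using True by blast
      then show ?thesis by simp
    qed (use \<epsilon> in simp)
    ultimately show ?thesis using u by auto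
  next
    case False
    then have "\<exists>t\<in>{u<..R}. \<epsilon> \<le> \<bar>x t - x u\<bar>" by blast
    then have v: "v = Inf ?A" unfolding v_def next_oscillation_def by (simp only: if_True)
    have bb: "bdd_below ?A" by (intro bdd_belowI[of _ u]) auto
    have lb: "u \<le> v" unfolding v using False by (intro cInf_greatest) auto
    have low: "v \<le> t" if "t \<in> ?A" for t unfolding v using that bb by (intro cInf_lower)
    have vR: "v \<le> R" using False low by fastforce
    have small: "\<bar>x t - x u\<bar> \<le> \<epsilon>" if "t \<in> {u..<v}" for t
    proof (rule ccontr)
      assume "\<not> ?thesis"
      then have "t \<in> ?A" using that vR \<epsilon> by (cases "t = u") auto
      then show False using low that by fastforce
    qed
    have far: "u < v \<and> \<epsilon> \<le> \<bar>x v - x u\<bar>" if "v < R"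
    proof (cases "v \<in> ?A")
      case True then show ?thesis by auto
    next
      case False
      have "\<exists>\<^sub>F t in at_right v. \<epsilon> \<le> \<bar>x t - x u\<bar>"
      proof (rule ccontr)
        assume "\<not> ?thesis"
        then have "\<forall>\<^sub>F t in at_right v. \<not> \<epsilon> \<le> \<bar>x t - x u\<bar>" by (simp add: not_frequently)
        then obtain b where b: "b > v" "\<And>t. v < t \<Longrightarrow> t < b \<Longrightarrow> \<not> \<epsilon> \<le> \<bar>x t - x u\<bar>"
          by (auto simp: eventually_at_right_field)
        have "Inf ?A < b" using b(1) v by simp
        then obtain t where t: "t \<in> ?A" "t < b" using cInf_lessD[OF \<open>?A \<noteq> {}\<close>] by blast
        then have "v < t" using low[OF t(1)] False by (cases "v = t") auto
        then show False using b(2)[of t] t by auto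
      qed
      moreover have lim: "((\<lambda>t. \<bar>x t - x u\<bar>) \<longlongrightarrow> \<bar>x v - x u\<bar>) (at_right v)"
        using rc[of v] u lb that by (intro tendsto_intros) auto
      ultimately have "\<epsilon> \<le> \<bar>x v - x u\<bar>"
        using order_tendstoD(2)[OF lim, of \<epsilon>] by (force simp: frequently_def not_le elim: eventually_mono)
      moreover from this have "u \<noteq> v" using \<epsilon> by auto
      ultimately show ?thesis using lb by auto
    qed
    show ?thesis using lb vR small far by blast
  qed
  then show "u \<le> v" "v \<le> R" "\<And>t. t \<in> {u..<v} \<Longrightarrow> \<bar>x t - x u\<bar> \<le> \<epsilon>" "v < R \<Longrightarrow> u < v \<and> \<epsilon> \<le> \<bar>x v - x u\<bar>"
    by blast+
qed

lemma oscillation_times: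
  fixes x :: "real \<Rightarrow> real"
  assumes R: "0 \<le> R" and \<epsilon>: "\<epsilon> > 0"
    and rc: "\<And>t. 0 \<le> t \<Longrightarrow> t < R \<Longrightarrow> (x \<longlongrightarrow> x t) (at_right t)"
  obtains s :: "nat \<Rightarrow> real" where "s 0 = 0" "incseq s" "range s \<subseteq> {0..R}"
    "\<And>k t. t \<in> {s k..<s (Suc k)} \<Longrightarrow> \<bar>x t - x (s k)\<bar> \<le> \<epsilon>"
    "\<And>k. s (Suc k) < R \<Longrightarrow> s k < s (Suc k) \<and> \<epsilon> \<le> \<bar>x (s (Suc k)) - x (s k)\<bar>"
proof -
  define s where "s k = (next_oscillation x \<epsilon> R ^^ k) 0" for k
  have s_Suc: "s (Suc k) = next_oscillation x \<epsilon> R (s k)" for k by (simp add: s_def)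
  have in_R: "0 \<le> s k \<and> s k \<le> R" for k
  proof (induction k)
    case 0 then show ?case using R by (simp add: s_def)
  next
    case (Suc k)
    then show ?case
      using next_oscillation(1,2)[of "s k" R \<epsilon> x, OF _ _ \<epsilon> rc] unfolding s_Suc by auto
  qed
  note N = next_oscillation[of "s k" R \<epsilon> x for k, OF _ _ \<epsilon> rc, folded s_Suc]
  show ?thesis
  proof (rule that[of s])
    show "s 0 = 0" by (simp add: s_def)
    show "incseq s" using N(1) in_R by (intro incseq_SucI) blast
    show "range s \<subseteq> {0..R}" using in_R by auto
    show "\<bar>x t - x (s k)\<bar> \<le> \<epsilon>" if "t \<in> {s k..<s (Suc k)}" for k t using N(3) in_R that by blast
    show "s k < s (Suc k) \<and> \<epsilon> \<le> \<bar>x (s (Suc k)) - x (s k)\<bar>" if "s (Suc k) < R" for k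
      using N(4) in_R that by blast
  qed
qed

text \<open>Each greedy step that ends before \<open>R\<close> is an increment of size at least
  \<open>\<epsilon>\<close>, hence above \<open>\<epsilon> / 2\<close>; \<open>N\<close> such steps
  would contradict \<open>osc\<close>.\<close>

lemma greedy_partition:
  fixes x :: "real \<Rightarrow> real"
  assumes R: "0 \<le> R" and \<epsilon>: "\<epsilon> > 0"
    and rc: "\<And>t. 0 \<le> t \<Longrightarrow> t < R \<Longrightarrow> (x \<longlongrightarrow> x t) (at_right t)"
    and osc: "\<not> oscillates x (\<epsilon> / 2) {0..R} N"
  obtains s :: "nat \<Rightarrow> real" where "s 0 = 0" "incseq s" "range s \<subseteq> {0..R}" "s N = R"
    "\<And>k t. t \<in> {s k..<s (Suc k)} \<Longrightarrow> \<bar>x t - x (s k)\<bar> \<le> \<epsilon>"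
proof -
  obtain s :: "nat \<Rightarrow> real" where s: "s 0 = 0" "incseq s" "range s \<subseteq> {0..R}"
    "\<And>k t. t \<in> {s k..<s (Suc k)} \<Longrightarrow> \<bar>x t - x (s k)\<bar> \<le> \<epsilon>"
    "\<And>k. s (Suc k) < R \<Longrightarrow> s k < s (Suc k) \<and> \<epsilon> \<le> \<bar>x (s (Suc k)) - x (s k)\<bar>"
    using oscillation_times[where x = x, OF R \<epsilon> rc] by blast
  have "s N = R"
  proof (rule ccontr)
    assume "s N \<noteq> R"
    then have "s N < R" using s(3) by (metis atLeastAtMost_iff order_le_less rangeI subsetD)
    have lt: "s (Suc k) < R" if "k < N" for k
      using \<open>s N < R\<close> incseqD[OF s(2), of "Suc k" N] that by simp
    have "oscillates x (\<epsilon> / 2) {0..R} N"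
      unfolding oscillates_def
    \<comment> \<open>The sequence \<open>s 0, s 1, s 1, s 2, s 2, ...\<close> has the consecutive
      times \<open>s j\<close> and \<open>s (j + 1)\<close> at positions \<open>2 * j\<close> and
      \<open>2 * j + 1\<close>.\<close>
    proof (intro exI[of _ "\<lambda>j. s (Suc j div 2)"] conjI allI impI)
      fix i j :: nat assume "i \<le> j"
      then show "s (Suc i div 2) \<le> s (Suc j div 2)" by (intro incseqD[OF s(2)] div_le_mono) simp
    next
      fix j show "s (Suc j div 2) \<in> {0..R}" using s(3) by blast
    next
      fix j assume "j < N"
      then have "\<epsilon> \<le> \<bar>x (s (Suc j)) - x (s j)\<bar>" using s(5) lt by blast
      moreover have "Suc (2 * j + 1) div 2 = Suc j" "Suc (2 * j) div 2 = j" by auto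
      ultimately show "\<epsilon> / 2 < \<bar>x (s (Suc (2 * j + 1) div 2)) - x (s (Suc (2 * j) div 2))\<bar>"
        using \<epsilon> by simp
    qed
    then show False using osc by simp
  qed
  then show ?thesis using that s by blast
qed

text \<open>Here left limits, not an oscillation bound, stop the greedy times: if these stayed below
  \<open>R\<close>, they would increase strictly to some \<open>b\<close>, and the increments, all
  at least \<open>\<epsilon>\<close>, would vanish by the left limit at \<open>b\<close>.\<close>

lemma cadlag_partition:
  fixes x :: "real \<Rightarrow> real"
  assumes R: "0 < R" and \<epsilon>: "\<epsilon> > 0"
    and rc: "\<And>t. 0 \<le> t \<Longrightarrow> t < R \<Longrightarrow> (x \<longlongrightarrow> x t) (at_right t)"
    and ll: "\<And>t. 0 < t \<Longrightarrow> t \<le> R \<Longrightarrow> \<exists>l. (x \<longlongrightarrow> l) (at_left t)"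
  obtains s :: "nat \<Rightarrow> real" and N where "s 0 = 0" "incseq s" "s N = R"
    "\<And>k t. t \<in> {s k..<s (Suc k)} \<Longrightarrow> \<bar>x t - x (s k)\<bar> \<le> \<epsilon>"
proof -
  obtain s :: "nat \<Rightarrow> real" where s: "s 0 = 0" "incseq s" "range s \<subseteq> {0..R}"
    "\<And>k t. t \<in> {s k..<s (Suc k)} \<Longrightarrow> \<bar>x t - x (s k)\<bar> \<le> \<epsilon>"
    "\<And>k. s (Suc k) < R \<Longrightarrow> s k < s (Suc k) \<and> \<epsilon> \<le> \<bar>x (s (Suc k)) - x (s k)\<bar>"
    using oscillation_times[where x = x, OF less_imp_le[OF R] \<epsilon> rc] by blast
  have "\<exists>N. s N = R"
  proof (rule ccontr)
    assume "\<nexists>N. s N = R"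
    then have lt: "s k < R" for k using s(3) by (metis atLeastAtMost_iff order_le_less rangeI subsetD)
    obtain b where b: "s \<longlonglongrightarrow> b" "\<And>k. s k \<le> b"
      using incseq_convergent[OF s(2), of R] lt less_imp_le by metis
    have sb: "s k < b" for k using s(5)[OF lt[of "Suc k"]] b(2)[of "Suc k"] by linarith
    have "b \<le> R" using b(1) lt by (intro LIMSEQ_le_const2[of s]) (auto intro: less_imp_le)
    moreover have "0 < b" using sb[of 0] s(1) by simp
    ultimately obtain l where l: "(x \<longlongrightarrow> l) (at_left b)" using ll by blast
    have "filterlim s (at_left b) sequentially"
      unfolding filterlim_at using b(1) sb by (auto intro!: always_eventually simp: less_imp_neq)
    then have lim: "(\<lambda>k. x (s k)) \<longlonglongrightarrow> l" by (rule filterlim_compose[OF l])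
    then have "(\<lambda>k. \<bar>x (s (Suc k)) - x (s k)\<bar>) \<longlonglongrightarrow> \<bar>l - l\<bar>"
      using LIMSEQ_Suc[OF lim] by (intro tendsto_intros)
    then have "\<epsilon> \<le> \<bar>l - l\<bar>"
      using s(5) lt by (intro LIMSEQ_le_const) auto
    then show False using \<epsilon> by simp
  qed
  then show ?thesis using that s by blast
qed

text \<open>Within one cell the function varies by at most \<open>2 * \<epsilon>\<close>, so each
  oscillation crosses a partition point, and different oscillations cross different points.\<close>

lemma partition_not_oscillates:
  fixes x :: "real \<Rightarrow> real"
  assumes s: "s 0 = 0" "incseq s" "s N = R" and \<epsilon>: "0 \<le> \<epsilon>"
    and close: "\<And>k t. t \<in> {s k..<s (Suc k)} \<Longrightarrow> \<bar>x t - x (s k)\<bar> \<le> \<epsilon>"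
  shows "\<not> oscillates x (2 * \<epsilon>) {0..R} (Suc N)"
proof
  assume "oscillates x (2 * \<epsilon>) {0..R} (Suc N)"
  then obtain t where t: "\<And>i j. i \<le> j \<Longrightarrow> j < 2 * Suc N \<Longrightarrow> t i \<le> t j" "\<And>j. j < 2 * Suc N \<Longrightarrow> t j \<in> {0..R}"
    "\<And>j. j < Suc N \<Longrightarrow> 2 * \<epsilon> < \<bar>x (t (2 * j + 1)) - x (t (2 * j))\<bar>"
    using oscillatesE[of x "2 * \<epsilon>" "{0..R}" "Suc N"] by metis
  have "\<exists>k\<le>N. t (2 * j) < s k \<and> s k \<le> t (2 * j + 1)" if j: "j < Suc N" for j
  proof (rule ccontr)
    assume no: "\<not> ?thesis"
    define k where "k = Max {i. i \<le> N \<and> s i \<le> t (2 * j)}"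
    have fin: "finite {i. i \<le> N \<and> s i \<le> t (2 * j)}" "{i. i \<le> N \<and> s i \<le> t (2 * j)} \<noteq> {}"
      using s(1) t(2)[of "2 * j"] j by auto
    have k: "k \<le> N" "s k \<le> t (2 * j)" using Max_in[OF fin] unfolding k_def by auto
    have le: "t (2 * j) \<le> t (2 * j + 1)" using j by (intro t(1)) auto
    show False
    proof (cases "k = N")
      case True
      then have "R \<le> t (2 * j)" using k s(3) by simp
      then have "t (2 * j) = t (2 * j + 1)" using le t(2)[of "2 * j + 1"] j by auto
      then show False using t(3)[OF j] \<epsilon> by simp
    next
      case False
      then have "\<not> s (Suc k) \<le> t (2 * j)"
        using k(1) Max_ge[OF fin(1), of "Suc k"] unfolding k_def[symmetric] by fastforce
      moreover from this have "\<not> s (Suc k) \<le> t (2 * j + 1)" using no k(1) False by auto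
      ultimately have "\<bar>x (t (2 * j)) - x (s k)\<bar> \<le> \<epsilon>" "\<bar>x (t (2 * j + 1)) - x (s k)\<bar> \<le> \<epsilon>"
        using k(2) le by (auto intro!: close)
      then show False using t(3)[OF j] by linarith
    qed
  qed
  then obtain k where k: "\<And>j. j < Suc N \<Longrightarrow> k j \<le> N \<and> t (2 * j) < s (k j) \<and> s (k j) \<le> t (2 * j + 1)" by metis
  \<comment> \<open>Indices of crossed points increase strictly and start above 0, since
    \<open>s 0 = 0\<close> cannot be crossed; the last one would exceed \<open>N\<close>.\<close>
  have "j < k j" if "j < Suc N" for j
    using that
  proof (induction j)
    case 0
    then have "s 0 < s (k 0)" using k[of 0] t(2)[of 0] s(1) by auto
    then show ?case by (cases "k 0") auto
  next
    case (Suc j)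
    then have "s (k j) \<le> t (2 * j + 1)" "t (2 * Suc j) < s (k (Suc j))"
      using k[of j] k[of "Suc j"] by auto
    moreover have "t (2 * j + 1) \<le> t (2 * Suc j)" using Suc(2) by (intro t(1)) auto
    ultimately have "s (k j) < s (k (Suc j))" by linarith
    then have "k j < k (Suc j)" using incseqD[OF s(2)] by (meson not_le)
    then show ?case using Suc by simp
  qed
  then show False using k[of N] by fastforce
qed


subsection \<open>Step functions\<close>

text \<open>Given by jump times and jump sizes, not by values on intervals: the representing measure
  is then the sum of the masses \<open>c k\<close> at \<open>s k\<close>, and convergence survives
  when jump times merge.\<close>

definition step_function :: "(nat \<Rightarrow> real) \<Rightarrow> (nat \<Rightarrow> real) \<Rightarrow> nat \<Rightarrow> real \<Rightarrow> real" where
  "step_function s c K t = (\<Sum>k\<le>K. if s k \<le> t then c k else 0)"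

lemma step_function_right_continuous: "(step_function s c K \<longlongrightarrow> step_function s c K t) (at_right t)"
  unfolding step_function_def[abs_def]
proof (rule tendsto_sum)
  fix k
  show "((\<lambda>u. if s k \<le> u then c k else 0) \<longlongrightarrow> (if s k \<le> t then c k else 0)) (at_right t)"
  proof (cases "s k \<le> t")
    case True
    have "\<forall>\<^sub>F u in at_right t. (if s k \<le> u then c k else 0) = (if s k \<le> t then c k else 0)"
      using eventually_at_right_less[of t] by eventually_elim (use True in auto)
    then show ?thesis by (rule tendsto_eventually)
  next
    case False
    then have "\<forall>\<^sub>F u in at_right t. u < s k" by (intro eventually_at_right_field[THEN iffD2] exI[of _ "s k"]) auto
    then have "\<forall>\<^sub>F u in at_right t. (if s k \<le> u then c k else 0) = (if s k \<le> t then c k else 0)"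
      by eventually_elim (use False in auto)
    then show ?thesis by (rule tendsto_eventually)
  qed
qed

lemma step_function_left_limit: "\<exists>l. (step_function s c K \<longlongrightarrow> l) (at_left t)"
proof -
  have "((\<lambda>u. if s k \<le> u then c k else 0) \<longlongrightarrow> (if s k < t then c k else 0)) (at_left t)" for k
  proof (cases "s k < t")
    case True
    then have "\<forall>\<^sub>F u in at_left t. s k < u" by (intro eventually_at_left_field[THEN iffD2] exI[of _ "s k"]) auto
    then have "\<forall>\<^sub>F u in at_left t. (if s k \<le> u then c k else 0) = (if s k < t then c k else 0)"
      by eventually_elim (use True in auto)
    then show ?thesis by (rule tendsto_eventually)
  next
    case False
    have "\<forall>\<^sub>F u in at_left t. u < t" by (intro eventually_at_left_field[THEN iffD2] exI[of _ "t - 1"]) auto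
    then have "\<forall>\<^sub>F u in at_left t. (if s k \<le> u then c k else 0) = (if s k < t then c k else 0)"
      by eventually_elim (use False in auto)
    then show ?thesis by (rule tendsto_eventually)
  qed
  then have "((\<lambda>u. \<Sum>k\<le>K. if s k \<le> u then c k else 0) \<longlongrightarrow> (\<Sum>k\<le>K. if s k < t then c k else 0)) (at_left t)"
    by (intro tendsto_sum)
  then show ?thesis unfolding step_function_def[abs_def] by blast
qed

text \<open>Only a limit jump time can spoil the pointwise limit. The second alternative admits the
  right endpoint, where all jumps have already happened.\<close>

lemma step_function_tendsto:
  assumes s: "\<And>k. (\<lambda>n. s n k) \<longlonglongrightarrow> s0 k" and c: "\<And>k. (\<lambda>n. c n k) \<longlonglongrightarrow> c0 k"
    and t: "\<And>k. k \<le> K \<Longrightarrow> s0 k \<noteq> t \<or> (\<forall>n. s n k \<le> t)"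
  shows "(\<lambda>n. step_function (s n) (c n) K t) \<longlonglongrightarrow> step_function s0 c0 K t"
  unfolding step_function_def
proof (rule tendsto_sum)
  fix k assume "k \<in> {..K}"
  then have "\<forall>\<^sub>F n in sequentially. (s n k \<le> t) = (s0 k \<le> t)"
  proof (cases "s0 k = t")
    case True
    then show ?thesis using t \<open>k \<in> {..K}\<close> by auto
  next
    case False
    then consider "s0 k < t" | "t < s0 k" by linarith
    then show ?thesis
    proof cases
      case 1
      from order_tendstoD(2)[OF s this] show ?thesis by eventually_elim (use 1 in auto)
    next
      case 2
      from order_tendstoD(1)[OF s this] show ?thesis by eventually_elim (use 2 in auto)
    qed
  qed
  then have "\<forall>\<^sub>F n in sequentially. (if s0 k \<le> t then c n k else 0) = (if s n k \<le> t then c n k else 0)"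
    by eventually_elim auto
  moreover have "(\<lambda>n. if s0 k \<le> t then c n k else 0) \<longlonglongrightarrow> (if s0 k \<le> t then c0 k else 0)"
    using c by simp
  ultimately show "(\<lambda>n. if s n k \<le> t then c n k else 0) \<longlonglongrightarrow> (if s0 k \<le> t then c0 k else 0)"
    by (rule Lim_transform_eventually[rotated])
qed

lemma finite_variation_step_function: "finite_variation R (step_function s c K)"
  unfolding finite_variation_def
proof (intro exI[of _ "\<Sum>k\<le>K. \<bar>c k\<bar>"] allI impI, elim conjE)
  fix t :: "nat \<Rightarrow> real" and n assume t: "incseq t"
  define b where "b k u = (if s k \<le> u then 1 else 0 :: real)" for k u
  have b_mono: "b k (t j) \<le> b k (t (Suc j))" for k j
    using incseq_SucD[OF t, of j] by (auto simp: b_def)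
  have b_le: "b k u - b k v \<le> 1" for k u v by (auto simp: b_def)
  have step: "step_function s c K u = (\<Sum>k\<le>K. c k * b k u)" for u
    unfolding step_function_def b_def by (intro sum.cong) auto
  have "(\<Sum>j<n. \<bar>step_function s c K (t (Suc j)) - step_function s c K (t j)\<bar>)
      \<le> (\<Sum>j<n. \<Sum>k\<le>K. \<bar>c k\<bar> * (b k (t (Suc j)) - b k (t j)))"
  proof (rule sum_mono)
    fix j
    have "\<bar>step_function s c K (t (Suc j)) - step_function s c K (t j)\<bar> = \<bar>\<Sum>k\<le>K. c k * (b k (t (Suc j)) - b k (t j))\<bar>"
      unfolding step by (simp add: sum_subtractf algebra_simps)
    also have "\<dots> \<le> (\<Sum>k\<le>K. \<bar>c k * (b k (t (Suc j)) - b k (t j))\<bar>)" by (rule sum_abs)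
    also have "\<dots> = (\<Sum>k\<le>K. \<bar>c k\<bar> * (b k (t (Suc j)) - b k (t j)))"
      using b_mono by (simp add: abs_mult)
    finally show "\<bar>step_function s c K (t (Suc j)) - step_function s c K (t j)\<bar> \<le> (\<Sum>k\<le>K. \<bar>c k\<bar> * (b k (t (Suc j)) - b k (t j)))" .
  qed
  also have "\<dots> = (\<Sum>k\<le>K. \<bar>c k\<bar> * (\<Sum>j<n. b k (t (Suc j)) - b k (t j)))"
    by (subst sum.swap) (simp add: sum_distrib_left)
  also have "\<dots> = (\<Sum>k\<le>K. \<bar>c k\<bar> * (b k (t n) - b k (t 0)))"
    using sum_lessThan_telescope[of "\<lambda>j. b k (t j)" n for k] by simp
  also have "\<dots> \<le> (\<Sum>k\<le>K. \<bar>c k\<bar>)"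
    using b_le by (intro sum_mono mult_left_le) auto
  finally show "(\<Sum>j<n. \<bar>step_function s c K (t (Suc j)) - step_function s c K (t j)\<bar>) \<le> (\<Sum>k\<le>K. \<bar>c k\<bar>)" .
qed

definition point_masses :: "'a measure \<Rightarrow> (nat \<Rightarrow> 'a) \<Rightarrow> (nat \<Rightarrow> real) \<Rightarrow> nat \<Rightarrow> 'a measure" where
  "point_masses M s c K = distr (point_measure {..K} (\<lambda>k. ennreal (c k))) M s"

lemma point_masses:
  assumes s: "\<And>k. s k \<in> space M" and c: "\<And>k. 0 \<le> c k"
  shows "finite_measure (point_masses M s c K)" "sets (point_masses M s c K) = sets M"
    and "A \<in> sets M \<Longrightarrow> measure (point_masses M s c K) A = (\<Sum>k\<le>K. c k * indicator A (s k))"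
    and "f \<in> borel_measurable M \<Longrightarrow> (\<integral>x. f x \<partial>point_masses M s c K) = (\<Sum>k\<le>K. c k * f (s k) :: real)"
proof -
  let ?P = "point_measure {..K} (\<lambda>k. ennreal (c k))"
  have sm [measurable]: "s \<in> measurable ?P M" using s by (simp add: point_measure_def)
  show "sets (point_masses M s c K) = sets M" by (simp add: point_masses_def)
  interpret P: finite_measure ?P
    by (rule finite_measureI) (simp add: space_point_measure emeasure_point_measure_finite sum_ennreal c)
  show "finite_measure (point_masses M s c K)"
    unfolding point_masses_def by (rule P.finite_measure_distr) measurable
  show "measure (point_masses M s c K) A = (\<Sum>k\<le>K. c k * indicator A (s k))" if "A \<in> sets M"
  proof -
    have "measure (point_masses M s c K) A = measure ?P (s -` A \<inter> {..K})"
      unfolding point_masses_def measure_distr[OF sm that] by (simp add: space_point_measure)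
    also have "emeasure ?P (s -` A \<inter> {..K}) = (\<Sum>k\<in>s -` A \<inter> {..K}. ennreal (c k))"
      by (rule emeasure_point_measure_finite) auto
    then have "measure ?P (s -` A \<inter> {..K}) = (\<Sum>k\<in>s -` A \<inter> {..K}. c k)"
      by (simp add: measure_def sum_ennreal c sum_nonneg)
    also have "\<dots> = (\<Sum>k\<le>K. c k * indicator A (s k))"
      by (intro sum.mono_neutral_cong_left) (auto simp: indicator_def)
    finally show ?thesis .
  qed
  show "(\<integral>x. f x \<partial>point_masses M s c K) = (\<Sum>k\<le>K. c k * f (s k))" if "f \<in> borel_measurable M"
    unfolding point_masses_def integral_distr[OF sm that]
    using c by (simp add: lebesgue_integral_point_measure_finite)
qed

text \<open>Upward and downward jumps give two finite measures whose difference represents the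
  function; the integral formula is then an instance of \<open>signed_integral_diff\<close>.\<close>

lemma step_function_represented:
  assumes s: "\<And>k. s k \<in> {0..R}"
  obtains m where "represents R m (step_function s c K)"
    "\<And>f. continuous_on {0..R} f \<Longrightarrow> signed_integral (restrict_space borel {0..R}) m f = (\<Sum>k\<le>K. c k * f (s k))"
proof -
  let ?M = "restrict_space borel {0..R::real}"
  let ?P = "point_masses ?M s (\<lambda>k. max 0 (c k)) K" and ?N = "point_masses ?M s (\<lambda>k. max 0 (- c k)) K"
  have sM: "s k \<in> space ?M" for k using s by (simp add: space_restrict_space)
  have c: "max 0 (c k) * a - max 0 (- c k) * a = c k * a" for k a by (auto simp: max_def)
  note P = point_masses[where s = s and M = ?M and c = "\<lambda>k. max 0 (c k)" and K = K, OF sM max.cobounded1]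
    and N = point_masses[where s = s and M = ?M and c = "\<lambda>k. max 0 (- c k)" and K = K, OF sM max.cobounded1]
  define m where "m A = measure ?P A - measure ?N A" for A
  have m: "m \<in> signed_measures ?M"
    unfolding m_def using P N by (intro diff_in_signed_measures) auto
  have m_eq: "m A = (\<Sum>k\<le>K. c k * indicator A (s k))" if "A \<in> sets ?M" for A
    unfolding m_def P(3)[OF that] N(3)[OF that] sum_subtractf[symmetric] c ..
  have "represents R m (step_function s c K)"
    unfolding represents_def
  proof (intro conjI ballI m)
    fix t assume t: "t \<in> {0..R}"
    then have "{0..t} \<in> sets ?M" by (subst sets_restrict_space_iff) auto
    then have "m {0..t} = (\<Sum>k\<le>K. c k * indicator {0..t} (s k))" by (rule m_eq)
    also have "\<dots> = step_function s c K t"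
      unfolding step_function_def using s by (intro sum.cong) (auto simp: indicator_def)
    finally show "m {0..t} = step_function s c K t" .
  qed
  moreover have "signed_integral ?M m f = (\<Sum>k\<le>K. c k * f (s k))" if f: "continuous_on {0..R} f" for f
  proof -
    have fm: "f \<in> borel_measurable ?M" by (rule borel_measurable_continuous_on_restrict[OF f])
    have "compact (f ` {0..R})" using f by (intro compact_continuous_image) auto
    then obtain B where B: "\<And>x. x \<in> {0..R} \<Longrightarrow> \<bar>f x\<bar> \<le> B"
      using compact_imp_bounded bounded_iff by (metis imageI real_norm_def)
    have "signed_integral ?M m f = (\<integral>x. f x \<partial>?P) - (\<integral>x. f x \<partial>?N)"
      unfolding m_def using B by (intro signed_integral_diff[OF P(1,2) N(1,2) fm, of B]) (auto simp: space_restrict_space)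
    also have "\<dots> = (\<Sum>k\<le>K. c k * f (s k))"
      unfolding P(4)[OF fm] N(4)[OF fm] sum_subtractf[symmetric] c ..
    finally show ?thesis .
  qed
  ultimately show ?thesis by (rule that)
qed

text \<open>The integral of a continuous \<open>f\<close> is the finite sum of the terms
  \<open>c k * f (s k)\<close>, which depends continuously on jump times and sizes.\<close>

lemma step_functions_weak_star_conv:
  assumes s: "\<And>n k. s n k \<in> {0..R}" "\<And>k. (\<lambda>n. s n k) \<longlonglongrightarrow> s0 k" and c: "\<And>k. (\<lambda>n. c n k) \<longlonglongrightarrow> c0 k"
  shows "fv_weak_star_conv R (\<lambda>n. step_function (s n) (c n) K) (step_function s0 c0 K)"
proof -
  have s0: "s0 k \<in> {0..R}" for k
    using closed_sequentially[of "{0..R}" "\<lambda>n. s n k" "s0 k"] s by simp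
  have "\<forall>n. \<exists>m. represents R m (step_function (s n) (c n) K) \<and> (\<forall>f. continuous_on {0..R} f \<longrightarrow>
      signed_integral (restrict_space borel {0..R}) m f = (\<Sum>k\<le>K. c n k * f (s n k)))" (is "\<forall>n. \<exists>m. ?P n m")
  proof
    fix n
    from step_function_represented[of "s n" R "c n" K, OF s(1)]
    show "\<exists>m. ?P n m" by blast
  qed
  then have "\<exists>m. \<forall>n. ?P n (m n)" by (rule choice)
  then obtain m where m: "\<And>n. represents R (m n) (step_function (s n) (c n) K)"
    "\<And>n f. continuous_on {0..R} f \<Longrightarrow> signed_integral (restrict_space borel {0..R}) (m n) f = (\<Sum>k\<le>K. c n k * f (s n k))"
    by blast
  obtain m0 where m0: "represents R m0 (step_function s0 c0 K)"
    "\<And>f. continuous_on {0..R} f \<Longrightarrow> signed_integral (restrict_space borel {0..R}) m0 f = (\<Sum>k\<le>K. c0 k * f (s0 k))"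
    using step_function_represented[of s0 R c0 K, OF s0] by blast
  have "(\<lambda>n. signed_integral (restrict_space borel {0..R}) (m n) f) \<longlonglongrightarrow> signed_integral (restrict_space borel {0..R}) m0 f"
    if f: "continuous_on {0..R} f" for f
    unfolding m(2)[OF f] m0(2)[OF f]
    using s s0 by (intro tendsto_sum tendsto_mult c continuous_on_tendsto_compose[OF f]) auto
  then show ?thesis
    unfolding fv_weak_star_conv_def using m(1) m0(1) by blast
qed

section \<open>Helly selection for functions with bounded oscillation numbers\<close>

lemma exists_right_sequence_off_countable:
  fixes t R :: real
  assumes "countable B" "t < R"
  obtains u where "u \<longlonglongrightarrow> t" "\<And>n. t < u n" "\<And>n. u n < R" "\<And>n. u n \<notin> B"
proof -
  have "\<exists>u. t < u \<and> u < min R (t + 1 / Suc n) \<and> u \<notin> B" for n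
  proof -
    have "uncountable ({t<..<min R (t + 1 / Suc n)} - B)"
      using assms by (intro uncountable_minus_countable) (auto simp: uncountable_open_interval)
    then have "{t<..<min R (t + 1 / Suc n)} - B \<noteq> {}" by (metis countable_empty)
    then show ?thesis by auto
  qed
  then obtain u where u: "\<And>n. t < u n" "\<And>n. u n < min R (t + 1 / Suc n)" "\<And>n. u n \<notin> B" by metis
  have "u \<longlonglongrightarrow> t"
  proof (rule tendsto_sandwich)
    show "\<forall>\<^sub>F n in sequentially. t \<le> u n" using u(1) by (simp add: less_imp_le)
    show "\<forall>\<^sub>F n in sequentially. u n \<le> t + 1 / Suc n" using u(2) by (simp add: less_imp_le)
    have "(\<lambda>n. t + 1 / real (Suc n)) \<longlonglongrightarrow> t + 0"
      using LIMSEQ_inverse_real_of_nat by (intro tendsto_intros) (simp add: inverse_eq_divide)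
    then show "(\<lambda>n. t + 1 / real (Suc n)) \<longlonglongrightarrow> t" by simp
  qed simp
  then show ?thesis using that u by simp
qed

lemma right_sequence_tendsto:
  fixes x :: "real \<Rightarrow> real"
  assumes "(x \<longlongrightarrow> l) (at_right t)" "u \<longlonglongrightarrow> t" "\<And>n. t < u n"
  shows "(\<lambda>n. x (u n)) \<longlonglongrightarrow> l"
proof (rule filterlim_compose[OF assms(1)])
  show "filterlim u (at_right t) sequentially"
    unfolding filterlim_at using assms(2,3) by (auto intro!: always_eventually simp: less_imp_neq[THEN not_sym])
qed

lemma eq_of_eq_off_countable:
  fixes x y :: "real \<Rightarrow> real"
  assumes "countable B" "t < R" "(x \<longlongrightarrow> x t) (at_right t)" "(y \<longlongrightarrow> y t) (at_right t)"
    and eq: "\<And>u. t < u \<Longrightarrow> u < R \<Longrightarrow> u \<notin> B \<Longrightarrow> x u = y u"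
  shows "x t = y t"
proof -
  obtain u where u: "u \<longlonglongrightarrow> t" "\<And>n. t < u n" "\<And>n. u n < R" "\<And>n. u n \<notin> B"
    using exists_right_sequence_off_countable[OF assms(1,2)] by blast
  have "(\<lambda>n. x (u n)) \<longlonglongrightarrow> x t" by (rule right_sequence_tendsto[OF assms(3) u(1,2)])
  moreover have "(\<lambda>n. x (u n)) \<longlonglongrightarrow> y t"
    using right_sequence_tendsto[OF assms(4) u(1,2)] eq u by simp
  ultimately show ?thesis by (rule LIMSEQ_unique)
qed

text \<open>The jumps telescope to the value of \<open>x\<close> at the last partition time not
  after \<open>t\<close>; at \<open>t = R\<close> this value is exact.\<close>

lemma step_function_of_partition:
  assumes s: "s 0 = 0" "incseq s" "s N = R" and t: "0 \<le> t" "t \<le> R"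
    and close: "\<And>k t. t \<in> {s k..<s (Suc k)} \<Longrightarrow> \<bar>x t - x (s k)\<bar> \<le> \<epsilon>" and \<epsilon>: "0 \<le> \<epsilon>"
  shows "\<bar>x t - step_function s (\<lambda>k. if k = 0 then x (s 0) else x (s k) - x (s (k - 1))) N t\<bar> \<le> \<epsilon>"
proof -
  let ?A = "{i. i \<le> N \<and> s i \<le> t}"
  define k where "k = Max ?A"
  have fin: "finite ?A" "?A \<noteq> {}" using s(1) t(1) by auto
  have k: "k \<le> N" "s k \<le> t" using Max_in[OF fin] unfolding k_def by auto
  have A: "(s i \<le> t) = (i \<le> k)" if "i \<le> N" for i
  proof
    assume "s i \<le> t"
    then show "i \<le> k" using that fin(1) unfolding k_def by (intro Max_ge) auto
  next
    assume "i \<le> k"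
    then show "s i \<le> t" using incseqD[OF s(2)] k(2) by (meson order_trans)
  qed
  let ?c = "\<lambda>k. if k = 0 then x (s 0) else x (s k) - x (s (k - 1))"
  have tel: "(\<Sum>i\<le>j. ?c i) = x (s j)" for j
    by (induction j) auto
  have "step_function s ?c N t = (\<Sum>i\<le>N. if i \<le> k then ?c i else 0)"
    unfolding step_function_def using A by (intro sum.cong) auto
  also have "\<dots> = (\<Sum>i\<le>k. ?c i)"
    using k(1) by (intro sum.mono_neutral_cong_right) auto
  finally have eq: "step_function s ?c N t = x (s k)" using tel by simp
  have "\<bar>x t - x (s k)\<bar> \<le> \<epsilon>"
  proof (cases "k = N")
    case True
    then have "t = s k" using k(2) s(3) t(2) by simp
    then show ?thesis using \<epsilon> by simp
  next
    case False
    then have "\<not> s (Suc k) \<le> t" using A[of "Suc k"] k(1) by simp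
    then show ?thesis using k(2) by (intro close) auto
  qed
  then show ?thesis unfolding eq .
qed

text \<open>At precision \<open>1 / (m + 1)\<close> the number of cells is the same for all
  \<open>n\<close>, so diagonal selection makes the jump times and sizes of every step approximation
  converge. Two limit step functions differ by at most \<open>\<epsilon> m + \<epsilon> m'\<close>,
  because both come from approximations of the same functions; hence they converge uniformly, and
  \<open>x0\<close> inherits their one-sided limits. The same step functions witness S-convergence
  at each precision.\<close>

lemma S_conv_real_selection:
  fixes x :: "nat \<Rightarrow> real \<Rightarrow> real"
  assumes R: "0 < R"
    and rc: "\<And>n t. 0 \<le> t \<Longrightarrow> t < R \<Longrightarrow> (x n \<longlongrightarrow> x n t) (at_right t)"
    and bound: "\<And>n t. 0 \<le> t \<Longrightarrow> t \<le> R \<Longrightarrow> \<bar>x n t\<bar> \<le> C"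
    and osc: "\<And>\<epsilon>. \<epsilon> > 0 \<Longrightarrow> \<exists>N. \<forall>n. \<not> oscillates (x n) \<epsilon> {0..R} N"
  obtains q x0 B where "strict_mono q" "countable B" "R \<notin> B"
    "\<And>t. 0 \<le> t \<Longrightarrow> t \<le> R \<Longrightarrow> t \<notin> B \<Longrightarrow> (\<lambda>n. x (q n) t) \<longlonglongrightarrow> x0 t"
    "\<And>t. 0 \<le> t \<Longrightarrow> t < R \<Longrightarrow> (x0 \<longlongrightarrow> x0 t) (at_right t)"
    "\<And>t. 0 < t \<Longrightarrow> t \<le> R \<Longrightarrow> \<exists>l. (x0 \<longlongrightarrow> l) (at_left t)"
    "S_conv_real R (\<lambda>n. x (q n)) x0"
proof -
  define \<epsilon> where "\<epsilon> m = 1 / real (Suc m)" for m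
  have \<epsilon>: "\<epsilon> m > 0" for m by (simp add: \<epsilon>_def)
  have \<epsilon>_lim: "\<epsilon> \<longlonglongrightarrow> 0"
    unfolding \<epsilon>_def using LIMSEQ_inverse_real_of_nat by (simp add: inverse_eq_divide)
  have "\<exists>N. \<forall>n. \<not> oscillates (x n) (\<epsilon> m / 2) {0..R} N" for m using osc[of "\<epsilon> m / 2"] \<epsilon>[of m] by simp
  then obtain N where N: "\<And>m n. \<not> oscillates (x n) (\<epsilon> m / 2) {0..R} (N m)" by metis
  define P where "P m n s \<longleftrightarrow> s 0 = 0 \<and> incseq s \<and> range s \<subseteq> {0..R} \<and> s (N m) = R \<and>
      (\<forall>k t. t \<in> {s k..<s (Suc k)} \<longrightarrow> \<bar>x n t - x n (s k)\<bar> \<le> \<epsilon> m)" for m n s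
  have "\<exists>s. P m n s" for m n
    by (rule greedy_partition[where x = "x n" and \<epsilon> = "\<epsilon> m" and N = "N m", OF less_imp_le[OF R] \<epsilon> rc N])
      (auto simp: P_def)
  then obtain s where "\<And>m n. P m n (s m n)" by metis
  then have s: "\<And>m n. s m n 0 = 0" "\<And>m n. incseq (s m n)" "\<And>m n. range (s m n) \<subseteq> {0..R}"
    "\<And>m n. s m n (N m) = R" "\<And>m n k t. t \<in> {s m n k..<s m n (Suc k)} \<Longrightarrow> \<bar>x n t - x n (s m n k)\<bar> \<le> \<epsilon> m"
    by (simp_all add: P_def)
  have sR: "0 \<le> s m n k" "s m n k \<le> R" for m n k using s(3)[of m n] by (auto simp: image_subset_iff)
  define c where "c m n k = (if k = 0 then x n (s m n 0) else x n (s m n k) - x n (s m n (k - 1)))" for m n k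
  have cC: "\<bar>c m n k\<bar> \<le> 2 * C" for m n k
    using bound[OF sR[of m n k], of n] bound[OF sR[of m n "k - 1"], of n] bound[OF sR[of m n 0], of n]
    unfolding c_def by (auto simp: abs_le_iff)
  obtain q1 where q1: "strict_mono q1" "\<And>i. convergent (\<lambda>n. (\<lambda>(m, k). s m (q1 n) k) (prod_decode i))"
  proof (rule convergent_diagonal_subsequence[where a = "\<lambda>i n. (\<lambda>(m, k). s m n k) (prod_decode i)"])
    fix i
    have "\<bar>(\<lambda>(m, k). s m n k) (prod_decode i)\<bar> \<le> R" for n
      using sR by (auto split: prod.split)
    then show "\<exists>B. \<forall>n. \<bar>(\<lambda>(m, k). s m n k) (prod_decode i)\<bar> \<le> B" by blast
  qed (use that in blast)
  obtain q2 where q2: "strict_mono q2" "\<And>i. convergent (\<lambda>n. (\<lambda>(m, k). c m (q1 (q2 n)) k) (prod_decode i))"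
  proof (rule convergent_diagonal_subsequence[where a = "\<lambda>i n. (\<lambda>(m, k). c m (q1 n) k) (prod_decode i)"])
    fix i
    have "\<bar>(\<lambda>(m, k). c m (q1 n) k) (prod_decode i)\<bar> \<le> 2 * C" for n
      using cC by (auto split: prod.split)
    then show "\<exists>B. \<forall>n. \<bar>(\<lambda>(m, k). c m (q1 n) k) (prod_decode i)\<bar> \<le> B" by blast
  qed (use that in blast)
  define q where "q n = q1 (q2 n)" for n
  have q: "strict_mono q" using q1(1) q2(1) by (auto simp: strict_mono_def q_def)
  have "convergent (\<lambda>n. s m (q n) k)" "convergent (\<lambda>n. c m (q n) k)" for m k
  proof -
    have "convergent (\<lambda>n. s m (q1 n) k)" using q1(2)[of "prod_encode (m, k)"] by simp
    from convergent_subseq_convergent[OF this q2(1)] show "convergent (\<lambda>n. s m (q n) k)"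
      by (simp add: o_def q_def)
    show "convergent (\<lambda>n. c m (q n) k)" using q2(2)[of "prod_encode (m, k)"] by (simp add: q_def)
  qed
  then have "\<forall>m k. \<exists>l. (\<lambda>n. s m (q n) k) \<longlonglongrightarrow> l" "\<forall>m k. \<exists>l. (\<lambda>n. c m (q n) k) \<longlonglongrightarrow> l"
    by (auto simp: convergent_def)
  then obtain s0 c0 where s0: "\<And>m k. (\<lambda>n. s m (q n) k) \<longlonglongrightarrow> s0 m k" and c0: "\<And>m k. (\<lambda>n. c m (q n) k) \<longlonglongrightarrow> c0 m k"
    by metis
  define \<nu> where "\<nu> m n = step_function (s m (q n)) (c m (q n)) (N m)" for m n
  define \<nu>0 where "\<nu>0 m = step_function (s0 m) (c0 m) (N m)" for m
  \<comment> \<open>The limit jump times. The endpoint \<open>R\<close> may be left out: no jump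
    time exceeds it, so the step functions converge there too.\<close>
  define B where "B = (\<Union>m k. {s0 m k}) - {R}"
  have B: "countable B" "R \<notin> B" by (auto simp: B_def)
  have x\<nu>: "\<bar>x (q n) t - \<nu> m n t\<bar> \<le> \<epsilon> m" if "0 \<le> t" "t \<le> R" for n t m
    unfolding \<nu>_def c_def[abs_def]
    by (rule step_function_of_partition[where R = R]) (use s that less_imp_le[OF \<epsilon>] in auto)
  have \<nu>_lim: "(\<lambda>n. \<nu> m n t) \<longlonglongrightarrow> \<nu>0 m t" if "0 \<le> t" "t \<le> R" "t \<notin> B" for t m
    unfolding \<nu>_def \<nu>0_def
  proof (rule step_function_tendsto[OF s0 c0])
    fix k show "s0 m k \<noteq> t \<or> (\<forall>n. s m (q n) k \<le> t)"
      using that sR by (cases "t = R") (auto simp: B_def)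
  qed
  have diff_off: "\<bar>\<nu>0 m t - \<nu>0 m' t\<bar> \<le> \<epsilon> m + \<epsilon> m'" if "0 \<le> t" "t \<le> R" "t \<notin> B" for t m m'
  proof (rule LIMSEQ_le_const2)
    show "(\<lambda>n. \<bar>\<nu> m n t - \<nu> m' n t\<bar>) \<longlonglongrightarrow> \<bar>\<nu>0 m t - \<nu>0 m' t\<bar>"
      using that by (intro tendsto_intros \<nu>_lim)
    have "\<bar>\<nu> m n t - \<nu> m' n t\<bar> \<le> \<epsilon> m + \<epsilon> m'" for n
      using x\<nu>[OF that(1,2), of n m] x\<nu>[OF that(1,2), of n m'] by linarith
    then show "\<exists>N. \<forall>n\<ge>N. \<bar>\<nu> m n t - \<nu> m' n t\<bar> \<le> \<epsilon> m + \<epsilon> m'" by blast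
  qed
  have \<nu>0_rc: "(\<nu>0 m \<longlongrightarrow> \<nu>0 m t) (at_right t)" for m t
    unfolding \<nu>0_def by (rule step_function_right_continuous)
  \<comment> \<open>Right-continuity of the limit step functions extends the estimate from the
    complement of \<open>B\<close> to all of \<open>[0, R]\<close>.\<close>
  have diff: "\<bar>\<nu>0 m t - \<nu>0 m' t\<bar> \<le> \<epsilon> m + \<epsilon> m'" if t: "0 \<le> t" "t \<le> R" for t m m'
  proof (cases "t = R")
    case True
    then show ?thesis using diff_off t B(2) by blast
  next
    case False
    then have "t < R" using t by simp
    then obtain u where u: "u \<longlonglongrightarrow> t" "\<And>n. t < u n" "\<And>n. u n < R" "\<And>n. u n \<notin> B"
      using exists_right_sequence_off_countable[OF B(1)] by blast
    have "(\<lambda>n. \<bar>\<nu>0 m (u n) - \<nu>0 m' (u n)\<bar>) \<longlonglongrightarrow> \<bar>\<nu>0 m t - \<nu>0 m' t\<bar>"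
      by (intro tendsto_intros right_sequence_tendsto[OF \<nu>0_rc u(1,2)])
    moreover have "\<bar>\<nu>0 m (u n) - \<nu>0 m' (u n)\<bar> \<le> \<epsilon> m + \<epsilon> m'" for n
      using u(2,3)[of n] u(4)[of n] t by (intro diff_off) auto
    ultimately show ?thesis by (intro LIMSEQ_le_const2) auto
  qed
  have cauchy_of: "convergent f" if f: "\<And>m m'. \<bar>f m - f m'\<bar> \<le> \<epsilon> m + \<epsilon> m'" for f :: "nat \<Rightarrow> real"
    unfolding Cauchy_convergent_iff[symmetric]
  proof (rule CauchyI)
    fix e :: real assume "e > 0"
    then have "\<forall>\<^sub>F m in sequentially. \<epsilon> m < e / 2" using order_tendstoD(2)[OF \<epsilon>_lim, of "e / 2"] by simp
    then obtain M where M: "\<And>m. m \<ge> M \<Longrightarrow> \<epsilon> m < e / 2" by (auto simp: eventually_sequentially)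
    have "norm (f m - f m') < e" if "m \<ge> M" "m' \<ge> M" for m m'
      using f[of m m'] M[OF that(1)] M[OF that(2)] by (simp only: real_norm_def)
    then show "\<exists>M. \<forall>m\<ge>M. \<forall>n\<ge>M. norm (f m - f n) < e" by blast
  qed
  define x0 where "x0 t = lim (\<lambda>m. \<nu>0 m t)" for t
  have \<nu>0_x0: "(\<lambda>m. \<nu>0 m t) \<longlonglongrightarrow> x0 t" if "0 \<le> t" "t \<le> R" for t
    unfolding x0_def using cauchy_of[OF diff[OF that]] by (simp add: convergent_LIMSEQ_iff)
  have x0\<nu>: "\<bar>x0 t - \<nu>0 m t\<bar> \<le> \<epsilon> m" if "0 \<le> t" "t \<le> R" for t m
  proof (rule LIMSEQ_le)
    show "(\<lambda>m'. \<bar>\<nu>0 m' t - \<nu>0 m t\<bar>) \<longlonglongrightarrow> \<bar>x0 t - \<nu>0 m t\<bar>"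
      using that by (intro tendsto_intros \<nu>0_x0)
    have "(\<lambda>m'. \<epsilon> m' + \<epsilon> m) \<longlonglongrightarrow> 0 + \<epsilon> m" by (intro tendsto_intros \<epsilon>_lim)
    then show "(\<lambda>m'. \<epsilon> m' + \<epsilon> m) \<longlonglongrightarrow> \<epsilon> m" by simp
    show "\<exists>N. \<forall>n\<ge>N. \<bar>\<nu>0 n t - \<nu>0 m t\<bar> \<le> \<epsilon> n + \<epsilon> m" using diff[OF that] by blast
  qed
  have unif: "uniform_limit {0..R} \<nu>0 x0 sequentially"
  proof (rule uniform_limitI)
    fix e :: real assume "e > 0"
    from order_tendstoD(2)[OF \<epsilon>_lim this]
    show "\<forall>\<^sub>F m in sequentially. \<forall>t\<in>{0..R}. dist (\<nu>0 m t) (x0 t) < e"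
    proof eventually_elim
      case (elim m)
      have "dist (\<nu>0 m t) (x0 t) < e" if "t \<in> {0..R}" for t
        using x0\<nu>[of t m] that elim by (auto simp: dist_real_def)
      then show ?case by blast
    qed
  qed
  show ?thesis
  proof (rule that[OF q B])
    fix t assume t: "0 \<le> t" "t \<le> R" "t \<notin> B"
    show "(\<lambda>n. x (q n) t) \<longlonglongrightarrow> x0 t"
    proof (rule LIMSEQ_I)
      fix e :: real assume "e > 0"
      then have "\<forall>\<^sub>F m in sequentially. \<epsilon> m < e / 3" using order_tendstoD(2)[OF \<epsilon>_lim, of "e / 3"] by simp
      then obtain m where m: "\<epsilon> m < e / 3" by (auto simp: eventually_sequentially)
      obtain n0 where n0: "\<And>n. n \<ge> n0 \<Longrightarrow> norm (\<nu> m n t - \<nu>0 m t) < e / 3"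
        using LIMSEQ_D[OF \<nu>_lim[OF t, of m], of "e / 3"] \<open>e > 0\<close> by auto
      have "norm (x (q n) t - x0 t) < e" if "n \<ge> n0" for n
        using n0[OF that] m x0\<nu>[OF t(1,2), of m] x\<nu>[OF t(1,2), of n m]
        unfolding real_norm_def by linarith
      then show "\<exists>no. \<forall>n\<ge>no. norm (x (q n) t - x0 t) < e" by blast
    qed
  next
    fix t assume t: "0 \<le> t" "t < R"
    have eq: "at_right t = at t within {t<..R}" 
      using t by (intro at_within_nhd[of _ "{..<R}"]) auto
    show "(x0 \<longlongrightarrow> x0 t) (at_right t)"
      unfolding eq
    proof (rule swap_uniform_limit)
      show "\<forall>\<^sub>F m in sequentially. (\<nu>0 m \<longlongrightarrow> \<nu>0 m t) (at t within {t<..R})"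
        using \<nu>0_rc[of _ t] unfolding eq by (intro always_eventually allI)
      show "(\<lambda>m. \<nu>0 m t) \<longlonglongrightarrow> x0 t" using t by (intro \<nu>0_x0) auto
      show "uniform_limit {t<..R} \<nu>0 x0 sequentially"
        using t by (intro uniform_limit_on_subset[OF unif]) auto
    qed simp
  next
    fix t assume t: "0 < t" "t \<le> R"
    have eq: "at_left t = at t within {0..<t}" 
      using t by (intro at_within_nhd[of _ "{0<..}"]) auto
    have "\<forall>m. \<exists>l. (\<nu>0 m \<longlongrightarrow> l) (at_left t)" unfolding \<nu>0_def using step_function_left_limit by blast
    then obtain l where l: "\<And>m. (\<nu>0 m \<longlongrightarrow> l m) (at_left t)" by metis
    have "\<bar>l m - l m'\<bar> \<le> \<epsilon> m + \<epsilon> m'" for m m'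
    proof (rule tendsto_upperbound)
      show "((\<lambda>u. \<bar>\<nu>0 m u - \<nu>0 m' u\<bar>) \<longlongrightarrow> \<bar>l m - l m'\<bar>) (at_left t)" by (intro tendsto_intros l)
      show "\<forall>\<^sub>F u in at_left t. \<bar>\<nu>0 m u - \<nu>0 m' u\<bar> \<le> \<epsilon> m + \<epsilon> m'"
        unfolding eq eventually_at_filter using t diff by (auto intro!: always_eventually)
    qed simp
    then obtain l0 where l0: "l \<longlonglongrightarrow> l0" using cauchy_of[of l] by (auto simp: convergent_def)
    have "(x0 \<longlongrightarrow> l0) (at_left t)"
      unfolding eq
    proof (rule swap_uniform_limit)
      show "\<forall>\<^sub>F m in sequentially. (\<nu>0 m \<longlongrightarrow> l m) (at t within {0..<t})"
        using l unfolding eq by (intro always_eventually allI)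
      show "uniform_limit {0..<t} \<nu>0 x0 sequentially"
        using t by (intro uniform_limit_on_subset[OF unif]) auto
    qed (use l0 in simp_all)
    then show "\<exists>l. (x0 \<longlongrightarrow> l) (at_left t)" by blast
  next
    show "S_conv_real R (\<lambda>n. x (q n)) x0"
      unfolding S_conv_real_def
    proof (intro allI impI)
      fix e :: real assume "e > 0"
      then have "\<forall>\<^sub>F m in sequentially. \<epsilon> m < e" by (rule order_tendstoD(2)[OF \<epsilon>_lim])
      then obtain m where m: "\<epsilon> m \<le> e" by (auto simp: eventually_sequentially intro: less_imp_le)
      show "\<exists>\<nu> \<nu>\<^sub>0. (\<forall>n. finite_variation R (\<nu> n)) \<and> finite_variation R \<nu>\<^sub>0 \<and>
          (\<forall>n. \<forall>t\<in>{0..R}. \<bar>x (q n) t - \<nu> n t\<bar> \<le> e) \<and> (\<forall>t\<in>{0..R}. \<bar>x0 t - \<nu>\<^sub>0 t\<bar> \<le> e) \<and> fv_weak_star_conv R \<nu> \<nu>\<^sub>0"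
      proof (intro exI conjI allI ballI)
        show "finite_variation R (\<nu> m n)" for n unfolding \<nu>_def by (rule finite_variation_step_function)
        show "finite_variation R (\<nu>0 m)" unfolding \<nu>0_def by (rule finite_variation_step_function)
        show "\<bar>x (q n) t - \<nu> m n t\<bar> \<le> e" if "t \<in> {0..R}" for n t using x\<nu>[of t n m] that m by auto
        show "\<bar>x0 t - \<nu>0 m t\<bar> \<le> e" if "t \<in> {0..R}" for t using x0\<nu>[of t m] that m by auto
        show "fv_weak_star_conv R (\<nu> m) (\<nu>0 m)"
          unfolding \<nu>_def[abs_def] \<nu>0_def using sR by (intro step_functions_weak_star_conv s0 c0) auto
      qed
    qed
  qed
qed

lemma S_conv_real_cong:
  assumes "S_conv_real R x y" "\<And>t. 0 \<le> t \<Longrightarrow> t \<le> R \<Longrightarrow> y t = z t"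
  shows "S_conv_real R x z"
  using assms unfolding S_conv_real_def by simp

lemma S_conv_real_cong_sequence:
  assumes "S_conv_real R x y" "\<And>n t. 0 \<le> t \<Longrightarrow> t \<le> R \<Longrightarrow> x n t = x' n t"
  shows "S_conv_real R x' y"
  using assms unfolding S_conv_real_def by simp

lemma fv_weak_star_conv_subseq:
  "fv_weak_star_conv R \<nu> \<nu>0 \<Longrightarrow> strict_mono q \<Longrightarrow> fv_weak_star_conv R (\<nu> \<circ> q) \<nu>0"
  unfolding fv_weak_star_conv_def
proof (elim exE conjE)
  fix m m0 assume q: "strict_mono q" and m: "\<forall>n. represents R (m n) (\<nu> n)" "represents R m0 \<nu>0"
    and lim: "\<forall>f. continuous_on {0..R} f \<longrightarrow> (\<lambda>n. signed_integral (restrict_space borel {0..R}) (m n) f)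
      \<longlonglongrightarrow> signed_integral (restrict_space borel {0..R}) m0 f"
  show "\<exists>m m\<^sub>0. (\<forall>n. represents R (m n) ((\<nu> \<circ> q) n)) \<and> represents R m\<^sub>0 \<nu>0 \<and>
    (\<forall>f. continuous_on {0..R} f \<longrightarrow> (\<lambda>n. signed_integral (restrict_space borel {0..R}) (m n) f)
      \<longlonglongrightarrow> signed_integral (restrict_space borel {0..R}) m\<^sub>0 f)"
  proof (intro exI[of _ "m \<circ> q"] exI[of _ m0] conjI allI impI)
    fix f :: "real \<Rightarrow> real" assume "continuous_on {0..R} f"
    then have "(\<lambda>n. signed_integral (restrict_space borel {0..R}) (m n) f)
      \<longlonglongrightarrow> signed_integral (restrict_space borel {0..R}) m0 f" using lim by blast
    from LIMSEQ_subseq_LIMSEQ[OF this q]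
    show "(\<lambda>n. signed_integral (restrict_space borel {0..R}) ((m \<circ> q) n) f)
      \<longlonglongrightarrow> signed_integral (restrict_space borel {0..R}) m0 f" by (simp add: o_def)
  qed (use m in simp_all)
qed

lemma S_conv_real_subseq:
  assumes "S_conv_real R x y" "strict_mono q"
  shows "S_conv_real R (x \<circ> q) y"
  unfolding S_conv_real_def
proof (intro allI impI)
  fix e :: real assume "e > 0"
  from assms(1)[unfolded S_conv_real_def, rule_format, OF this]
  obtain \<nu> \<nu>0 where "\<forall>n. finite_variation R (\<nu> n)" "finite_variation R \<nu>0"
    "\<forall>n. \<forall>t\<in>{0..R}. \<bar>x n t - \<nu> n t\<bar> \<le> e" "\<forall>t\<in>{0..R}. \<bar>y t - \<nu>0 t\<bar> \<le> e" "fv_weak_star_conv R \<nu> \<nu>0"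
    by (elim exE conjE) (rule that)
  note \<nu> = this
  show "\<exists>\<nu> \<nu>\<^sub>0. (\<forall>n. finite_variation R (\<nu> n)) \<and> finite_variation R \<nu>\<^sub>0 \<and>
          (\<forall>n. \<forall>t\<in>{0..R}. \<bar>(x \<circ> q) n t - \<nu> n t\<bar> \<le> e) \<and> (\<forall>t\<in>{0..R}. \<bar>y t - \<nu>\<^sub>0 t\<bar> \<le> e) \<and> fv_weak_star_conv R \<nu> \<nu>\<^sub>0"
  proof (intro exI[of _ "\<nu> \<circ> q"] exI[of _ \<nu>0] conjI)
    show "\<forall>n. finite_variation R ((\<nu> \<circ> q) n)" using \<nu>(1) by simp
    show "\<forall>n. \<forall>t\<in>{0..R}. \<bar>(x \<circ> q) n t - (\<nu> \<circ> q) n t\<bar> \<le> e" using \<nu>(3) by simp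
    show "finite_variation R \<nu>0" by (rule \<nu>(2))
    show "\<forall>t\<in>{0..R}. \<bar>y t - \<nu>0 t\<bar> \<le> e" by (rule \<nu>(4))
    show "fv_weak_star_conv R (\<nu> \<circ> q) \<nu>0" by (rule fv_weak_star_conv_subseq[OF \<nu>(5) assms(2)])
  qed
qed

text \<open>The limit found by selection agrees with \<open>y\<close> off a countable set, hence
  below \<open>R\<close> by right-continuity of both, and at \<open>R\<close> because
  \<open>R\<close> is not exceptional.\<close>

lemma S_conv_real_of_pointwise:
  fixes x :: "nat \<Rightarrow> real \<Rightarrow> real"
  assumes R: "0 < R"
    and rc: "\<And>n t. 0 \<le> t \<Longrightarrow> t < R \<Longrightarrow> (x n \<longlongrightarrow> x n t) (at_right t)"
    and bound: "\<And>n t. 0 \<le> t \<Longrightarrow> t \<le> R \<Longrightarrow> \<bar>x n t\<bar> \<le> C"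
    and osc: "\<And>\<epsilon>. \<epsilon> > 0 \<Longrightarrow> \<exists>N. \<forall>n. \<not> oscillates (x n) \<epsilon> {0..R} N"
    and B: "countable B" "R \<notin> B"
    and lim: "\<And>t. 0 \<le> t \<Longrightarrow> t \<le> R \<Longrightarrow> t \<notin> B \<Longrightarrow> (\<lambda>n. x n t) \<longlonglongrightarrow> y t"
    and y: "\<And>t. 0 \<le> t \<Longrightarrow> t < R \<Longrightarrow> (y \<longlongrightarrow> y t) (at_right t)"
  shows "\<exists>q. strict_mono q \<and> S_conv_real R (x \<circ> q) y"
proof -
  obtain q x0 B' where q: "strict_mono q" and B': "countable B'" "R \<notin> B'"
    and lim': "\<And>t. 0 \<le> t \<Longrightarrow> t \<le> R \<Longrightarrow> t \<notin> B' \<Longrightarrow> (\<lambda>n. x (q n) t) \<longlonglongrightarrow> x0 t"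
    and x0: "\<And>t. 0 \<le> t \<Longrightarrow> t < R \<Longrightarrow> (x0 \<longlongrightarrow> x0 t) (at_right t)"
    and S: "S_conv_real R (\<lambda>n. x (q n)) x0"
  proof (rule S_conv_real_selection[of R x C, OF R])
    show "(x n \<longlongrightarrow> x n t) (at_right t)" if "0 \<le> t" "t < R" for n t using rc that .
    show "\<bar>x n t\<bar> \<le> C" if "0 \<le> t" "t \<le> R" for n t using bound that .
    show "\<exists>N. \<forall>n. \<not> oscillates (x n) \<epsilon> {0..R} N" if "\<epsilon> > 0" for \<epsilon> using osc that .
  qed (rule that)
  have off: "x0 t = y t" if "0 \<le> t" "t \<le> R" "t \<notin> B \<union> B'" for t
  proof (rule LIMSEQ_unique)
    show "(\<lambda>n. x (q n) t) \<longlonglongrightarrow> x0 t" using lim' that by auto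
    show "(\<lambda>n. x (q n) t) \<longlonglongrightarrow> y t"
      using LIMSEQ_subseq_LIMSEQ[OF lim q, of t] that by (auto simp: o_def)
  qed
  have "x0 t = y t" if t: "0 \<le> t" "t \<le> R" for t
  proof (cases "t = R")
    case True
    then show ?thesis using off t B B' by auto
  next
    case False
    then have "t < R" using t by simp
    then show ?thesis
      using B B' off t by (intro eq_of_eq_off_countable[of "B \<union> B'" t R x0 y] x0 y) auto
  qed
  then show ?thesis
    using S_conv_real_cong[OF S, of y] q by (intro exI[of _ q]) (simp add: o_def)
qed

text \<open>Serves the \<open>tail\<close> requirement of the diagonal argument. Prepending finitely
  many terms is not free, since each needs its own finite-variation approximation; finite
  oscillation numbers supply a greedy step function.\<close>

lemma S_conv_real_tail:
  fixes x :: "nat \<Rightarrow> real \<Rightarrow> real"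
  assumes S: "S_conv_real R (\<lambda>n. x (k + n)) y" and R: "0 < R"
    and rc: "\<And>n t. 0 \<le> t \<Longrightarrow> t < R \<Longrightarrow> (x n \<longlongrightarrow> x n t) (at_right t)"
    and osc: "\<And>n \<epsilon>. \<epsilon> > 0 \<Longrightarrow> \<exists>N. \<not> oscillates (x n) \<epsilon> {0..R} N"
  shows "S_conv_real R x y"
  unfolding S_conv_real_def
proof (intro allI impI)
  fix \<epsilon> :: real assume \<epsilon>: "\<epsilon> > 0"
  from S[unfolded S_conv_real_def, rule_format, OF this]
  obtain \<nu> \<nu>0 where \<nu>: "\<forall>n. finite_variation R (\<nu> n)" "finite_variation R \<nu>0"
    "\<forall>n. \<forall>t\<in>{0..R}. \<bar>x (k + n) t - \<nu> n t\<bar> \<le> \<epsilon>" "\<forall>t\<in>{0..R}. \<bar>y t - \<nu>0 t\<bar> \<le> \<epsilon>" "fv_weak_star_conv R \<nu> \<nu>0"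
    by (elim exE conjE) (rule that)
  from \<nu>(5) obtain m m0 where m: "\<forall>n. represents R (m n) (\<nu> n)" "represents R m0 \<nu>0"
    "\<forall>f. continuous_on {0..R} f \<longrightarrow> (\<lambda>n. signed_integral (restrict_space borel {0..R}) (m n) f)
      \<longlonglongrightarrow> signed_integral (restrict_space borel {0..R}) m0 f"
    unfolding fv_weak_star_conv_def by (elim exE conjE) (rule that)
  define P where "P n v \<mu> \<longleftrightarrow> finite_variation R v \<and> (\<forall>t\<in>{0..R}. \<bar>x n t - v t\<bar> \<le> \<epsilon>) \<and> represents R \<mu> v" for n v \<mu>
  have "\<exists>v \<mu>. P n v \<mu>" for n
  proof -
    obtain N where N: "\<not> oscillates (x n) (\<epsilon> / 2) {0..R} N" using osc[of "\<epsilon> / 2"] \<epsilon> by auto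
    obtain s where s: "s 0 = 0" "incseq s" "range s \<subseteq> {0..R}" "s N = R"
      "\<And>k t. t \<in> {s k..<s (Suc k)} \<Longrightarrow> \<bar>x n t - x n (s k)\<bar> \<le> \<epsilon>"
    proof (rule greedy_partition[where x = "x n", OF less_imp_le[OF R] \<epsilon> _ N])
      show "(x n \<longlongrightarrow> x n t) (at_right t)" if "0 \<le> t" "t < R" for t using rc that .
    qed (rule that)
    let ?v = "step_function s (\<lambda>k. if k = 0 then x n (s 0) else x n (s k) - x n (s (k - 1))) N"
    have sR: "s k \<in> {0..R}" for k using s(3) by blast
    obtain \<mu> where "represents R \<mu> ?v" by (rule step_function_represented[OF sR])
    moreover have "\<forall>t\<in>{0..R}. \<bar>x n t - ?v t\<bar> \<le> \<epsilon>"
      using \<epsilon> s(5) by (intro ballI step_function_of_partition[OF s(1,2,4)]) auto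
    ultimately show ?thesis
      unfolding P_def using finite_variation_step_function by blast
  qed
  then obtain v \<mu> where v: "\<And>n. P n (v n) (\<mu> n)" by metis
  define \<nu>' where "\<nu>' n = (if n < k then v n else \<nu> (n - k))" for n
  define m' where "m' n = (if n < k then \<mu> n else m (n - k))" for n
  have "(\<lambda>n. signed_integral (restrict_space borel {0..R}) (m' n) f)
      \<longlonglongrightarrow> signed_integral (restrict_space borel {0..R}) m0 f" if "continuous_on {0..R} f" for f
  proof (rule LIMSEQ_offset[of _ k])
    show "(\<lambda>n. signed_integral (restrict_space borel {0..R}) (m' (n + k)) f)
      \<longlonglongrightarrow> signed_integral (restrict_space borel {0..R}) m0 f"
      using m(3) that by (simp add: m'_def)
  qed
  moreover have "represents R (m' n) (\<nu>' n)" for n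
    using v[of n] m(1) by (simp add: m'_def \<nu>'_def P_def)
  ultimately have "fv_weak_star_conv R \<nu>' \<nu>0"
    unfolding fv_weak_star_conv_def using m(2) by blast
  moreover have "finite_variation R (\<nu>' n)" for n
    using v[of n] \<nu>(1) by (simp add: \<nu>'_def P_def)
  moreover have "\<bar>x n t - \<nu>' n t\<bar> \<le> \<epsilon>" if "t \<in> {0..R}" for n t
  proof (cases "n < k")
    case True
    then show ?thesis using v[of n] that by (simp add: \<nu>'_def P_def)
  next
    case False
    then show ?thesis using \<nu>(3)[rule_format, OF that, of "n - k"] by (simp add: \<nu>'_def)
  qed
  ultimately show "\<exists>\<nu> \<nu>\<^sub>0. (\<forall>n. finite_variation R (\<nu> n)) \<and> finite_variation R \<nu>\<^sub>0 \<and>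
          (\<forall>n. \<forall>t\<in>{0..R}. \<bar>x n t - \<nu> n t\<bar> \<le> \<epsilon>) \<and> (\<forall>t\<in>{0..R}. \<bar>y t - \<nu>\<^sub>0 t\<bar> \<le> \<epsilon>) \<and> fv_weak_star_conv R \<nu> \<nu>\<^sub>0"
    using \<nu>(2,4) by blast
qed

section \<open>Convergence of sequences in the S-topology\<close>

lemma topspace_S_seq_topology: "topspace (S_seq_topology I) = (cadlag_paths I :: ('d::finite) path set)"
proof (rule antisym)
  show "topspace (S_seq_topology I) \<subseteq> (cadlag_paths I :: 'd path set)"
    using openin_topspace[of "S_seq_topology I :: 'd path topology"]
    unfolding openin_S_seq_topology by (rule conjunct1)
  have "openin (S_seq_topology I) (cadlag_paths I :: 'd path set)"
    unfolding openin_S_seq_topology S_closed_def by auto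
  then show "cadlag_paths I \<subseteq> topspace (S_seq_topology I :: 'd path topology)" by (rule openin_subset)
qed

text \<open>Were \<open>w\<close> infinitely often outside an open \<open>U\<close> around
  \<open>w0\<close>, these terms would form a sequence in a closed set that converges to
  \<open>w0\<close> in the subsequential sense, which puts \<open>w0\<close> outside
  \<open>U\<close>.\<close>

lemma limitin_S_seq_topology:
  fixes w :: "nat \<Rightarrow> ('d::finite) path"
  assumes w: "range w \<subseteq> cadlag_paths I" "w0 \<in> cadlag_paths I" and S: "S_conv_subseq I w w0"
  shows "limitin (S_seq_topology I) w w0 sequentially"
proof -
  show ?thesis
    unfolding limitin_def
  proof (intro conjI allI impI)
    show "w0 \<in> topspace (S_seq_topology I)" using w(2) by (simp add: topspace_S_seq_topology)
    fix U assume U: "openin (S_seq_topology I) U \<and> w0 \<in> U"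
    show "\<forall>\<^sub>F n in sequentially. w n \<in> U"
    proof (rule ccontr)
      assume "\<not> ?thesis"
      then have inf: "infinite {n. w n \<notin> U}"
        by (simp add: eventually_sequentially infinite_nat_iff_unbounded_le)
      define r where "r = enumerate {n. w n \<notin> U}"
      have r: "strict_mono r" using inf by (simp add: r_def strict_mono_enumerate)
      have "r n \<in> {n. w n \<notin> U}" for n unfolding r_def by (rule enumerate_in_set[OF inf])
      then have "range (w \<circ> r) \<subseteq> cadlag_paths I - U" using w(1) by auto
      moreover have "S_conv_subseq I (w \<circ> r) w0"
        unfolding S_conv_subseq_def
      proof (intro allI impI)
        fix s :: "nat \<Rightarrow> nat" assume "strict_mono s"
        then have "strict_mono (r \<circ> s)" using r by (simp add: strict_mono_o)
        then show "\<exists>q. strict_mono q \<and> S_conv I (w \<circ> r \<circ> s \<circ> q) w0"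
          using S unfolding S_conv_subseq_def by (metis comp_assoc)
      qed
      ultimately have "w0 \<in> cadlag_paths I - U"
        using U w(2) unfolding openin_S_seq_topology S_closed_def by blast
      then show False using U by blast
    qed
  qed
qed

section \<open>The path space\<close>

locale time_line =
  fixes I :: "ereal set"
  assumes I: "time_interval I"
begin

lemma I_cases:
  obtains (finite) T where "0 < T" "I = {0..ereal T}" "Sup I = ereal T"
  | (closed) "I = {0..\<infinity>}" "Sup I = \<infinity>"
  | (half_open) "I = {0..<\<infinity>}" "Sup I = \<infinity>"
proof -
  consider (1) T where "T > 0" "I = {0..T}" | (2) "I = {0..<\<infinity>}"
    using I unfolding time_interval_def by blast
  then show ?thesis
  proof cases
    case 1
    then have "Sup I = T" by simp
    with 1 show ?thesis using finite closed by (cases T) auto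
  next
    case 2
    then have "Sup I = \<infinity>" by (simp add: Sup_atLeastLessThan)
    with 2 show ?thesis using half_open by blast
  qed
qed

text \<open>Treats the three shapes of \<open>I\<close> uniformly: what distinguishes them later is
  mostly whether the supremum belongs to \<open>I\<close>.\<close>

lemma in_I_iff: "t \<in> I \<longleftrightarrow> 0 \<le> t \<and> (t < Sup I \<or> t = Sup I \<and> Sup I \<in> I)"
proof (cases rule: I_cases)
  case (finite T)
  then show ?thesis unfolding finite(3) unfolding finite(2) by (cases t) auto
next
  case closed
  then show ?thesis unfolding closed(2) unfolding closed(1) by (cases t) auto
next
  case half_open
  then show ?thesis unfolding half_open(2) unfolding half_open(1) by (cases t) auto
qed

lemma Sup_pos: "0 < Sup I"
proof (cases rule: I_cases)
  case (finite T)
  then show ?thesis unfolding finite(3) by simp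
qed simp_all

lemma zero_in_I: "0 \<in> I"
  unfolding in_I_iff[of 0] using Sup_pos by blast

lemma real_in_I_iff: "ereal t \<in> I \<longleftrightarrow> 0 \<le> t \<and> ereal t \<le> Sup I"
proof (cases rule: I_cases)
  case (finite T)
  then show ?thesis unfolding finite(3) unfolding finite(2) by auto
next
  case closed
  then show ?thesis unfolding closed(2) unfolding closed(1) by auto
next
  case half_open
  then show ?thesis unfolding half_open(2) unfolding half_open(1) by auto
qed

lemma eventually_less_Sup:
  assumes "ereal t < Sup I"
  shows "\<forall>\<^sub>F u in at_right t. ereal u < Sup I"
proof (cases "Sup I")
  case (real T)
  then have "t < T" using assms by simp
  then show ?thesis unfolding real by (auto simp: eventually_at_right_field)
next
  case PInf
  show ?thesis unfolding PInf by simp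
next
  case MInf
  then show ?thesis using Sup_pos by simp
qed

lemma in_I_mono: "0 \<le> u \<Longrightarrow> u \<le> t \<Longrightarrow> t \<in> I \<Longrightarrow> u \<in> I"
  unfolding in_I_iff[of u] in_I_iff[of t] by (cases "u = t") (auto simp only: order_le_less intro: order.strict_trans)

lemma cadlag_right:
  assumes "w \<in> cadlag_paths I" "0 \<le> t" "ereal t < Sup I"
  shows "(component i w \<longlongrightarrow> component i w t) (at_right t)"
proof -
  have "ereal t \<in> I" unfolding real_in_I_iff using assms(2,3) less_imp_le by blast
  then have lim: "(w \<longlongrightarrow> w (ereal t)) (at (ereal t) within I \<inter> {ereal t<..})"
    using assms(1) by (simp add: cadlag_paths_def)
  have "\<forall>\<^sub>F u in at_right t. ereal u \<in> I \<inter> {ereal t<..} \<and> ereal u \<noteq> ereal t"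
    using eventually_less_Sup[OF assms(3)] eventually_at_right_less[of t]
  proof eventually_elim
    case (elim u)
    then have "ereal u \<in> I" unfolding real_in_I_iff using assms(2) by auto
    then show ?case using elim by simp
  qed
  then have "filterlim ereal (at (ereal t) within I \<inter> {ereal t<..}) (at_right t)"
    unfolding filterlim_at by (auto elim: eventually_mono)
  from filterlim_compose[OF lim this] have "((\<lambda>u. w (ereal u)) \<longlongrightarrow> w (ereal t)) (at_right t)" .
  then show ?thesis unfolding component_def[abs_def] by (rule tendsto_vec_nth)
qed

lemma cadlag_left:
  assumes "w \<in> cadlag_paths I" "0 < t" "ereal t \<in> I"
  shows "\<exists>l. (component i w \<longlongrightarrow> l) (at_left t)"
proof -
  obtain l where lim: "(w \<longlongrightarrow> l) (at (ereal t) within I \<inter> {..<ereal t})"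
    using assms by (auto simp: cadlag_paths_def)
  have "\<forall>\<^sub>F u in at_left t. u < t" "\<forall>\<^sub>F u in at_left t. 0 < u"
    using assms(2) by (auto simp: eventually_at_left_field intro: exI[of _ "t - 1"])
  then have "\<forall>\<^sub>F u in at_left t. ereal u \<in> I \<inter> {..<ereal t} \<and> ereal u \<noteq> ereal t"
  proof eventually_elim
    case (elim u)
    then have "ereal u \<in> I" using in_I_mono[OF _ _ assms(3), of "ereal u"] by simp
    then show ?case using elim by simp
  qed
  then have "filterlim ereal (at (ereal t) within I \<inter> {..<ereal t}) (at_left t)"
    unfolding filterlim_at by (auto elim: eventually_mono)
  from filterlim_compose[OF lim this] have "((\<lambda>u. w (ereal u)) \<longlongrightarrow> l) (at_left t)" .
  from tendsto_vec_nth[OF this] show ?thesis unfolding component_def[abs_def] by blast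
qed

text \<open>The value at infinity is passed separately as \<open>z\<close>, since no limit ties it
  to the rest of the path.\<close>

definition make_path :: "('d \<Rightarrow> real \<Rightarrow> real) \<Rightarrow> real^'d \<Rightarrow> ('d::finite) path" where
  "make_path x z u = (if u \<in> I then if u = \<infinity> then z else \<chi> i. x i (real_of_ereal u) else undefined)"

lemma component_make_path: "ereal t \<in> I \<Longrightarrow> component i (make_path x z) t = x i t"
  by (simp add: component_def make_path_def)

lemma make_path_infinity: "\<infinity> \<in> I \<Longrightarrow> make_path x z \<infinity> = z"
  by (simp add: make_path_def)

lemma make_path_cadlag:
  assumes rc: "\<And>i t. 0 \<le> t \<Longrightarrow> ereal t < Sup I \<Longrightarrow> (x i \<longlongrightarrow> x i t) (at_right t)"
    and ll: "\<And>i t. 0 < t \<Longrightarrow> ereal t \<in> I \<Longrightarrow> \<exists>l. (x i \<longlongrightarrow> l) (at_left t)"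
  shows "make_path x z \<in> cadlag_paths I"
proof -
  let ?w = "make_path x z"
  have "(?w \<longlongrightarrow> ?w t) (at t within I \<inter> {t<..})" if t: "t \<in> I" for t
  proof (cases "t < Sup I")
    case False
    then have "u \<le> t" if "u \<in> I" for u using that in_I_iff[of u] by auto
    then have "I \<inter> {t<..} = {}" by force
    then show ?thesis by simp
  next
    case True
    then obtain s where s: "t = ereal s" "0 \<le> s" using t in_I_iff[of t] by (cases t) auto
    have "((\<lambda>u. \<chi> i. x i u) \<longlongrightarrow> (\<chi> i. x i s)) (at_right s)"
      using rc s True by (intro vec_tendstoI) auto
    moreover have "\<forall>\<^sub>F u in at_right s. (\<chi> i. x i u) = ?w (ereal u)"
    proof -
      have "\<forall>\<^sub>F u in at_right s. ereal u < Sup I"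
        using True s(1) by (intro eventually_less_Sup) simp
      then show ?thesis using eventually_at_right_less[of s]
      proof eventually_elim
        case (elim u)
        then have "ereal u \<in> I" unfolding real_in_I_iff using s(2) by auto
        then show ?case by (simp add: make_path_def)
      qed
    qed
    ultimately have "((\<lambda>u. ?w (ereal u)) \<longlongrightarrow> (\<chi> i. x i s)) (at_right s)"
      by (rule Lim_transform_eventually)
    moreover have "?w t = (\<chi> i. x i s)" using t s by (simp add: make_path_def)
    ultimately have "(?w \<longlongrightarrow> ?w t) (at_right t)"
      unfolding s(1) at_right_ereal filterlim_filtermap by simp
    then show ?thesis by (rule tendsto_within_subset) auto
  qed
  moreover have "\<exists>l. (?w \<longlongrightarrow> l) (at t within I \<inter> {..<t})" if t: "t \<in> I" "t \<noteq> \<infinity>" for t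
  proof (cases "t = 0")
    case True
    moreover have "0 \<le> u" if "u \<in> I" for u using that in_I_iff[of u] by auto
    ultimately have "I \<inter> {..<t} = {}" by force
    then show ?thesis by simp
  next
    case False
    then obtain s where s: "t = ereal s" "0 < s" using t in_I_iff[of t] by (cases t) auto
    have "\<forall>i. \<exists>l. (x i \<longlongrightarrow> l) (at_left s)" using ll s t by blast
    then obtain l where l: "\<And>i. (x i \<longlongrightarrow> l i) (at_left s)" by metis
    then have "((\<lambda>u. \<chi> i. x i u) \<longlongrightarrow> (\<chi> i. l i)) (at_left s)"
      by (intro vec_tendstoI) auto
    moreover have "\<forall>\<^sub>F u in at_left s. (\<chi> i. x i u) = ?w (ereal u)"
    proof -
      have "\<forall>\<^sub>F u in at_left s. u < s" "\<forall>\<^sub>F u in at_left s. 0 < u"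
        using s(2) by (auto simp: eventually_at_left_field intro: exI[of _ "s - 1"])
      then show ?thesis
      proof eventually_elim
        case (elim u)
        then have "ereal u \<in> I" using in_I_mono[of "ereal u" t] s t by auto
        then show ?case by (simp add: make_path_def)
      qed
    qed
    ultimately have "((\<lambda>u. ?w (ereal u)) \<longlongrightarrow> (\<chi> i. l i)) (at_left s)"
      by (rule Lim_transform_eventually)
    then have "(?w \<longlongrightarrow> (\<chi> i. l i)) (at_left t)"
      unfolding s(1) at_left_ereal filterlim_filtermap by simp
    then show ?thesis by (meson tendsto_within_subset inf_le2)
  qed
  ultimately show ?thesis
    unfolding cadlag_paths_def by (auto simp: make_path_def extensional_def)
qed

section \<open>Paths with controlled supremum and oscillations\<close>

definition horizon :: "nat \<Rightarrow> real set" where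
  "horizon r = {t. 0 \<le> t \<and> t < real r + 1 \<and> ereal t \<in> I}"

text \<open>One number \<open>k\<close> bounds three quantities, so that levels are indexed by
  naturals; oscillations are larger than \<open>1 / (m + 1)\<close>. The horizon is open at
  \<open>r + 1\<close>, which leaves room to move times to the right, and it never contains
  infinity, hence the separate bound at \<open>Sup I\<close>.\<close>

definition good :: "'d \<Rightarrow> nat \<Rightarrow> nat \<Rightarrow> nat \<Rightarrow> ('d::finite) path set" where
  "good i r m k = {w \<in> cadlag_paths I. (\<forall>t\<in>horizon r. \<bar>component i w t\<bar> \<le> real k) \<and>
     \<not> oscillates (component i w) (1 / real (Suc m)) (horizon r) k \<and> (Sup I \<in> I \<longrightarrow> \<bar>w (Sup I) $ i\<bar> \<le> real k)}"

lemma good_mono: "k \<le> k' \<Longrightarrow> good i r m k \<subseteq> good i r m k'"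
  unfolding good_def
  by (auto intro: order_trans[of _ "real k" "real k'"] dest: oscillates_mono[where k' = k, OF _ order_refl _ order_refl])

lemma horizon_superset:
  assumes "0 \<le> R" "ereal R \<in> I"
  obtains r where "{0..R} \<subseteq> horizon r"
proof -
  obtain r :: nat where "R < real r" using reals_Archimedean2 by blast
  then have "{0..R} \<subseteq> horizon r"
    using assms in_I_mono[of "ereal _" "ereal R"] by (auto simp: horizon_def)
  then show ?thesis by (rule that)
qed

lemma path_partition:
  fixes w :: "('d::finite) path"
  assumes w: "w \<in> cadlag_paths I" and R: "0 < R" "ereal R \<in> I" and \<epsilon>: "\<epsilon> > 0"
  obtains s :: "nat \<Rightarrow> real" and N where "s 0 = 0" "incseq s" "s N = R"
    "\<And>k t. t \<in> {s k..<s (Suc k)} \<Longrightarrow> \<bar>component i w t - component i w (s k)\<bar> \<le> \<epsilon>"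
proof (rule cadlag_partition[where x = "component i w" and \<epsilon> = \<epsilon>, OF R(1) \<epsilon>])
  show "(component i w \<longlongrightarrow> component i w t) (at_right t)" if "0 \<le> t" "t < R" for t
  proof (rule cadlag_right[OF w that(1)])
    have "ereal t < ereal R" using that(2) by simp
    also have "\<dots> \<le> Sup I" using R(2) real_in_I_iff by blast
    finally show "ereal t < Sup I" .
  qed
  show "\<exists>l. (component i w \<longlongrightarrow> l) (at_left t)" if "0 < t" "t \<le> R" for t
    using that R in_I_mono[of "ereal t" "ereal R"] by (intro cadlag_left[OF w]) auto
qed (rule that)

lemma path_not_oscillates:
  fixes w :: "('d::finite) path"
  assumes w: "w \<in> cadlag_paths I" and R: "0 < R" "ereal R \<in> I" and \<epsilon>: "\<epsilon> > 0"
  shows "\<exists>N. \<not> oscillates (component i w) \<epsilon> {0..R} N"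
proof -
  obtain s :: "nat \<Rightarrow> real" and N where s: "s 0 = 0" "incseq s" "s N = R"
    "\<And>k t. t \<in> {s k..<s (Suc k)} \<Longrightarrow> \<bar>component i w t - component i w (s k)\<bar> \<le> \<epsilon> / 2"
    using path_partition[OF w R, of "\<epsilon> / 2" i] \<epsilon> by (metis half_gt_zero)
  have "\<not> oscillates (component i w) (2 * (\<epsilon> / 2)) {0..R} (Suc N)"
    using \<epsilon> s(4) by (intro partition_not_oscillates[OF s(1,2,3)]) auto
  then show ?thesis by auto
qed

lemma path_bounded:
  fixes w :: "('d::finite) path"
  assumes w: "w \<in> cadlag_paths I" and R: "0 < R" "ereal R \<in> I"
  shows "\<exists>C. \<forall>t\<in>{0..R}. \<bar>component i w t\<bar> \<le> C"
proof -
  obtain s :: "nat \<Rightarrow> real" and N where s: "s 0 = 0" "incseq s" "s N = R"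
    "\<And>k t. t \<in> {s k..<s (Suc k)} \<Longrightarrow> \<bar>component i w t - component i w (s k)\<bar> \<le> 1"
    by (rule path_partition[where i = i, OF w R zero_less_one]) (rule that)
  define C where "C = Max ((\<lambda>k. \<bar>component i w (s k)\<bar>) ` {..N}) + 1"
  have C: "\<bar>component i w (s k)\<bar> + 1 \<le> C" if "k \<le> N" for k
    unfolding C_def using that by (auto intro!: Max_ge)
  have "\<bar>component i w t\<bar> \<le> C" if t: "t \<in> {0..R}" for t
  proof -
    let ?A = "{k. k \<le> N \<and> s k \<le> t}"
    have fin: "finite ?A" "?A \<noteq> {}" using s(1) t by auto
    define k where "k = Max ?A"
    have k: "k \<le> N" "s k \<le> t" using Max_in[OF fin] unfolding k_def by auto
    show ?thesis
    proof (cases "k = N")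
      case True
      then have "t = s k" using k(2) s(3) t by simp
      then show ?thesis using C[OF k(1)] by simp
    next
      case False
      have "\<not> s (Suc k) \<le> t"
      proof
        assume "s (Suc k) \<le> t"
        then have "Suc k \<le> k" unfolding k_def using False k(1) fin(1) by (intro Max_ge) (auto simp: k_def)
        then show False by simp
      qed
      then have "\<bar>component i w t - component i w (s k)\<bar> \<le> 1" using k(2) by (intro s(4)) auto
      then show ?thesis using C[OF k(1)] by linarith
    qed
  qed
  then show ?thesis by blast
qed

lemma horizon_subset:
  obtains R where "0 < R" "ereal R \<in> I" "horizon r \<subseteq> {0..R}"
proof (cases "Sup I")
  case (real T)
  then have "0 < T" "ereal T \<in> I" using Sup_pos real_in_I_iff[of T] by auto
  moreover have "horizon r \<subseteq> {0..T}" using real by (auto simp: horizon_def real_in_I_iff)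
  ultimately show ?thesis by (rule that)
next
  case PInf
  show ?thesis by (rule that[of "real r + 1"]) (auto simp: horizon_def real_in_I_iff PInf)
qed (use Sup_pos in auto)

lemma good_exhausts:
  fixes w :: "('d::finite) path"
  assumes w: "w \<in> cadlag_paths I"
  shows "\<exists>k. w \<in> good i r m k"
proof -
  obtain R where R: "0 < R" "ereal R \<in> I" "horizon r \<subseteq> {0..R}" by (rule horizon_subset)
  obtain C where C: "\<forall>t\<in>{0..R}. \<bar>component i w t\<bar> \<le> C" using path_bounded[OF w R(1,2)] by blast
  obtain N where N: "\<not> oscillates (component i w) (1 / real (Suc m)) {0..R} N"
    using path_not_oscillates[OF w R(1,2), of "1 / real (Suc m)"] by auto
  obtain k1 :: nat where k1: "C \<le> real k1" using real_arch_simple by blast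
  obtain k2 :: nat where k2: "\<bar>w (Sup I) $ i\<bar> \<le> real k2" using real_arch_simple by blast
  define k where "k = max N (max k1 k2)"
  have "\<not> oscillates (component i w) (1 / real (Suc m)) (horizon r) k"
    using N oscillates_mono[OF _ R(3), where k' = N and \<epsilon>' = "1 / real (Suc m)"] by (auto simp: k_def)
  moreover have "\<bar>component i w t\<bar> \<le> real k" if "t \<in> horizon r" for t
  proof -
    have "\<bar>component i w t\<bar> \<le> C" using C R(3) that by blast
    also have "\<dots> \<le> real k" using k1 by (simp add: k_def)
    finally show ?thesis .
  qed
  moreover have "\<bar>w (Sup I) $ i\<bar> \<le> real k" using k2 by (simp add: k_def)
  ultimately show ?thesis using w by (auto simp: good_def)
qed

text \<open>If \<open>I\<close> is bounded, one horizon reaching the endpoint is repeated for every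
  \<open>j\<close>; otherwise the horizons exhaust the half-line.\<close>

definition terminal_horizon :: "nat \<Rightarrow> real" where
  "terminal_horizon j = (if Sup I = \<infinity> then real j + 1 else real_of_ereal (Sup I))"

lemma terminal_horizon: "0 < terminal_horizon j" "ereal (terminal_horizon j) \<in> I"
proof -
  have "0 < terminal_horizon j \<and> ereal (terminal_horizon j) \<in> I"
  proof (cases "Sup I")
    case (real T)
    then have "0 < T" using Sup_pos by simp
    then show ?thesis using real by (simp add: terminal_horizon_def real_in_I_iff)
  next
    case PInf
    then show ?thesis by (simp add: terminal_horizon_def real_in_I_iff)
  qed (use Sup_pos in simp)
  then show "0 < terminal_horizon j" "ereal (terminal_horizon j) \<in> I" by auto
qed

lemma less_terminal_horizon:
  assumes "ereal t \<in> I"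
  shows "t < terminal_horizon (nat \<lfloor>t\<rfloor>) \<or> t = terminal_horizon (nat \<lfloor>t\<rfloor>) \<and> Sup I \<noteq> \<infinity>"
proof (cases "Sup I")
  case (real T)
  then have "t \<le> T" using assms by (simp add: real_in_I_iff)
  then show ?thesis using real by (auto simp: terminal_horizon_def)
next
  case PInf
  have "0 \<le> t" using assms by (simp add: real_in_I_iff)
  then have "t < real (nat \<lfloor>t\<rfloor>) + 1" by linarith
  then show ?thesis using PInf by (simp add: terminal_horizon_def)
qed (use Sup_pos in simp)

lemma path_right_below:
  assumes "w \<in> cadlag_paths I" "ereal R \<in> I" "0 \<le> t" "t < R"
  shows "(component i w \<longlongrightarrow> component i w t) (at_right t)"
proof (rule cadlag_right[OF assms(1,3)])
  have "ereal t < ereal R" using assms(4) by simp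
  also have "\<dots> \<le> Sup I" using assms(2) unfolding real_in_I_iff by blast
  finally show "ereal t < Sup I" .
qed

section \<open>Sequential compactness of the controlled sets\<close>

lemma good_bounds:
  fixes s :: "nat \<Rightarrow> ('d::finite) path"
  assumes good: "\<And>i r m. \<exists>k. \<forall>n. s n \<in> good i r m k" and R: "0 < R" "ereal R \<in> I"
  shows "\<exists>C. \<forall>n. \<forall>t\<in>{0..R}. \<bar>component i (s n) t\<bar> \<le> C"
    and "\<epsilon> > 0 \<Longrightarrow> \<exists>N. \<forall>n. \<not> oscillates (component i (s n)) \<epsilon> {0..R} N"
proof -
  obtain r where r: "{0..R} \<subseteq> horizon r" using horizon_superset[OF less_imp_le[OF R(1)] R(2)] by blast
  obtain k where k: "\<forall>n. s n \<in> good i r 0 k" using good by blast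
  then have "\<bar>component i (s n) t\<bar> \<le> real k" if "t \<in> {0..R}" for n t
    using that r unfolding good_def by blast
  then show "\<exists>C. \<forall>n. \<forall>t\<in>{0..R}. \<bar>component i (s n) t\<bar> \<le> C" by blast
  assume "\<epsilon> > 0"
  then obtain m :: nat where m: "1 / real (Suc m) < \<epsilon>" using nat_approx_posE by blast
  obtain k where k: "\<forall>n. s n \<in> good i r m k" using good by blast
  have "\<not> oscillates (component i (s n)) \<epsilon> {0..R} k" for n
  proof
    assume "oscillates (component i (s n)) \<epsilon> {0..R} k"
    then have "oscillates (component i (s n)) (1 / real (Suc m)) (horizon r) k"
      by (rule oscillates_mono[OF _ r order_refl]) (use m in simp)
    then show False using k unfolding good_def by blast
  qed
  then show "\<exists>N. \<forall>n. \<not> oscillates (component i (s n)) \<epsilon> {0..R} N" by blast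
qed

text \<open>The exceptional set must avoid the terminal time, and the terminal value is asked for
  separately to cover infinity, which is no real time.\<close>

definition pointwise_limit :: "(nat \<Rightarrow> ('d::finite) path) \<Rightarrow> 'd path \<Rightarrow> real set \<Rightarrow> bool" where
  "pointwise_limit s w B \<longleftrightarrow> countable B \<and> (\<forall>t\<in>B. ereal t \<noteq> Sup I) \<and>
     (\<forall>i t. ereal t \<in> I \<longrightarrow> t \<notin> B \<longrightarrow> (\<lambda>n. component i (s n) t) \<longlonglongrightarrow> component i w t) \<and>
     (Sup I \<in> I \<longrightarrow> (\<lambda>n. s n (Sup I)) \<longlonglongrightarrow> w (Sup I))"

text \<open>One diagonal argument performs the Helly selection for all coordinates and horizons and
  makes the terminal values converge. The limits on different horizons agree off a countable set,
  hence, by right-continuity, everywhere below both ends, and can be glued.\<close>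

lemma pointwise_selection:
  fixes s :: "nat \<Rightarrow> ('d::finite) path"
  assumes s: "\<And>n. s n \<in> cadlag_paths I" and good: "\<And>i r m. \<exists>k. \<forall>n. s n \<in> good i r m k"
  obtains w q B where "w \<in> cadlag_paths I" "strict_mono q" "pointwise_limit (s \<circ> q) w B"
proof -
  \<comment> \<open>Every clause survives passage to subsequences and depends on the tail of
    \<open>f\<close> only, as the diagonal argument requires.\<close>
  define L where "L i j f x B \<longleftrightarrow> countable B \<and> terminal_horizon j \<notin> B \<and>
      (\<forall>t\<in>{0..terminal_horizon j} - B. (\<lambda>n. component i (s (f n)) t) \<longlonglongrightarrow> x t) \<and>
      (\<forall>t. 0 \<le> t \<longrightarrow> t < terminal_horizon j \<longrightarrow> (x \<longlongrightarrow> x t) (at_right t)) \<and>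
      (\<forall>t. 0 < t \<longrightarrow> t \<le> terminal_horizon j \<longrightarrow> (\<exists>l. (x \<longlongrightarrow> l) (at_left t)))"
    for i j and f :: "nat \<Rightarrow> nat" and x :: "real \<Rightarrow> real" and B
  define P where "P p f \<longleftrightarrow> (case from_nat p of (i, j) \<Rightarrow> (\<exists>x B. L i j f x B) \<and>
      (Sup I \<in> I \<longrightarrow> convergent (\<lambda>n. s (f n) (Sup I) $ i)))" for p and f :: "nat \<Rightarrow> nat"
  obtain q where q: "strict_mono q" and Pq: "\<And>p. P p q"
  proof (rule diagonal_subsequence[of P])
    fix p and f :: "nat \<Rightarrow> nat" assume "strict_mono f"
    obtain i j where ij: "from_nat p = (i :: 'd, j :: nat)" by (cases "from_nat p :: 'd \<times> nat")
    let ?R = "terminal_horizon j"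
    note R = terminal_horizon[of j]
    obtain C where C: "\<forall>n. \<forall>t\<in>{0..?R}. \<bar>component i (s n) t\<bar> \<le> C" using good_bounds(1)[OF good R] by blast
    obtain g x B where g: "strict_mono g" "countable B" "?R \<notin> B"
      "\<And>t. 0 \<le> t \<Longrightarrow> t \<le> ?R \<Longrightarrow> t \<notin> B \<Longrightarrow> (\<lambda>n. component i (s (f (g n))) t) \<longlonglongrightarrow> x t"
      "\<And>t. 0 \<le> t \<Longrightarrow> t < ?R \<Longrightarrow> (x \<longlongrightarrow> x t) (at_right t)"
      "\<And>t. 0 < t \<Longrightarrow> t \<le> ?R \<Longrightarrow> \<exists>l. (x \<longlongrightarrow> l) (at_left t)"
    proof (rule S_conv_real_selection[of ?R "\<lambda>n. component i (s (f n))" C, OF R(1)])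
      show "(component i (s (f n)) \<longlongrightarrow> component i (s (f n)) t) (at_right t)" if "0 \<le> t" "t < ?R" for n t
        using path_right_below[OF s R(2) that] .
      show "\<bar>component i (s (f n)) t\<bar> \<le> C" if "0 \<le> t" "t \<le> ?R" for n t using C that by simp
      show "\<exists>N. \<forall>n. \<not> oscillates (component i (s (f n))) \<epsilon> {0..?R} N" if "\<epsilon> > 0" for \<epsilon>
        using good_bounds(2)[OF good R that, of i] by blast
    qed (rule that)
    have L1: "L i j (f \<circ> g) x B" unfolding L_def using g(2-6) by simp
    have "\<exists>h. strict_mono h \<and> (Sup I \<in> I \<longrightarrow> convergent (\<lambda>n. s (f (g (h n))) (Sup I) $ i))"
    proof (cases "Sup I \<in> I")
      case True
      obtain k where "\<forall>n. s n \<in> good i 0 0 k" using good by blast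
      then have "\<bar>s n (Sup I) $ i\<bar> \<le> real k" for n using True unfolding good_def by blast
      then have "bounded (range (\<lambda>n. s (f (g n)) (Sup I) $ i))" by (intro boundedI[of _ "real k"]) auto
      then obtain l h where "strict_mono (h::nat \<Rightarrow> nat)" "((\<lambda>n. s (f (g n)) (Sup I) $ i) \<circ> h) \<longlonglongrightarrow> l"
        using bounded_imp_convergent_subsequence by blast
      then show ?thesis by (auto simp: o_def convergent_def)
    qed (auto simp: strict_mono_def)
    then obtain h where h: "strict_mono h" "Sup I \<in> I \<longrightarrow> convergent (\<lambda>n. s (f (g (h n))) (Sup I) $ i)" by blast
    have "L i j (f \<circ> (g \<circ> h)) x B"
      unfolding L_def
    proof (intro conjI ballI)
      fix t assume "t \<in> {0..?R} - B"
      then have "(\<lambda>n. component i (s ((f \<circ> g) n)) t) \<longlonglongrightarrow> x t" using L1 unfolding L_def by blast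
      from LIMSEQ_subseq_LIMSEQ[OF this h(1)]
      show "(\<lambda>n. component i (s ((f \<circ> (g \<circ> h)) n)) t) \<longlonglongrightarrow> x t" by (simp add: o_def)
    qed (use L1 in \<open>simp_all add: L_def\<close>)
    then have "P p (f \<circ> (g \<circ> h))" unfolding P_def ij using h(2) by auto
    moreover have "strict_mono (g \<circ> h)" using g(1) h(1) by (rule strict_mono_o)
    ultimately show "\<exists>r. strict_mono r \<and> P p (f \<circ> r)" by blast
  next
    fix p and f g :: "nat \<Rightarrow> nat" assume g: "strict_mono g" and P: "P p f"
    obtain i j where ij: "from_nat p = (i :: 'd, j :: nat)" by (cases "from_nat p :: 'd \<times> nat")
    obtain x B where L: "L i j f x B" using P unfolding P_def ij by auto
    have "L i j (f \<circ> g) x B"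
      unfolding L_def
    proof (intro conjI ballI)
      fix t assume "t \<in> {0..terminal_horizon j} - B"
      then have "(\<lambda>n. component i (s (f n)) t) \<longlonglongrightarrow> x t" using L unfolding L_def by blast
      from LIMSEQ_subseq_LIMSEQ[OF this g]
      show "(\<lambda>n. component i (s ((f \<circ> g) n)) t) \<longlonglongrightarrow> x t" by (simp add: o_def)
    qed (use L in \<open>simp_all add: L_def\<close>)
    moreover have "Sup I \<in> I \<longrightarrow> convergent (\<lambda>n. s ((f \<circ> g) n) (Sup I) $ i)"
      using P convergent_subseq_convergent[OF _ g, of "\<lambda>n. s (f n) (Sup I) $ i"] unfolding P_def ij by (auto simp: o_def)
    ultimately show "P p (f \<circ> g)" unfolding P_def ij by auto
  next
    fix p and f :: "nat \<Rightarrow> nat" and k assume P: "P p (f \<circ> (+) k)"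
    obtain i j where ij: "from_nat p = (i :: 'd, j :: nat)" by (cases "from_nat p :: 'd \<times> nat")
    obtain x B where L: "L i j (f \<circ> (+) k) x B" using P unfolding P_def ij by auto
    have "L i j f x B"
      unfolding L_def
    proof (intro conjI ballI)
      fix t assume "t \<in> {0..terminal_horizon j} - B"
      then have "(\<lambda>n. component i (s ((f \<circ> (+) k) n)) t) \<longlonglongrightarrow> x t" using L unfolding L_def by blast
      then show "(\<lambda>n. component i (s (f n)) t) \<longlonglongrightarrow> x t"
        using LIMSEQ_offset[of "\<lambda>n. component i (s (f n)) t" k] by (simp add: o_def add.commute)
    qed (use L in \<open>simp_all add: L_def\<close>)
    moreover have "Sup I \<in> I \<longrightarrow> convergent (\<lambda>n. s (f n) (Sup I) $ i)"
      using P convergent_ignore_initial_segment[of "\<lambda>n. s (f n) (Sup I) $ i" k]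
      unfolding P_def ij by (auto simp: o_def add.commute)
    ultimately show "P p f" unfolding P_def ij by auto
  qed (rule that)
  have Lq: "\<exists>x B. L i j q x B" and Tq: "Sup I \<in> I \<longrightarrow> convergent (\<lambda>n. s (q n) (Sup I) $ i)" for i j
    using Pq[of "to_nat (i, j)"] unfolding P_def by auto
  have "\<exists>x0 B0. \<forall>i j. L i j q (x0 i j) (B0 i j)" using Lq by metis
  then obtain x0 :: "'d \<Rightarrow> nat \<Rightarrow> real \<Rightarrow> real" and B0 where L0: "\<And>i j. L i j q (x0 i j) (B0 i j)" by blast
  have lim0: "(\<lambda>n. component i (s (q n)) t) \<longlonglongrightarrow> x0 i j t" if "0 \<le> t" "t \<le> terminal_horizon j" "t \<notin> B0 i j" for i j t
    using L0[of i j] that unfolding L_def by auto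
  have rc0: "(x0 i j \<longlongrightarrow> x0 i j t) (at_right t)" if "0 \<le> t" "t < terminal_horizon j" for i j t
    using L0[of i j] that unfolding L_def by auto
  have ll0: "\<exists>l. (x0 i j \<longlongrightarrow> l) (at_left t)" if "0 < t" "t \<le> terminal_horizon j" for i j t
    using L0[of i j] that unfolding L_def by auto
  have B0: "countable (B0 i j)" "terminal_horizon j \<notin> B0 i j" for i j
    using L0[of i j] unfolding L_def by auto
  have consistent: "x0 i j t = x0 i j' t" if t: "0 \<le> t" "t < min (terminal_horizon j) (terminal_horizon j')" for i j j' t
  proof (rule eq_of_eq_off_countable[where x = "x0 i j" and y = "x0 i j'" and t = t])
    show "countable (B0 i j \<union> B0 i j')" using B0 by simp
    show "t < min (terminal_horizon j) (terminal_horizon j')" by (rule t(2))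
    show "(x0 i j \<longlongrightarrow> x0 i j t) (at_right t)" "(x0 i j' \<longlongrightarrow> x0 i j' t) (at_right t)"
      using t by (auto intro: rc0)
    fix u assume "t < u" "u < min (terminal_horizon j) (terminal_horizon j')" "u \<notin> B0 i j \<union> B0 i j'"
    then show "x0 i j u = x0 i j' u"
      using t by (intro LIMSEQ_unique[OF lim0 lim0]) auto
  qed
  \<comment> \<open>For unbounded \<open>I\<close> the horizon with index
    \<open>nat \<lfloor>t\<rfloor>\<close> ends strictly after \<open>t\<close>; for bounded
    \<open>I\<close> all horizons coincide.\<close>
  define x where "x i t = x0 i (nat \<lfloor>t\<rfloor>) t" for i t
  have x_eq: "x i t = x0 i j t"
    if t: "ereal t \<in> I" "t < terminal_horizon j \<or> t = terminal_horizon j \<and> Sup I \<noteq> \<infinity>" for i j t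
  proof (cases "Sup I = \<infinity>")
    case True
    have "0 \<le> t" using t(1) by (simp add: real_in_I_iff)
    then show ?thesis
      unfolding x_def using t less_terminal_horizon[OF t(1)] True by (intro consistent) auto
  next
    case False
    then have same: "terminal_horizon j' = terminal_horizon j" for j' by (simp add: terminal_horizon_def)
    have t0: "0 \<le> t" using t(1) by (simp add: real_in_I_iff)
    show ?thesis
    proof (cases "t < terminal_horizon j")
      case True
      then show ?thesis unfolding x_def using t0 same[of "nat \<lfloor>t\<rfloor>"] by (intro consistent) simp_all
    next
      case False
      then have eq: "t = terminal_horizon j" using t(2) by simp
      then have "t \<notin> B0 i j" "t \<notin> B0 i (nat \<lfloor>t\<rfloor>)"
        using B0(2)[of j i] B0(2)[of "nat \<lfloor>t\<rfloor>" i] unfolding same[of "nat \<lfloor>t\<rfloor>"] by blast+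
      then show ?thesis
        unfolding x_def using t0 eq same[of "nat \<lfloor>t\<rfloor>"] by (intro LIMSEQ_unique[OF lim0 lim0]) auto
    qed
  qed
  have below: "\<exists>j. ereal t < Sup I \<longrightarrow> t < terminal_horizon j" for t
  proof (cases "Sup I")
    case (real T)
    then show ?thesis by (auto simp: terminal_horizon_def)
  next
    case PInf
    obtain j :: nat where "t < real j" using reals_Archimedean2 by blast
    then show ?thesis using PInf by (intro exI[of _ j]) (simp add: terminal_horizon_def)
  qed (use Sup_pos in simp)
  define z where "z = (\<chi> i. lim (\<lambda>n. s (q n) (Sup I) $ i))"
  define w where "w = make_path x z"
  have wD: "w \<in> cadlag_paths I"
    unfolding w_def
  proof (rule make_path_cadlag)
    fix i t assume t: "0 \<le> t" "ereal t < Sup I"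
    then obtain j where j: "t < terminal_horizon j" using below by blast
    have "\<forall>\<^sub>F u in at_right t. x0 i j u = x i u"
    proof -
      have "\<forall>\<^sub>F u in at_right t. u < terminal_horizon j" using j by (auto simp: eventually_at_right_field)
      with eventually_at_right_less[of t] eventually_less_Sup[OF t(2)] show ?thesis
      proof eventually_elim
        case (elim u)
        then have "ereal u \<in> I" using t(1) by (simp add: real_in_I_iff)
        then show ?case using x_eq[of u j i] elim by simp
      qed
    qed
    moreover have "x i t = x0 i j t" using t j by (intro x_eq) (auto simp: real_in_I_iff)
    ultimately show "(x i \<longlongrightarrow> x i t) (at_right t)"
      using rc0[OF t(1) j, of i] by (auto intro: Lim_transform_eventually)
  next
    fix i t assume t: "0 < t" "ereal t \<in> I"
    define j where "j = nat \<lfloor>t\<rfloor>"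
    have j: "t \<le> terminal_horizon j" using less_terminal_horizon[OF t(2)] by (auto simp: j_def)
    have "\<forall>\<^sub>F u in at_left t. u < t" "\<forall>\<^sub>F u in at_left t. 0 < u"
      using t(1) by (auto simp: eventually_at_left_field intro: exI[of _ "t - 1"])
    then have "\<forall>\<^sub>F u in at_left t. x0 i j u = x i u"
    proof eventually_elim
      case (elim u)
      then have "ereal u \<in> I" using in_I_mono[OF _ _ t(2), of "ereal u"] by simp
      then show ?case using x_eq[of u j i] elim j by simp
    qed
    then show "\<exists>l. (x i \<longlongrightarrow> l) (at_left t)"
      using ll0[OF t(1) j, of i] by (auto intro: Lim_transform_eventually)
  qed
  \<comment> \<open>Removing the terminal time from the exceptional set is harmless: when it is a
    real number it is the end of each horizon, and no \<open>B0 i j\<close> contains the end of its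
    horizon.\<close>
  define B where "B = {t \<in> \<Union>i. \<Union>j. B0 i j. ereal t \<noteq> Sup I}"
  have lim: "(\<lambda>n. component i (s (q n)) t) \<longlonglongrightarrow> component i w t" if t: "ereal t \<in> I" "t \<notin> B" for i t
  proof -
    define j where "j = nat \<lfloor>t\<rfloor>"
    have j: "t < terminal_horizon j \<or> t = terminal_horizon j \<and> Sup I \<noteq> \<infinity>"
      using less_terminal_horizon[OF t(1)] by (simp add: j_def)
    have "t \<notin> B0 i j"
    proof (cases "ereal t = Sup I")
      case True
      then have "terminal_horizon j = t" by (auto simp: terminal_horizon_def simp flip: True)
      then show ?thesis using B0(2)[of j i] by simp
    next
      case False
      then show ?thesis using t(2) by (auto simp: B_def)
    qed
    moreover have "0 \<le> t" using t(1) by (simp add: real_in_I_iff)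
    ultimately have "(\<lambda>n. component i (s (q n)) t) \<longlonglongrightarrow> x0 i j t" using j by (intro lim0) auto
    moreover have "component i w t = x0 i j t"
      using x_eq[OF t(1) j] component_make_path[OF t(1), of i x z] by (simp add: w_def)
    ultimately show ?thesis by simp
  qed
  have "(\<lambda>n. s (q n) (Sup I)) \<longlonglongrightarrow> w (Sup I)" if SI: "Sup I \<in> I"
  proof (rule vec_tendstoI)
    fix i
    show "(\<lambda>n. s (q n) (Sup I) $ i) \<longlonglongrightarrow> w (Sup I) $ i"
    proof (cases "Sup I")
      case (real T)
      then have "T \<notin> B" by (simp add: B_def)
      then show ?thesis using lim[of T i] SI real by (simp add: component_def)
    next
      case PInf
      then have "w (Sup I) = z" using SI make_path_infinity[of x z] by (simp add: w_def)
      then show ?thesis using Tq[of i] SI by (simp add: z_def convergent_LIMSEQ_iff)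
    qed (use Sup_pos in simp)
  qed
  moreover have "countable B"
    by (rule countable_subset[of _ "\<Union>i. \<Union>j. B0 i j"]) (auto simp: B_def B0)
  ultimately have "pointwise_limit (s \<circ> q) w B"
    unfolding pointwise_limit_def using lim by (auto simp: B_def)
  with wD q show ?thesis by (rule that)
qed

text \<open>The ends \<open>R j\<close> must avoid \<open>B\<close>, because S-convergence on
  \<open>[0, R]\<close> includes convergence at \<open>R\<close>. A further diagonal argument serves
  all coordinates and all ends with one subsequence.\<close>

lemma S_conv_of_pointwise_limit:
  fixes s :: "nat \<Rightarrow> ('d::finite) path" and R :: "nat \<Rightarrow> real"
  assumes s: "\<And>n. s n \<in> cadlag_paths I" and good: "\<And>i r m. \<exists>k. \<forall>n. s n \<in> good i r m k"
    and w: "w \<in> cadlag_paths I" and lim: "pointwise_limit s w B"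
    and R: "\<And>j. 0 < R j" "\<And>j. ereal (R j) \<in> I" "\<And>j. R j \<notin> B"
  obtains q where "strict_mono q" "\<And>i j. S_conv_real (R j) (\<lambda>n. component i (s (q n))) (component i w)"
proof -
  define P where "P p f \<longleftrightarrow> (case from_nat p of (i :: 'd, j :: nat) \<Rightarrow> S_conv_real (R j) (\<lambda>n. component i (s (f n))) (component i w))"
    for p and f :: "nat \<Rightarrow> nat"
  obtain q where q: "strict_mono q" and Pq: "\<And>p. P p q"
  proof (rule diagonal_subsequence[of P])
    fix p and f :: "nat \<Rightarrow> nat" assume f: "strict_mono f"
    obtain i j where ij: "from_nat p = (i :: 'd, j :: nat)" by (cases "from_nat p :: 'd \<times> nat")
    obtain C where C: "\<forall>n. \<forall>t\<in>{0..R j}. \<bar>component i (s n) t\<bar> \<le> C" using good_bounds(1)[OF good R(1,2)] by blast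
    have "\<exists>q. strict_mono q \<and> S_conv_real (R j) ((\<lambda>n. component i (s (f n))) \<circ> q) (component i w)"
    proof (rule S_conv_real_of_pointwise[of "R j" _ C B])
      show "(component i (s (f n)) \<longlongrightarrow> component i (s (f n)) t) (at_right t)" if "0 \<le> t" "t < R j" for n t
        using path_right_below[OF s R(2) that] .
      show "(component i w \<longlongrightarrow> component i w t) (at_right t)" if "0 \<le> t" "t < R j" for t
        using path_right_below[OF w R(2) that] .
      show "\<bar>component i (s (f n)) t\<bar> \<le> C" if "0 \<le> t" "t \<le> R j" for n t using C that by simp
      show "\<exists>N. \<forall>n. \<not> oscillates (component i (s (f n))) \<epsilon> {0..R j} N" if "\<epsilon> > 0" for \<epsilon>
        using good_bounds(2)[OF good R(1,2) that, of i] by blast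
      show "countable B" using lim by (simp add: pointwise_limit_def)
      show "(\<lambda>n. component i (s (f n)) t) \<longlonglongrightarrow> component i w t" if "0 \<le> t" "t \<le> R j" "t \<notin> B" for t
      proof -
        have "ereal t \<in> I" using that R(2) in_I_mono[of "ereal t" "ereal (R j)"] by simp
        then have "(\<lambda>n. component i (s n) t) \<longlonglongrightarrow> component i w t"
          using lim that(3) unfolding pointwise_limit_def by blast
        from LIMSEQ_subseq_LIMSEQ[OF this f] show ?thesis by (simp add: o_def)
      qed
    qed (use R in auto)
    then show "\<exists>r. strict_mono r \<and> P p (f \<circ> r)" unfolding P_def ij by (simp add: o_def)
  next
    fix p and f g :: "nat \<Rightarrow> nat" assume g: "strict_mono g" and P: "P p f"
    obtain i j where ij: "from_nat p = (i :: 'd, j :: nat)" by (cases "from_nat p :: 'd \<times> nat")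
    have "S_conv_real (R j) (\<lambda>n. component i (s (f n))) (component i w)" using P unfolding P_def ij by simp
    from S_conv_real_subseq[OF this g] show "P p (f \<circ> g)" unfolding P_def ij by (simp add: o_def)
  next
    fix p and f :: "nat \<Rightarrow> nat" and k assume P: "P p (f \<circ> (+) k)"
    obtain i j where ij: "from_nat p = (i :: 'd, j :: nat)" by (cases "from_nat p :: 'd \<times> nat")
    have "S_conv_real (R j) (\<lambda>n. component i (s (f (k + n)))) (component i w)" using P unfolding P_def ij by simp
    then have "S_conv_real (R j) (\<lambda>n. component i (s (f n))) (component i w)"
    proof (rule S_conv_real_tail[where x = "\<lambda>n. component i (s (f n))", OF _ R(1)])
      show "(component i (s (f n)) \<longlongrightarrow> component i (s (f n)) t) (at_right t)" if "0 \<le> t" "t < R j" for n t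
        using path_right_below[OF s R(2) that] .
      show "\<exists>N. \<not> oscillates (component i (s (f n))) \<epsilon> {0..R j} N" if "\<epsilon> > 0" for n \<epsilon>
        using path_not_oscillates[OF s R(1,2) that] .
    qed
    then show "P p f" unfolding P_def ij by simp
  qed (rule that)
  show ?thesis
  proof (rule that[OF q])
    show "S_conv_real (R j) (\<lambda>n. component i (s (q n))) (component i w)" for i j
      using Pq[of "to_nat (i, j)"] unfolding P_def by simp
  qed
qed

lemma pointwise_limit_subseq:
  assumes "pointwise_limit s w B" "strict_mono q"
  shows "pointwise_limit (s \<circ> q) w B"
  unfolding pointwise_limit_def
proof (intro conjI allI impI)
  fix i t assume "ereal t \<in> I" "t \<notin> B"
  then have "(\<lambda>n. component i (s n) t) \<longlonglongrightarrow> component i w t" using assms(1) unfolding pointwise_limit_def by blast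
  from LIMSEQ_subseq_LIMSEQ[OF this assms(2)]
  show "(\<lambda>n. component i ((s \<circ> q) n) t) \<longlonglongrightarrow> component i w t" by (simp add: o_def)
next
  assume "Sup I \<in> I"
  then have "(\<lambda>n. s n (Sup I)) \<longlonglongrightarrow> w (Sup I)" using assms(1) unfolding pointwise_limit_def by blast
  from LIMSEQ_subseq_LIMSEQ[OF this assms(2)]
  show "(\<lambda>n. (s \<circ> q) n (Sup I)) \<longlonglongrightarrow> w (Sup I)" by (simp add: o_def)
qed (use assms(1) in \<open>simp_all add: pointwise_limit_def\<close>)

text \<open>The bounds are closed conditions and an oscillation is an open one, so both can be
  compared with the sequence at times outside \<open>B\<close>; other times are approached from the
  right through times outside \<open>B\<close>.\<close>

lemma real_limit_in_good:
  fixes s :: "nat \<Rightarrow> ('d::finite) path"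
  assumes s: "\<And>n. s n \<in> good i r m k" and w: "w \<in> cadlag_paths I" and lim: "pointwise_limit s w B"
  shows "w \<in> good i r m k"
proof -
  let ?\<epsilon> = "1 / real (Suc m)"
  have B: "countable B" "\<And>t. t \<in> B \<Longrightarrow> ereal t \<noteq> Sup I"
    and limt: "\<And>t. ereal t \<in> I \<Longrightarrow> t \<notin> B \<Longrightarrow> (\<lambda>n. component i (s n) t) \<longlonglongrightarrow> component i w t"
    and limS: "Sup I \<in> I \<Longrightarrow> (\<lambda>n. s n (Sup I)) \<longlonglongrightarrow> w (Sup I)"
    using lim unfolding pointwise_limit_def by auto
  have right: "\<exists>b>t. \<forall>u. t < u \<longrightarrow> u < b \<longrightarrow> u \<in> horizon r" if t: "t \<in> horizon r" "ereal t < Sup I" for t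
  proof -
    have "\<forall>\<^sub>F u in at_right t. u < real r + 1" using t(1) by (auto simp: eventually_at_right_field horizon_def)
    with eventually_less_Sup[OF t(2)] eventually_at_right_less[of t]
    have "\<forall>\<^sub>F u in at_right t. u \<in> horizon r"
    proof eventually_elim
      case (elim u)
      then show ?case using t(1) by (auto simp: horizon_def real_in_I_iff)
    qed
    then show ?thesis by (simp add: eventually_at_right_field)
  qed
  have rc: "(component i w \<longlongrightarrow> component i w t) (at_right t)" if "t \<in> horizon r" "ereal t < Sup I" for t
    using that by (intro cadlag_right[OF w]) (auto simp: horizon_def)
  have last: "ereal t = Sup I" if "t \<in> horizon r" "\<not> ereal t < Sup I" for t
    using that by (auto simp: horizon_def real_in_I_iff)
  have "\<bar>component i w t\<bar> \<le> real k" if t: "t \<in> horizon r" for t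
  proof -
    have off: "\<bar>component i w u\<bar> \<le> real k" if "u \<in> horizon r" "u \<notin> B" for u
    proof (rule LIMSEQ_le_const2)
      show "(\<lambda>n. \<bar>component i (s n) u\<bar>) \<longlonglongrightarrow> \<bar>component i w u\<bar>"
        using that by (intro tendsto_rabs limt) (auto simp: horizon_def)
      show "\<exists>N. \<forall>n\<ge>N. \<bar>component i (s n) u\<bar> \<le> real k" using s that(1) unfolding good_def by blast
    qed
    show ?thesis
    proof (cases "ereal t < Sup I")
      case True
      obtain b where b: "b > t" "\<And>u. t < u \<Longrightarrow> u < b \<Longrightarrow> u \<in> horizon r" using right[OF t True] by blast
      obtain u where u: "u \<longlonglongrightarrow> t" "\<And>n. t < u n" "\<And>n. u n < b" "\<And>n. u n \<notin> B"
        using exists_right_sequence_off_countable[OF B(1) b(1)] by blast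
      have "(\<lambda>n. \<bar>component i w (u n)\<bar>) \<longlonglongrightarrow> \<bar>component i w t\<bar>"
        by (intro tendsto_rabs right_sequence_tendsto[OF rc[OF t True] u(1,2)])
      then show ?thesis using off b(2) u by (intro LIMSEQ_le_const2) blast+
    next
      case False
      then have "t \<notin> B" using last[OF t] B(2) by blast
      then show ?thesis using off t by blast
    qed
  qed
  moreover have "\<not> oscillates (component i w) ?\<epsilon> (horizon r) k"
  proof
    assume "oscillates (component i w) ?\<epsilon> (horizon r) k"
    then obtain t where t: "\<forall>i j. i \<le> j \<longrightarrow> j < 2 * k \<longrightarrow> t i \<le> t j" "\<forall>j<2 * k. t j \<in> horizon r"
      "\<forall>j<k. ?\<epsilon> < \<bar>component i w (t (2 * j + 1)) - component i w (t (2 * j))\<bar>" by (rule oscillatesE)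
    text \<open>Shifting all times to the right by a common small amount avoids \<open>B\<close> and keeps their order.\<close>
    define sh where "sh h j = (if ereal (t j) < Sup I then t j + h else t j)" for h j
    have "\<forall>j<2 * k. \<exists>b>0. \<forall>h. 0 < h \<longrightarrow> h < b \<longrightarrow> sh h j \<in> horizon r"
    proof (intro allI impI)
      fix j assume j: "j < 2 * k"
      show "\<exists>b>0. \<forall>h. 0 < h \<longrightarrow> h < b \<longrightarrow> sh h j \<in> horizon r"
      proof (cases "ereal (t j) < Sup I")
        case True
        obtain b where b: "b > t j" "\<And>u. t j < u \<Longrightarrow> u < b \<Longrightarrow> u \<in> horizon r" using right t(2) j True by blast
        then show ?thesis using True by (intro exI[of _ "b - t j"]) (auto simp: sh_def)
      next
        case False
        then show ?thesis using t(2) j by (intro exI[of _ 1]) (auto simp: sh_def)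
      qed
    qed
    then obtain b where b: "\<And>j. j < 2 * k \<Longrightarrow> 0 < b j" "\<And>j h. j < 2 * k \<Longrightarrow> 0 < h \<Longrightarrow> h < b j \<Longrightarrow> sh h j \<in> horizon r"
      by metis
    define b0 where "b0 = Min (insert 1 (b ` {..<2 * k}))"
    have b0: "0 < b0" unfolding b0_def using b(1) by (subst Min_gr_iff) auto
    have b0_le: "b0 \<le> b j" if "j < 2 * k" for j unfolding b0_def using that by (intro Min_le) auto
    \<comment> \<open>The shifts that would move some \<open>t j\<close> into \<open>B\<close>;
      there are only countably many.\<close>
    define B' where "B' = (\<Union>j. (\<lambda>u. u - t j) ` B)"
    have "countable B'" unfolding B'_def using B(1) by auto
    then obtain h where h: "h \<longlonglongrightarrow> 0" "\<And>n. 0 < h n" "\<And>n. h n < b0" "\<And>n. h n \<notin> B'"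
      using exists_right_sequence_off_countable[OF _ b0] by blast
    have sh_hor: "sh (h n) j \<in> horizon r" if "j < 2 * k" for n j
      using b(2)[OF that h(2)] h(3)[of n] b0_le[OF that] by simp
    have sh_B: "sh (h n) j \<notin> B" if j: "j < 2 * k" for n j
    proof (cases "ereal (t j) < Sup I")
      case True
      show ?thesis
      proof
        assume "sh (h n) j \<in> B"
        then have "h n \<in> B'" unfolding B'_def using True by (auto simp: sh_def image_iff intro!: exI[of _ j] bexI[of _ "t j + h n"])
        then show False using h(4) by blast
      qed
    next
      case False
      then show ?thesis using last[of "t j"] t(2) j B(2)[of "t j"] by (auto simp: sh_def)
    qed
    have sh_lim: "(\<lambda>n. component i w (sh (h n) j)) \<longlonglongrightarrow> component i w (t j)" if j: "j < 2 * k" for j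
    proof (cases "ereal (t j) < Sup I")
      case True
      have "(\<lambda>n. t j + h n) \<longlonglongrightarrow> t j + 0" by (intro tendsto_intros h(1))
      then have "(\<lambda>n. component i w (t j + h n)) \<longlonglongrightarrow> component i w (t j)"
        using t(2) j True h(2) by (intro right_sequence_tendsto[OF rc]) auto
      then show ?thesis using True by (simp add: sh_def)
    qed (simp add: sh_def)
    have "\<forall>\<^sub>F n in sequentially. \<forall>j\<in>{..<k}. ?\<epsilon> < \<bar>component i w (sh (h n) (2 * j + 1)) - component i w (sh (h n) (2 * j))\<bar>"
    proof (rule eventually_ball_finite, simp, intro ballI)
      fix j assume j: "j \<in> {..<k}"
      have "(\<lambda>n. \<bar>component i w (sh (h n) (2 * j + 1)) - component i w (sh (h n) (2 * j))\<bar>) \<longlonglongrightarrow>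
        \<bar>component i w (t (2 * j + 1)) - component i w (t (2 * j))\<bar>"
        using j by (intro tendsto_intros sh_lim) auto
      then show "\<forall>\<^sub>F n in sequentially. ?\<epsilon> < \<bar>component i w (sh (h n) (2 * j + 1)) - component i w (sh (h n) (2 * j))\<bar>"
        using t(3) j by (intro order_tendstoD(1)) auto
    qed
    then obtain n0 where n0: "\<And>j. j < k \<Longrightarrow> ?\<epsilon> < \<bar>component i w (sh (h n0) (2 * j + 1)) - component i w (sh (h n0) (2 * j))\<bar>"
      by (auto simp: eventually_sequentially)
    define t' where "t' = sh (h n0)"
    have "\<forall>\<^sub>F n in sequentially. \<forall>j\<in>{..<k}. ?\<epsilon> < \<bar>component i (s n) (t' (2 * j + 1)) - component i (s n) (t' (2 * j))\<bar>"
    proof (rule eventually_ball_finite, simp, intro ballI)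
      fix j assume j: "j \<in> {..<k}"
      have "(\<lambda>n. \<bar>component i (s n) (t' (2 * j + 1)) - component i (s n) (t' (2 * j))\<bar>) \<longlonglongrightarrow>
        \<bar>component i w (t' (2 * j + 1)) - component i w (t' (2 * j))\<bar>"
        using j sh_hor[of _ n0] sh_B[of _ n0] by (intro tendsto_intros limt) (auto simp: t'_def horizon_def)
      then show "\<forall>\<^sub>F n in sequentially. ?\<epsilon> < \<bar>component i (s n) (t' (2 * j + 1)) - component i (s n) (t' (2 * j))\<bar>"
        using n0 j by (intro order_tendstoD(1)) (auto simp: t'_def)
    qed
    then obtain n where n: "\<And>j. j < k \<Longrightarrow> ?\<epsilon> < \<bar>component i (s n) (t' (2 * j + 1)) - component i (s n) (t' (2 * j))\<bar>"
      by (auto simp: eventually_sequentially)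
    have "oscillates (component i (s n)) ?\<epsilon> (horizon r) k"
    proof (rule oscillatesI[of k t'])
      fix a b assume ab: "a \<le> b" "b < 2 * k"
      then have le: "t a \<le> t b" using t(1) by blast
      show "t' a \<le> t' b"
      \<comment> \<open>Only a terminal time stays in place, and nothing that remains in the horizon
        can overtake it; all other times move by the same amount.\<close>
      proof (cases "ereal (t b) < Sup I")
        case True
        then have "ereal (t a) < Sup I" using le by (meson ereal_less_eq(3) le_less_trans)
        then show ?thesis using True le by (simp add: t'_def sh_def)
      next
        case False
        then have "ereal (t b) = Sup I" using last t(2) ab(2) by blast
        moreover have "ereal (t' a) \<le> Sup I"
          using sh_hor[of a n0] ab by (auto simp: t'_def horizon_def real_in_I_iff)
        moreover have "t' b = t b" using False by (simp add: t'_def sh_def)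
        ultimately show ?thesis by (metis ereal_less_eq(3))
      qed
    next
      show "t' j \<in> horizon r" if "j < 2 * k" for j unfolding t'_def by (rule sh_hor[OF that])
    qed (use n in simp)
    then show False using s[of n] unfolding good_def by blast
  qed
  moreover have "\<bar>w (Sup I) $ i\<bar> \<le> real k" if "Sup I \<in> I"
  proof (rule LIMSEQ_le_const2)
    show "(\<lambda>n. \<bar>s n (Sup I) $ i\<bar>) \<longlonglongrightarrow> \<bar>w (Sup I) $ i\<bar>"
      by (intro tendsto_rabs tendsto_vec_nth limS that)
    show "\<exists>N. \<forall>n\<ge>N. \<bar>s n (Sup I) $ i\<bar> \<le> real k" using s that unfolding good_def by blast
  qed
  ultimately show ?thesis using w unfolding good_def by blast
qed

lemma S_conv_restrict_infinity:
  "S_conv {0..<\<infinity>} (\<lambda>n. restrict (s n) {0..<\<infinity>}) (restrict w {0..<\<infinity>}) \<longleftrightarrow>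
     (\<forall>i. \<exists>R::nat \<Rightarrow> real. (\<forall>r. 0 < R r) \<and> incseq R \<and> filterlim R at_top sequentially \<and>
             (\<forall>r. S_conv_real (R r) (\<lambda>n. component i (s n)) (component i w)))"
  (is "?lhs \<longleftrightarrow> ?rhs")
proof -
  have eq: "component i (restrict \<eta> {0..<\<infinity>}) t = component i \<eta> t" if "0 \<le> t" for i t and \<eta> :: "('a::finite) path"
    using that by (simp add: component_def zero_ereal_def)
  have *: "S_conv_real R (\<lambda>n. component i (restrict (s n) {0..<\<infinity>})) (component i (restrict w {0..<\<infinity>})) \<longleftrightarrow>
     S_conv_real R (\<lambda>n. component i (s n)) (component i w)" for R i
  proof
    assume "S_conv_real R (\<lambda>n. component i (restrict (s n) {0..<\<infinity>})) (component i (restrict w {0..<\<infinity>}))"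
    then show "S_conv_real R (\<lambda>n. component i (s n)) (component i w)"
      by (rule S_conv_real_cong_sequence[OF S_conv_real_cong]) (simp_all add: eq)
  next
    assume "S_conv_real R (\<lambda>n. component i (s n)) (component i w)"
    then show "S_conv_real R (\<lambda>n. component i (restrict (s n) {0..<\<infinity>})) (component i (restrict w {0..<\<infinity>}))"
      by (rule S_conv_real_cong_sequence[OF S_conv_real_cong]) (simp_all add: eq)
  qed
  show ?thesis unfolding S_conv_def by (simp add: *)
qed

text \<open>Every subsequence still has \<open>w\<close> as its pointwise limit and so contains an
  S-convergent one. Over the half-line the ends are chosen outside \<open>B\<close> between
  consecutive integers; over \<open>[0, \<infinity>]\<close> the last value is the second factor of
  the product.\<close>

lemma limitin_S_topology:
  fixes s :: "nat \<Rightarrow> ('d::finite) path"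
  assumes s: "\<And>n. s n \<in> cadlag_paths I" and good: "\<And>i r m. \<exists>k. \<forall>n. s n \<in> good i r m k"
    and w: "w \<in> cadlag_paths I" and lim: "pointwise_limit s w B"
  shows "limitin (S_topology I) s w sequentially"
proof -
  have B: "countable B" using lim by (simp add: pointwise_limit_def)
  have sub: "\<exists>q. strict_mono q \<and> (\<forall>i j. S_conv_real (R j) (\<lambda>n. component i (s (f (q n)))) (component i w))"
    if f: "strict_mono f" and R: "\<And>j. 0 < R j" "\<And>j. ereal (R j) \<in> I" "\<And>j. R j \<notin> B" for f :: "nat \<Rightarrow> nat" and R :: "nat \<Rightarrow> real"
  proof -
    have lim': "pointwise_limit (s \<circ> f) w B" by (rule pointwise_limit_subseq[OF lim f])
    have good': "\<exists>k. \<forall>n. (s \<circ> f) n \<in> good i r m k" for i r m using good[of i r m] by auto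
    have s': "(s \<circ> f) n \<in> cadlag_paths I" for n using s by simp
    obtain q where "strict_mono q" "\<And>i j. S_conv_real (R j) (\<lambda>n. component i ((s \<circ> f) (q n))) (component i w)"
      by (rule S_conv_of_pointwise_limit[OF s' good' w lim' R]) (rule that)
    then show ?thesis by auto
  qed
  have unbounded: "\<exists>R. (\<forall>j. 0 < R j) \<and> (\<forall>j. R j \<notin> B) \<and> incseq R \<and> filterlim R at_top sequentially"
  proof -
    have "\<exists>u. real j < u \<and> u < real j + 1 \<and> u \<notin> B" for j
    proof -
      have "real j < real j + 1" by simp
      from exists_right_sequence_off_countable[OF B this] show ?thesis by metis
    qed
    then obtain R where R: "\<And>j. real j < R j" "\<And>j. R j < real j + 1" "\<And>j. R j \<notin> B" by metis
    have "R j \<le> R (Suc j)" for j using R(1)[of "Suc j"] R(2)[of j] by simp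
    then have "incseq R" by (rule incseq_SucI)
    moreover have "filterlim R at_top sequentially"
      by (rule filterlim_at_top_mono[OF filterlim_real_sequentially always_eventually])
         (use R(1) less_imp_le in blast)
    moreover have "0 < R j" for j using R(1)[of j] by linarith
    ultimately show ?thesis using R(3) by blast
  qed
  show ?thesis
  proof (cases rule: I_cases)
    case (finite T)
    have ne: "I \<noteq> {0..\<infinity>}" "I \<noteq> {0..<\<infinity>}"
    proof -
      have "ereal (T + 1) \<notin> I" using finite(2) by simp
      moreover have "ereal (T + 1) \<in> {0..\<infinity>}" "ereal (T + 1) \<in> {0..<\<infinity>}" using finite(1) by auto
      ultimately show "I \<noteq> {0..\<infinity>}" "I \<noteq> {0..<\<infinity>}" by blast+
    qed
    have "T \<notin> B" using lim finite(3) by (auto simp: pointwise_limit_def)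
    moreover have "ereal T \<in> I" using finite(1,2) by auto
    ultimately have "\<exists>q. strict_mono q \<and> S_conv I (s \<circ> f \<circ> q) w" if "strict_mono f" for f :: "nat \<Rightarrow> nat"
      using sub[OF that, of "\<lambda>_. T"] finite(1,3) ne by (auto simp: S_conv_def o_def)
    then have "S_conv_subseq I s w" unfolding S_conv_subseq_def by blast
    then show ?thesis
      using limitin_S_seq_topology[of s I w] s w ne by (auto simp: S_topology_def)
  next
    case half_open
    obtain R where R: "\<And>j. 0 < R j" "\<And>j. R j \<notin> B" "incseq R" "filterlim R at_top sequentially"
      using unbounded by blast
    have RI: "ereal (R j) \<in> I" for j using R(1)[of j] half_open(1) by auto
    have "\<exists>q. strict_mono q \<and> S_conv I (s \<circ> f \<circ> q) w" if f: "strict_mono f" for f :: "nat \<Rightarrow> nat"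
    proof -
      obtain q where q: "strict_mono q" "\<forall>i j. S_conv_real (R j) (\<lambda>n. component i (s (f (q n)))) (component i w)"
        using sub[of f R, OF f R(1) RI R(2)] by blast
      have "S_conv I (\<lambda>n. s (f (q n))) w"
        unfolding S_conv_def using half_open(1) q(2) R(1,3,4) by auto
      then show ?thesis using q(1) by (auto simp: o_def)
    qed
    then have "S_conv_subseq I s w" unfolding S_conv_subseq_def by blast
    moreover have "I \<noteq> {0..\<infinity>}"
    proof -
      have "\<infinity> \<notin> I" using half_open(1) by simp
      moreover have "\<infinity> \<in> {0..\<infinity>::ereal}" by simp
      ultimately show ?thesis by metis
    qed
    ultimately show ?thesis
      using limitin_S_seq_topology[of s I w] s w by (auto simp: S_topology_def)
  next
    case closed
    obtain R where R: "\<And>j. 0 < R j" "\<And>j. R j \<notin> B" "incseq R" "filterlim R at_top sequentially"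
      using unbounded by blast
    let ?I = "{0..<\<infinity>} :: ereal set"
    let ?res = "\<lambda>\<eta>::'d path. restrict \<eta> ?I"
    have RI: "ereal (R j) \<in> I" for j using R(1)[of j] closed(1) by auto
    have "\<exists>q. strict_mono q \<and> S_conv ?I ((\<lambda>n. ?res (s n)) \<circ> f \<circ> q) (?res w)" if f: "strict_mono f" for f :: "nat \<Rightarrow> nat"
    proof -
      obtain q where q: "strict_mono q" "\<forall>i j. S_conv_real (R j) (\<lambda>n. component i (s (f (q n)))) (component i w)"
        using sub[of f R, OF f R(1) RI R(2)] by blast
      have "S_conv ?I (\<lambda>n. ?res (s (f (q n)))) (?res w)"
        unfolding S_conv_restrict_infinity using q(2) R by blast
      then show ?thesis using q(1) by (auto simp: o_def)
    qed
    then have S: "S_conv_subseq ?I (\<lambda>n. ?res (s n)) (?res w)" unfolding S_conv_subseq_def by blast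
    have resD: "?res \<eta> \<in> cadlag_paths ?I" if \<eta>: "\<eta> \<in> cadlag_paths I" for \<eta>
    proof -
      have eq: "(?res \<eta> \<longlongrightarrow> l) (at t within ?I \<inter> A) = (\<eta> \<longlongrightarrow> l) (at t within ?I \<inter> A)" for l t A
        by (intro tendsto_cong) (auto simp: eventually_at_filter)
      have sub: "?I \<subseteq> I" using closed(1) by auto
      have "(\<eta> \<longlongrightarrow> \<eta> t) (at t within ?I \<inter> {t<..})" if "t \<in> ?I" for t
      proof -
        have "(\<eta> \<longlongrightarrow> \<eta> t) (at t within I \<inter> {t<..})" using \<eta> that sub unfolding cadlag_paths_def by blast
        then show ?thesis by (rule tendsto_within_subset) (use sub in blast)
      qed
      moreover have "\<exists>l. (\<eta> \<longlongrightarrow> l) (at t within ?I \<inter> {..<t})" if t: "t \<in> ?I" for t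
      proof -
        have "t \<noteq> \<infinity>" using t by auto
        then obtain l where "(\<eta> \<longlongrightarrow> l) (at t within I \<inter> {..<t})" using \<eta> t sub unfolding cadlag_paths_def by blast
        then have "(\<eta> \<longlongrightarrow> l) (at t within ?I \<inter> {..<t})" by (rule tendsto_within_subset) (use sub in blast)
        then show ?thesis by blast
      qed
      ultimately show ?thesis unfolding cadlag_paths_def by (simp add: eq)
    qed
    have lim1: "limitin (S_seq_topology ?I) (\<lambda>n. ?res (s n)) (?res w) sequentially"
      using resD s w by (intro limitin_S_seq_topology[OF _ _ S]) auto
    have "Sup I \<in> I" using closed by simp
    then have "(\<lambda>n. s n (Sup I)) \<longlonglongrightarrow> w (Sup I)" using lim unfolding pointwise_limit_def by blast
    then have lim2: "limitin euclidean (\<lambda>n. s n \<infinity>) (w \<infinity>) sequentially" unfolding closed(2) by simp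
    have lim12: "limitin (prod_topology (S_seq_topology ?I) euclidean) (\<lambda>n. (?res (s n), s n \<infinity>)) (?res w, w \<infinity>) sequentially"
      unfolding limitin_pairwise using lim1 lim2 by (simp add: o_def)
    show ?thesis
      unfolding limitin_def
    proof (intro conjI allI impI)
      show "w \<in> topspace (S_topology I)"
        using w resD[OF w] closed(1) by (simp add: S_topology_def product_with_infinity_def topspace_pullback_topology topspace_S_seq_topology)
      fix U assume U: "openin (S_topology I) U \<and> w \<in> U"
      then obtain V where V: "openin (prod_topology (S_seq_topology ?I) euclidean) V"
        "U = (\<lambda>w. (?res w, w \<infinity>)) -` V \<inter> cadlag_paths I"
        using closed(1) by (auto simp: S_topology_def product_with_infinity_def openin_pullback_topology)
      then have "(?res w, w \<infinity>) \<in> V" using U by auto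
      then have "\<forall>\<^sub>F n in sequentially. (?res (s n), s n \<infinity>) \<in> V"
        using lim12 V(1) unfolding limitin_def by blast
      then show "\<forall>\<^sub>F n in sequentially. s n \<in> U"
        unfolding V(2) using s by (auto elim: eventually_mono)
    qed
  qed
qed

theorem good_compact:
  fixes s :: "nat \<Rightarrow> ('d::finite) path"
  assumes s: "\<And>n. s n \<in> cadlag_paths I" and good: "\<And>i r m. \<exists>k. \<forall>n. s n \<in> good i r m k"
  obtains w q where "w \<in> cadlag_paths I" "strict_mono q" "limitin (S_topology I) (s \<circ> q) w sequentially"
    "\<And>i r m k. (\<And>n. s n \<in> good i r m k) \<Longrightarrow> w \<in> good i r m k"
proof -
  obtain w q B where w: "w \<in> cadlag_paths I" and q: "strict_mono q" and lim: "pointwise_limit (s \<circ> q) w B"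
    using pointwise_selection[of s, OF s good] by blast
  show ?thesis
  proof (rule that[OF w q])
    show "limitin (S_topology I) (s \<circ> q) w sequentially"
    proof (rule limitin_S_topology[OF _ _ w lim])
      show "\<exists>k. \<forall>n. (s \<circ> q) n \<in> good i r m k" for i r m using good[of i r m] by auto
    qed (use s in simp)
    show "w \<in> good i r m k" if "\<And>n. s n \<in> good i r m k" for i r m k
      by (rule real_limit_in_good[OF _ w lim]) (simp add: that)
  qed
qed

end

section \<open>Averages over short time intervals\<close>

text \<open>
  A coordinate \<open>w \<mapsto> w t $ i\<close> is not continuous in the Meyer-Zheng topology, but its average over
  \<open>(t, t + \<delta>)\<close> is; the weight \<open>bump\<close> is continuous because the integrands of that topology are.
\<close>

definition bump :: "real \<Rightarrow> real \<Rightarrow> real \<Rightarrow> real" where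
  "bump t \<delta> u = max 0 ((u - t) * (t + \<delta> - u))"

definition avg :: "real \<Rightarrow> real \<Rightarrow> 'd \<Rightarrow> (real \<Rightarrow> real) \<Rightarrow> ('d::finite) path \<Rightarrow> real" where
  "avg t \<delta> i \<phi> w = (\<integral>u. bump t \<delta> u * \<phi> (component i w u) \<partial>lborel) / (\<integral>u. bump t \<delta> u \<partial>lborel)"

lemma continuous_on_bump: "continuous_on A (bump t \<delta>)"
  unfolding bump_def[abs_def] by (intro continuous_intros)

lemma bump_nonneg: "0 \<le> bump t \<delta> u"
  by (simp add: bump_def)

lemma bump_eq_0: "u \<notin> {t<..<t + \<delta>} \<Longrightarrow> 0 \<le> \<delta> \<Longrightarrow> bump t \<delta> u = 0"
proof -
  assume "u \<notin> {t<..<t + \<delta>}" "0 \<le> \<delta>"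
  then consider "u \<le> t" | "t + \<delta> \<le> u" "t \<le> u" by fastforce
  then have "(u - t) * (t + \<delta> - u) \<le> 0"
  proof cases
    case 1
    then show ?thesis using \<open>0 \<le> \<delta>\<close> by (intro mult_nonpos_nonneg) auto
  next
    case 2
    then show ?thesis by (intro mult_nonneg_nonpos) auto
  qed
  then show ?thesis by (simp add: bump_def)
qed

lemma bump_pos: "u \<in> {t<..<t + \<delta>} \<Longrightarrow> 0 < bump t \<delta> u"
  by (simp add: bump_def)

lemma bump_le: "0 \<le> \<delta> \<Longrightarrow> bump t \<delta> u \<le> \<delta> * \<delta>"
proof (cases "u \<in> {t<..<t + \<delta>}")
  case True
  then have "(u - t) * (t + \<delta> - u) \<le> \<delta> * \<delta>" by (intro mult_mono) auto
  then show ?thesis by (simp add: bump_def)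
qed (simp add: bump_eq_0)

lemma borel_measurable_bump [measurable]: "bump t \<delta> \<in> borel_measurable borel"
  by (rule borel_measurable_continuous_onI[OF continuous_on_bump])

lemma integrable_bump: 
  assumes "0 < \<delta>"
  shows "integrable lborel (bump t \<delta>)"
proof -
  have "set_integrable lborel {t..t + \<delta>} (bump t \<delta>)"
    by (rule borel_integrable_atLeastAtMost'[OF continuous_on_bump])
  then have "integrable lborel (\<lambda>u. indicator {t..t + \<delta>} u *\<^sub>R bump t \<delta> u)" by (simp add: set_integrable_def)
  moreover have "(\<lambda>u. indicator {t..t + \<delta>} u *\<^sub>R bump t \<delta> u) = bump t \<delta>"
  proof
    fix u show "indicator {t..t + \<delta>} u *\<^sub>R bump t \<delta> u = bump t \<delta> u"
      using bump_eq_0[of u t \<delta>] assms by (cases "u \<in> {t<..<t + \<delta>}") simp_all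
  qed
  ultimately show ?thesis by simp
qed

lemma integral_bump_pos:
  assumes "0 < \<delta>"
  shows "0 < (\<integral>u. bump t \<delta> u \<partial>lborel)"
proof -
  have "(\<integral>u. bump t \<delta> u \<partial>lborel) \<noteq> 0"
  proof
    assume "(\<integral>u. bump t \<delta> u \<partial>lborel) = 0"
    then have "AE u in lborel. bump t \<delta> u = 0"
      by (subst (asm) integral_nonneg_eq_0_iff_AE[OF integrable_bump[OF assms]]) (rule AE_I2[OF bump_nonneg])
    then have "AE u in lborel. u \<notin> {t<..<t + \<delta>}"
    proof eventually_elim
      case (elim u)
      show ?case
      proof
        assume "u \<in> {t<..<t + \<delta>}"
        from bump_pos[OF this] elim show False by simp
      qed
    qed
    then have "{t<..<t + \<delta>} \<in> null_sets lborel"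
      by (subst AE_iff_null_sets) (rule lborelD, simp)
    then have "emeasure lborel {t<..<t + \<delta>} = 0" by (rule null_setsD1)
    then show False using assms by simp
  qed
  moreover have "0 \<le> (\<integral>u. bump t \<delta> u \<partial>lborel)" by (rule integral_nonneg_AE[OF AE_I2[OF bump_nonneg]])
  ultimately show ?thesis by simp
qed

lemma topspace_MZ_init: "topspace (MZ_init_topology J) = (cadlag_paths J :: ('d::finite) path set)"
proof -
  have "w \<in> \<Union>{{w \<in> cadlag_paths J.
         (LINT t:{t. ereal t \<in> J}|lborel. f (t, component i w t) * exp (- t)) \<in> U} | f i U.
         continuous_on ({t. ereal t \<in> J} \<times> UNIV) f \<and>
         bounded (f ` ({t. ereal t \<in> J} \<times> UNIV)) \<and> open (U :: real set)}"
    if "w \<in> cadlag_paths J" for w :: "'d path"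
  proof (rule UnionI[OF CollectI])
    let ?f = "\<lambda>_::real \<times> real. 0::real" and ?i = "undefined :: 'd"
    show "\<exists>f i U. {w \<in> cadlag_paths J. (LINT t:{t. ereal t \<in> J}|lborel. ?f (t, component ?i w t) * exp (- t)) \<in> UNIV} =
        {w \<in> cadlag_paths J. (LINT t:{t. ereal t \<in> J}|lborel. f (t, component i w t) * exp (- t)) \<in> U} \<and>
         continuous_on ({t. ereal t \<in> J} \<times> UNIV) f \<and>
         bounded (f ` ({t. ereal t \<in> J} \<times> UNIV)) \<and> open (U :: real set)"
      by (intro exI[of _ ?f] exI[of _ ?i] exI[of _ UNIV]) (auto intro!: boundedI[of _ 0])
  qed (use that in simp)
  then show ?thesis
    unfolding MZ_init_topology_def topology_generated_by_topspace
    by (intro antisym Union_least subsetI subsetD[OF Union_mono[OF Un_upper1]]) (elim UnE CollectE exE conjE; simp)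
qed

lemma continuous_map_avg:
  fixes \<phi> :: "real \<Rightarrow> real"
  assumes \<delta>: "0 < \<delta>" and J: "\<And>u. u \<in> {t<..<t + \<delta>} \<Longrightarrow> ereal u \<in> J"
    and \<phi>: "continuous_on UNIV \<phi>" "\<And>x. \<bar>\<phi> x\<bar> \<le> B"
  shows "continuous_map (MZ_init_topology J) euclideanreal (avg t \<delta> i \<phi> :: ('d::finite) path \<Rightarrow> real)"
  unfolding continuous_map_def
proof (intro conjI allI impI)
  fix U :: "real set" assume "openin euclideanreal U"
  then have U: "open U" by simp
  define c where "c = (\<integral>u. bump t \<delta> u \<partial>lborel)"
  \<comment> \<open>The factor \<open>exp u\<close> cancels the weight \<open>exp (- u)\<close> of
    the topology; the product stays bounded because the bump vanishes outside
    \<open>(t, t + \<delta>)\<close>.\<close>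
  define f where "f = (\<lambda>(u, x). bump t \<delta> u * exp u * \<phi> x / c)"
  have c: "c > 0" unfolding c_def by (rule integral_bump_pos[OF \<delta>])
  have eq: "avg t \<delta> i \<phi> w = (LINT u:{t. ereal t \<in> J}|lborel. f (u, component i w u) * exp (- u))" for w :: "'d path"
  proof -
    have "indicator {t. ereal t \<in> J} u *\<^sub>R (f (u, component i w u) * exp (- u)) = bump t \<delta> u * \<phi> (component i w u) / c" for u
    proof (cases "u \<in> {t<..<t + \<delta>}")
      case True
      then show ?thesis using J[OF True] by (simp add: f_def exp_minus)
    next
      case False
      then show ?thesis using bump_eq_0[OF False] \<delta> by (simp add: f_def)
    qed
    then show ?thesis unfolding set_lebesgue_integral_def avg_def c_def[symmetric] by simp
  qed
  have "continuous_on UNIV f"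
    unfolding f_def case_prod_unfold
    using c by (intro continuous_intros continuous_on_compose2[OF continuous_on_bump[of UNIV]] continuous_on_compose2[OF \<phi>(1)]) auto
  then have "continuous_on ({t. ereal t \<in> J} \<times> UNIV) f" by (rule continuous_on_subset) simp
  moreover have "bounded (f ` ({t. ereal t \<in> J} \<times> UNIV))"
  proof (rule boundedI)
    fix y assume "y \<in> f ` ({t. ereal t \<in> J} \<times> UNIV)"
    then obtain u x where y: "y = bump t \<delta> u * exp u * \<phi> x / c" by (auto simp: f_def)
    have "bump t \<delta> u * exp u \<le> \<delta> * \<delta> * exp (t + \<delta>)"
    proof (cases "u \<in> {t<..<t + \<delta>}")
      case True
      then show ?thesis using bump_le[of \<delta> t u] \<delta> by (intro mult_mono) auto
    next
      case False
      then show ?thesis using bump_eq_0[OF False] \<delta> by simp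
    qed
    then have "\<bar>bump t \<delta> u * exp u\<bar> * \<bar>\<phi> x\<bar> \<le> (\<delta> * \<delta> * exp (t + \<delta>)) * B"
      using \<phi>(2)[of x] bump_nonneg[of t \<delta> u] by (intro mult_mono) auto
    then show "norm y \<le> (\<delta> * \<delta> * exp (t + \<delta>)) * B / c"
      unfolding y using c by (simp add: abs_mult divide_right_mono)
  qed
  ultimately have "openin (MZ_init_topology J) {w \<in> cadlag_paths J. (LINT u:{t. ereal t \<in> J}|lborel. f (u, component i w u) * exp (- u)) \<in> U}"
    unfolding MZ_init_topology_def using U
    by (intro topology_generated_by_Basis UnI1 CollectI exI[of _ f] exI[of _ i] exI[of _ U] conjI refl)
  then show "openin (MZ_init_topology J) {w \<in> topspace (MZ_init_topology J). avg t \<delta> i \<phi> w \<in> U}"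
    unfolding topspace_MZ_init eq .
qed simp

section \<open>Filtrations\<close>

lemma space_raw_filtration [simp]: "space (raw_filtration I t) = cadlag_paths I"
  by (simp add: raw_filtration_def space_measure_of_conv)

lemma sets_raw_filtration:
  "sets (raw_filtration I t) = sigma_sets (cadlag_paths I) {{w \<in> cadlag_paths I. w s \<in> A} | s A. s \<in> I \<and> s \<le> t \<and> A \<in> sets borel}"
  unfolding raw_filtration_def by (subst sets_measure_of) auto

lemma space_terminal_sigma [simp]: "space (terminal_sigma I) = cadlag_paths I"
  by (simp add: terminal_sigma_def space_measure_of_conv)

lemma sets_terminal_sigma:
  "sets (terminal_sigma I) = sigma_sets (cadlag_paths I) (\<Union>t\<in>I. sets (raw_filtration I t))"
  unfolding terminal_sigma_def
proof (rule sets_measure_of)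
  show "(\<Union>t\<in>I. sets (raw_filtration I t)) \<subseteq> Pow (cadlag_paths I)"
  proof
    fix A assume "A \<in> (\<Union>t\<in>I. sets (raw_filtration I t))"
    then obtain t where "A \<in> sets (raw_filtration I t)" by blast
    from sets.sets_into_space[OF this] show "A \<in> Pow (cadlag_paths I)" by simp
  qed
qed

lemma raw_filtration_mono: "s \<le> t \<Longrightarrow> sets (raw_filtration I s) \<subseteq> sets (raw_filtration I t)"
  unfolding sets_raw_filtration by (intro sigma_sets_mono') (auto intro: order_trans)

lemma raw_filtration_subset_terminal: "sets (raw_filtration I t) \<subseteq> sets (terminal_sigma I)"
proof -
  have "{w \<in> cadlag_paths I. w s \<in> A} \<in> sets (terminal_sigma I)" if "s \<in> I" "A \<in> sets borel" for s A
  proof -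
    have "{w \<in> cadlag_paths I. w s \<in> A} \<in> sets (raw_filtration I s)"
      unfolding sets_raw_filtration using that by (intro sigma_sets.Basic) blast
    then show ?thesis unfolding sets_terminal_sigma using that by blast
  qed
  then have "{{w \<in> cadlag_paths I. w s \<in> A} | s A. s \<in> I \<and> s \<le> t \<and> A \<in> sets borel} \<subseteq> sets (terminal_sigma I)"
    by blast
  from sets.sigma_sets_subset[OF this] show ?thesis unfolding sets_raw_filtration by simp
qed

lemma space_rc_filtration [simp]: "space (rc_filtration I t) = cadlag_paths I"
  by (simp add: rc_filtration_def space_measure_of_conv)

text \<open>An intersection of \<sigma>-algebras is one already, so membership can be used at each
  \<open>\<epsilon>\<close> directly.\<close>

lemma sets_rc_filtration: "sets (rc_filtration I t) = (\<Inter>\<epsilon>\<in>{0<..}. sets (raw_filtration I (t + ereal \<epsilon>)))"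
proof -
  let ?A = "\<Inter>\<epsilon>\<in>{0<..}. sets (raw_filtration I (t + ereal \<epsilon>))"
  have sub: "?A \<subseteq> Pow (cadlag_paths I)"
  proof
    fix A assume "A \<in> ?A"
    then have "A \<in> sets (raw_filtration I (t + ereal 1))" by (rule INT_D) simp
    from sets.sets_into_space[OF this] show "A \<in> Pow (cadlag_paths I)" by simp
  qed
  have "sets (rc_filtration I t) = sigma_sets (cadlag_paths I) ?A"
    unfolding rc_filtration_def using sub by (rule sets_measure_of)
  also have "\<dots> = ?A"
  proof (rule antisym)
    have "sigma_sets (cadlag_paths I) ?A \<subseteq> sets (raw_filtration I (t + ereal \<epsilon>))" if "\<epsilon> > 0" for \<epsilon>
      using sets.sigma_sets_subset[of ?A "raw_filtration I (t + ereal \<epsilon>)"] that by auto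
    then show "sigma_sets (cadlag_paths I) ?A \<subseteq> ?A" by blast
  qed (auto intro: sigma_sets.Basic)
  finally show ?thesis .
qed

lemma raw_filtration_subset_rc: "sets (raw_filtration I t) \<subseteq> sets (rc_filtration I t)"
proof -
  have "t \<le> t + ereal \<epsilon>" if "\<epsilon> > 0" for \<epsilon>
    using that by (cases t) auto
  then show ?thesis unfolding sets_rc_filtration using raw_filtration_mono by fastforce
qed

lemma rc_filtration_subset_raw: "\<epsilon> > 0 \<Longrightarrow> sets (rc_filtration I t) \<subseteq> sets (raw_filtration I (t + ereal \<epsilon>))"
  unfolding sets_rc_filtration by auto

lemma rc_filtration_subset_terminal: "sets (rc_filtration I t) \<subseteq> sets (terminal_sigma I)"
  using rc_filtration_subset_raw[of 1 I t] raw_filtration_subset_terminal by auto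

lemma value_measurable:
  assumes "s \<in> I" "s \<le> t"
  shows "(\<lambda>w. w s) \<in> borel_measurable (raw_filtration I t :: ('d::finite) path measure)"
proof (rule measurableI)
  fix A :: "(real^'d) set" assume "A \<in> sets borel"
  moreover have "(\<lambda>w. w s) -` A \<inter> space (raw_filtration I t) = {w \<in> cadlag_paths I. w s \<in> A}" by auto
  ultimately show "(\<lambda>w. w s) -` A \<inter> space (raw_filtration I t) \<in> sets (raw_filtration I t)"
    unfolding sets_raw_filtration using assms by (auto intro!: sigma_sets.Basic)
qed simp

lemma coordinate_measurable:
  assumes "s \<in> I" "s \<le> t"
  shows "(\<lambda>w. w s $ i) \<in> borel_measurable (raw_filtration I t :: ('d::finite) path measure)"
  by (rule measurable_compose[OF value_measurable[OF assms] borel_measurable_nth])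

lemma measurable_from_subset:
  assumes "f \<in> borel_measurable M" "sets M \<subseteq> sets N" "space M = space N"
  shows "f \<in> borel_measurable N"
  using assms by (auto simp: measurable_def)

lemma coordinate_measurable_terminal:
  assumes "s \<in> I"
  shows "(\<lambda>w. w s $ i) \<in> borel_measurable (terminal_sigma I :: ('d::finite) path measure)"
  by (rule measurable_from_subset[OF coordinate_measurable[OF assms order_refl] raw_filtration_subset_terminal]) simp

section \<open>Measurability and continuity of averaged coordinates\<close>

context time_line
begin

lemma path_right_sequence:
  assumes w: "w \<in> cadlag_paths I" and r: "ereal r \<in> I" and c: "0 \<le> c" "c \<le> r"
    and v: "v \<longlonglongrightarrow> c" "\<And>n. c \<le> v n" "\<And>n. v n \<le> r"
  shows "(\<lambda>n. component i w (v n)) \<longlonglongrightarrow> component i w c"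
proof (cases "c < r")
  case False
  then have "v n = c" for n using c v(2,3)[of n] by simp
  then show ?thesis by simp
next
  case True
  have rc: "(component i w \<longlongrightarrow> component i w c) (at_right c)" by (rule path_right_below[OF w r c(1) True])
  show ?thesis
  proof (rule tendstoI)
    fix e :: real assume "e > 0"
    with rc have "\<forall>\<^sub>F u in at_right c. dist (component i w u) (component i w c) < e" by (rule tendstoD)
    then obtain b where b: "b > c" "\<And>u. c < u \<Longrightarrow> u < b \<Longrightarrow> dist (component i w u) (component i w c) < e"
      by (auto simp: eventually_at_right_field)
    from order_tendstoD(2)[OF v(1) b(1)]
    show "\<forall>\<^sub>F n in sequentially. dist (component i w (v n)) (component i w c) < e"
    proof eventually_elim
      case (elim n)
      show ?case
      proof (cases "v n = c")
        case False
        then show ?thesis using b(2) v(2)[of n] elim by simp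
      qed (use \<open>e > 0\<close> in simp)
    qed
  qed
qed

lemma dyadic_right_approximation:
  "(\<lambda>p. real_of_int \<lceil>2 ^ p * u\<rceil> / 2 ^ p) \<longlonglongrightarrow> u" "u \<le> real_of_int \<lceil>2 ^ p * u\<rceil> / 2 ^ p"
proof -
  have ge: "u \<le> real_of_int \<lceil>2 ^ p * u\<rceil> / 2 ^ p" for p
    by (simp add: field_simps)
  then show "u \<le> real_of_int \<lceil>2 ^ p * u\<rceil> / 2 ^ p" .
  have le: "real_of_int \<lceil>2 ^ p * u\<rceil> / 2 ^ p \<le> u + (1/2) ^ p" for p
  proof -
    have "real_of_int \<lceil>2 ^ p * u\<rceil> \<le> 2 ^ p * u + 1" by linarith
    then have "real_of_int \<lceil>2 ^ p * u\<rceil> / 2 ^ p \<le> (2 ^ p * u + 1) / 2 ^ p" by (rule divide_right_mono) simp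
    also have "\<dots> = u + (1/2) ^ p" by (simp add: field_simps power_one_over)
    finally show ?thesis .
  qed
  show "(\<lambda>p. real_of_int \<lceil>2 ^ p * u\<rceil> / 2 ^ p) \<longlonglongrightarrow> u"
  proof (rule tendsto_sandwich)
    show "\<forall>\<^sub>F p in sequentially. u \<le> real_of_int \<lceil>2 ^ p * u\<rceil> / 2 ^ p" using ge by (rule always_eventually[OF allI])
    show "\<forall>\<^sub>F p in sequentially. real_of_int \<lceil>2 ^ p * u\<rceil> / 2 ^ p \<le> u + (1/2) ^ p" using le by (rule always_eventually[OF allI])
    have "(\<lambda>p. u + (1/2) ^ p) \<longlonglongrightarrow> u + 0" by (intro tendsto_intros LIMSEQ_realpow_zero) auto
    then show "(\<lambda>p. u + (1/2) ^ p) \<longlonglongrightarrow> u" by simp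
  qed simp
qed

text \<open>Progressive measurability: dyadic times approach \<open>u\<close> from the right, and
  the cap at \<open>r\<close> keeps them within the past of \<open>r\<close>. Clamping to
  \<open>[0, r]\<close> makes the map total in \<open>u\<close>, as integration over the whole line
  requires.\<close>

lemma joint_measurable:
  assumes r: "0 \<le> r" "ereal r \<in> I"
  shows "(\<lambda>(u, w). component i w (max 0 (min u r))) \<in> borel_measurable (borel \<Otimes>\<^sub>M (raw_filtration I (ereal r) :: ('d::finite) path measure))"
proof (rule borel_measurable_LIMSEQ_real[where u =
      "\<lambda>p x. component i (snd x) (max 0 (min (real_of_int \<lceil>(2::real) ^ p * fst x\<rceil> / 2 ^ p) r))"])
  let ?M = "borel \<Otimes>\<^sub>M (raw_filtration I (ereal r) :: 'd path measure)"
  let ?d = "\<lambda>p (z::int). max 0 (min (real_of_int z / 2 ^ p) r)"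
  fix p :: nat
  have "(\<lambda>x. component i (snd x) (?d p z)) \<in> borel_measurable ?M" for z
  proof -
    have "ereal (?d p z) \<in> I" using r in_I_mono[of "ereal (?d p z)" "ereal r"] by (auto simp: zero_ereal_def)
    moreover have "ereal (?d p z) \<le> ereal r" using r by simp
    ultimately have "(\<lambda>w. w (ereal (?d p z)) $ i) \<in> borel_measurable (raw_filtration I (ereal r) :: 'd path measure)"
      by (rule coordinate_measurable)
    then show ?thesis unfolding component_def by measurable
  qed
  moreover have "(\<lambda>x. \<lceil>(2::real) ^ p * fst x\<rceil>) \<in> measurable ?M (count_space UNIV)" by measurable
  ultimately show "(\<lambda>x. component i (snd x) (?d p \<lceil>(2::real) ^ p * fst x\<rceil>)) \<in> borel_measurable ?M"
    by (rule measurable_compose_countable[where f = "\<lambda>z x. component i (snd x) (?d p z)"])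
next
  fix x :: "real \<times> 'd path" assume "x \<in> space (borel \<Otimes>\<^sub>M (raw_filtration I (ereal r) :: 'd path measure))"
  then have w: "snd x \<in> cadlag_paths I" by (auto simp: space_pair_measure)
  let ?v = "\<lambda>p. max 0 (min (real_of_int \<lceil>2 ^ p * fst x\<rceil> / 2 ^ p) r)"
  have "(\<lambda>p. component i (snd x) (?v p)) \<longlonglongrightarrow> component i (snd x) (max 0 (min (fst x) r))"
  proof (rule path_right_sequence[OF w r(2)])
    show "?v \<longlonglongrightarrow> max 0 (min (fst x) r)" by (intro tendsto_intros dyadic_right_approximation)
    show "max 0 (min (fst x) r) \<le> ?v p" for p
      using dyadic_right_approximation(2)[of "fst x" p] by (intro max.mono min.mono) auto
  qed (use r in auto)
  then show "(\<lambda>p. component i (snd x) (max 0 (min (real_of_int \<lceil>2 ^ p * fst x\<rceil> / 2 ^ p) r))) \<longlonglongrightarrow>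
      (case x of (u, w) \<Rightarrow> component i w (max 0 (min u r)))" by (simp add: case_prod_unfold)
qed

text \<open>The bump vanishes outside its window, so clamping changes nothing and makes
  \<open>joint_measurable\<close> applicable to the integrand.\<close>

lemma avg_clamp:
  assumes "0 < \<delta>" "0 \<le> t"
  shows "bump t \<delta> u * \<phi> (component i w u) = bump t \<delta> u * \<phi> (component i w (max 0 (min u (t + \<delta>))))"
proof (cases "u \<in> {t<..<t + \<delta>}")
  case True
  then have "max 0 (min u (t + \<delta>)) = u" using assms by auto
  then show ?thesis by simp
next
  case False
  then show ?thesis using assms bump_eq_0[OF False] by simp
qed

lemma avg_measurable:
  assumes t: "0 \<le> t" "0 < \<delta>" "ereal (t + \<delta>) \<in> I" and [measurable]: "\<phi> \<in> borel_measurable borel"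
  shows "avg t \<delta> i \<phi> \<in> borel_measurable (raw_filtration I (ereal (t + \<delta>)) :: ('d::finite) path measure)"
proof -
  let ?M = "raw_filtration I (ereal (t + \<delta>)) :: 'd path measure"
  have [measurable]: "(\<lambda>(u, w). component i w (max 0 (min u (t + \<delta>)))) \<in> borel_measurable (borel \<Otimes>\<^sub>M ?M)"
    using t by (intro joint_measurable) auto
  have "(\<lambda>x. component i (fst x) (max 0 (min (snd x) (t + \<delta>)))) \<in> borel_measurable (?M \<Otimes>\<^sub>M lborel)"
    using measurable_compose[OF measurable_pair_swap'[of ?M borel] joint_measurable[of "t + \<delta>" i]] t
    by (simp add: case_prod_unfold)
  then have "(\<lambda>(w, u). bump t \<delta> u * \<phi> (component i w (max 0 (min u (t + \<delta>))))) \<in> borel_measurable (?M \<Otimes>\<^sub>M lborel)"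
    unfolding case_prod_unfold by measurable
  then have "(\<lambda>w. \<integral>u. bump t \<delta> u * \<phi> (component i w (max 0 (min u (t + \<delta>)))) \<partial>lborel) \<in> borel_measurable ?M"
    by (rule sigma_finite_measure.borel_measurable_lebesgue_integral[OF sigma_finite_lborel])
  then show ?thesis
    unfolding avg_def[abs_def] avg_clamp[OF t(2,1)] by measurable
qed

lemma path_section_measurable:
  assumes w: "w \<in> cadlag_paths I" and r: "0 \<le> r" "ereal r \<in> I"
  shows "(\<lambda>u. component i w (max 0 (min u r))) \<in> borel_measurable borel"
proof -
  have "(\<lambda>u. (u, w)) \<in> measurable borel (borel \<Otimes>\<^sub>M raw_filtration I (ereal r))"
    by (rule measurable_Pair2') (simp add: w)
  from measurable_compose[OF this joint_measurable[OF r, of i]] show ?thesis by simp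
qed

lemma avg_bounds:
  assumes w: "w \<in> cadlag_paths I" and t: "0 \<le> t" "0 < \<delta>" "ereal (t + \<delta>) \<in> I" and [measurable]: "\<phi> \<in> borel_measurable borel"
    and bounds: "\<And>u. u \<in> {t<..<t + \<delta>} \<Longrightarrow> lo \<le> \<phi> (component i w u) \<and> \<phi> (component i w u) \<le> hi"
  shows "lo \<le> avg t \<delta> i \<phi> w" "avg t \<delta> i \<phi> w \<le> hi"
proof -
  let ?f = "\<lambda>u. bump t \<delta> u * \<phi> (component i w u)"
  note int = integrable_bump[OF t(2), of t]
  have [measurable]: "(\<lambda>u. component i w (max 0 (min u (t + \<delta>)))) \<in> borel_measurable borel"
    using t by (intro path_section_measurable[OF w]) auto
  have meas: "?f \<in> borel_measurable lborel" unfolding avg_clamp[OF t(2,1)] by measurable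
  have b: "bump t \<delta> u * lo \<le> ?f u" "?f u \<le> bump t \<delta> u * hi" for u
  proof -
    have "bump t \<delta> u * lo \<le> ?f u \<and> ?f u \<le> bump t \<delta> u * hi"
    proof (cases "u \<in> {t<..<t + \<delta>}")
      case True
      then show ?thesis using bounds bump_nonneg by (auto intro!: mult_left_mono)
    next
      case False
      then show ?thesis using bump_eq_0[OF False] t by simp
    qed
    then show "bump t \<delta> u * lo \<le> ?f u" "?f u \<le> bump t \<delta> u * hi" by auto
  qed
  have f: "integrable lborel ?f"
  proof (rule Bochner_Integration.integrable_bound)
    show "integrable lborel (\<lambda>u. bump t \<delta> u * (\<bar>lo\<bar> + \<bar>hi\<bar>))" using int by simp
    have "\<bar>?f u\<bar> \<le> \<bar>bump t \<delta> u * (\<bar>lo\<bar> + \<bar>hi\<bar>)\<bar>" for u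
    proof -
      have "bump t \<delta> u * - (\<bar>lo\<bar> + \<bar>hi\<bar>) \<le> bump t \<delta> u * lo" "bump t \<delta> u * hi \<le> bump t \<delta> u * (\<bar>lo\<bar> + \<bar>hi\<bar>)"
        by (intro mult_left_mono bump_nonneg; linarith)+
      then have "\<bar>?f u\<bar> \<le> bump t \<delta> u * (\<bar>lo\<bar> + \<bar>hi\<bar>)"
        unfolding mult_minus_right using b[of u] by linarith
      then show ?thesis by linarith
    qed
    then show "AE u in lborel. norm (?f u) \<le> norm (bump t \<delta> u * (\<bar>lo\<bar> + \<bar>hi\<bar>))" by simp
  qed (rule meas)
  have "(\<integral>u. bump t \<delta> u * lo \<partial>lborel) \<le> (\<integral>u. ?f u \<partial>lborel)" "(\<integral>u. ?f u \<partial>lborel) \<le> (\<integral>u. bump t \<delta> u * hi \<partial>lborel)"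
    by (rule integral_mono[OF _ f b(1)], use int in simp) (rule integral_mono[OF f _ b(2)], use int in simp)
  then have "(\<integral>u. bump t \<delta> u \<partial>lborel) * lo \<le> (\<integral>u. ?f u \<partial>lborel)" "(\<integral>u. ?f u \<partial>lborel) \<le> (\<integral>u. bump t \<delta> u \<partial>lborel) * hi"
    by simp_all
  then show "lo \<le> avg t \<delta> i \<phi> w" "avg t \<delta> i \<phi> w \<le> hi"
    unfolding avg_def pos_le_divide_eq[OF integral_bump_pos[OF t(2)]] pos_divide_le_eq[OF integral_bump_pos[OF t(2)]]
    by (simp_all add: mult.commute)
qed

lemma not_Sup_cases:
  assumes "t \<in> I" "t \<noteq> Sup I"
  obtains s where "t = ereal s" "0 \<le> s" "ereal s < Sup I"
proof -
  have t: "0 \<le> t" "t < Sup I" using assms in_I_iff[of t] by auto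
  then obtain s where "t = ereal s" by (cases t) auto
  with t show ?thesis using that by auto
qed

definition width :: "nat \<Rightarrow> real \<Rightarrow> real" where
  "width n t = (if Sup I = \<infinity> then 1 / real (Suc n) else min (1 / real (Suc n)) (real_of_ereal (Sup I) - t))"

lemma width:
  assumes "0 \<le> t" "ereal t < Sup I"
  shows "0 < width n t" "width n t \<le> 1 / real (Suc n)" "ereal (t + width n t) \<in> I"
proof -
  have "0 < width n t \<and> width n t \<le> 1 / real (Suc n) \<and> ereal (t + width n t) \<in> I"
  proof (cases "Sup I")
    case (real T)
    then have "t < T" using assms by simp
    then show ?thesis using assms real by (simp add: width_def real_in_I_iff min_def)
  next
    case PInf
    then show ?thesis using assms by (simp add: width_def real_in_I_iff)
  qed (use Sup_pos in simp)
  then show "0 < width n t" "width n t \<le> 1 / real (Suc n)" "ereal (t + width n t) \<in> I" by auto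
qed

text \<open>At the terminal time there is no room for an average to the right, but there the value
  itself is continuous; elsewhere \<open>width\<close> keeps the averaging window inside
  \<open>I\<close>.\<close>

definition obs :: "nat \<Rightarrow> ereal \<Rightarrow> 'd \<Rightarrow> (real \<Rightarrow> real) \<Rightarrow> ('d::finite) path \<Rightarrow> real" where
  "obs n t i \<phi> w = (if t = Sup I then \<phi> (w t $ i) else avg (real_of_ereal t) (width n (real_of_ereal t)) i \<phi> w)"

lemma obs_bounds:
  assumes w: "w \<in> cadlag_paths I" and t: "t \<in> I" and \<phi>: "\<phi> \<in> borel_measurable borel" "\<And>x. lo \<le> \<phi> x" "\<And>x. \<phi> x \<le> hi"
  shows "lo \<le> obs n t i \<phi> w" "obs n t i \<phi> w \<le> hi"
proof -
  have "lo \<le> obs n t i \<phi> w \<and> obs n t i \<phi> w \<le> hi"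
  proof (cases "t = Sup I")
    case True
    then show ?thesis using \<phi> by (simp add: obs_def)
  next
    case False
    then obtain s where s: "t = ereal s" "0 \<le> s" "ereal s < Sup I" by (rule not_Sup_cases[OF t])
    show ?thesis
      using avg_bounds[OF w s(2) width(1,3)[OF s(2,3), of n] \<phi>(1), of lo i hi] \<phi>(2,3) False s by (simp add: obs_def)
  qed
  then show "lo \<le> obs n t i \<phi> w" "obs n t i \<phi> w \<le> hi" by auto
qed

lemma obs_tendsto:
  assumes w: "w \<in> cadlag_paths I" and t: "t \<in> I" and \<phi>: "continuous_on UNIV \<phi>"
  shows "(\<lambda>n. obs n t i \<phi> w) \<longlonglongrightarrow> \<phi> (w t $ i)"
proof (cases "t = Sup I")
  case True
  then show ?thesis by (simp add: obs_def)
next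
  case False
  then obtain s where s: "t = ereal s" "0 \<le> s" "ereal s < Sup I" by (rule not_Sup_cases[OF t])
  have [measurable]: "\<phi> \<in> borel_measurable borel" by (rule borel_measurable_continuous_onI[OF \<phi>])
  have lim: "((\<lambda>u. \<phi> (component i w u)) \<longlongrightarrow> \<phi> (component i w s)) (at_right s)"
    using \<phi> cadlag_right[OF w s(2,3), of i] by (auto simp: continuous_on_eq_continuous_at intro: isCont_tendsto_compose)
  show ?thesis
  proof (rule LIMSEQ_I)
    fix e :: real assume e: "e > 0"
    from tendstoD[OF lim half_gt_zero[OF e]] obtain b where b: "b > s"
      "\<And>u. s < u \<Longrightarrow> u < b \<Longrightarrow> dist (\<phi> (component i w u)) (\<phi> (component i w s)) < e / 2"
      by (auto simp: eventually_at_right_field)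
    obtain n0 where n0: "1 / real (Suc n0) < b - s" using nat_approx_posE[of "b - s"] b(1) by auto
    have "norm (obs n t i \<phi> w - \<phi> (w t $ i)) < e" if "n \<ge> n0" for n
    proof -
      have "1 / real (Suc n) \<le> 1 / real (Suc n0)" using that by (simp add: frac_le)
      then have wd: "s + width n s < b" using width(2)[OF s(2,3), of n] n0 by linarith
      have bd: "\<phi> (component i w s) - e / 2 \<le> \<phi> (component i w u) \<and> \<phi> (component i w u) \<le> \<phi> (component i w s) + e / 2"
        if "u \<in> {s<..<s + width n s}" for u
      proof -
        have "\<bar>\<phi> (component i w u) - \<phi> (component i w s)\<bar> < e / 2"
        proof -
          have "s < u" "u < b" using that wd by auto
          from b(2)[OF this] show ?thesis by (simp only: dist_real_def)
        qed
        then show ?thesis by linarith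
      qed
      have "obs n t i \<phi> w = avg s (width n s) i \<phi> w" using False s(1) by (simp add: obs_def)
      moreover have "component i w s = w t $ i" by (simp add: component_def s(1))
      moreover have "\<phi> (component i w s) - e / 2 \<le> avg s (width n s) i \<phi> w"
        "avg s (width n s) i \<phi> w \<le> \<phi> (component i w s) + e / 2"
        by (rule avg_bounds[OF w s(2) width(1,3)[OF s(2,3), of n] \<open>\<phi> \<in> borel_measurable borel\<close> bd], assumption)+
      ultimately show ?thesis using e by (simp add: abs_less_iff)
    qed
    then show "\<exists>no. \<forall>n\<ge>no. norm (obs n t i \<phi> w - \<phi> (w t $ i)) < e" by blast
  qed
qed

lemma obs_measurable:
  assumes t: "t \<in> I" and [measurable]: "\<phi> \<in> borel_measurable borel"
  shows "obs n t i \<phi> \<in> borel_measurable (raw_filtration I (t + ereal (1 / real (Suc n))) :: ('d::finite) path measure)"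
proof (cases "t = Sup I")
  case True
  have "t \<le> t + ereal (1 / real (Suc n))" by (cases t) auto
  then have "(\<lambda>w. w t $ i) \<in> borel_measurable (raw_filtration I (t + ereal (1 / real (Suc n))) :: 'd path measure)"
    by (rule coordinate_measurable[OF t])
  then have "(\<lambda>w. \<phi> (w t $ i)) \<in> borel_measurable (raw_filtration I (t + ereal (1 / real (Suc n))) :: 'd path measure)"
    by measurable
  then show ?thesis using True by (simp add: obs_def[abs_def])
next
  case False
  then obtain s where s: "t = ereal s" "0 \<le> s" "ereal s < Sup I" by (rule not_Sup_cases[OF t])
  have m: "avg s (width n s) i \<phi> \<in> borel_measurable (raw_filtration I (ereal (s + width n s)) :: 'd path measure)"
    using width[OF s(2,3), of n] s by (intro avg_measurable) auto
  have "ereal (s + width n s) \<le> t + ereal (1 / real (Suc n))" using width(2)[OF s(2,3), of n] s(1) by simp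
  from measurable_from_subset[OF m raw_filtration_mono[OF this]]
  show ?thesis using False s(1) by (simp add: obs_def[abs_def])
qed

lemma obs_measurable_terminal:
  assumes "t \<in> I" "\<phi> \<in> borel_measurable borel"
  shows "obs n t i \<phi> \<in> borel_measurable (terminal_sigma I :: ('d::finite) path measure)"
  by (rule measurable_from_subset[OF obs_measurable[OF assms] raw_filtration_subset_terminal]) simp

text \<open>Over \<open>[0, \<infinity>]\<close> the topology is pulled back from a product:
  averages factor through the restriction to \<open>[0, \<infinity>)\<close>, the terminal value
  through the second component.\<close>

lemma obs_continuous:
  fixes \<phi> :: "real \<Rightarrow> real"
  assumes t: "t \<in> I" and \<phi>: "continuous_on UNIV \<phi>" "\<And>x. \<bar>\<phi> x\<bar> \<le> B"
  shows "continuous_map (MZ_topology I) euclideanreal (obs n t i \<phi> :: ('d::finite) path \<Rightarrow> real)"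
proof -
  have open_coordinate: "open {x :: real^'d. \<phi> (x $ i) \<in> U}" if "open U" for U
  proof -
    have "continuous_on UNIV (\<lambda>x::real^'d. \<phi> (x $ i))"
      by (intro continuous_on_compose2[OF \<phi>(1)] continuous_intros) auto
    from open_vimage[OF that this] show ?thesis by (simp add: vimage_def)
  qed
  show ?thesis
  proof (cases "I = {0..\<infinity>}")
    case False
    then have MZ: "MZ_topology I = (MZ_init_topology I :: 'd path topology)" by (simp add: MZ_topology_def)
    show ?thesis
    proof (cases "t = Sup I")
      case True
      have "openin (MZ_init_topology I) {w \<in> cadlag_paths I. w (Sup I) \<in> V}" if "open V" for V :: "(real^'d) set"
        unfolding MZ_init_topology_def using that t True
        by (intro topology_generated_by_Basis UnI2 CollectI exI[of _ V] conjI refl) auto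
      from this[OF open_coordinate] show ?thesis
        unfolding MZ continuous_map_def topspace_MZ_init using True by (simp add: obs_def)
    next
      case False
      then obtain s where s: "t = ereal s" "0 \<le> s" "ereal s < Sup I" by (rule not_Sup_cases[OF t])
      have "continuous_map (MZ_init_topology I) euclideanreal (avg s (width n s) i \<phi> :: 'd path \<Rightarrow> real)"
        using width[OF s(2,3), of n] in_I_mono[of "ereal _" "ereal (s + width n s)"] s(2)
        by (intro continuous_map_avg[OF _ _ \<phi>]) auto
      then show ?thesis unfolding MZ using False s(1) by (simp add: obs_def[abs_def])
    qed
  next
    case True
    let ?J = "{0..<\<infinity>} :: ereal set"
    let ?f = "\<lambda>w::'d path. (restrict w ?J, w \<infinity>)"
    have MZ: "MZ_topology I = (pullback_topology (cadlag_paths I) ?f (prod_topology (MZ_init_topology ?J) euclidean))"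
      unfolding MZ_topology_def product_with_infinity_def using True by simp
    have SI: "Sup I = \<infinity>" using True by simp
    show ?thesis
    proof (cases "t = Sup I")
      case t: True
      have "continuous_map (prod_topology (MZ_init_topology ?J) euclidean) euclideanreal (\<lambda>p. \<phi> (snd p $ i))"
      proof -
        have "continuous_map euclidean euclideanreal (\<lambda>x::real^'d. \<phi> (x $ i))"
          unfolding continuous_map_iff_continuous2
          by (intro continuous_on_compose2[OF \<phi>(1)] continuous_intros) auto
        from continuous_map_compose[OF continuous_map_snd this] show ?thesis by (simp add: o_def)
      qed
      then have "continuous_map (MZ_topology I) euclideanreal ((\<lambda>p. \<phi> (snd p $ i)) \<circ> ?f)"
        unfolding MZ by (rule continuous_map_pullback)
      moreover have "(\<lambda>p. \<phi> (snd p $ i)) \<circ> ?f = obs n t i \<phi>" using t SI by (simp add: fun_eq_iff obs_def)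
      ultimately show ?thesis by simp
    next
      case False
      then obtain s where s: "t = ereal s" "0 \<le> s" "ereal s < Sup I" by (rule not_Sup_cases[OF t])
      note wd = width(1)[OF s(2,3), of n]
      have "continuous_map (MZ_init_topology ?J) euclideanreal (avg s (width n s) i \<phi> :: 'd path \<Rightarrow> real)"
        using wd s(2) by (intro continuous_map_avg[OF _ _ \<phi>]) auto
      from continuous_map_compose[OF continuous_map_fst this, of euclidean]
      have "continuous_map (MZ_topology I) euclideanreal ((avg s (width n s) i \<phi> \<circ> fst) \<circ> ?f)"
        unfolding MZ by (rule continuous_map_pullback)
      moreover have "((avg s (width n s) i \<phi> \<circ> fst) \<circ> ?f) = obs n t i \<phi>"
      proof
        fix w :: "'d path"
        have "bump s (width n s) u * \<phi> (component i (restrict w ?J) u) = bump s (width n s) u * \<phi> (component i w u)" for u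
        proof (cases "u \<in> {s<..<s + width n s}")
          case True
          then show ?thesis using s(2) by (simp add: component_def)
        next
          case False
          then show ?thesis using bump_eq_0[OF False] wd by simp
        qed
        then have "avg s (width n s) i \<phi> (restrict w ?J) = avg s (width n s) i \<phi> w"
          unfolding avg_def by presburger
        then show "((avg s (width n s) i \<phi> \<circ> fst) \<circ> ?f) w = obs n t i \<phi> w"
          using False s(1) by (simp add: obs_def)
      qed
      ultimately show ?thesis by simp
    qed
  qed
qed

end

section \<open>Dyadic grids: suprema and oscillations from countably many times\<close>

context time_line
begin

text \<open>Capping at \<open>Sup I\<close> makes every index admissible and puts the terminal time
  on the grid when \<open>I\<close> is bounded.\<close>

definition grid :: "nat \<Rightarrow> nat \<Rightarrow> real" where
  "grid p z = (if Sup I = \<infinity> then real z / 2 ^ p else min (real z / 2 ^ p) (real_of_ereal (Sup I)))"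

text \<open>Rounding goes up, because paths are continuous only from the right.\<close>

definition grid_index :: "nat \<Rightarrow> real \<Rightarrow> nat" where
  "grid_index p t = nat \<lceil>2 ^ p * t\<rceil>"

text \<open>The positions form a list, not a function, so the existential quantifier is countable
  and the event measurable.\<close>

definition grid_oscillates :: "(real \<Rightarrow> real) \<Rightarrow> real \<Rightarrow> nat \<Rightarrow> nat \<Rightarrow> nat \<Rightarrow> bool" where
  "grid_oscillates x \<epsilon> r k p \<longleftrightarrow> (\<exists>l::nat list. length l = 2 * k \<and> (\<forall>j<2 * k. \<forall>i\<le>j. l ! i \<le> l ! j) \<and>
     (\<forall>j<2 * k. grid p (l ! j) \<in> horizon r) \<and>
     (\<forall>j<k. \<epsilon> < \<bar>x (grid p (l ! (2 * j + 1))) - x (grid p (l ! (2 * j)))\<bar>))"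

lemma grid_in_I: "ereal (grid p z) \<in> I"
proof (cases "Sup I")
  case (real T)
  then have "0 < T" using Sup_pos by simp
  then have "0 \<le> grid p z \<and> grid p z \<le> T" using real by (simp add: grid_def)
  then show ?thesis unfolding real_in_I_iff real by simp
qed (use Sup_pos in \<open>simp_all add: grid_def real_in_I_iff\<close>)

lemma grid_mono: "z \<le> z' \<Longrightarrow> grid p z \<le> grid p z'"
proof -
  assume "z \<le> z'"
  then have "real z / 2 ^ p \<le> real z' / 2 ^ p" by (intro divide_right_mono) auto
  then show ?thesis unfolding grid_def by auto
qed

lemma grid_nonneg: "0 \<le> grid p z"
  using grid_in_I[of p z] real_in_I_iff by simp

lemma grid_0: "grid p 0 = 0"
  using Sup_pos by (cases "Sup I") (auto simp: grid_def)

lemma grid_index_mono: "t \<le> t' \<Longrightarrow> grid_index p t \<le> grid_index p t'"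
  unfolding grid_index_def by (intro nat_mono ceiling_mono mult_left_mono) auto

lemma grid_approximation:
  assumes t: "ereal t \<in> I"
  shows "(\<lambda>p. grid p (grid_index p t)) \<longlonglongrightarrow> t" "t \<le> grid p (grid_index p t)"
proof -
  have t0: "0 \<le> t" using t by (simp add: real_in_I_iff)
  have idx: "real (grid_index p t) = real_of_int \<lceil>2 ^ p * t\<rceil>" for p
    using t0 by (simp add: grid_index_def)
  have "(\<lambda>p. grid p (grid_index p t)) \<longlonglongrightarrow> t \<and> (\<forall>p. t \<le> grid p (grid_index p t))"
  proof (cases "Sup I")
    case (real T)
    then have "t \<le> T" using t by (simp add: real_in_I_iff)
    moreover have "(\<lambda>p. min (real_of_int \<lceil>2 ^ p * t\<rceil> / 2 ^ p) T) \<longlonglongrightarrow> min t T"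
      by (intro tendsto_intros dyadic_right_approximation)
    ultimately show ?thesis
      using real dyadic_right_approximation(2)[of t] by (simp add: grid_def idx min_absorb1)
  next
    case PInf
    then show ?thesis using dyadic_right_approximation[of t] by (simp add: grid_def idx)
  qed (use Sup_pos in simp)
  then show "(\<lambda>p. grid p (grid_index p t)) \<longlonglongrightarrow> t" "t \<le> grid p (grid_index p t)" by auto
qed

lemma component_grid_tendsto:
  assumes w: "w \<in> cadlag_paths I" and t: "ereal t \<in> I"
  shows "(\<lambda>p. component i w (grid p (grid_index p t))) \<longlonglongrightarrow> component i w t"
proof -
  have t0: "0 \<le> t" using t by (simp add: real_in_I_iff)
  have "\<exists>r. ereal r \<in> I \<and> t \<le> r \<and> (\<forall>p. grid p (grid_index p t) \<le> r)"
  proof (cases "Sup I")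
    case (real T)
    then have "0 < T" using Sup_pos by simp
    then show ?thesis using real t by (intro exI[of _ T]) (simp add: grid_def real_in_I_iff)
  next
    case PInf
    have "real (grid_index p t) / 2 ^ p \<le> t + 1" for p
    proof -
      have "real (grid_index p t) \<le> 2 ^ p * t + 1" using t0 by (simp add: grid_index_def)
      also have "\<dots> \<le> 2 ^ p * (t + 1)" by (simp add: algebra_simps)
      finally show ?thesis by (simp add: field_simps)
    qed
    then show ?thesis using PInf t0 by (intro exI[of _ "t + 1"]) (simp add: grid_def real_in_I_iff)
  qed (use Sup_pos in simp)
  then obtain r where r: "ereal r \<in> I" "t \<le> r" "\<And>p. grid p (grid_index p t) \<le> r" by blast
  show "(\<lambda>p. component i w (grid p (grid_index p t))) \<longlonglongrightarrow> component i w t"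
    by (rule path_right_sequence[OF w r(1) t0 r(2) grid_approximation[OF t] r(3)])
qed

lemma eventually_grid_in_horizon:
  assumes "t \<in> horizon r"
  shows "\<forall>\<^sub>F p in sequentially. grid p (grid_index p t) \<in> horizon r"
proof -
  have t: "ereal t \<in> I" "t < real r + 1" using assms by (auto simp: horizon_def)
  from order_tendstoD(2)[OF grid_approximation(1)[OF t(1)] t(2)] show ?thesis
    by eventually_elim (simp add: horizon_def grid_in_I grid_nonneg)
qed

lemma eventually_grid_exceeds:
  assumes w: "w \<in> cadlag_paths I" and t: "t \<in> horizon r" "c < \<bar>component i w t\<bar>"
  shows "\<forall>\<^sub>F p in sequentially. \<exists>z. grid p z \<in> horizon r \<and> c < \<bar>component i w (grid p z)\<bar>"
proof -
  have "ereal t \<in> I" using t(1) by (simp add: horizon_def)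
  from order_tendstoD(1)[OF tendsto_rabs[OF component_grid_tendsto[OF w this]] t(2)] eventually_grid_in_horizon[OF t(1)]
  show ?thesis by eventually_elim blast
qed

text \<open>Rounding up keeps the order of the times, and the finitely many strict inequalities
  survive by right-continuity once the grid is fine enough.\<close>

lemma eventually_grid_oscillates:
  assumes w: "w \<in> cadlag_paths I" and osc: "oscillates (component i w) \<epsilon> (horizon r) k"
  shows "\<forall>\<^sub>F p in sequentially. grid_oscillates (component i w) \<epsilon> r k p"
proof -
  obtain t where t: "\<forall>i j. i \<le> j \<longrightarrow> j < 2 * k \<longrightarrow> t i \<le> t j" "\<forall>j<2 * k. t j \<in> horizon r"
    "\<forall>j<k. \<epsilon> < \<bar>component i w (t (2 * j + 1)) - component i w (t (2 * j))\<bar>"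
    by (rule oscillatesE[OF osc])
  have tI: "ereal (t j) \<in> I" if "j < 2 * k" for j using t(2) that by (simp add: horizon_def)
  have "\<forall>\<^sub>F p in sequentially. \<forall>j\<in>{..<2 * k}. grid p (grid_index p (t j)) \<in> horizon r"
    using t(2) by (intro eventually_ball_finite ballI eventually_grid_in_horizon) auto
  moreover have "\<forall>\<^sub>F p in sequentially. \<forall>j\<in>{..<k}.
      \<epsilon> < \<bar>component i w (grid p (grid_index p (t (2 * j + 1)))) - component i w (grid p (grid_index p (t (2 * j))))\<bar>"
  proof (rule eventually_ball_finite, simp, intro ballI)
    fix j assume j: "j \<in> {..<k}"
    have "(\<lambda>p. \<bar>component i w (grid p (grid_index p (t (2 * j + 1)))) - component i w (grid p (grid_index p (t (2 * j))))\<bar>) \<longlonglongrightarrow>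
       \<bar>component i w (t (2 * j + 1)) - component i w (t (2 * j))\<bar>"
      using j by (intro tendsto_rabs tendsto_diff component_grid_tendsto[OF w] tI) auto
    then show "\<forall>\<^sub>F p in sequentially.
      \<epsilon> < \<bar>component i w (grid p (grid_index p (t (2 * j + 1)))) - component i w (grid p (grid_index p (t (2 * j))))\<bar>"
      using t(3) j by (intro order_tendstoD(1)) auto
  qed
  ultimately show ?thesis
  proof eventually_elim
    case (elim p)
    show ?case
      unfolding grid_oscillates_def
    proof (intro exI[of _ "map (\<lambda>j. grid_index p (t j)) [0..<2 * k]"] conjI allI impI)
      fix j i assume "j < 2 * k" "i \<le> j"
      then show "map (\<lambda>j. grid_index p (t j)) [0..<2 * k] ! i \<le> map (\<lambda>j. grid_index p (t j)) [0..<2 * k] ! j"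
        using t(1) grid_index_mono by simp
    qed (use elim in auto)
  qed
qed

lemma grid_oscillates_imp_oscillates:
  assumes "grid_oscillates x \<epsilon> r k p"
  shows "oscillates x \<epsilon> (horizon r) k"
proof -
  obtain l :: "nat list" where l: "\<forall>j<2 * k. \<forall>i\<le>j. l ! i \<le> l ! j" "\<forall>j<2 * k. grid p (l ! j) \<in> horizon r"
     "\<forall>j<k. \<epsilon> < \<bar>x (grid p (l ! (2 * j + 1))) - x (grid p (l ! (2 * j)))\<bar>"
    using assms unfolding grid_oscillates_def by blast
  show ?thesis
    by (rule oscillatesI[of k "\<lambda>j. grid p (l ! j)"]) (use l grid_mono in auto)
qed

lemma component_grid_measurable:
  "(\<lambda>w. component i w (grid p z)) \<in> borel_measurable (terminal_sigma I :: ('d::finite) path measure)"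
  unfolding component_def by (rule coordinate_measurable_terminal[OF grid_in_I])

lemma grid_oscillates_sets:
  "{w \<in> space (terminal_sigma I). grid_oscillates (component i w) \<epsilon> r k p} \<in> sets (terminal_sigma I :: ('d::finite) path measure)"
proof -
  note [measurable] = component_grid_measurable
  define C where "C l \<longleftrightarrow> length l = 2 * k \<and> (\<forall>j<2 * k. \<forall>i\<le>j. l ! i \<le> l ! j) \<and>
    (\<forall>j<2 * k. grid p (l ! j) \<in> horizon r)" for l
  have osc: "grid_oscillates x \<epsilon> r k p \<longleftrightarrow>
    (\<exists>l. C l \<and> (\<forall>j\<in>{..<k}. \<epsilon> < \<bar>x (grid p (l ! (2 * j + 1))) - x (grid p (l ! (2 * j)))\<bar>))" for x
    unfolding grid_oscillates_def C_def by (simp only: conj_assoc Ball_def lessThan_iff)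
  show ?thesis
    unfolding osc
    by (intro sets.sets_Collect_conj sets.sets_Collect_const sets.sets_Collect_countable_Ex
        sets.sets_Collect_finite_All finite_lessThan; measurable)
qed

text \<open>Strictness and right-continuity push any violation of a bound, and any oscillation, onto
  a sufficiently fine grid, which replaces uncountable quantifiers by countable ones.\<close>

lemma good_sets: "good i r m k \<in> sets (terminal_sigma I :: ('d::finite) path measure)"
proof -
  let ?M = "terminal_sigma I :: 'd path measure"
  note [measurable] = component_grid_measurable
  have "good i r m k = {w \<in> space ?M. (\<forall>p z. grid p z \<in> horizon r \<longrightarrow> \<bar>component i w (grid p z)\<bar> \<le> real k) \<and>
     \<not> (\<exists>p. grid_oscillates (component i w) (1 / real (Suc m)) r k p)} \<inter>
     {w \<in> space ?M. Sup I \<in> I \<longrightarrow> \<bar>w (Sup I) $ i\<bar> \<le> real k}" (is "?A = ?B \<inter> ?C")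
  proof (intro set_eqI iffI)
    fix w assume "w \<in> ?A"
    then show "w \<in> ?B \<inter> ?C" unfolding good_def using grid_oscillates_imp_oscillates by auto
  next
    fix w assume w: "w \<in> ?B \<inter> ?C"
    then have D: "w \<in> cadlag_paths I" by simp
    have "\<bar>component i w t\<bar> \<le> real k" if "t \<in> horizon r" for t
    proof (rule ccontr)
      assume "\<not> ?thesis"
      then have "\<forall>\<^sub>F p in sequentially. \<exists>z. grid p z \<in> horizon r \<and> real k < \<bar>component i w (grid p z)\<bar>"
        using eventually_grid_exceeds[OF D that] by simp
      from eventually_happens'[OF sequentially_bot this]
      obtain p z where pz: "grid p z \<in> horizon r" "real k < \<bar>component i w (grid p z)\<bar>" by blast
      moreover have "\<bar>component i w (grid p z)\<bar> \<le> real k" using w pz(1) by blast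
      ultimately show False by simp
    qed
    moreover have "\<not> oscillates (component i w) (1 / real (Suc m)) (horizon r) k"
    proof
      assume "oscillates (component i w) (1 / real (Suc m)) (horizon r) k"
      from eventually_happens'[OF sequentially_bot eventually_grid_oscillates[OF D this]]
      show False using w by blast
    qed
    ultimately show "w \<in> ?A" unfolding good_def using w by simp
  qed
  moreover have "?B \<in> sets ?M"
    by (intro sets.sets_Collect_conj sets.sets_Collect_countable_All sets.sets_Collect_imp sets.sets_Collect_const
        sets.sets_Collect_neg sets.sets_Collect_countable_Ex grid_oscillates_sets; measurable)
  moreover have "?C \<in> sets ?M"
  proof (cases "Sup I \<in> I")
    case True
    have "(\<lambda>w. \<bar>w (Sup I) $ i\<bar>) \<in> borel_measurable ?M"
      by (rule borel_measurable_abs[OF coordinate_measurable_terminal[OF True]])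
    from borel_measurable_le[OF this borel_measurable_const, of "real k"] show ?thesis using True by simp
  next
    case False
    then have "?C = space ?M" by simp
    then show ?thesis by (simp only: sets.top)
  qed
  ultimately show ?thesis by simp
qed

end

section \<open>A countable family of tests\<close>

text \<open>As \<open>\<bar>arctan x\<bar> < pi / 2 < 2\<close>, the values stay in [1/4, 3/4], and
  so do averages of them, safely inside the interval [0,1) that the coding requires;
  \<open>tan\<close> undoes the map.\<close>

definition squash :: "real \<Rightarrow> real" where
  "squash x = 1 / 2 + arctan x / 8"

lemma squash_bounds: "1 / 4 \<le> squash x" "squash x \<le> 3 / 4"
  using arctan_bounded[of x] pi_less_4 by (auto simp: squash_def)

lemma abs_squash: "\<bar>squash x\<bar> \<le> 1"
  using squash_bounds[of x] by simp

lemma continuous_on_squash: "continuous_on A squash"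
  unfolding squash_def[abs_def] by (intro continuous_intros) auto

lemma measurable_squash [measurable]: "squash \<in> borel_measurable borel"
  by (rule borel_measurable_continuous_onI[OF continuous_on_squash])

lemma tan_squash: "tan (8 * (squash x - 1 / 2)) = x"
  by (simp add: squash_def tan_arctan)

lemma inj_squash: "squash x = squash y \<Longrightarrow> x = y"
  by (metis tan_squash)

lemma measurable_vector:
  fixes f :: "'a \<Rightarrow> real^'d::finite"
  assumes "\<And>i. (\<lambda>x. f x $ i) \<in> borel_measurable M"
  shows "f \<in> borel_measurable M"
proof (rule borel_measurable_euclidean_space[THEN iffD2], intro ballI)
  fix b :: "real^'d" assume "b \<in> Basis"
  then obtain i where "b = axis i 1" by (auto simp: Basis_vec_def)
  then show "(\<lambda>x. f x \<bullet> b) \<in> borel_measurable M" using assms[of i] by (simp add: inner_axis)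
qed

context time_line
begin

definition times :: "ereal set" where
  "times = {t \<in> I. t = Sup I \<or> (\<exists>q::rat. t = ereal (real_of_rat q))}"

lemma times_subset: "times \<subseteq> I"
  by (auto simp: times_def)

lemma zero_in_times: "0 \<in> times"
  using zero_in_I by (auto simp: times_def intro!: exI[of _ "0::rat"])

lemma countable_times: "countable times"
proof (rule countable_subset)
  show "times \<subseteq> insert (Sup I) (range (\<lambda>q::rat. ereal (real_of_rat q)))" by (auto simp: times_def)
qed simp

lemma times_right_sequence:
  assumes t: "t \<in> I" "t \<noteq> Sup I" "t < u"
  obtains v where "\<And>p. v p \<in> times" "\<And>p. t \<le> v p" "\<And>p. v p < u"
    "\<And>w::('d::finite) path. \<And>i. w \<in> cadlag_paths I \<Longrightarrow> (\<lambda>p::nat. w (v p) $ i) \<longlonglongrightarrow> w t $ i"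
proof -
  obtain s where s: "t = ereal s" "0 \<le> s" "ereal s < Sup I" by (rule not_Sup_cases[OF t(1,2)])
  have "ereal s < min u (Sup I)" using t(3) s by simp
  then obtain r where r: "ereal s < ereal (real_of_rat r)" "ereal (real_of_rat r) < min u (Sup I)"
    using ereal_dense3 by blast
  then have rI: "ereal (real_of_rat r) \<in> I"
    using s(2) by (intro real_in_I_iff[THEN iffD2]) (auto simp del: zero_le_of_rat_iff)
  \<comment> \<open>Dyadic times approaching \<open>s\<close> from the right, capped at a rational
    time below \<open>u\<close> and \<open>Sup I\<close>: they stay rational and inside
    \<open>I\<close>.\<close>
  let ?v = "\<lambda>p. min (real_of_int \<lceil>2 ^ p * s\<rceil> / 2 ^ p) (real_of_rat r)"
  have ge: "s \<le> ?v p" for p using dyadic_right_approximation(2)[of s p] r(1) by simp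
  have rat: "\<exists>q::rat. ?v p = real_of_rat q" for p
  proof -
    have "real_of_int \<lceil>2 ^ p * s\<rceil> / 2 ^ p = real_of_rat (of_int \<lceil>2 ^ p * s\<rceil> / 2 ^ p)"
      by (simp add: of_rat_divide of_rat_power)
    then show ?thesis unfolding min_def by (cases "real_of_int \<lceil>2 ^ p * s\<rceil> / 2 ^ p \<le> real_of_rat r") auto
  qed
  show ?thesis
  proof (rule that[of "\<lambda>p. ereal (?v p)"])
    fix p
    have "ereal (?v p) \<in> I"
      using order_trans[OF s(2) ge[of p]] by (intro in_I_mono[OF _ _ rI]) (simp_all only: zero_ereal_def ereal_less_eq min.cobounded2)
    then show "ereal (?v p) \<in> times" using rat[of p] unfolding times_def by blast
    show "t \<le> ereal (?v p)" using ge[of p] s(1) by simp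
    have "ereal (?v p) \<le> ereal (real_of_rat r)" by simp
    also have "\<dots> < u" using r(2) by simp
    finally show "ereal (?v p) < u" .
  next
    fix w :: "'d path" and i assume w: "w \<in> cadlag_paths I"
    have "?v \<longlonglongrightarrow> min s (real_of_rat r)" by (intro tendsto_intros dyadic_right_approximation)
    then have "?v \<longlonglongrightarrow> s" using r(1) by (simp add: min_absorb1)
    then have "(\<lambda>p. component i w (?v p)) \<longlonglongrightarrow> component i w s"
      using r(1) s(2) ge by (intro path_right_sequence[OF w rI]) auto
    then show "(\<lambda>p. w (ereal (?v p)) $ i) \<longlonglongrightarrow> w t $ i" by (simp add: component_def s(1))
  qed
qed

definition test :: "nat \<Rightarrow> ('d::finite) path \<Rightarrow> real" where
  "test l = (case from_nat l of (i, n, j) \<Rightarrow> obs n (from_nat_into times j) i squash)"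

definition good_set :: "nat \<Rightarrow> nat \<Rightarrow> ('d::finite) path set" where
  "good_set l k = (case from_nat l of (i, r, m) \<Rightarrow> good i r m k)"

lemma test_cases:
  obtains t i n where "t \<in> times" "(test l :: ('d::finite) path \<Rightarrow> real) = obs n t i squash"
proof -
  obtain i :: 'd and n j :: nat where "from_nat l = (i, n, j)" by (metis prod_cases3)
  then show ?thesis
    using from_nat_into[of times j] zero_in_times by (intro that[of "from_nat_into times j" n i]) (auto simp: test_def)
qed

lemma test_eq_obs:
  assumes "t \<in> times"
  obtains l where "(test l :: ('d::finite) path \<Rightarrow> real) = obs n t i squash"
proof -
  obtain j where "from_nat_into times j = t" using assms countable_times from_nat_into_surj by metis
  then show ?thesis by (intro that[of "to_nat (i, n, j)"]) (simp add: test_def)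
qed

lemma good_set_cases:
  obtains i r m where "\<And>k. (good_set l k :: ('d::finite) path set) = good i r m k"
proof -
  obtain i :: 'd and r m :: nat where "from_nat l = (i, r, m)" by (metis prod_cases3)
  then show ?thesis by (intro that[of i r m]) (simp add: good_set_def)
qed

lemma good_set_eq_good: "good_set (to_nat (i, r, m)) k = good i r m k"
  by (simp add: good_set_def)

lemma test_limit:
  assumes "w \<in> cadlag_paths I" "t \<in> times"
  shows "(\<lambda>n. obs n t i squash w) \<longlonglongrightarrow> squash (w t $ i)"
  using assms times_subset by (intro obs_tendsto continuous_on_squash) auto

text \<open>Averages at a fixed time determine the value there as their width shrinks, and
  right-continuity passes from rational times to all times.\<close>

lemma tests_separate:
  assumes w: "w \<in> cadlag_paths I" and w': "w' \<in> cadlag_paths I"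
    and eq: "\<And>l. test l w = test l (w' :: ('d::finite) path)"
  shows "w = w'"
proof -
  have rat: "w t $ i = w' t $ i" if t: "t \<in> times" for t i
  proof -
    have "obs n t i squash w = obs n t i squash w'" for n
    proof -
      obtain l where "(test l :: 'd path \<Rightarrow> real) = obs n t i squash" by (rule test_eq_obs[OF t])
      with eq[of l] show ?thesis by simp
    qed
    then have "(\<lambda>n. obs n t i squash w) \<longlonglongrightarrow> squash (w' t $ i)" using test_limit[OF w' t, of i] by presburger
    from inj_squash[OF LIMSEQ_unique[OF test_limit[OF w t, of i] this]] show ?thesis .
  qed
  have "w t = w' t" if t: "t \<in> I" for t
  proof (cases "t \<in> times")
    case True
    then show ?thesis using rat by (simp add: vec_eq_iff)
  next
    case False
    then have ne: "t \<noteq> Sup I" using t by (auto simp: times_def)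
    then have "t < Sup I" using t in_I_iff[of t] by auto
    then obtain v where v: "\<And>p. v p \<in> times"
      "\<And>w::'d path. \<And>i. w \<in> cadlag_paths I \<Longrightarrow> (\<lambda>p::nat. w (v p) $ i) \<longlonglongrightarrow> w t $ i"
      by (rule times_right_sequence[OF t ne]) blast
    have "w t $ i = w' t $ i" for i
      using LIMSEQ_unique[OF v(2)[OF w, of i]] v(2)[OF w', of i] rat[OF v(1)] by simp
    then show ?thesis by (simp add: vec_eq_iff)
  qed
  then show ?thesis using w w' by (intro extensionalityI[of _ I]) (auto simp: cadlag_paths_def)
qed

text \<open>Used twice. For the terminal \<sigma>-algebra every test is available; for the past of a
  time \<open>u\<close> only those whose averaging window ends by \<open>u\<close> are, hence the
  bound on \<open>q\<close> and the threshold \<open>n0 q\<close>.\<close>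

lemma value_measurable_from_tests:
  fixes N :: "('d::finite) path measure"
  assumes space: "space N = cadlag_paths I" and t: "t \<in> I"
    and obs: "\<And>q n i. q \<in> times \<Longrightarrow> t \<le> q \<Longrightarrow> q < u \<Longrightarrow> n0 q \<le> n \<Longrightarrow> obs n q i squash \<in> borel_measurable N"
    and u: "t < u" "t = Sup I \<Longrightarrow> t \<in> times"
  shows "(\<lambda>w. w t) \<in> borel_measurable N"
proof (rule measurable_vector)
  fix i :: 'd
  have times: "(\<lambda>w. w q $ i) \<in> borel_measurable N" if q: "q \<in> times" "t \<le> q" "q < u" for q
  proof -
    have [measurable]: "(\<lambda>w. squash (w q $ i)) \<in> borel_measurable N"
      by (rule borel_measurable_LIMSEQ_real[OF LIMSEQ_ignore_initial_segment[OF test_limit[OF _ q(1)], of _ "n0 q"]])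
        (use obs[OF q] space in auto)
    have [measurable]: "(tan :: real \<Rightarrow> real) \<in> borel_measurable borel"
      unfolding tan_def[abs_def] by measurable
    have "(\<lambda>w. tan (8 * (squash (w q $ i) - 1 / 2))) \<in> borel_measurable N" by measurable
    then show ?thesis unfolding tan_squash .
  qed
  show "(\<lambda>w. w t $ i) \<in> borel_measurable N"
  proof (cases "t = Sup I")
    case True
    then show ?thesis using times[of t] u by simp
  next
    case False
    obtain v where v: "\<And>p. v p \<in> times" "\<And>p. t \<le> v p" "\<And>p. v p < u"
      "\<And>w::'d path. \<And>i. w \<in> cadlag_paths I \<Longrightarrow> (\<lambda>p::nat. w (v p) $ i) \<longlonglongrightarrow> w t $ i"
      by (rule times_right_sequence[OF t False u(1)]) blast
    show ?thesis
      by (rule borel_measurable_LIMSEQ_real[where u = "\<lambda>p w. w (v p) $ i"]) (use v times space in auto)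
  qed
qed

lemma terminal_sigma_generated:
  "sets (terminal_sigma I :: ('d::finite) path measure)
     \<subseteq> sigma_sets (cadlag_paths I) (\<Union>l. {test l -` A \<inter> cadlag_paths I | A. A \<in> sets borel})"
proof -
  let ?S = "\<Union>l. {test l -` A \<inter> cadlag_paths I | A. A \<in> sets borel} :: 'd path set set"
  define N where "N = sigma (cadlag_paths I) ?S"
  have sub: "?S \<subseteq> Pow (cadlag_paths I)" by auto
  have N: "space N = cadlag_paths I" "sets N = sigma_sets (cadlag_paths I) ?S"
    using sub by (simp_all add: N_def space_measure_of sets_measure_of)
  have obs: "obs n q i squash \<in> borel_measurable N" if q: "q \<in> times" for q n i
  proof -
    obtain l where l: "(test l :: 'd path \<Rightarrow> real) = obs n q i squash" by (rule test_eq_obs[OF q])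
    have "test l \<in> borel_measurable N"
    proof (rule measurableI)
      fix A :: "real set" assume "A \<in> sets borel"
      then show "test l -` A \<inter> space N \<in> sets N" unfolding N by (intro sigma_sets.Basic) blast
    qed simp
    then show ?thesis using l by simp
  qed
  have val: "(\<lambda>w. w t) \<in> borel_measurable N" if t: "t \<in> I" for t
  \<comment> \<open>Time infinity is set apart because the general argument asks for some
    \<open>u > t\<close>.\<close>
  proof (cases "t = \<infinity>")
    case True
    then have tS: "t = Sup I" using t in_I_iff[of t] by auto
    then have tt: "t \<in> times" using t by (simp add: times_def)
    show ?thesis
    proof (rule measurable_vector)
      fix i
      have "(\<lambda>w. tan (8 * (obs 0 t i squash w - 1 / 2))) \<in> borel_measurable N"
        using obs[OF tt, of 0 i] unfolding tan_def by measurable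
      then show "(\<lambda>w. w t $ i) \<in> borel_measurable N" unfolding obs_def if_P[OF tS] tan_squash .
    qed
  next
    case False
    then show ?thesis
      by (intro value_measurable_from_tests[OF N(1) t obs, of \<infinity> "\<lambda>_. 0"]) (use t in \<open>auto simp: times_def\<close>)
  qed
  have gen: "{w \<in> cadlag_paths I. w s \<in> A} \<in> sets N" if "s \<in> I" "A \<in> sets borel" for s and A :: "(real^'d) set"
  proof -
    have "{w \<in> cadlag_paths I. w s \<in> A} = (\<lambda>w. w s) -` A \<inter> space N" using N(1) by auto
    then show ?thesis using measurable_sets[OF val[OF that(1)] that(2)] by simp
  qed
  have "sets (raw_filtration I t) \<subseteq> sets N" for t
  proof -
    have "{{w \<in> cadlag_paths I. w s \<in> A} | s A. s \<in> I \<and> s \<le> t \<and> A \<in> sets borel} \<subseteq> sets N" using gen by blast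
    from sets.sigma_sets_subset[OF this] show ?thesis unfolding sets_raw_filtration N(1) .
  qed
  then have "(\<Union>t\<in>I. sets (raw_filtration I t)) \<subseteq> sets N" by blast
  from sets.sigma_sets_subset[OF this] have "sets (terminal_sigma I) \<subseteq> sets N"
    unfolding sets_terminal_sigma N(1) .
  then show ?thesis unfolding N(2) .
qed

lemma limitin_weaker_topology:
  assumes "weaker_topology \<tau> \<sigma>" "limitin \<sigma> s x F"
  shows "limitin \<tau> s x F"
  using assms unfolding weaker_topology_def limitin_def by metis

text \<open>The comparison with the S-topology supplies convergent subsequences, the comparison with
  the Meyer-Zheng topology the continuity of the tests.\<close>

lemma tests_instance:
  fixes \<tau> :: "('d::finite) path topology"
  assumes top: "topspace \<tau> = cadlag_paths I"
    and S: "weaker_topology \<tau> (S_topology I)" and MZ: "weaker_topology (MZ_topology I) \<tau>"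
  shows "countably_tested_space \<tau> (terminal_sigma I) test good_set"
proof
  show "space (terminal_sigma I) = topspace \<tau>" by (simp add: top)
  fix l
  obtain t i n where t: "t \<in> times" and test: "(test l :: 'd path \<Rightarrow> real) = obs n t i squash" by (rule test_cases)
  have tI: "t \<in> I" using t times_subset by auto
  have "continuous_map (MZ_topology I) euclideanreal (test l :: 'd path \<Rightarrow> real)"
    unfolding test by (rule obs_continuous[OF tI continuous_on_squash abs_squash])
  then show "continuous_map \<tau> euclideanreal (test l :: 'd path \<Rightarrow> real)"
    using MZ unfolding weaker_topology_def continuous_map_def by auto
  show "test l \<in> borel_measurable (terminal_sigma I :: 'd path measure)"
    unfolding test by (rule obs_measurable_terminal[OF tI measurable_squash])
  show "0 \<le> test l w \<and> test l w < 1" if "w \<in> topspace \<tau>" for w :: "'d path"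
    using obs_bounds[of w t squash "1/4" "3/4" n i] that tI squash_bounds unfolding test top by force
next
  fix l k k' and w :: "'d path"
  obtain i r m where G: "\<And>k. (good_set l k :: 'd path set) = good i r m k" by (rule good_set_cases) blast
  show "good_set l k \<in> sets (terminal_sigma I :: 'd path measure)" unfolding G by (rule good_sets)
  show "good_set l k \<subseteq> (good_set l k' :: 'd path set)" if "k \<le> k'" unfolding G by (rule good_mono[OF that])
  show "\<exists>k. w \<in> good_set l k" if "w \<in> topspace \<tau>"
    unfolding G using good_exhausts that top by auto
next
  fix s :: "nat \<Rightarrow> 'd path"
  assume s: "range s \<subseteq> topspace \<tau>" and good: "\<exists>k. \<forall>n. s n \<in> good_set l k" for l
  have "s n \<in> cadlag_paths I" for n using s top by auto
  moreover have "\<exists>k. \<forall>n. s n \<in> good i r m k" for i r m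
    using good[of "to_nat (i, r, m)"] unfolding good_set_eq_good .
  ultimately obtain w q where w: "w \<in> cadlag_paths I" "strict_mono q" "limitin (S_topology I) (s \<circ> q) w sequentially"
    "\<And>i r m k. (\<And>n. s n \<in> good i r m k) \<Longrightarrow> w \<in> good i r m k"
    by (rule good_compact) blast
  have "\<forall>l k. (\<forall>n. s n \<in> good_set l k) \<longrightarrow> w \<in> good_set l k"
  proof (intro allI impI)
    fix l k
    obtain i r m where G: "\<And>k. (good_set l k :: 'd path set) = good i r m k" by (rule good_set_cases) blast
    assume "\<forall>n. s n \<in> good_set l k"
    then show "w \<in> good_set l k" unfolding G using w(4) by blast
  qed
  with w(1,2) limitin_weaker_topology[OF S w(3)]
  show "\<exists>w q. w \<in> topspace \<tau> \<and> strict_mono (q::nat \<Rightarrow> nat) \<and> limitin \<tau> (s \<circ> q) w sequentially \<and>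
     (\<forall>l k. (\<forall>n. s n \<in> good_set l k) \<longrightarrow> w \<in> good_set l k)" unfolding top by blast
qed (use tests_separate terminal_sigma_generated top in auto)

end

section \<open>Pathwise inequalities\<close>

text \<open>The elementary integral along a grid. As for elementary integrands, the value on the
  initial time and on the first interval are both given by \<open>c 0\<close>.\<close>

definition transform :: "(nat \<Rightarrow> real) \<Rightarrow> (nat \<Rightarrow> real) \<Rightarrow> nat \<Rightarrow> real" where
  "transform c y N = c 0 * y 0 + (\<Sum>k<N. c k * (y (Suc k) - y k))"

lemma transform_Suc: "transform c y (Suc N) = transform c y N + c N * (y (Suc N) - y N)"
  by (simp add: transform_def)

lemma transform_0: "transform c y 0 = c 0 * y 0"
  by (simp add: transform_def)

text \<open>The sign at the first exceedance is kept for ever after; the decision at each step uses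
  the past only.\<close>

fun exceed_sign :: "real \<Rightarrow> (nat \<Rightarrow> real) \<Rightarrow> nat \<Rightarrow> real" where
  "exceed_sign c y 0 = (if c < \<bar>y 0\<bar> then sgn (y 0) else 0)"
| "exceed_sign c y (Suc k) = (if exceed_sign c y k \<noteq> 0 then exceed_sign c y k
     else if c < \<bar>y (Suc k)\<bar> then sgn (y (Suc k)) else 0)"

lemma exceed_sign_cases: "exceed_sign c y k = 0 \<or> exceed_sign c y k = 1 \<or> exceed_sign c y k = - 1"
  by (induction k) (auto simp: sgn_if)

lemma exceed_sign_nonzero: "0 \<le> c \<Longrightarrow> j \<le> k \<Longrightarrow> c < \<bar>y j\<bar> \<Longrightarrow> exceed_sign c y k \<noteq> 0"
  by (induction k) (auto simp: sgn_if le_Suc_eq)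

text \<open>Holding \<open>- sgn (y \<tau>)\<close> from the first exceedance \<open>\<tau>\<close>
  on gains \<open>\<bar>y \<tau>\<bar> - sgn (y \<tau>) * y N\<close>, which exceeds
  \<open>c - \<bar>y N\<bar>\<close>. The term \<open>\<bar>y 0\<bar>\<close> pays for an exceedance
  at time 0, where the integrand also multiplies the initial value.\<close>

lemma maximal_inequality_pathwise:
  assumes "0 \<le> c"
  shows "c * of_bool (\<exists>j\<le>N. c < \<bar>y j\<bar>) \<le> transform (\<lambda>k. - exceed_sign c y k) y N + \<bar>y 0\<bar> + \<bar>y N\<bar>"
proof -
  let ?s = "exceed_sign c y" and ?W = "transform (\<lambda>k. - exceed_sign c y k) y"
  have "if ?s N = 0 then ?W N = 0 else c - \<bar>y 0\<bar> - ?s N * y N \<le> ?W N"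
  proof (induction N)
    case 0
    then show ?case by (auto simp: transform_0)
  next
    case (Suc N)
    show ?case
    proof (cases "?s N = 0")
      case True
      then have "?W (Suc N) = 0" using Suc by (simp add: transform_Suc)
      moreover have "c < ?s (Suc N) * y (Suc N)" if "?s (Suc N) \<noteq> 0"
        using that True by (auto simp: sgn_if split: if_splits)
      ultimately show ?thesis by (auto simp del: exceed_sign.simps)
    next
      case False
      then have "?s (Suc N) = ?s N" by simp
      then show ?thesis using Suc False by (simp add: transform_Suc algebra_simps del: exceed_sign.simps)
    qed
  qed
  moreover have "- ?s N * y N \<ge> - \<bar>y N\<bar>" using exceed_sign_cases[of c y N] by auto
  moreover have "?s N \<noteq> 0" if "\<exists>j\<le>N. c < \<bar>y j\<bar>" using that exceed_sign_nonzero[OF assms] by blast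
  ultimately show ?thesis by (cases "?s N = 0") (auto simp: of_bool_def)
qed

definition clip :: "real \<Rightarrow> real \<Rightarrow> real" where
  "clip C v = max (- C) (min C v)"

text \<open>Clipping bounds the position by \<open>C\<close> on every path, so that the anchor
  divided by \<open>C\<close> is an admissible integrand; on paths within \<open>[- C, C]\<close> it
  has no effect.\<close>

fun anchor :: "real \<Rightarrow> real \<Rightarrow> (nat \<Rightarrow> real) \<Rightarrow> nat \<Rightarrow> real" where
  "anchor \<epsilon> C y 0 = clip C (y 0)"
| "anchor \<epsilon> C y (Suc k) = (if \<epsilon> < \<bar>y (Suc k) - anchor \<epsilon> C y k\<bar> then clip C (y (Suc k)) else anchor \<epsilon> C y k)"

lemma anchor_bound: "0 \<le> C \<Longrightarrow> \<bar>anchor \<epsilon> C y k\<bar> \<le> C"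
  by (induction k) (auto simp: clip_def)

text \<open>The difference of the two sides is the change of \<open>L\<close> in the proof of
  \<open>oscillation_inequality_pathwise\<close> when the anchor moves from \<open>p\<close> to the
  clipped value. Inside \<open>[- C, C]\<close> it equals \<open>(v - p)\<^sup>2 / 2\<close>;
  outside, the part of \<open>v\<close> beyond the clip has the same sign as the move.\<close>

lemma clip_gain_nonneg:
  assumes "\<bar>p\<bar> \<le> C"
  shows "((clip C v)\<^sup>2 - p\<^sup>2) / 2 \<le> (clip C v - p) * v"
proof -
  have C: "- C \<le> p" "p \<le> C" using assms by auto
  have "0 \<le> (clip C v - p) * (v - (clip C v + p) / 2)"
  proof -
    consider "v > C" | "v < - C" | "- C \<le> v" "v \<le> C" by linarith
    then show ?thesis
    proof cases
      case 1
      then have "clip C v = C" using C by (simp add: clip_def)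
      then show ?thesis using C 1 by (intro mult_nonneg_nonneg) (auto simp: field_simps)
    next
      case 2
      then have "clip C v = - C" using C by (simp add: clip_def)
      then show ?thesis using C 2 by (intro mult_nonpos_nonpos) (auto simp: field_simps)
    next
      case 3
      then have "clip C v = v" by (simp add: clip_def)
      then have "(clip C v - p) * (v - (clip C v + p) / 2) = (v - p)\<^sup>2 / 2" by (simp add: power2_eq_square field_simps)
      also have "0 \<le> \<dots>" by simp
      finally show ?thesis .
    qed
  qed
  then show ?thesis by (simp add: power2_eq_square field_simps)
qed

text \<open>
  Trading against the anchor: \<open>L k\<close> is the gain of the strategy \<open>- anchor\<close>, liquidated at the anchor
  price.  It never decreases, and increases by at least \<open>\<epsilon>\<^sup>2 / 2\<close> whenever the anchor moves.
\<close>

lemma oscillation_inequality_pathwise: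
  fixes y :: "nat \<Rightarrow> real" and N k :: nat
  assumes \<epsilon>: "0 \<le> \<epsilon>" and C: "0 < C"
  defines "osc \<equiv> \<exists>l::nat list. (\<forall>j<2 * k. \<forall>i\<le>j. l ! i \<le> l ! j) \<and> (\<forall>j<2 * k. l ! j \<le> N) \<and>
     (\<forall>j<k. 2 * \<epsilon> < \<bar>y (l ! (2 * j + 1)) - y (l ! (2 * j))\<bar>)"
  shows "real k * (\<epsilon>\<^sup>2 / 2) * of_bool ((\<forall>j\<le>N. \<bar>y j\<bar> \<le> C) \<and> osc)
    \<le> C * transform (\<lambda>k. - anchor \<epsilon> C y k / C) y N + C * \<bar>y N\<bar> + C\<^sup>2 / 2"
proof -
  let ?p = "anchor \<epsilon> C y"
  define W where "W n = C * transform (\<lambda>k. - ?p k / C) y n" for n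
  \<comment> \<open>With this correction \<open>L\<close> stays constant while the anchor rests, and
    changes by the difference estimated in \<open>clip_gain_nonneg\<close> when it moves.\<close>
  define L where "L n = W n + ?p n * y n - (?p n)\<^sup>2 / 2" for n
  have W_Suc: "W (Suc n) = W n - ?p n * (y (Suc n) - y n)" for n
    using C by (simp add: W_def transform_Suc field_simps)
  have pC: "\<bar>?p n\<bar> \<le> C" for n using anchor_bound C by simp
  have "(?p n)\<^sup>2 \<le> C\<^sup>2" for n using pC[of n] C by (intro abs_le_square_iff[THEN iffD1]) simp
  have L_Suc: "L n \<le> L (Suc n)" for n
    using clip_gain_nonneg[OF pC, of "y (Suc n)" n] unfolding L_def W_Suc by (simp add: algebra_simps diff_divide_distrib)
  have mono: "L n \<le> L n'" if "n \<le> n'" for n n' using lift_Suc_mono_le[of L, OF L_Suc that] .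
  have L0: "L 0 \<ge> - C\<^sup>2 / 2"
    using C \<open>(?p 0)\<^sup>2 \<le> C\<^sup>2\<close> by (simp add: L_def W_def transform_0 del: anchor.simps)
  have LN: "L N \<ge> - C\<^sup>2 / 2 + real k * (\<epsilon>\<^sup>2 / 2)" if bd: "\<forall>j\<le>N. \<bar>y j\<bar> \<le> C" and osc
  proof -
    obtain l :: "nat list" where l: "\<And>j i. j < 2 * k \<Longrightarrow> i \<le> j \<Longrightarrow> l ! i \<le> l ! j" "\<And>j. j < 2 * k \<Longrightarrow> l ! j \<le> N"
       "\<And>j. j < k \<Longrightarrow> 2 * \<epsilon> < \<bar>y (l ! (2 * j + 1)) - y (l ! (2 * j))\<bar>"
      using \<open>osc\<close> unfolding osc_def by blast
    have yc: "clip C (y n) = y n" if "n \<le> N" for n using bd that by (auto simp: clip_def max_def min_def abs_le_iff)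
    have near: "\<bar>y n - ?p n\<bar> \<le> \<epsilon>" if "n \<le> N" for n
      using yc[OF that] \<epsilon> by (cases n) auto
    have jump: "L n + \<epsilon>\<^sup>2 / 2 \<le> L (Suc n)" if "Suc n \<le> N" "?p (Suc n) \<noteq> ?p n" for n
    proof -
      have p: "?p (Suc n) = y (Suc n)" "\<epsilon> < \<bar>y (Suc n) - ?p n\<bar>"
        using that yc[of "Suc n"] by (auto split: if_splits)
      have "\<epsilon>\<^sup>2 \<le> (y (Suc n) - ?p n)\<^sup>2" using p(2) \<epsilon> by (intro abs_le_square_iff[THEN iffD1]) simp
      then show ?thesis unfolding L_def W_Suc p(1) by (simp add: power2_eq_square field_simps)
    qed
    \<comment> \<open>Otherwise the anchor rests between \<open>a\<close> and \<open>b\<close>, and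
      \<open>y\<close> lies within \<open>\<epsilon>\<close> of it at both ends, too close for an
      increment above \<open>2 * \<epsilon>\<close>.\<close>
    have pair: "L a + \<epsilon>\<^sup>2 / 2 \<le> L b" if ab: "a \<le> b" "b \<le> N" "2 * \<epsilon> < \<bar>y b - y a\<bar>" for a b
    proof (rule ccontr)
      assume "\<not> ?thesis"
      then have const: "?p (Suc n) = ?p n" if "a \<le> n" "Suc n \<le> b" for n
        using jump[of n] mono[of a n] mono[of "Suc n" b] that ab by force
      have "n \<le> b \<longrightarrow> ?p n = ?p a" if "a \<le> n" for n
        using that by (induction n rule: dec_induct) (use const in \<open>auto simp del: anchor.simps\<close>)
      from this[of b] near[of a] near[of b] ab show False by simp
    qed
    \<comment> \<open>Oscillation number \<open>j\<close>, counted from 1, ends at position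
      \<open>2 * j - 1\<close>; each one adds \<open>\<epsilon>\<^sup>2 / 2\<close> to the initial
      value, which is at least \<open>- C\<^sup>2 / 2\<close>.\<close>
    have "L (if j = 0 then 0 else l ! (2 * j - 1)) \<ge> - C\<^sup>2 / 2 + real j * (\<epsilon>\<^sup>2 / 2)" if "j \<le> k" for j
      using that
    proof (induction j)
      case (Suc j)
      have "(if j = 0 then 0 else l ! (2 * j - 1)) \<le> l ! (2 * j)" using l(1)[of "2 * j" "2 * j - 1"] Suc.prems by auto
      from mono[OF this] have "- C\<^sup>2 / 2 + real j * (\<epsilon>\<^sup>2 / 2) \<le> L (l ! (2 * j))" using Suc by simp
      also have "L (l ! (2 * j)) + \<epsilon>\<^sup>2 / 2 \<le> L (l ! (2 * j + 1))"
        using Suc.prems l by (intro pair) auto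
      ultimately show ?case by (simp add: algebra_simps add_divide_distrib)
    qed (use L0 in simp)
    from this[of k] have "- C\<^sup>2 / 2 + real k * (\<epsilon>\<^sup>2 / 2) \<le> L (if k = 0 then 0 else l ! (2 * k - 1))" by simp
    also have "\<dots> \<le> L N" using l(2)[of "2 * k - 1"] by (intro mono) auto
    finally show ?thesis .
  qed
  have "- ?p N * y N \<ge> - (C * \<bar>y N\<bar>)"
  proof -
    have "\<bar>?p N * y N\<bar> \<le> C * \<bar>y N\<bar>" unfolding abs_mult by (intro mult_right_mono pC) simp
    then show ?thesis by linarith
  qed
  then have "W N \<ge> L N - C * \<bar>y N\<bar>" unfolding L_def using zero_le_power2[of "?p N"] by linarith
  then show ?thesis
    using LN mono[of 0 N] L0 unfolding W_def[symmetric] by (cases "(\<forall>j\<le>N. \<bar>y j\<bar> \<le> C) \<and> osc") auto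
qed

section \<open>Uniform tightness\<close>

text \<open>The lower limit of the events \<open>B p\<close> has mass at most \<open>b\<close>; this
  passes from grids, on which the estimates hold, to whole paths.\<close>

lemma (in finite_measure) measure_le_if_eventually_in:
  assumes A: "A \<in> sets M" and B: "\<And>p::nat. B p \<in> sets M" "\<And>p. measure M (B p) \<le> b"
    and ev: "\<And>x. x \<in> A \<Longrightarrow> \<forall>\<^sub>F p in sequentially. x \<in> B p"
  shows "measure M A \<le> b"
proof -
  define D where "D n = (\<Inter>p\<in>{n..}. A \<inter> B p)" for n
  have D: "D n \<in> sets M" for n unfolding D_def using A B by (intro sets.countable_INT') auto
  have "incseq D" unfolding D_def by (intro incseq_SucI) auto
  moreover have "(\<Union>n. D n) = A"
  proof
    show "A \<subseteq> (\<Union>n. D n)" using ev unfolding D_def eventually_sequentially by fastforce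
  qed (auto simp: D_def)
  ultimately have "(\<lambda>n. measure M (D n)) \<longlonglongrightarrow> measure M A"
    using finite_Lim_measure_incseq[of D] D by auto
  moreover have "measure M (D n) \<le> b" for n
  proof -
    have "measure M (D n) \<le> measure M (B n)" using B by (intro finite_measure_mono) (auto simp: D_def)
    then show ?thesis using B(2)[of n] by linarith
  qed
  ultimately show ?thesis by (intro LIMSEQ_le_const2) auto
qed

lemma exceed_sign_measurable:
  assumes "\<And>j. j \<le> k \<Longrightarrow> y j \<in> borel_measurable M"
  shows "(\<lambda>w. exceed_sign c (\<lambda>j. y j w) k) \<in> borel_measurable M"
  using assms
proof (induction k)
  case 0
  then have [measurable]: "y 0 \<in> borel_measurable M" by simp
  show ?case unfolding exceed_sign.simps by measurable
next
  case (Suc k)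
  then have [measurable]: "y (Suc k) \<in> borel_measurable M" "(\<lambda>w. exceed_sign c (\<lambda>j. y j w) k) \<in> borel_measurable M"
    by simp_all
  show ?case unfolding exceed_sign.simps by measurable
qed

lemma anchor_measurable:
  assumes "\<And>j. j \<le> k \<Longrightarrow> y j \<in> borel_measurable M"
  shows "(\<lambda>w. anchor \<epsilon> C (\<lambda>j. y j w) k) \<in> borel_measurable M"
  using assms
proof (induction k)
  case 0
  then have [measurable]: "y 0 \<in> borel_measurable M" by simp
  show ?case unfolding anchor.simps clip_def by measurable
next
  case (Suc k)
  then have [measurable]: "y (Suc k) \<in> borel_measurable M" "(\<lambda>w. anchor \<epsilon> C (\<lambda>j. y j w) k) \<in> borel_measurable M"
    by simp_all
  show ?case unfolding anchor.simps clip_def by measurable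
qed

lemma integrable_mult_bounded:
  fixes f g :: "'a \<Rightarrow> real"
  assumes g: "g \<in> borel_measurable M" "\<And>x. x \<in> space M \<Longrightarrow> \<bar>g x\<bar> \<le> 1" and f: "integrable M f"
  shows "integrable M (\<lambda>x. g x * f x)"
proof (rule Bochner_Integration.integrable_bound[OF f])
  show "(\<lambda>x. g x * f x) \<in> borel_measurable M" using g(1) f by measurable
  have "norm (g x * f x) \<le> norm (f x)" if "x \<in> space M" for x
    using mult_right_mono[OF g(2)[OF that], of "\<bar>f x\<bar>"] by (simp add: abs_mult)
  then show "AE x in M. norm (g x * f x) \<le> norm (f x)" by (rule AE_I2)
qed

lemma abs_nth_le_l1_norm: "\<bar>x $ i\<bar> \<le> l1_norm x"
  unfolding l1_norm_def by (rule member_le_sum) auto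

text \<open>The last assumption is the uniform integrability of the negative parts.\<close>

locale UI_family = time_line +
  fixes \<M> :: "('d::finite) path measure set" and K :: real
  assumes supermartingale_measure: "Q \<in> \<M> \<Longrightarrow> supermartingale_measure I Q"
    and K_nonneg: "0 \<le> K"
    and l1_norm_bound: "Q \<in> \<M> \<Longrightarrow> t \<in> I \<Longrightarrow> (\<integral>w. l1_norm (w t) \<partial>Q) \<le> K"
    and elementary_integral_bound: "Q \<in> \<M> \<Longrightarrow> t \<in> I \<Longrightarrow> H \<in> elementary_integrands I Q \<Longrightarrow>
          (\<integral>w. elementary_integral H t w \<partial>Q) \<le> K"
    and neg_part_excess: "t \<in> I \<Longrightarrow> 0 < \<eta> \<Longrightarrow> \<exists>c. \<forall>Q\<in>\<M>. (\<integral>w. max 0 (- (w t $ i) - c) \<partial>Q) \<le> \<eta>"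
begin

lemma members:
  assumes "Q \<in> \<M>"
  shows "prob_space Q" "space Q = cadlag_paths I" "sets Q = sets (terminal_sigma I)"
    and "t \<in> I \<Longrightarrow> integrable Q (\<lambda>w. w t $ i)"
  using supermartingale_measure[OF assms] by (auto simp: supermartingale_measure_def supermartingale_def)

lemma abs_integral_bound:
  assumes Q: "Q \<in> \<M>" and t: "t \<in> I"
  shows "(\<integral>w. \<bar>w t $ i\<bar> \<partial>Q) \<le> K"
proof -
  have "integrable Q (\<lambda>w. l1_norm (w t))"
    unfolding l1_norm_def using members(4)[OF Q t] by (intro Bochner_Integration.integrable_sum integrable_abs)
  then have "(\<integral>w. \<bar>w t $ i\<bar> \<partial>Q) \<le> (\<integral>w. l1_norm (w t) \<partial>Q)"
    using members(4)[OF Q t] abs_nth_le_l1_norm by (intro integral_mono) auto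
  also have "\<dots> \<le> K" by (rule l1_norm_bound[OF Q t])
  finally show ?thesis .
qed

text \<open>The integrand trades coordinate \<open>i\<close> alone, so the sum over coordinates
  collapses; the raw past is contained in the right-continuous one, which makes the strategy an
  elementary integrand.\<close>

lemma transform_bound:
  assumes Q: "Q \<in> \<M>" and c: "\<And>k. k \<le> N \<Longrightarrow> c k \<in> borel_measurable (raw_filtration I (ereal (grid p k)))"
    "\<And>k w. \<bar>c k w\<bar> \<le> 1"
  shows "integrable Q (\<lambda>w. transform (\<lambda>k. c k w) (\<lambda>k. component i w (grid p k)) N)"
    and "(\<integral>w. transform (\<lambda>k. c k w) (\<lambda>k. component i w (grid p k)) N \<partial>Q) \<le> K"
proof -
  let ?T = "\<lambda>w. transform (\<lambda>k. c k w) (\<lambda>k. component i w (grid p k)) N"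
  have cQ: "c k \<in> borel_measurable Q" if "k \<le> N" for k
    using measurable_from_subset[OF c(1)[OF that], of Q] raw_filtration_subset_terminal members(2,3)[OF Q] by auto
  have y: "integrable Q (\<lambda>w. component i w (grid p k))" for k
    unfolding component_def by (rule members(4)[OF Q grid_in_I])
  have "integrable Q (\<lambda>w. c k w * f w)" if "k \<le> N" "integrable Q f" for k f
    by (rule integrable_mult_bounded[OF cQ[OF that(1)] c(2) that(2)])
  then show "integrable Q ?T"
    unfolding transform_def using y
    by (intro Bochner_Integration.integrable_add Bochner_Integration.integrable_sum Bochner_Integration.integrable_diff) auto
  let ?h = "\<lambda>j k w. if j = i then c k w else 0" and ?t = "\<lambda>(j::'d) k. ereal (grid p k)"
  have "elementary_integral (N, ?t, ?h) (ereal (grid p N)) w = ?T w" for w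
  proof -
    have "(\<Sum>k=1..N. c (k - 1) w * (w (min (ereal (grid p k)) (ereal (grid p N))) $ i - w (min (ereal (grid p (k - 1))) (ereal (grid p N))) $ i))
      = (\<Sum>k=1..N. c (k - 1) w * (component i w (grid p k) - component i w (grid p (k - 1))))"
      by (intro sum.cong refl) (auto simp: component_def grid_mono min_absorb1)
    also have "\<dots> = (\<Sum>k<N. c k w * (component i w (grid p (Suc k)) - component i w (grid p k)))"
      by (rule sum.reindex_bij_witness[of _ Suc "\<lambda>k. k - 1"]) auto
    finally have "elementary_integral (N, ?t, ?h) (ereal (grid p N)) w = (\<Sum>j\<in>UNIV. if j = i then ?T w else 0)"
      unfolding elementary_integral_def transform_def prod.case
      by (intro sum.cong refl) (simp add: grid_0 component_def zero_ereal_def)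
    then show ?thesis by simp
  qed
  moreover have "(N, ?t, ?h) \<in> elementary_integrands I Q"
  proof -
    have "?h j k \<in> borel_measurable (rc_filtration I (ereal (grid p k)))" if "k \<le> N" for j k
      using measurable_from_subset[OF c(1)[OF that] raw_filtration_subset_rc] by (cases "j = i") auto
    then show ?thesis using c(2) by (auto simp: elementary_integrands_def grid_0 grid_in_I grid_mono)
  qed
  ultimately show "(\<integral>w. ?T w \<partial>Q) \<le> K"
    using elementary_integral_bound[OF Q grid_in_I[of p N], of "(N, ?t, ?h)"] by (simp only: simp_thms)
qed

lemma grid_component_facts:
  assumes Q: "Q \<in> \<M>"
  shows "integrable Q (\<lambda>w. component i w (grid p k))" "(\<integral>w. \<bar>component i w (grid p k)\<bar> \<partial>Q) \<le> K"
    "(\<lambda>w. component i w (grid p k)) \<in> borel_measurable Q"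
    and "j \<le> k \<Longrightarrow> (\<lambda>w. component i w (grid p j)) \<in> borel_measurable (raw_filtration I (ereal (grid p k)) :: 'd path measure)"
proof -
  show "integrable Q (\<lambda>w. component i w (grid p k))" "(\<integral>w. \<bar>component i w (grid p k)\<bar> \<partial>Q) \<le> K"
    unfolding component_def using members(4)[OF Q grid_in_I] abs_integral_bound[OF Q grid_in_I] by auto
  then show "(\<lambda>w. component i w (grid p k)) \<in> borel_measurable Q" by auto
  show "j \<le> k \<Longrightarrow> (\<lambda>w. component i w (grid p j)) \<in> borel_measurable (raw_filtration I (ereal (grid p k)) :: 'd path measure)"
    unfolding component_def by (intro coordinate_measurable grid_in_I) (simp add: grid_mono)
qed

text \<open>Expectation of the pathwise inequality: one \<open>K\<close> for the elementary integral
  and one for each of the first moments at the grid times with index 0 and \<open>N\<close>. The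
  bound depends on neither \<open>N\<close> nor \<open>p\<close>.\<close>

lemma maximal_inequality:
  assumes Q: "Q \<in> \<M>" and c: "0 < c"
  shows "measure Q {w \<in> space Q. \<exists>j\<le>N. c < \<bar>component i w (grid p j)\<bar>} \<le> 3 * K / c"
proof -
  interpret prob_space Q by (rule members(1)[OF Q])
  note y = grid_component_facts[OF Q, where i = i and p = p]
  note [measurable] = y(3)
  let ?E = "{w \<in> space Q. \<exists>j\<le>N. c < \<bar>component i w (grid p j)\<bar>}"
  let ?T = "\<lambda>w. transform (\<lambda>k. - exceed_sign c (\<lambda>k. component i w (grid p k)) k) (\<lambda>k. component i w (grid p k)) N"
  have E: "?E \<in> sets Q" by measurable
  have T: "integrable Q ?T" "(\<integral>w. ?T w \<partial>Q) \<le> K"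
  proof (rule_tac [!] transform_bound[OF Q])
    show "(\<lambda>w. - exceed_sign c (\<lambda>k. component i w (grid p k)) k) \<in> borel_measurable (raw_filtration I (ereal (grid p k)))" for k
      by (intro borel_measurable_uminus exceed_sign_measurable y(4))
    then show "(\<lambda>w. - exceed_sign c (\<lambda>k. component i w (grid p k)) k) \<in> borel_measurable (raw_filtration I (ereal (grid p k)))" for k .
    show "\<bar>- exceed_sign c (\<lambda>k. component i w (grid p k)) k\<bar> \<le> 1" for k w
      using exceed_sign_cases[of c "\<lambda>k. component i w (grid p k)" k] by auto
    then show "\<bar>- exceed_sign c (\<lambda>k. component i w (grid p k)) k\<bar> \<le> 1" for k w .
  qed
  have "(\<integral>w. c * indicator ?E w \<partial>Q) \<le> (\<integral>w. ?T w + \<bar>component i w (grid p 0)\<bar> + \<bar>component i w (grid p N)\<bar> \<partial>Q)"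
  proof (rule integral_mono)
    show "integrable Q (\<lambda>w. c * indicator ?E w)" using E by (simp add: emeasure_eq_measure)
    show "integrable Q (\<lambda>w. ?T w + \<bar>component i w (grid p 0)\<bar> + \<bar>component i w (grid p N)\<bar>)"
      using T(1) y(1) by (intro Bochner_Integration.integrable_add integrable_abs)
    fix w assume "w \<in> space Q"
    then show "c * indicator ?E w \<le> ?T w + \<bar>component i w (grid p 0)\<bar> + \<bar>component i w (grid p N)\<bar>"
      using maximal_inequality_pathwise[of c N "\<lambda>k. component i w (grid p k)"] c by (simp add: indicator_def of_bool_def)
  qed
  also have "\<dots> = (\<integral>w. ?T w \<partial>Q) + (\<integral>w. \<bar>component i w (grid p 0)\<bar> \<partial>Q) + (\<integral>w. \<bar>component i w (grid p N)\<bar> \<partial>Q)"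
    using T(1) y(1) by (simp add: integrable_abs)
  also have "\<dots> \<le> 3 * K" using T(2) y(2)[of 0] y(2)[of N] by linarith
  finally have "c * measure Q ?E \<le> 3 * K" using E by simp
  then show ?thesis using c by (simp add: field_simps)
qed

text \<open>An index above \<open>2 ^ p * (r + 1)\<close> can reach the horizon only if
  \<open>I\<close> ends before \<open>r + 1\<close>; its grid time is then the terminal one, which
  the cut index gives as well. Finitely many indices thus cover the horizon.\<close>

lemma grid_min:
  assumes "grid p z \<in> horizon r"
  shows "grid p (min z (2 ^ p * (r + 1))) = grid p z"
proof (cases "z \<le> 2 ^ p * (r + 1)")
  case False
  then have z: "z > 2 ^ p * (r + 1)" by simp
  have eq: "real (2 ^ p * (r + 1)) / 2 ^ p = real r + 1" by (simp add: add_divide_distrib distrib_left)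
  have "real (2 ^ p * (r + 1)) / 2 ^ p \<le> real z / 2 ^ p" by (rule divide_right_mono[OF of_nat_le_iff[THEN iffD2, OF less_imp_le[OF z]]]) simp
  then have ge: "real r + 1 \<le> real z / 2 ^ p" unfolding eq .
  have lt: "grid p z < real r + 1" using assms by (simp add: horizon_def)
  show ?thesis
    using z ge lt eq unfolding grid_def by (auto simp: min_def split: if_splits)
qed simp

text \<open>The numerator collects \<open>C * K\<close> from the strategy, \<open>C * K\<close> from
  closing the position at index \<open>N\<close>, and the possible initial loss
  \<open>C\<^sup>2 / 2\<close>.\<close>

lemma oscillation_inequality:
  fixes i :: 'd
  assumes Q: "Q \<in> \<M>" and \<epsilon>: "0 < \<epsilon>" and C: "0 < C" and k: "0 < k" and N: "2 ^ p * (r + 1) \<le> N"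
  defines "E \<equiv> {w \<in> space Q. (\<forall>j\<le>N. \<bar>component i w (grid p j)\<bar> \<le> C) \<and> grid_oscillates (component i w) (2 * \<epsilon>) r k p}"
  assumes E: "E \<in> sets Q"
  shows "measure Q E \<le> (2 * C * K + C\<^sup>2 / 2) / (real k * (\<epsilon>\<^sup>2 / 2))"
proof -
  interpret prob_space Q by (rule members(1)[OF Q])
  note y = grid_component_facts[OF Q, where i = i and p = p]
  let ?y = "\<lambda>w k. component i w (grid p k)"
  let ?T = "\<lambda>w. transform (\<lambda>k. - anchor \<epsilon> C (?y w) k / C) (?y w) N"
  let ?a = "real k * (\<epsilon>\<^sup>2 / 2)"
  have m: "(\<lambda>w. - anchor \<epsilon> C (?y w) k / C) \<in> borel_measurable (raw_filtration I (ereal (grid p k)))" for k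
    by (intro borel_measurable_divide borel_measurable_const borel_measurable_uminus anchor_measurable y(4))
  have b: "\<bar>- anchor \<epsilon> C (?y w) k / C\<bar> \<le> 1" for k w
    using anchor_bound[of C \<epsilon> "?y w" k] C by simp
  note T = transform_bound[OF Q m b, where i = i and N = N]
  have "(\<integral>w. ?a * indicator E w \<partial>Q) \<le> (\<integral>w. C * ?T w + C * \<bar>?y w N\<bar> + C\<^sup>2 / 2 \<partial>Q)"
  proof (rule integral_mono)
    show "integrable Q (\<lambda>w. ?a * indicator E w)" using E by (simp add: emeasure_eq_measure)
    show "integrable Q (\<lambda>w. C * ?T w + C * \<bar>?y w N\<bar> + C\<^sup>2 / 2)" using T(1) y(1)[of N] by simp
    fix w assume w: "w \<in> space Q"
    have "\<exists>l::nat list. (\<forall>j<2 * k. \<forall>i\<le>j. l ! i \<le> l ! j) \<and> (\<forall>j<2 * k. l ! j \<le> N) \<and>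
       (\<forall>j<k. 2 * \<epsilon> < \<bar>?y w (l ! (2 * j + 1)) - ?y w (l ! (2 * j))\<bar>)" if wE: "w \<in> E"
    proof -
      obtain l :: "nat list" where l: "length l = 2 * k" "\<And>j i. j < 2 * k \<Longrightarrow> i \<le> j \<Longrightarrow> l ! i \<le> l ! j"
        "\<And>j. j < 2 * k \<Longrightarrow> grid p (l ! j) \<in> horizon r"
        "\<And>j. j < k \<Longrightarrow> 2 * \<epsilon> < \<bar>?y w (l ! (2 * j + 1)) - ?y w (l ! (2 * j))\<bar>"
        using wE unfolding E_def grid_oscillates_def by blast
      \<comment> \<open>Cutting indices at \<open>B\<close> leaves the grid times in the horizon
        unchanged and brings all indices below \<open>N\<close>.\<close>
      define B where "B = 2 ^ p * (r + 1)"
      let ?l = "map (\<lambda>z. min z B) l"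
      have nth: "?l ! j = min (l ! j) B" if "j < 2 * k" for j using that l(1) by simp
      show ?thesis
      proof (intro exI[of _ ?l] conjI allI impI)
        fix j i assume "j < 2 * k" "i \<le> j"
        then show "?l ! i \<le> ?l ! j" using l(2)[of j i] by (simp add: nth min.coboundedI1 del: nth_map)
      next
        fix j assume "j < 2 * k"
        then show "?l ! j \<le> N" using N[folded B_def] by (simp add: nth min.coboundedI2 del: nth_map)
      next
        fix j assume j: "j < k"
        then show "2 * \<epsilon> < \<bar>?y w (?l ! (2 * j + 1)) - ?y w (?l ! (2 * j))\<bar>"
          using l(4)[OF j] grid_min[OF l(3)[of "2 * j"], folded B_def] grid_min[OF l(3)[of "2 * j + 1"], folded B_def]
          by (simp add: nth del: nth_map)
      qed
    qed
    moreover have "\<forall>j\<le>N. \<bar>?y w j\<bar> \<le> C" if "w \<in> E" using that by (simp add: E_def)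
    ultimately have "?a * indicator E w \<le> ?a * of_bool ((\<forall>j\<le>N. \<bar>?y w j\<bar> \<le> C) \<and>
       (\<exists>l::nat list. (\<forall>j<2 * k. \<forall>i\<le>j. l ! i \<le> l ! j) \<and> (\<forall>j<2 * k. l ! j \<le> N) \<and>
       (\<forall>j<k. 2 * \<epsilon> < \<bar>?y w (l ! (2 * j + 1)) - ?y w (l ! (2 * j))\<bar>)))"
      by (cases "w \<in> E") auto
    also have "\<dots> \<le> C * ?T w + C * \<bar>?y w N\<bar> + C\<^sup>2 / 2"
      using \<epsilon> C by (intro oscillation_inequality_pathwise) auto
    finally show "?a * indicator E w \<le> C * ?T w + C * \<bar>?y w N\<bar> + C\<^sup>2 / 2" .
  qed
  also have "\<dots> = C * (\<integral>w. ?T w \<partial>Q) + C * (\<integral>w. \<bar>?y w N\<bar> \<partial>Q) + C\<^sup>2 / 2"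
    using T(1) y(1)[of N] by (simp add: prob_space)
  also have "\<dots> \<le> C * K + C * K + C\<^sup>2 / 2"
    using C T(2) y(2)[of N] by (intro add_mono mult_left_mono) auto
  finally have "?a * measure Q E \<le> 2 * C * K + C\<^sup>2 / 2" using E by simp
  then show ?thesis using k \<epsilon> by (simp add: pos_le_divide_eq mult.commute)
qed

text \<open>A path outside the good set exceeds \<open>k\<close> in the horizon, exceeds
  \<open>C\<close> on the grid, oscillates \<open>k\<close> times while staying within
  \<open>C\<close>, or exceeds \<open>k\<close> at the terminal time. The level \<open>C\<close> is
  separate from \<open>k\<close> since the oscillation estimate contains \<open>C\<^sup>2\<close>:
  with \<open>C = k\<close> it would not become small.\<close>

lemma not_good_bound:
  assumes Q: "Q \<in> \<M>" and C: "0 < C" and k: "0 < k"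
  shows "measure Q (cadlag_paths I - good i r m k) \<le> 3 * K / C +
     (4 * K + 8 * (real (Suc m))\<^sup>2 * (2 * C * K + C\<^sup>2 / 2)) / real k"
proof -
  interpret prob_space Q by (rule members(1)[OF Q])
  note space = members(2)[OF Q] and sets = members(3)[OF Q]
  note [measurable] = grid_component_facts(3)[OF Q]
  define N :: "nat \<Rightarrow> nat" where "N p = 2 ^ p * (r + 1)" for p
  define X where "X c p = {w \<in> space Q. \<exists>j\<le>N p. c < \<bar>component i w (grid p j)\<bar>}" for c p
  \<comment> \<open>The pathwise inequality counts increments above \<open>2 * \<epsilon>\<close>,
    whereas good sets use \<open>1 / (m + 1)\<close>; with the division by 2 in the gain this leads
    to the factor 8.\<close>
  define \<epsilon> where "\<epsilon> = 1 / (2 * real (Suc m))"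
  define Y where "Y p = {w \<in> space Q. (\<forall>j\<le>N p. \<bar>component i w (grid p j)\<bar> \<le> C) \<and> grid_oscillates (component i w) (2 * \<epsilon>) r k p}" for p
  define Z where "Z = {w \<in> space Q. Sup I \<in> I \<and> real k < \<bar>w (Sup I) $ i\<bar>}"
  have \<epsilon>: "0 < \<epsilon>" "2 * \<epsilon> = 1 / real (Suc m)" by (simp_all add: \<epsilon>_def field_simps)
  have X: "X c p \<in> sets Q" for c p unfolding X_def by measurable
  have Y: "Y p \<in> sets Q" for p
  proof -
    have a: "{w \<in> space Q. grid_oscillates (component i w) (2 * \<epsilon>) r k p} \<in> sets Q"
      using grid_oscillates_sets[of i "2 * \<epsilon>" r k p] unfolding sets space space_terminal_sigma .
    have "{w \<in> space Q. \<forall>j\<le>N p. \<bar>component i w (grid p j)\<bar> \<le> C} \<in> sets Q" by measurable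
    from sets.sets_Collect_conj[OF a this] show ?thesis unfolding Y_def .
  qed
  have Z: "Z \<in> sets Q" "measure Q Z \<le> K / real k"
  proof -
    have "Z \<in> sets Q \<and> measure Q Z \<le> K / real k"
    proof (cases "Sup I \<in> I")
      case True
      note int = members(4)[OF Q True, of i]
      have ZQ: "Z \<in> sets Q" unfolding Z_def using True borel_measurable_integrable[OF int] by measurable
      have "measure Q Z \<le> measure Q {w \<in> space Q. real k \<le> \<bar>w (Sup I) $ i\<bar>}"
        using borel_measurable_integrable[OF int] by (intro finite_measure_mono) (auto simp: Z_def)
      also have "\<dots> \<le> (\<integral>w. \<bar>w (Sup I) $ i\<bar> \<partial>Q) / real k"
        by (rule integral_Markov_inequality_measure[where A = "{}", OF integrable_abs[OF int]]) (use k in auto)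
      also have "\<dots> \<le> K / real k" using abs_integral_bound[OF Q True, of i] by (intro divide_right_mono) auto
      finally show ?thesis using ZQ by simp
    qed (use K_nonneg in \<open>simp add: Z_def\<close>)
    then show "Z \<in> sets Q" "measure Q Z \<le> K / real k" by auto
  qed
  have "measure Q (cadlag_paths I - good i r m k) \<le>
     3 * K / real k + (2 * C * K + C\<^sup>2 / 2) / (real k * (\<epsilon>\<^sup>2 / 2)) + 3 * K / C + K / real k"
  proof (rule measure_le_if_eventually_in)
    show "cadlag_paths I - good i r m k \<in> sets Q"
      using sets.compl_sets[OF good_sets[of i r m k]] unfolding sets space_terminal_sigma .
    fix p
    let ?B = "\<lambda>p. ((X (real k) p \<union> Y p) \<union> X C p) \<union> Z"
    show "?B p \<in> sets Q" using X Y Z by auto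
    have "measure Q (?B p) \<le> ((measure Q (X (real k) p) + measure Q (Y p)) + measure Q (X C p)) + measure Q Z"
      using measure_Un_le[of "(X (real k) p \<union> Y p) \<union> X C p" Q Z]
        measure_Un_le[of "X (real k) p \<union> Y p" Q "X C p"]
        measure_Un_le[of "X (real k) p" Q "Y p"] X Y Z by simp
    also have "\<dots> \<le> ((3 * K / real k + (2 * C * K + C\<^sup>2 / 2) / (real k * (\<epsilon>\<^sup>2 / 2))) + 3 * K / C) + K / real k"
    proof (intro add_mono Z(2))
      show "measure Q (X (real k) p) \<le> 3 * K / real k" "measure Q (X C p) \<le> 3 * K / C"
        unfolding X_def by (rule maximal_inequality[OF Q], use k C in simp)+
      show "measure Q (Y p) \<le> (2 * C * K + C\<^sup>2 / 2) / (real k * (\<epsilon>\<^sup>2 / 2))"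
        using Y[of p] unfolding Y_def by (rule oscillation_inequality[OF Q \<epsilon>(1) C k, rotated]) (simp add: N_def)
    qed
    finally show "measure Q (?B p) \<le> 3 * K / real k + (2 * C * K + C\<^sup>2 / 2) / (real k * (\<epsilon>\<^sup>2 / 2)) + 3 * K / C + K / real k" .
  next
    fix w assume "w \<in> cadlag_paths I - good i r m k"
    then have w: "w \<in> cadlag_paths I" and "w \<notin> good i r m k" by auto
    then consider t where "t \<in> horizon r" "real k < \<bar>component i w t\<bar>"
      | "oscillates (component i w) (2 * \<epsilon>) (horizon r) k" | "w \<in> Z"
    proof -
      assume 1: "\<And>t. t \<in> horizon r \<Longrightarrow> real k < \<bar>component i w t\<bar> \<Longrightarrow> thesis"
        and 2: "oscillates (component i w) (2 * \<epsilon>) (horizon r) k \<Longrightarrow> thesis" and 3: "w \<in> Z \<Longrightarrow> thesis"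
      show thesis
      proof (rule ccontr)
        assume not: "\<not> thesis"
        have "\<bar>component i w t\<bar> \<le> real k" if "t \<in> horizon r" for t using 1[OF that] not by linarith
        moreover have "\<not> oscillates (component i w) (1 / real (Suc m)) (horizon r) k"
          using 2 not unfolding \<epsilon>(2) by blast
        moreover have "Sup I \<in> I \<longrightarrow> \<bar>w (Sup I) $ i\<bar> \<le> real k"
          using 3 not w unfolding Z_def space by force
        ultimately have "w \<in> good i r m k" using w unfolding good_def by simp
        with \<open>w \<notin> good i r m k\<close> show False ..
      qed
    qed
    then show "\<forall>\<^sub>F p in sequentially. w \<in> ((X (real k) p \<union> Y p) \<union> X C p) \<union> Z"
    proof cases
      case 1
      from eventually_grid_exceeds[OF w this] show ?thesis
      proof eventually_elim
        case (elim p)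
        then obtain z where z: "grid p z \<in> horizon r" "real k < \<bar>component i w (grid p z)\<bar>" by blast
        have "min z (N p) \<le> N p" "real k < \<bar>component i w (grid p (min z (N p)))\<bar>"
          using z grid_min[OF z(1)] by (simp_all add: N_def)
        then show ?case using w unfolding X_def space by blast
      qed
    next
      case 2
      from eventually_grid_oscillates[OF w this] show ?thesis
      proof eventually_elim
        case (elim p)
        then have "w \<in> Y p" if "\<not> (\<exists>j\<le>N p. C < \<bar>component i w (grid p j)\<bar>)"
          using w that unfolding Y_def space by (simp add: not_less)
        then show ?case using w unfolding X_def space by blast
      qed
    qed simp
  qed
  also have "(2 * C * K + C\<^sup>2 / 2) / (real k * (\<epsilon>\<^sup>2 / 2)) = 8 * (real (Suc m))\<^sup>2 * (2 * C * K + C\<^sup>2 / 2) / real k"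
    (is "?l = ?r / real k")
  proof -
    have "real k * (\<epsilon>\<^sup>2 / 2) = real k / (8 * (real (Suc m))\<^sup>2)" by (simp add: \<epsilon>_def power_divide power_mult_distrib del: of_nat_Suc)
    then show ?thesis by (simp only: divide_divide_eq_right mult.commute)
  qed
  also have "3 * K / real k + ?r / real k + 3 * K / C + K / real k = 3 * K / C + (4 * K + ?r) / real k"
  proof -
    have "3 * K / real k + x / real k + 3 * K / C + K / real k = 3 * K / C + (4 * K + x) / real k" for x
      by (simp add: add_divide_distrib)
    then show ?thesis .
  qed
  finally show ?thesis .
qed

lemma uniformly_good:
  assumes \<eta>: "0 < \<eta>"
  shows "\<exists>k. \<forall>Q\<in>\<M>. measure Q (cadlag_paths I - good i r m k) \<le> \<eta>"
proof -
  \<comment> \<open>Fixed first, so that \<open>3 * K / C\<close> stays below \<open>\<eta>\<close>;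
    only then does \<open>k\<close> tend to infinity. Adding 1 keeps \<open>C\<close> positive when
    \<open>K = 0\<close>.\<close>
  define C where "C = (3 * K + 1) * 2 / \<eta>"
  have C: "0 < C" using \<eta> K_nonneg by (simp add: C_def)
  have "3 * K / C < \<eta>" using \<eta> K_nonneg by (simp add: C_def divide_simps)
  moreover have "(\<lambda>k. 3 * K / C + (4 * K + 8 * (real (Suc m))\<^sup>2 * (2 * C * K + C\<^sup>2 / 2)) / real k) \<longlonglongrightarrow> 3 * K / C + 0"
    by (intro tendsto_add tendsto_const lim_const_over_n)
  ultimately have "\<forall>\<^sub>F k in sequentially. 3 * K / C + (4 * K + 8 * (real (Suc m))\<^sup>2 * (2 * C * K + C\<^sup>2 / 2)) / real k < \<eta>"
    by (intro order_tendstoD(2)) auto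
  with eventually_gt_at_top[of 0]
  have "\<forall>\<^sub>F k in sequentially. 0 < k \<and> 3 * K / C + (4 * K + 8 * (real (Suc m))\<^sup>2 * (2 * C * K + C\<^sup>2 / 2)) / real k < \<eta>"
    by eventually_elim simp
  from eventually_happens'[OF sequentially_bot this] obtain k where k: "0 < k"
    "3 * K / C + (4 * K + 8 * (real (Suc m))\<^sup>2 * (2 * C * K + C\<^sup>2 / 2)) / real k < \<eta>" by blast
  then show ?thesis using order_trans[OF not_good_bound[OF _ C k(1), of _ i r m] less_imp_le[OF k(2)]] by blast
qed

end

text \<open>The condition with index \<open>l\<close> may lose mass
  \<open>(1/2) ^ (l + 1) / (m + 1)\<close>; these losses sum to \<open>1 / (m + 1)\<close> over the
  countably many conditions that define a core.\<close>

lemma (in countably_tested_space) tight_family_if_uniform: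
  assumes Z: "\<And>Q. Q \<in> Z \<Longrightarrow> prob_space Q" "\<And>Q. Q \<in> Z \<Longrightarrow> sets Q = sets F"
    and unif: "\<And>l \<eta>. 0 < \<eta> \<Longrightarrow> \<exists>k. \<forall>Q\<in>Z. measure Q (topspace \<tau> - G l k) \<le> \<eta>"
  shows "\<exists>\<phi>. Z \<subseteq> tight_family \<phi>"
proof -
  have *: "\<forall>m l. \<exists>k. \<forall>Q\<in>Z. measure Q (topspace \<tau> - G l k) \<le> (1/2) ^ Suc l / real (Suc m)"
    by (intro allI unif) simp
  have "\<forall>m. \<exists>f. \<forall>l. \<forall>Q\<in>Z. measure Q (topspace \<tau> - G l (f l)) \<le> (1/2) ^ Suc l / real (Suc m)"
  proof (intro allI)
    fix m
    show "\<exists>f. \<forall>l. \<forall>Q\<in>Z. measure Q (topspace \<tau> - G l (f l)) \<le> (1/2) ^ Suc l / real (Suc m)"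
      by (rule choice[OF spec[OF *]])
  qed
  then obtain \<phi> where \<phi>: "\<forall>m l. \<forall>Q\<in>Z. measure Q (topspace \<tau> - G l (\<phi> m l)) \<le> (1/2) ^ Suc l / real (Suc m)"
    by (drule_tac choice) (elim exE, rule that)
  have "Q \<in> tight_family \<phi>" if Q: "Q \<in> Z" for Q
  proof -
    interpret prob_space Q by (rule Z(1)[OF Q])
    have sp: "space Q = topspace \<tau>" using sets_eq_imp_space_eq[OF Z(2)[OF Q]] space_F by simp
    have A: "topspace \<tau> - G l (\<phi> m l) \<in> sets Q" for l m
      using sets.compl_sets[OF G_sets, of l "\<phi> m l"] by (simp add: Z(2)[OF Q] space_F)
    have "1 - 1 / real (Suc m) \<le> measure Q (core \<phi> m)" for m
    proof -
      have sums: "(\<lambda>l. (1/2) ^ Suc l / real (Suc m)) sums (1 / real (Suc m))"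
        using sums_divide[OF power_half_series] .
      have le: "measure Q (topspace \<tau> - G l (\<phi> m l)) \<le> (1/2) ^ Suc l / real (Suc m)" for l using \<phi> Q by (elim allE ballE) auto
      have sm: "summable (\<lambda>l. measure Q (topspace \<tau> - G l (\<phi> m l)))"
        by (rule summable_comparison_test'[OF sums_summable[OF sums], of 0]) (use le in simp)
      have "measure Q (\<Union>l. topspace \<tau> - G l (\<phi> m l)) \<le> (\<Sum>l. measure Q (topspace \<tau> - G l (\<phi> m l)))"
        using A by (intro finite_measure_subadditive_countably sm) auto
      also have "\<dots> \<le> 1 / real (Suc m)"
        using suminf_le[OF le sm sums_summable[OF sums]] sums_unique[OF sums] by simp
      finally have "measure Q (\<Union>l. topspace \<tau> - G l (\<phi> m l)) \<le> 1 / real (Suc m)" .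
      moreover have "core \<phi> m = space Q - (\<Union>l. topspace \<tau> - G l (\<phi> m l))"
        unfolding core_def sp by auto
      moreover have "(\<Union>l. topspace \<tau> - G l (\<phi> m l)) \<in> sets Q"
        by (rule sets.countable_nat_UN) (use A in blast)
      ultimately show ?thesis using prob_compl by simp
    qed
    then show ?thesis using Z[OF Q] prob_space_axioms by (simp add: tight_family_def)
  qed
  then show ?thesis by blast
qed

section \<open>Limits of supermartingale measures\<close>

text \<open>The truncation splits into a concave nondecreasing function, which preserves the
  supermartingale inequality, and the excess of the negative part over \<open>C\<close>, which
  uniform integrability makes small.\<close>

lemma max_min_decomposition: "0 \<le> C \<Longrightarrow> clip C x = min C x + max 0 (- x - C)"
  by (auto simp: clip_def max_def min_def)

lemma abs_clip_le: "0 \<le> C \<Longrightarrow> \<bar>clip C x\<bar> \<le> C"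
  by (auto simp: clip_def)

lemma abs_clip_le_abs: "0 \<le> C \<Longrightarrow> \<bar>clip C x\<bar> \<le> \<bar>x\<bar>"
  by (auto simp: clip_def)

lemma continuous_on_clip: "continuous_on A (clip C)"
  unfolding clip_def[abs_def] by (intro continuous_intros)

lemma measurable_clip [measurable]: "clip C \<in> borel_measurable borel"
  by (rule borel_measurable_continuous_onI[OF continuous_on_clip])

lemma clip_tendsto: "(\<lambda>j. clip (real j) x) \<longlonglongrightarrow> x"
proof (rule tendsto_eventually)
  obtain n where "\<bar>x\<bar> \<le> real n" using real_arch_simple by blast
  then have "clip (real j) x = x" if "j \<ge> n" for j
  proof -
    have "\<bar>x\<bar> \<le> real j" using \<open>\<bar>x\<bar> \<le> real n\<close> that by linarith
    then show ?thesis by (auto simp: clip_def)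
  qed
  then show "\<forall>\<^sub>F j in sequentially. clip (real j) x = x" unfolding eventually_sequentially by blast
qed

lemma subalgebra_rc_filtration:
  assumes "sets Q = sets (terminal_sigma I :: ('d::finite) path measure)"
  shows "subalgebra Q (rc_filtration I t :: 'd path measure)"
  unfolding subalgebra_def using sets_eq_imp_space_eq[OF assms] rc_filtration_subset_terminal[of I t] assms by simp

text \<open>By Fubini the expectation of an average is the average of the expectations, so any bound
  valid throughout the window is inherited. The upper bound serves the later of two times, the lower
  bound the earlier one.\<close>

lemma (in time_line) avg_expectation:
  fixes i :: "'d::finite"
  assumes Q: "prob_space Q" "sets Q = sets (terminal_sigma I :: 'd path measure)"
    and t: "0 \<le> t" "0 < \<delta>" "ereal (t + \<delta>) \<in> I"
    and \<phi> [measurable]: "\<phi> \<in> borel_measurable borel" and \<phi>B: "\<And>x. \<bar>\<phi> x\<bar> \<le> B"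
    and G: "G \<in> borel_measurable Q" "\<And>w. w \<in> space Q \<Longrightarrow> \<bar>G w\<bar> \<le> 1"
  shows "(\<And>u. u \<in> {t<..<t + \<delta>} \<Longrightarrow> (\<integral>w. G w * \<phi> (component i w u) \<partial>Q) \<le> a) \<Longrightarrow>
      (\<integral>w. G w * avg t \<delta> i \<phi> w \<partial>Q) \<le> a"
    and "(\<And>u. u \<in> {t<..<t + \<delta>} \<Longrightarrow> a \<le> (\<integral>w. G w * \<phi> (component i w u) \<partial>Q)) \<Longrightarrow>
      a \<le> (\<integral>w. G w * avg t \<delta> i \<phi> w \<partial>Q)"
proof -
  interpret prob_space Q by (rule Q(1))
  interpret pair_sigma_finite lborel Q by standard
  have space: "space Q = cadlag_paths I" using sets_eq_imp_space_eq[OF Q(2)] by simp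
  define f where "f u w = bump t \<delta> u * (G w * \<phi> (component i w (max 0 (min u (t + \<delta>)))))" for u w
  define Z where "Z = (\<integral>u. bump t \<delta> u \<partial>lborel)"
  have Z: "Z > 0" unfolding Z_def by (rule integral_bump_pos[OF t(2)])
  note [measurable] = G(1)
  have "(\<lambda>(u, w). component i w (max 0 (min u (t + \<delta>)))) \<in> borel_measurable (borel \<Otimes>\<^sub>M (raw_filtration I (ereal (t + \<delta>)) :: 'd path measure))"
    using t by (intro joint_measurable) auto
  then have [measurable]: "(\<lambda>(u, w). component i w (max 0 (min u (t + \<delta>)))) \<in> borel_measurable (lborel \<Otimes>\<^sub>M Q)"
  proof (rule measurable_from_subset)
    show "sets (borel \<Otimes>\<^sub>M raw_filtration I (ereal (t + \<delta>))) \<subseteq> sets (lborel \<Otimes>\<^sub>M Q)"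
      by (rule sets_pair_in_sets) (use Q(2) raw_filtration_subset_terminal in \<open>auto intro!: pair_measureI\<close>)
    show "space (borel \<Otimes>\<^sub>M raw_filtration I (ereal (t + \<delta>))) = space (lborel \<Otimes>\<^sub>M Q)"
      by (simp add: space_pair_measure space)
  qed
  have f_meas [measurable]: "case_prod f \<in> borel_measurable (lborel \<Otimes>\<^sub>M Q)"
    unfolding f_def case_prod_unfold by measurable
  have f_bound: "\<bar>f u w\<bar> \<le> bump t \<delta> u * B" if "w \<in> space Q" for u w
  proof -
    have "\<bar>G w * \<phi> x\<bar> \<le> 1 * B" for x
      unfolding abs_mult using G(2)[OF that] \<phi>B[of x] by (intro mult_mono) auto
    then show ?thesis unfolding f_def abs_mult[of "bump t \<delta> u"] abs_of_nonneg[OF bump_nonneg]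
      by (intro mult_left_mono bump_nonneg) simp
  qed
  have f_sec: "integrable Q (f u)" for u
  proof (rule integrable_const_bound)
    show "AE w in Q. norm (f u w) \<le> bump t \<delta> u * B" using f_bound by (intro AE_I2) simp
    show "f u \<in> borel_measurable Q" using measurable_compose[OF measurable_Pair1' f_meas, of u] by simp
  qed
  have f_int: "integrable (lborel \<Otimes>\<^sub>M Q) (case_prod f)"
  proof (rule Fubini_integrable[OF f_meas])
    show "integrable lborel (\<lambda>u. \<integral>w. norm (case_prod f (u, w)) \<partial>Q)"
    proof (rule Bochner_Integration.integrable_bound)
      show "integrable lborel (\<lambda>u. bump t \<delta> u * B)" using integrable_bump[OF t(2)] by simp
      show "(\<lambda>u. \<integral>w. norm (case_prod f (u, w)) \<partial>Q) \<in> borel_measurable lborel" by measurable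
      have "(\<integral>w. norm (f u w) \<partial>Q) \<le> bump t \<delta> u * B" for u
      proof -
        have "(\<integral>w. norm (f u w) \<partial>Q) \<le> (\<integral>w. bump t \<delta> u * B \<partial>Q)"
          using f_bound by (intro integral_mono integrable_norm f_sec) auto
        then show ?thesis by (simp add: prob_space)
      qed
      moreover have "norm (\<integral>w. norm (f u w) \<partial>Q) = (\<integral>w. norm (f u w) \<partial>Q)" for u
        unfolding real_norm_def by (rule abs_of_nonneg[OF integral_nonneg_AE]) simp
      ultimately have "norm (\<integral>w. norm (f u w) \<partial>Q) \<le> norm (bump t \<delta> u * B)" for u
        by (simp only: real_norm_def) (rule order_trans[OF _ abs_ge_self])
      then show "AE u in lborel. norm (\<integral>w. norm (case_prod f (u, w)) \<partial>Q) \<le> norm (bump t \<delta> u * B)" by simp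
    qed
    show "AE u in lborel. integrable Q (\<lambda>w. case_prod f (u, w))" using f_sec by simp
  qed
  have "(\<integral>w. G w * avg t \<delta> i \<phi> w \<partial>Q) = (\<integral>w. (\<integral>u. f u w \<partial>lborel) / Z \<partial>Q)"
  proof (rule Bochner_Integration.integral_cong[OF refl])
    fix w
    have "(\<integral>u. f u w \<partial>lborel) = (\<integral>u. G w * (bump t \<delta> u * \<phi> (component i w u)) \<partial>lborel)"
      unfolding f_def avg_clamp[OF t(2,1)] by (simp add: mult.left_commute)
    also have "\<dots> = G w * (\<integral>u. bump t \<delta> u * \<phi> (component i w u) \<partial>lborel)" by simp
    finally show "G w * avg t \<delta> i \<phi> w = (\<integral>u. f u w \<partial>lborel) / Z" unfolding avg_def Z_def by simp
  qed
  also have "\<dots> = (\<integral>u. (\<integral>w. f u w \<partial>Q) \<partial>lborel) / Z"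
    using Fubini_integral[OF f_int] by simp
  finally have eq: "(\<integral>w. G w * avg t \<delta> i \<phi> w \<partial>Q) = (\<integral>u. (\<integral>w. f u w \<partial>Q) \<partial>lborel) / Z" .
  have int: "integrable lborel (\<lambda>u. \<integral>w. f u w \<partial>Q)" using integrable_fst'[OF f_int] by simp
  have f_in: "(\<integral>w. f u w \<partial>Q) = bump t \<delta> u * (\<integral>w. G w * \<phi> (component i w u) \<partial>Q)" if "u \<in> {t<..<t + \<delta>}" for u
  proof -
    have "max 0 (min u (t + \<delta>)) = u" using that t by auto
    then show ?thesis by (simp add: f_def)
  qed
  have f_out: "(\<integral>w. f u w \<partial>Q) = 0" "bump t \<delta> u = 0" if "u \<notin> {t<..<t + \<delta>}" for u
    using bump_eq_0[OF that] t by (simp_all add: f_def)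
  have Za: "(\<integral>u. bump t \<delta> u * a \<partial>lborel) = Z * a" by (simp add: Z_def)
  note inta = integrable_mult_left[OF integrable_bump[OF t(2), of t], of a]
  {
    assume le: "\<And>u. u \<in> {t<..<t + \<delta>} \<Longrightarrow> (\<integral>w. G w * \<phi> (component i w u) \<partial>Q) \<le> a"
    have "(\<integral>w. f u w \<partial>Q) \<le> bump t \<delta> u * a" for u
    proof (cases "u \<in> {t<..<t + \<delta>}")
      case True
      show ?thesis unfolding f_in[OF True] by (rule mult_left_mono[OF le[OF True] bump_nonneg])
    next
      case False
      show ?thesis unfolding f_out(1)[OF False] f_out(2)[OF False] by simp
    qed
    then have "(\<integral>u. (\<integral>w. f u w \<partial>Q) \<partial>lborel) \<le> Z * a"
      unfolding Za[symmetric] by (intro integral_mono int inta)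
    then show "(\<integral>w. G w * avg t \<delta> i \<phi> w \<partial>Q) \<le> a" unfolding eq using Z by (simp add: field_simps)
  }
  {
    assume le: "\<And>u. u \<in> {t<..<t + \<delta>} \<Longrightarrow> a \<le> (\<integral>w. G w * \<phi> (component i w u) \<partial>Q)"
    have "bump t \<delta> u * a \<le> (\<integral>w. f u w \<partial>Q)" for u
    proof (cases "u \<in> {t<..<t + \<delta>}")
      case True
      show ?thesis unfolding f_in[OF True] by (rule mult_left_mono[OF le[OF True] bump_nonneg])
    next
      case False
      show ?thesis unfolding f_out(1)[OF False] f_out(2)[OF False] by simp
    qed
    then have "Z * a \<le> (\<integral>u. (\<integral>w. f u w \<partial>Q) \<partial>lborel)"
      unfolding Za[symmetric] by (intro integral_mono int inta)
    then show "a \<le> (\<integral>w. G w * avg t \<delta> i \<phi> w \<partial>Q)" unfolding eq using Z by (simp add: field_simps)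
  }
qed

lemma (in UI_family) supermartingale_integral_le:
  assumes Q: "Q \<in> \<M>" and uv: "u \<in> I" "v \<in> I" "u \<le> v"
    and H: "H \<in> borel_measurable (rc_filtration I u)" "\<And>w. 0 \<le> H w \<and> H w \<le> 1"
  shows "(\<integral>w. H w * (w v $ i) \<partial>Q) \<le> (\<integral>w. H w * (w u $ i) \<partial>Q)"
proof -
  interpret prob_space Q by (rule members(1)[OF Q])
  have sub: "subalgebra Q (rc_filtration I u)"
    by (rule subalgebra_rc_filtration[OF members(3)[OF Q]])
  interpret finite_measure_subalgebra Q "rc_filtration I u" by standard (rule sub)
  have HQ: "H \<in> borel_measurable Q" by (rule measurable_from_subalg[OF sub H(1)])
  have H1: "\<bar>H w\<bar> \<le> 1" for w using H(2)[of w] by auto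
  note int = integrable_mult_bounded[OF HQ H1 members(4)[OF Q]]
  note meas = borel_measurable_integrable[OF members(4)[OF Q uv(2)], of i]
  have "(\<integral>w. H w * (w v $ i) \<partial>Q) = (\<integral>w. H w * real_cond_exp Q (rc_filtration I u) (\<lambda>w. w v $ i) w \<partial>Q)"
    by (rule real_cond_exp_intg(2)[OF int[OF uv(2)] H(1) meas, symmetric])
  also have "\<dots> \<le> (\<integral>w. H w * (w u $ i) \<partial>Q)"
  proof (rule integral_mono_AE)
    show "integrable Q (\<lambda>w. H w * real_cond_exp Q (rc_filtration I u) (\<lambda>w. w v $ i) w)"
      by (rule real_cond_exp_intg(1)[OF int[OF uv(2)] H(1) meas])
    have "AE w in Q. real_cond_exp Q (rc_filtration I u) (\<lambda>w. w v $ i) w \<le> w u $ i"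
      using supermartingale_measure[OF Q] uv by (auto simp: supermartingale_measure_def supermartingale_def)
    then show "AE w in Q. H w * real_cond_exp Q (rc_filtration I u) (\<lambda>w. w v $ i) w \<le> H w * (w u $ i)"
      by eventually_elim (use H(2) in \<open>simp add: mult_left_mono\<close>)
  qed (rule int[OF uv(1)])
  finally show ?thesis .
qed

text \<open>Jensen's inequality for \<open>min c\<close>, made explicit: on the event
  \<open>w u $ i \<le> c\<close>, which is known at \<open>u\<close>, the supermartingale inequality
  is used; on its complement \<open>min c (w u $ i) = c\<close> is the largest possible
  value.\<close>

lemma (in UI_family) min_integral_le:
  assumes Q: "Q \<in> \<M>" and uv: "u \<in> I" "v \<in> I" "u \<le> v"
    and H: "H \<in> borel_measurable (rc_filtration I u)" "\<And>w. 0 \<le> H w \<and> H w \<le> 1"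
  shows "(\<integral>w. H w * min c (w v $ i) \<partial>Q) \<le> (\<integral>w. H w * min c (w u $ i) \<partial>Q)"
proof -
  interpret prob_space Q by (rule members(1)[OF Q])
  let ?F = "rc_filtration I u :: 'd path measure"
  have sub: "subalgebra Q ?F"
    by (rule subalgebra_rc_filtration[OF members(3)[OF Q]])
  define B where "B = {w \<in> space ?F. w u $ i \<le> c}"
  have "(\<lambda>w. w u $ i) \<in> borel_measurable ?F"
    by (rule measurable_from_subset[OF coordinate_measurable[OF uv(1) order_refl] raw_filtration_subset_rc]) simp
  then have B: "B \<in> sets ?F" unfolding B_def by measurable
  have HQ: "H \<in> borel_measurable Q" by (rule measurable_from_subalg[OF sub H(1)])
  have B1 [measurable]: "(\<lambda>w. H w * indicator B w) \<in> borel_measurable ?F" using B H(1) by measurable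
  have BQ: "B \<in> sets Q" using B sub by (auto simp: subalgebra_def)
  have H1: "\<bar>H w\<bar> \<le> 1" and HB: "0 \<le> H w * indicator B w \<and> H w * indicator B w \<le> 1"
    and HB1: "\<bar>H w * indicator B w\<bar> \<le> 1" for w
    using H(2)[of w] by (auto simp: indicator_def)
  note X = members(4)[OF Q, of _ i]
  have Xmin: "integrable Q (\<lambda>w. min c (w t $ i))" if "t \<in> I" for t using X[OF that] by (intro Bochner_Integration.integrable_min) auto
  note int = integrable_mult_bounded[OF HQ H1 Xmin]
  note intB = integrable_mult_bounded[OF measurable_from_subalg[OF sub B1] HB1 X]
  have rest: "integrable Q (\<lambda>w. H w * (indicator (space Q - B) w * c))"
    using BQ by (intro integrable_mult_bounded[OF HQ H1] integrable_mult_left integrable_real_indicator) (auto simp: emeasure_eq_measure)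
  have "(\<integral>w. H w * min c (w v $ i) \<partial>Q) \<le> (\<integral>w. H w * indicator B w * (w v $ i) + H w * (indicator (space Q - B) w * c) \<partial>Q)"
  proof (rule integral_mono[OF int[OF uv(2)] Bochner_Integration.integrable_add[OF intB[OF uv(2)] rest]])
    fix w assume "w \<in> space Q"
    then have "H w * min c (w v $ i) \<le> H w * (indicator B w * (w v $ i) + indicator (space Q - B) w * c)"
      using H(2)[of w] by (intro mult_left_mono) (auto simp: indicator_def)
    then show "H w * min c (w v $ i) \<le> H w * indicator B w * (w v $ i) + H w * (indicator (space Q - B) w * c)"
      by (simp add: algebra_simps)
  qed
  also have "\<dots> \<le> (\<integral>w. H w * indicator B w * (w u $ i) + H w * (indicator (space Q - B) w * c) \<partial>Q)"
    using supermartingale_integral_le[OF Q uv B1 HB, of i]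
    by (simp only: Bochner_Integration.integral_add[OF intB[OF uv(1)] rest] Bochner_Integration.integral_add[OF intB[OF uv(2)] rest] add_right_mono)
  also have "\<dots> = (\<integral>w. H w * min c (w u $ i) \<partial>Q)"
  proof (rule Bochner_Integration.integral_cong[OF refl])
    fix w assume "w \<in> space Q"
    then show "H w * indicator B w * (w u $ i) + H w * (indicator (space Q - B) w * c) = H w * min c (w u $ i)"
      using members(2)[OF Q] by (auto simp: B_def indicator_def)
  qed
  finally show ?thesis .
qed

text \<open>The excess \<open>max 0 (- x - C) = - C - min (- C) x\<close> has nondecreasing
  expectation in time, so its value at \<open>v\<close> is dominated by that at any later
  \<open>z\<close>. A single \<open>z\<close> thus provides the error term for all times of a
  window.\<close>

lemma (in UI_family) clip_integral_le:
  assumes Q: "Q \<in> \<M>" and uv: "u \<in> I" "v \<in> I" "u \<le> v" "z \<in> I" "v \<le> z" and C: "0 \<le> C"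
    and H: "H \<in> borel_measurable (rc_filtration I u)" "\<And>w. 0 \<le> H w \<and> H w \<le> 1"
  shows "(\<integral>w. H w * clip C (w v $ i) \<partial>Q) \<le> (\<integral>w. H w * clip C (w u $ i) \<partial>Q) + (\<integral>w. max 0 (- (w z $ i) - C) \<partial>Q)"
proof -
  interpret prob_space Q by (rule members(1)[OF Q])
  have sub: "subalgebra Q (rc_filtration I u)"
    by (rule subalgebra_rc_filtration[OF members(3)[OF Q]])
  have HQ: "H \<in> borel_measurable Q" by (rule measurable_from_subalg[OF sub H(1)])
  have H1: "\<bar>H w\<bar> \<le> 1" for w using H(2)[of w] by auto
  note X = members(4)[OF Q, of _ i]
  have Xmin: "integrable Q (\<lambda>w. min c (w t $ i))" if "t \<in> I" for t c
    using X[OF that] by (intro Bochner_Integration.integrable_min) auto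
  have Xex: "integrable Q (\<lambda>w. max 0 (- (w t $ i) - C))" if "t \<in> I" for t
    using X[OF that] by (intro Bochner_Integration.integrable_max Bochner_Integration.integrable_diff) auto
  note int = integrable_mult_bounded[OF HQ H1]
  have split: "(\<integral>w. H w * clip C (w t $ i) \<partial>Q) = (\<integral>w. H w * min C (w t $ i) \<partial>Q) + (\<integral>w. H w * max 0 (- (w t $ i) - C) \<partial>Q)"
    if "t \<in> I" for t
    unfolding max_min_decomposition[OF C] distrib_left
    by (rule Bochner_Integration.integral_add[OF int[OF Xmin[OF that]] int[OF Xex[OF that]]])
  have ex: "(\<integral>w. max 0 (- (w t $ i) - C) \<partial>Q) = - C - (\<integral>w. min (- C) (w t $ i) \<partial>Q)" if "t \<in> I" for t
  proof -
    have "(\<integral>w. max 0 (- (w t $ i) - C) \<partial>Q) = (\<integral>w. - C - min (- C) (w t $ i) \<partial>Q)"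
      by (intro Bochner_Integration.integral_cong refl) (auto simp: max_def min_def)
    also have "\<dots> = - C - (\<integral>w. min (- C) (w t $ i) \<partial>Q)"
      using Xmin[OF that, of "- C"] by (simp add: prob_space)
    finally show ?thesis .
  qed
  have "(\<integral>w. H w * max 0 (- (w v $ i) - C) \<partial>Q) \<le> (\<integral>w. max 0 (- (w v $ i) - C) \<partial>Q)"
    using H(2) by (intro integral_mono int Xex uv(2) mult_left_le_one_le) auto
  also have "\<dots> \<le> (\<integral>w. max 0 (- (w z $ i) - C) \<partial>Q)"
    using min_integral_le[OF Q uv(2,4,5), of "\<lambda>_. 1" "- C" i] unfolding ex[OF uv(2)] ex[OF uv(4)] by simp
  finally have 1: "(\<integral>w. H w * max 0 (- (w v $ i) - C) \<partial>Q) \<le> (\<integral>w. max 0 (- (w z $ i) - C) \<partial>Q)" .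
  have "0 \<le> (\<integral>w. H w * max 0 (- (w u $ i) - C) \<partial>Q)"
    using H(2) by (intro integral_nonneg_AE) simp
  then show ?thesis
    using 1 min_integral_le[OF Q uv(1-3) H, of C i] unfolding split[OF uv(1)] split[OF uv(2)] by linarith
qed

lemma (in time_line) obs_expectation:
  fixes i :: "'d::finite"
  assumes Q: "prob_space Q" "sets Q = sets (terminal_sigma I :: 'd path measure)" and t: "t \<in> I"
    and \<phi>: "\<phi> \<in> borel_measurable borel" "\<And>x. \<bar>\<phi> x\<bar> \<le> B"
    and G: "G \<in> borel_measurable Q" "\<And>w. w \<in> space Q \<Longrightarrow> \<bar>G w\<bar> \<le> 1"
  shows "(\<And>u. u \<in> I \<Longrightarrow> t \<le> u \<Longrightarrow> u \<le> t + ereal (1 / real (Suc n)) \<Longrightarrow> (\<integral>w. G w * \<phi> (w u $ i) \<partial>Q) \<le> a) \<Longrightarrow>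
      (\<integral>w. G w * obs n t i \<phi> w \<partial>Q) \<le> a"
    and "(\<And>u. u \<in> I \<Longrightarrow> t \<le> u \<Longrightarrow> u \<le> t + ereal (1 / real (Suc n)) \<Longrightarrow> a \<le> (\<integral>w. G w * \<phi> (w u $ i) \<partial>Q)) \<Longrightarrow>
      a \<le> (\<integral>w. G w * obs n t i \<phi> w \<partial>Q)"
proof -
  let ?P = "\<lambda>u. u \<in> I \<and> t \<le> u \<and> u \<le> t + ereal (1 / real (Suc n))"
  let ?E = "\<lambda>u. \<integral>w. G w * \<phi> (w u $ i) \<partial>Q" and ?O = "\<integral>w. G w * obs n t i \<phi> w \<partial>Q"
  have "((\<forall>u. ?P u \<longrightarrow> ?E u \<le> a) \<longrightarrow> ?O \<le> a) \<and> ((\<forall>u. ?P u \<longrightarrow> a \<le> ?E u) \<longrightarrow> a \<le> ?O)"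
  proof (cases "t = Sup I")
    case True
    have "?P t" using t by (cases t) auto
    moreover have "?O = ?E t" using True by (simp add: obs_def)
    ultimately show ?thesis by auto
  next
    case False
    then obtain s where s: "t = ereal s" "0 \<le> s" "ereal s < Sup I" by (rule not_Sup_cases[OF t])
    note z = width[OF s(2,3), of n]
    have obs: "obs n t i \<phi> w = avg s (width n s) i \<phi> w" for w using False s(1) by (simp add: obs_def)
    have range: "?P (ereal u)" if "u \<in> {s<..<s + width n s}" for u
      using that z s(1,2) in_I_mono[of "ereal u" "ereal (s + width n s)"] by auto
    note avg = avg_expectation[OF Q s(2) z(1,3) \<phi> G, where i = i and a = a, unfolded component_def]
    show ?thesis unfolding obs
    proof (intro conjI impI)
      assume bound: "\<forall>u. ?P u \<longrightarrow> ?E u \<le> a"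
      show "(\<integral>w. G w * avg s (width n s) i \<phi> w \<partial>Q) \<le> a"
        by (rule avg(1)) (assumption, rule bound[rule_format, OF range])
    next
      assume bound: "\<forall>u. ?P u \<longrightarrow> a \<le> ?E u"
      show "a \<le> (\<integral>w. G w * avg s (width n s) i \<phi> w \<partial>Q)"
        by (rule avg(2)) (assumption, rule bound[rule_format, OF range])
    qed
  qed
  then show "(\<And>u. u \<in> I \<Longrightarrow> t \<le> u \<Longrightarrow> u \<le> t + ereal (1 / real (Suc n)) \<Longrightarrow> ?E u \<le> a) \<Longrightarrow> ?O \<le> a"
    "(\<And>u. u \<in> I \<Longrightarrow> t \<le> u \<Longrightarrow> u \<le> t + ereal (1 / real (Suc n)) \<Longrightarrow> a \<le> ?E u) \<Longrightarrow> a \<le> ?O" by auto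
qed

section \<open>The supermartingale inequality in the limit\<close>

locale UI_limit = UI_family +
  fixes q :: "nat \<Rightarrow> ('d::finite) path measure" and Q :: "'d path measure"
  assumes q_in: "q n \<in> \<M>" and prob_Q: "prob_space Q" and sets_Q: "sets Q = sets (terminal_sigma I)"
    and conv: "f \<in> borel_measurable (terminal_sigma I) \<Longrightarrow> continuous_map (MZ_topology I) euclideanreal f \<Longrightarrow>
          (\<And>w. w \<in> cadlag_paths I \<Longrightarrow> \<bar>f w\<bar> \<le> B) \<Longrightarrow> (\<lambda>n. \<integral>w. f w \<partial>q n) \<longlonglongrightarrow> (\<integral>w. f w \<partial>Q)"
begin

sublocale prob_space Q by (rule prob_Q)

lemma space_Q: "space Q = cadlag_paths I"
  using sets_eq_imp_space_eq[OF sets_Q] by simp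

lemma measurable_Q:
  assumes "f \<in> borel_measurable (terminal_sigma I :: 'd path measure)"
  shows "f \<in> borel_measurable Q"
  by (rule measurable_from_subset[OF assms]) (simp_all add: sets_Q space_Q)

lemma coordinate_measurable_Q: "t \<in> I \<Longrightarrow> (\<lambda>w. w t $ i) \<in> borel_measurable Q"
  by (rule measurable_Q[OF coordinate_measurable_terminal])

lemma bounded_coordinate_limit:
  assumes t: "t \<in> I" and G: "G \<in> borel_measurable Q" "\<And>w. w \<in> space Q \<Longrightarrow> \<bar>G w\<bar> \<le> 1"
    and \<phi>: "continuous_on UNIV \<phi>" "\<And>x. \<bar>\<phi> x\<bar> \<le> B"
  shows "(\<lambda>n. \<integral>w. G w * obs n t i \<phi> w \<partial>Q) \<longlonglongrightarrow> (\<integral>w. G w * \<phi> (w t $ i) \<partial>Q)"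
proof (rule integral_dominated_convergence[where w = "\<lambda>_. B"])
  have [measurable]: "\<phi> \<in> borel_measurable borel" by (rule borel_measurable_continuous_onI[OF \<phi>(1)])
  note [measurable] = G(1) coordinate_measurable_Q[OF t] measurable_Q[OF obs_measurable_terminal[OF t, of \<phi>]]
  show "(\<lambda>w. G w * \<phi> (w t $ i)) \<in> borel_measurable Q" by measurable
  show "(\<lambda>w. G w * obs n t i \<phi> w) \<in> borel_measurable Q" for n by measurable
  show "AE w in Q. (\<lambda>n. G w * obs n t i \<phi> w) \<longlonglongrightarrow> G w * \<phi> (w t $ i)"
    by (intro AE_I2 tendsto_mult_left obs_tendsto t \<phi>(1)) (simp add: space_Q)
  show "AE w in Q. norm (G w * obs n t i \<phi> w) \<le> B" for n
  proof (rule AE_I2)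
    fix w assume w: "w \<in> space Q"
    have "- B \<le> \<phi> x" "\<phi> x \<le> B" for x using \<phi>(2)[of x] by auto
    then have "\<bar>obs n t i \<phi> w\<bar> \<le> B"
      using obs_bounds[of w t \<phi> "- B" B n i] w t by (simp add: space_Q abs_le_iff)
    then have "\<bar>G w\<bar> * \<bar>obs n t i \<phi> w\<bar> \<le> 1 * B" using G(2)[OF w] by (intro mult_mono) auto
    then show "norm (G w * obs n t i \<phi> w) \<le> B" by (simp add: abs_mult)
  qed
qed simp

text \<open>Averaging windows have length at most 1, so one time \<open>z\<close> lies after all
  windows that start at \<open>v\<close>; uniform integrability is then used at this time
  only.\<close>

lemma later_time:
  assumes v: "v \<in> I"
  obtains z where "z \<in> I" "\<And>n r. r \<in> I \<Longrightarrow> r \<le> v + ereal (1 / real (Suc n)) \<Longrightarrow> r \<le> z"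
proof (cases "Sup I \<in> I")
  case True
  then show ?thesis by (intro that[of "Sup I"]) (auto simp: Sup_upper)
next
  case False
  then have "v \<noteq> Sup I" using v by auto
  then obtain s where s: "v = ereal s" "0 \<le> s" "ereal s < Sup I" by (rule not_Sup_cases[OF v])
  have inf: "Sup I = \<infinity>" using False by (rule_tac I_cases) auto
  show ?thesis
  proof (rule that[of "ereal (s + 1)"])
    show "ereal (s + 1) \<in> I" using s inf by (simp add: real_in_I_iff)
    fix r :: ereal and n assume "r \<le> v + ereal (1 / real (Suc n))"
    also have "\<dots> \<le> ereal (s + 1)" unfolding s(1) by (simp add: field_simps)
    finally show "r \<le> ereal (s + 1)" .
  qed
qed

text \<open>For fixed windows the inequality passes to \<open>Q\<close> along \<open>q\<close>,
  since averages and weight are continuous; shrinking the windows then recovers the coordinates. The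
  error \<open>\<eta>\<close> occurs twice: for moving from the window after \<open>v\<close> back
  to \<open>v\<close>, and from \<open>v\<close> back to the window after \<open>u\<close>, which
  must end by \<open>v\<close>.\<close>

lemma continuous_weight_bound:
  assumes uv: "u \<in> I" "v \<in> I" "u < v" and z: "z \<in> I" "\<And>n r. r \<in> I \<Longrightarrow> r \<le> v + ereal (1 / real (Suc n)) \<Longrightarrow> r \<le> z"
    and C: "0 \<le> C" and \<eta>: "\<And>P. P \<in> \<M> \<Longrightarrow> (\<integral>w. max 0 (- (w z $ i) - C) \<partial>P) \<le> \<eta>"
    and G: "G \<in> borel_measurable (raw_filtration I u)" "continuous_map (MZ_topology I) euclideanreal G"
      "\<And>w. 0 \<le> G w \<and> G w \<le> 1"
  shows "(\<integral>w. G w * clip C (w v $ i) \<partial>Q) \<le> (\<integral>w. G w * clip C (w u $ i) \<partial>Q) + 2 * \<eta>"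
proof -
  have G1: "\<bar>G w\<bar> \<le> 1" for w using G(3)[of w] by auto
  have Gt: "G \<in> borel_measurable (terminal_sigma I)"
    by (rule measurable_from_subset[OF G(1) raw_filtration_subset_terminal]) simp
  have Grc: "G \<in> borel_measurable (rc_filtration I r)" if "u \<le> r" for r
    by (rule measurable_from_subset[OF G(1)]) (use raw_filtration_mono[OF that, of I] raw_filtration_subset_rc[of I r] in auto)
  have vv: "v \<le> v + ereal (1 / real (Suc n))" for n by (cases v) auto
  have vw: "v \<le> z" by (rule z(2)[OF uv(2) vv])
  have lim: "(\<lambda>m. \<integral>w. G w * obs n t i (clip C) w \<partial>q m) \<longlonglongrightarrow> (\<integral>w. G w * obs n t i (clip C) w \<partial>Q)" if t: "t \<in> I" for n t
  proof (rule conv[where B = C])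
    show "(\<lambda>w. G w * obs n t i (clip C) w) \<in> borel_measurable (terminal_sigma I)"
      using Gt obs_measurable_terminal[OF t measurable_clip] by measurable
    show "continuous_map (MZ_topology I) euclideanreal (\<lambda>w. G w * obs n t i (clip C) w)"
      by (intro continuous_map_real_mult G(2) obs_continuous[OF t continuous_on_clip abs_clip_le[OF C]])
    fix w :: "'d path" assume w: "w \<in> cadlag_paths I"
    have "- C \<le> clip C x" "clip C x \<le> C" for x using abs_clip_le[OF C, of x] by auto
    then have "\<bar>obs n t i (clip C) w\<bar> \<le> C"
      using obs_bounds[OF w t measurable_clip, of "- C" C C n i] by (simp add: abs_le_iff)
    then have "\<bar>G w\<bar> * \<bar>obs n t i (clip C) w\<bar> \<le> 1 * C" using G1[of w] by (intro mult_mono) auto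
    then show "\<bar>G w * obs n t i (clip C) w\<bar> \<le> C" by (simp add: abs_mult)
  qed
  have step: "(\<integral>w. G w * obs n v i (clip C) w \<partial>Q) \<le> (\<integral>w. G w * obs n' u i (clip C) w \<partial>Q) + 2 * \<eta>"
    if n': "u + ereal (1 / real (Suc n')) \<le> v" for n n'
  proof (rule LIMSEQ_le[OF lim[OF uv(2)] tendsto_add[OF lim[OF uv(1)] tendsto_const]], intro exI allI impI)
    fix m :: nat
    note P = members(1,3)[OF q_in[of m]]
    have GP: "G \<in> borel_measurable (q m)"
      by (rule measurable_from_subset[OF Gt]) (simp_all add: P(2) members(2)[OF q_in])
    let ?a = "\<integral>w. G w * clip C (w v $ i) \<partial>q m"
    have "(\<integral>w. G w * obs n v i (clip C) w \<partial>q m) \<le> ?a + \<eta>"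
    proof (rule obs_expectation(1)[OF P uv(2) measurable_clip abs_clip_le[OF C] GP G1])
      fix r assume r: "r \<in> I" "v \<le> r" "r \<le> v + ereal (1 / real (Suc n))"
      show "(\<integral>w. G w * clip C (w r $ i) \<partial>q m) \<le> ?a + \<eta>"
        using clip_integral_le[OF q_in[of m] uv(2) r(1,2) z(1) z(2)[OF r(1,3)] C Grc[OF less_imp_le[OF uv(3)]] G(3), of i]
          \<eta>[OF q_in[of m]] by linarith
    qed
    moreover have "?a - \<eta> \<le> (\<integral>w. G w * obs n' u i (clip C) w \<partial>q m)"
    proof (rule obs_expectation(2)[OF P uv(1) measurable_clip abs_clip_le[OF C] GP G1])
      fix r assume r: "r \<in> I" "u \<le> r" "r \<le> u + ereal (1 / real (Suc n'))"
      have "r \<le> v" using r(3) n' by (rule order_trans)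
      then show "?a - \<eta> \<le> (\<integral>w. G w * clip C (w r $ i) \<partial>q m)"
        using clip_integral_le[OF q_in[of m] r(1) uv(2) _ z(1) vw C Grc[OF r(2)] G(3), of i] \<eta>[OF q_in[of m]] by simp
    qed
    ultimately show "(\<integral>w. G w * obs n v i (clip C) w \<partial>q m) \<le> (\<integral>w. G w * obs n' u i (clip C) w \<partial>q m) + 2 * \<eta>"
      by linarith
  qed
  note GQ = measurable_Q[OF Gt]
  note limQ = bounded_coordinate_limit[OF _ GQ G1 continuous_on_clip abs_clip_le[OF C], where i = i]
  have "u \<noteq> Sup I" using uv in_I_iff[of v] by auto
  then obtain s where s: "u = ereal s" "0 \<le> s" "ereal s < Sup I" by (rule not_Sup_cases[OF uv(1)])
  obtain b where b: "s < b" "ereal b \<le> v"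
    using uv(3) unfolding s(1) by (cases v) (auto intro: that[of "s + 1"])
  obtain n0 where n0: "1 / real (Suc n0) < b - s" using nat_approx_posE[of "b - s"] b(1) by auto
  have small: "u + ereal (1 / real (Suc n)) \<le> v" if "n0 \<le> n" for n
  proof -
    have "1 / real (Suc n) \<le> 1 / real (Suc n0)" using that by (simp add: frac_le)
    then have "ereal (s + 1 / real (Suc n)) \<le> ereal b" using n0 by simp
    then have "u + ereal (1 / real (Suc n)) \<le> ereal b" by (simp add: s(1))
    then show ?thesis using b(2) by (rule order_trans)
  qed
  show ?thesis
  proof (rule LIMSEQ_le[OF limQ[OF uv(2)] tendsto_add[OF limQ[OF uv(1)] tendsto_const]], intro exI allI impI)
    fix n assume "n0 \<le> n"
    then show "(\<integral>w. G w * obs n v i (clip C) w \<partial>Q) \<le> (\<integral>w. G w * obs n u i (clip C) w \<partial>Q) + 2 * \<eta>"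
      by (intro step small)
  qed
qed

end

section \<open>From continuous weights to events of the past\<close>

context UI_limit
begin

text \<open>All tests that are decided by time \<open>u\<close>, the others being replaced by 0: a
  continuous map into a Polish space that remembers the past.\<close>

definition history :: "ereal \<Rightarrow> 'd path \<Rightarrow> nat \<Rightarrow> real" where
  "history u w l = (if test l \<in> borel_measurable (raw_filtration I u :: 'd path measure) then test l w else 0)"

lemma history_measurable: "history u \<in> borel_measurable (raw_filtration I u)"
proof (rule measurable_coordinatewise_then_product)
  show "(\<lambda>w. history u w l) \<in> borel_measurable (raw_filtration I u)" for l
    by (cases "test l \<in> borel_measurable (raw_filtration I u :: 'd path measure)") (simp_all add: history_def)
qed

lemma history_continuous: "continuous_map (MZ_topology I) euclidean (history u)"
proof -
  have "continuous_map (MZ_topology I) euclideanreal (\<lambda>w. history u w l)" for l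
  proof (cases "test l \<in> borel_measurable (raw_filtration I u :: 'd path measure)")
    case True
    obtain t i n where t: "t \<in> times" and l: "(test l :: 'd path \<Rightarrow> real) = obs n t i squash" by (rule test_cases)
    have "continuous_map (MZ_topology I) euclideanreal (test l :: 'd path \<Rightarrow> real)"
      unfolding l using t times_subset by (intro obs_continuous[OF _ continuous_on_squash abs_squash]) auto
    then show ?thesis using True by (simp add: history_def)
  qed (simp add: history_def)
  then have "continuous_map (MZ_topology I) (product_topology (\<lambda>_. euclidean) UNIV) (history u)"
    by (intro continuous_map_coordinatewise_then_product) auto
  then show ?thesis by (simp add: euclidean_product_topology)
qed

text \<open>The gap between \<open>r\<close> and \<open>u\<close> leaves room for the averages,
  which look ahead: the values up to \<open>r\<close> are recovered from averages whose windows end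
  by \<open>u\<close>, and those belong to the history.\<close>

lemma raw_filtration_history:
  assumes A: "A \<in> sets (raw_filtration I r :: 'd path measure)" and ru: "r < u" "u \<in> I"
  obtains B where "B \<in> sets borel" "A = history u -` B \<inter> cadlag_paths I"
proof -
  define N where "N = vimage_algebra (cadlag_paths I) (history u) borel"
  have sp: "space N = cadlag_paths I" by (simp add: N_def)
  have h: "history u \<in> borel_measurable N" unfolding N_def by (rule measurable_vimage_algebra1) simp
  have "(\<lambda>w. w t) \<in> borel_measurable N" if t: "t \<in> I" "t \<le> r" for t
  proof -
    have "\<exists>n0::nat. q + ereal (1 / real (Suc n0)) \<le> u" if q: "q \<in> times" "q < u" for q
    proof -
      have qI: "q \<in> I" "q \<noteq> Sup I" using q ru(2) times_subset in_I_iff[of u] by auto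
      obtain s where s: "q = ereal s" "0 \<le> s" "ereal s < Sup I" by (rule not_Sup_cases[OF qI])
      obtain b where b: "s < b" "ereal b \<le> u"
        using q(2) unfolding s(1) by (cases u) (auto intro: that[of "s + 1"])
      obtain n0 where "1 / real (Suc n0) < b - s" using nat_approx_posE[of "b - s"] b(1) by auto
      then have "q + ereal (1 / real (Suc n0)) \<le> ereal b" by (simp add: s(1))
      from order_trans[OF this b(2)] show ?thesis by blast
    qed
    then obtain n0 :: "ereal \<Rightarrow> nat" where n0: "\<And>q. q \<in> times \<Longrightarrow> q < u \<Longrightarrow> q + ereal (1 / real (Suc (n0 q))) \<le> u" by metis
    have tu: "t < u" using t(2) ru(1) by simp
    show ?thesis
    proof (rule value_measurable_from_tests[OF sp t(1) _ tu, of n0])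
      fix q n i assume q: "q \<in> times" "t \<le> q" "q < u" "n0 q \<le> n"
      have "q + ereal (1 / real (Suc n)) \<le> q + ereal (1 / real (Suc (n0 q)))"
        using q(4) by (intro add_left_mono) (simp add: frac_le)
      then have "q + ereal (1 / real (Suc n)) \<le> u" using n0[OF q(1,3)] by (rule order_trans)
      note m = measurable_from_subset[OF obs_measurable raw_filtration_mono[OF this]]
      have m: "obs n q i squash \<in> borel_measurable (raw_filtration I u :: 'd path measure)"
        using q(1) times_subset by (intro m) auto
      obtain l where l: "(test l :: 'd path \<Rightarrow> real) = obs n q i squash" by (rule test_eq_obs[OF q(1)])
      have "(\<lambda>w. history u w l) \<in> borel_measurable N" by (rule measurable_product_then_coordinatewise[OF h])
      then show "obs n q i squash \<in> borel_measurable N" using m by (simp add: history_def l)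
    next
      assume "t = Sup I"
      then show "t \<in> times" using tu Sup_upper[OF ru(2)] by simp
    qed
  qed
  then have "{w \<in> cadlag_paths I. w t \<in> V} \<in> sets N" if "t \<in> I" "t \<le> r" "V \<in> sets borel" for t and V :: "(real^'d) set"
    using measurable_sets[of "\<lambda>w. w t" N borel V] that sp by (simp add: vimage_def Int_def conj_commute)
  then have "{{w \<in> cadlag_paths I. w t \<in> V} | t V. t \<in> I \<and> t \<le> r \<and> V \<in> sets borel} \<subseteq> sets N" by blast
  from sets.sigma_sets_subset[OF this] have "A \<in> sets N" using A unfolding sets_raw_filtration sp by blast
  then have "A \<in> {history u -` B \<inter> cadlag_paths I | B. B \<in> sets borel}"
    unfolding N_def by (subst (asm) sets_vimage_algebra2) auto
  then show ?thesis using that by blast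
qed

text \<open>
  The law of \<open>history u\<close> on the Polish space \<open>nat \<Rightarrow> real\<close> is regular, and indicators of compact sets
  are limits of continuous weights.
\<close>

lemma extend_weight_bound:
  assumes D: "D \<in> borel_measurable Q" "\<And>w. \<bar>D w\<bar> \<le> b"
    and weight: "\<And>G. G \<in> borel_measurable (raw_filtration I u) \<Longrightarrow> continuous_map (MZ_topology I) euclideanreal G \<Longrightarrow>
       (\<And>w. 0 \<le> G w \<and> G w \<le> 1) \<Longrightarrow> (\<integral>w. G w * D w \<partial>Q) \<le> a"
    and A: "A \<in> sets (raw_filtration I r)" "r < u" "u \<in> I"
  shows "(\<integral>w. indicator A w * D w \<partial>Q) \<le> a"
proof -
  have hQ: "history u \<in> borel_measurable Q"
    using history_measurable[of u] raw_filtration_subset_terminal[of I u] sets_Q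
    by (auto simp: measurable_def space_Q)
  note [measurable] = D(1) hQ
  have Dint: "integrable Q (\<lambda>w. G w * D w)" if "G \<in> borel_measurable Q" "\<And>w. \<bar>G w\<bar> \<le> 1" for G :: "'d path \<Rightarrow> real"
    by (rule integrable_mult_bounded[OF that integrable_const_bound[OF AE_I2 D(1), of b]]) (use D(2) in simp)
  have compact: "(\<integral>w. indicator C (history u w) * D w \<partial>Q) \<le> a" if C: "compact C" for C
  \<comment> \<open>\<open>infdist\<close> to the empty set is 0, so the cut-offs below would be
    constantly 1; the weight 0 settles this case.\<close>
  proof (cases "C = {}")
    case True
    show ?thesis using weight[of "\<lambda>_. 0"] by (simp add: True)
  next
    case False
    define g where "g m x = max 0 (1 - real m * infdist x C)" for m and x :: "nat \<Rightarrow> real"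
    have g01: "0 \<le> g m x \<and> g m x \<le> 1" for m x using infdist_nonneg[of x C] by (simp add: g_def)
    have g_cont: "continuous_on UNIV (g m)" for m unfolding g_def by (intro continuous_intros)
    have g_meas [measurable]: "g m \<in> borel_measurable borel" for m by (rule borel_measurable_continuous_onI[OF g_cont])
    have C_sets: "C \<in> sets borel" using C by (simp add: borel_closed compact_imp_closed)
    have "(\<lambda>m. \<integral>w. g m (history u w) * D w \<partial>Q) \<longlonglongrightarrow> (\<integral>w. indicator C (history u w) * D w \<partial>Q)"
    proof (rule integral_dominated_convergence[where w = "\<lambda>_. b"])
      have "(\<lambda>m. g m x) \<longlonglongrightarrow> indicator C x" for x
      proof (cases "x \<in> C")
        case True
        then show ?thesis using False by (simp add: g_def)
      next
        case x: False
        then have pos: "0 < infdist x C" using C False by (simp add: infdist_pos_not_in_closed compact_imp_closed)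
        obtain m0 where m0: "1 / infdist x C \<le> real m0" using real_arch_simple by blast
        have "g m x = 0" if "m0 \<le> m" for m
        proof -
          have "1 / infdist x C \<le> real m" using m0 that by linarith
          then have "1 \<le> real m * infdist x C" using pos by (simp add: field_simps)
          then show ?thesis by (simp add: g_def)
        qed
        then have "\<forall>\<^sub>F m in sequentially. g m x = 0" unfolding eventually_sequentially by blast
        then show ?thesis using x by (simp add: tendsto_eventually)
      qed
      then show "AE w in Q. (\<lambda>m. g m (history u w) * D w) \<longlonglongrightarrow> indicator C (history u w) * D w"
        by (intro AE_I2 tendsto_mult_right)
      have "\<bar>g m x * D w\<bar> \<le> 1 * b" for m x w
        unfolding abs_mult using g01[of m x] D(2)[of w] by (intro mult_mono) auto
      then show "AE w in Q. norm (g m (history u w) * D w) \<le> b" for m by (intro AE_I2) simp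
    qed (intro borel_measurable_times D(1) measurable_compose[OF hQ] g_meas borel_measurable_indicator C_sets integrable_const)+
    moreover have "(\<integral>w. g m (history u w) * D w \<partial>Q) \<le> a" for m
    proof (rule weight)
      show "(\<lambda>w. g m (history u w)) \<in> borel_measurable (raw_filtration I u)"
        by (rule measurable_compose[OF history_measurable g_meas])
      have "continuous_map euclidean euclideanreal (g m)" using g_cont by simp
      from continuous_map_compose[OF history_continuous this]
      show "continuous_map (MZ_topology I) euclideanreal (\<lambda>w. g m (history u w))" by (simp add: o_def)
    qed (rule g01)
    ultimately show ?thesis by (intro LIMSEQ_le_const2) auto
  qed
  obtain B where B: "B \<in> sets borel" "A = history u -` B \<inter> cadlag_paths I" by (rule raw_filtration_history[OF A])
  note [measurable] = B(1)
  let ?M = "distr Q borel (history u)"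
  interpret M: prob_space ?M by (rule prob_space_distr) measurable
  have ind: "(\<integral>w. indicator A w * D w \<partial>Q) = (\<integral>w. indicator B (history u w) * D w \<partial>Q)"
    by (intro Bochner_Integration.integral_cong refl) (simp add: B(2) indicator_def space_Q)
  have "0 \<le> b" using D(2)[of undefined] by linarith
  show ?thesis unfolding ind
  proof (rule field_le_epsilon)
    fix e :: real assume e: "0 < e"
    \<comment> \<open>The indicators of \<open>B\<close> and of the compact \<open>C\<close> differ
      on a set of measure below \<open>?e\<close>, where \<open>D\<close> is at most
      \<open>b\<close>; adding 1 admits \<open>b = 0\<close>.\<close>
    let ?e = "e / (b + 1)"
    have reg: "emeasure ?M B = (SUP C\<in>{C. C \<subseteq> B \<and> compact C}. emeasure ?M C)"
      by (rule inner_regular) (auto simp: M.emeasure_eq_measure)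
    have e': "0 < ?e" using e \<open>0 \<le> b\<close> by simp
    obtain C where C: "C \<subseteq> B" "compact C" "measure ?M B - ?e < measure ?M C"
    \<comment> \<open>\<open>ennreal\<close> would truncate a negative number to 0, and a strict
      inequality could fail for a null set; here the empty set serves as \<open>C\<close>.\<close>
    proof (cases "measure ?M B - ?e < 0")
      case True
      then show ?thesis by (intro that[of "{}"]) simp_all
    next
      case False
      then have "ennreal (measure ?M B - ?e) < emeasure ?M B"
        using e' by (simp add: M.emeasure_eq_measure ennreal_less_iff)
      then obtain C where C: "C \<subseteq> B" "compact C" "ennreal (measure ?M B - ?e) < emeasure ?M C"
        unfolding reg less_SUP_iff by blast
      from C(3) False have "measure ?M B - ?e < measure ?M C"
        by (simp add: M.emeasure_eq_measure ennreal_less_iff)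
      with C(1,2) show ?thesis by (rule that)
    qed
    have [measurable]: "C \<in> sets borel" using C(2) by (simp add: borel_closed compact_imp_closed)
    have "measure ?M (B - C) < ?e" using M.finite_measure_Diff[of B C] C(1,3) by simp
    then have small: "measure Q (history u -` (B - C) \<inter> space Q) < ?e" by (simp add: measure_distr)
    have meas: "history u -` (B - C) \<inter> space Q \<in> sets Q" by measurable
    have i1: "integrable Q (\<lambda>w. indicator C (history u w) * D w)" by (rule Dint) (auto simp: indicator_def)
    have i2: "integrable Q (\<lambda>w. indicator (history u -` (B - C) \<inter> space Q) w * b)"
      using meas by (intro integrable_mult_left integrable_real_indicator) (auto simp: emeasure_eq_measure)
    have "(\<integral>w. indicator B (history u w) * D w \<partial>Q) \<le>
        (\<integral>w. indicator C (history u w) * D w + indicator (history u -` (B - C) \<inter> space Q) w * b \<partial>Q)"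
    proof (rule integral_mono[OF _ Bochner_Integration.integrable_add[OF i1 i2]])
      show "integrable Q (\<lambda>w. indicator B (history u w) * D w)" by (rule Dint) (auto simp: indicator_def)
      fix w assume "w \<in> space Q"
      then show "indicator B (history u w) * D w \<le>
          indicator C (history u w) * D w + indicator (history u -` (B - C) \<inter> space Q) w * b"
        using C(1) D(2)[of w] by (auto simp: indicator_def)
    qed
    also have "\<dots> \<le> a + measure Q (history u -` (B - C) \<inter> space Q) * b"
      using compact[OF C(2)] meas i1 i2 by simp
    also have "\<dots> \<le> a + ?e * b" using small \<open>0 \<le> b\<close> by (intro add_left_mono mult_right_mono) auto
    also have "\<dots> \<le> a + e" using e \<open>0 \<le> b\<close> by (simp add: divide_simps) (simp add: algebra_simps)
    finally show "(\<integral>w. indicator B (history u w) * D w \<partial>Q) \<le> a + e" .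
  qed
qed

lemma clip_measurable_Q: "t \<in> I \<Longrightarrow> (\<lambda>w. clip C (w t $ i)) \<in> borel_measurable Q"
  by (rule measurable_compose[OF coordinate_measurable_Q measurable_clip])

text \<open>An event of the right-continuous past of \<open>s\<close> belongs to the raw past of
  \<open>s + \<delta> / 2\<close> for every \<open>\<delta> > 0\<close>, so it can be tested at the
  strictly later time \<open>s + \<delta>\<close>; as \<open>\<delta>\<close> decreases to 0,
  right-continuity of the paths returns to \<open>s\<close>.\<close>

lemma clip_difference_bound:
  assumes st: "s \<in> I" "t \<in> I" "s < t" and z: "z \<in> I" "\<And>n r. r \<in> I \<Longrightarrow> r \<le> t + ereal (1 / real (Suc n)) \<Longrightarrow> r \<le> z"
    and C: "0 \<le> C" and \<eta>: "\<And>P. P \<in> \<M> \<Longrightarrow> (\<integral>w. max 0 (- (w z $ i) - C) \<partial>P) \<le> \<eta>"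
    and A: "A \<in> sets (rc_filtration I s)"
  shows "(\<integral>w. indicator A w * (clip C (w t $ i) - clip C (w s $ i)) \<partial>Q) \<le> 2 * \<eta>"
proof -
  have "s \<noteq> Sup I" using st in_I_iff[of t] by auto
  then obtain x where x: "s = ereal x" "0 \<le> x" "ereal x < Sup I" by (rule not_Sup_cases[OF st(1)])
  obtain b where b: "x < b" "ereal b \<le> t"
    using st(3) unfolding x(1) by (cases t) (auto intro: that[of "x + 1"])
  have bI: "ereal b \<in> I" using b x(2) by (intro in_I_mono[OF _ b(2) st(2)]) simp
  \<comment> \<open>The denominator starts at 2, which keeps \<open>u m\<close> strictly below
    \<open>b\<close> and hence strictly between \<open>s\<close> and \<open>t\<close>.\<close>
  define \<delta> where "\<delta> m = (b - x) / real (Suc (Suc m))" for m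
  define u where "u m = x + \<delta> m" for m
  have \<delta>: "0 < \<delta> m" "\<delta> m < b - x" for m using b(1) by (simp_all add: \<delta>_def divide_simps)
  have u: "x < u m" "u m < b" for m using \<delta>[of m] by (simp_all add: u_def)
  have uI: "ereal (u m) \<in> I" for m using u[of m] x(2) by (intro in_I_mono[OF _ _ bI]) auto
  have "(\<lambda>m. x + (b - x) / real (m + 2)) \<longlonglongrightarrow> x + 0"
    by (intro tendsto_add tendsto_const LIMSEQ_ignore_initial_segment[OF lim_const_over_n])
  then have "u \<longlonglongrightarrow> x" by (simp add: u_def[abs_def] \<delta>_def[abs_def])
  then have u_lim: "(\<lambda>m. component i w (u m)) \<longlonglongrightarrow> component i w x" if "w \<in> cadlag_paths I" for w
    using u b x(2) by (intro path_right_sequence[OF that bI]) (auto intro: less_imp_le)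
  have AQ: "A \<in> sets Q" using A rc_filtration_subset_terminal[of I s] sets_Q by auto
  have bound: "\<bar>clip C y - clip C z\<bar> \<le> 2 * C" for y z using abs_clip_le[OF C, of y] abs_clip_le[OF C, of z] by linarith
  have "(\<lambda>m. \<integral>w. indicator A w * (clip C (w t $ i) - clip C (w (ereal (u m)) $ i)) \<partial>Q)
      \<longlonglongrightarrow> (\<integral>w. indicator A w * (clip C (w t $ i) - clip C (w s $ i)) \<partial>Q)"
  proof (rule integral_dominated_convergence[where w = "\<lambda>_. 2 * C"])
    have "(\<lambda>m. clip C (w (ereal (u m)) $ i)) \<longlonglongrightarrow> clip C (w s $ i)" if "w \<in> space Q" for w
    proof -
      have "isCont (clip C) (component i w x)" using continuous_on_clip[of UNIV C] by (simp add: continuous_on_eq_continuous_at)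
      from isCont_tendsto_compose[OF this u_lim] that show ?thesis by (simp add: space_Q component_def x(1))
    qed
    then show "AE w in Q. (\<lambda>m. indicator A w * (clip C (w t $ i) - clip C (w (ereal (u m)) $ i)))
        \<longlonglongrightarrow> indicator A w * (clip C (w t $ i) - clip C (w s $ i))"
      by (intro AE_I2 tendsto_intros)
    show "AE w in Q. norm (indicator A w * (clip C (w t $ i) - clip C (w (ereal (u m)) $ i))) \<le> 2 * C" for m
      using bound C by (intro AE_I2) (auto simp: indicator_def)
  qed (intro integrable_const borel_measurable_times borel_measurable_diff borel_measurable_indicator AQ clip_measurable_Q st uI)+
  moreover have "(\<integral>w. indicator A w * (clip C (w t $ i) - clip C (w (ereal (u m)) $ i)) \<partial>Q) \<le> 2 * \<eta>" for m
  proof (rule extend_weight_bound[OF _ bound])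
    have "s + ereal (\<delta> m / 2) < ereal (u m)" using \<delta>[of m] by (simp add: x(1) u_def)
    then show "s + ereal (\<delta> m / 2) < ereal (u m)" .
    show "A \<in> sets (raw_filtration I (s + ereal (\<delta> m / 2)))"
      using A \<delta>(1)[of m] unfolding sets_rc_filtration by auto
    show "ereal (u m) \<in> I" by (rule uI)
    show "(\<lambda>w. clip C (w t $ i) - clip C (w (ereal (u m)) $ i)) \<in> borel_measurable Q"
      by (intro borel_measurable_diff clip_measurable_Q st uI)
    fix G :: "'d path \<Rightarrow> real"
    assume G: "G \<in> borel_measurable (raw_filtration I (ereal (u m)))" "continuous_map (MZ_topology I) euclideanreal G"
      "\<And>w. 0 \<le> G w \<and> G w \<le> 1"
    have ut: "ereal (u m) < t"
    proof -
      have "ereal (u m) < ereal b" using u[of m] by simp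
      then show ?thesis using b(2) by (rule less_le_trans)
    qed
    have GQ: "G \<in> borel_measurable Q"
      by (rule measurable_Q[OF measurable_from_subset[OF G(1) raw_filtration_subset_terminal]]) simp
    have G1: "\<bar>G w\<bar> \<le> 1" for w using G(3)[of w] by auto
    have int: "integrable Q (\<lambda>w. G w * clip C (w r $ i))" if "r \<in> I" for r
      by (rule integrable_mult_bounded[OF GQ G1 integrable_const_bound[of _ C]])
        (use abs_clip_le[OF C] clip_measurable_Q[OF that] in auto)
    have "(\<integral>w. G w * clip C (w t $ i) \<partial>Q) \<le> (\<integral>w. G w * clip C (w (ereal (u m)) $ i) \<partial>Q) + 2 * \<eta>"
      by (rule continuous_weight_bound[OF uI st(2) ut z(1)]) (fact z C \<eta> G)+
    then show "(\<integral>w. G w * (clip C (w t $ i) - clip C (w (ereal (u m)) $ i)) \<partial>Q) \<le> 2 * \<eta>"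
      using int[OF st(2)] int[OF uI]
      by (simp add: right_diff_distrib)
  qed
  ultimately show ?thesis by (intro LIMSEQ_le_const2) auto
qed

text \<open>The truncated first moments are bounded by \<open>K\<close> along \<open>q\<close>,
  hence under \<open>Q\<close>, and Fatou's lemma removes the truncation.\<close>

lemma integrable_coordinate: 
  assumes t: "t \<in> I"
  shows "integrable Q (\<lambda>w. w t $ i)"
proof -
  note [measurable] = coordinate_measurable_Q[OF t]
  let ?\<phi> = "\<lambda>j x. \<bar>clip (real j) x\<bar>"
  have \<phi>: "continuous_on UNIV (?\<phi> j)" "?\<phi> j \<in> borel_measurable borel" "\<bar>?\<phi> j x\<bar> \<le> real j" for j x
    using abs_clip_le[of "real j" x] by (auto intro!: continuous_on_rabs continuous_on_clip)
  have "(\<integral>w. ?\<phi> j (w t $ i) \<partial>Q) \<le> K" for j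
  proof -
    have "(\<integral>w. 1 * obs n t i (?\<phi> j) w \<partial>Q) \<le> K" for n
    proof (rule LIMSEQ_le_const2)
      show "(\<lambda>m. \<integral>w. 1 * obs n t i (?\<phi> j) w \<partial>q m) \<longlonglongrightarrow> (\<integral>w. 1 * obs n t i (?\<phi> j) w \<partial>Q)"
      proof (rule conv[where B = "real j"])
        show "(\<lambda>w. 1 * obs n t i (?\<phi> j) w) \<in> borel_measurable (terminal_sigma I)"
          using obs_measurable_terminal[OF t \<phi>(2)] by simp
        show "continuous_map (MZ_topology I) euclideanreal (\<lambda>w. 1 * obs n t i (?\<phi> j) w)"
          using obs_continuous[OF t \<phi>(1,3)] by simp
        show "\<bar>1 * obs n t i (?\<phi> j) w\<bar> \<le> real j" if "w \<in> cadlag_paths I" for w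
          using obs_bounds[OF that t \<phi>(2), of 0 j "real j" n i] \<phi>(3)[of j] by simp
      qed
      have "(\<integral>w. 1 * obs n t i (?\<phi> j) w \<partial>q m) \<le> K" for m
      proof (rule obs_expectation(1)[OF members(1,3)[OF q_in] t \<phi>(2,3)])
        fix r assume r: "r \<in> I"
        have "(\<integral>w. 1 * ?\<phi> j (w r $ i) \<partial>q m) \<le> (\<integral>w. \<bar>w r $ i\<bar> \<partial>q m)"
        proof (rule integral_mono)
          note X = members(4)[OF q_in[of m] r, of i]
          show "integrable (q m) (\<lambda>w. \<bar>w r $ i\<bar>)" using X by simp
          show "integrable (q m) (\<lambda>w. 1 * ?\<phi> j (w r $ i))"
            using measurable_compose[OF borel_measurable_integrable[OF X] \<phi>(2)] abs_clip_le_abs[of "real j"]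
            by (intro Bochner_Integration.integrable_bound[OF X]) auto
        qed (simp add: abs_clip_le_abs)
        also have "\<dots> \<le> K" by (rule abs_integral_bound[OF q_in r])
        finally show "(\<integral>w. 1 * ?\<phi> j (w r $ i) \<partial>q m) \<le> K" .
      qed simp_all
      then show "\<exists>N. \<forall>m\<ge>N. (\<integral>w. 1 * obs n t i (?\<phi> j) w \<partial>q m) \<le> K" by blast
    qed
    moreover have "(\<lambda>n. \<integral>w. 1 * obs n t i (?\<phi> j) w \<partial>Q) \<longlonglongrightarrow> (\<integral>w. 1 * ?\<phi> j (w t $ i) \<partial>Q)"
      by (rule bounded_coordinate_limit[OF t _ _ \<phi>(1,3)]) simp_all
    ultimately have "(\<integral>w. 1 * ?\<phi> j (w t $ i) \<partial>Q) \<le> K" by (intro LIMSEQ_le_const2) auto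
    then show ?thesis by simp
  qed
  then have nn: "(\<integral>\<^sup>+w. ennreal (?\<phi> j (w t $ i)) \<partial>Q) \<le> ennreal K" for j
    by (subst nn_integral_eq_integral[OF integrable_const_bound[of _ "real j"]])
      (use \<phi>(3) measurable_compose[OF coordinate_measurable_Q[OF t] \<phi>(2)] in \<open>auto intro: ennreal_leI\<close>)
  have "(\<integral>\<^sup>+w. ennreal \<bar>w t $ i\<bar> \<partial>Q) = (\<integral>\<^sup>+w. liminf (\<lambda>j. ennreal (?\<phi> j (w t $ i))) \<partial>Q)"
    by (intro nn_integral_cong lim_imp_Liminf[symmetric] tendsto_ennrealI tendsto_rabs clip_tendsto) simp
  also have "\<dots> \<le> liminf (\<lambda>j. \<integral>\<^sup>+w. ennreal (?\<phi> j (w t $ i)) \<partial>Q)"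
    by (rule nn_integral_liminf) measurable
  also have "\<dots> \<le> liminf (\<lambda>j. ennreal K)" by (rule Liminf_mono) (simp add: nn)
  also have "\<dots> = ennreal K" by (simp add: Liminf_const)
  finally have "(\<integral>\<^sup>+w. ennreal (norm (w t $ i)) \<partial>Q) < \<infinity>" by (simp add: le_less_trans)
  then show ?thesis by (intro integrableI_bounded) measurable
qed

text \<open>The truncation level tends to infinity only here: beyond the level \<open>c\<close> that
  uniform integrability provides for \<open>e / 2\<close> the error is at most \<open>e\<close>, and
  the limit in \<open>j\<close> is dominated by the coordinates, which are integrable under
  \<open>Q\<close>.\<close>

lemma coordinate_difference_nonpos:
  assumes st: "s \<in> I" "t \<in> I" "s < t" and A: "A \<in> sets (rc_filtration I s)"
  shows "(\<integral>w. indicator A w * (w t $ i - w s $ i) \<partial>Q) \<le> 0"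
proof (rule field_le_epsilon)
  fix e :: real assume "0 < e"
  then have e: "0 < e / 2" by simp
  obtain z where z: "z \<in> I" "\<And>n r. r \<in> I \<Longrightarrow> r \<le> t + ereal (1 / real (Suc n)) \<Longrightarrow> r \<le> z" by (rule later_time[OF st(2)]) blast
  obtain c where c: "\<And>P. P \<in> \<M> \<Longrightarrow> (\<integral>w. max 0 (- (w z $ i) - c) \<partial>P) \<le> e / 2"
    using neg_part_excess[OF z(1) e] by blast
  have AQ: "A \<in> sets Q" using A rc_filtration_subset_terminal[of I s] sets_Q by auto
  note int = integrable_coordinate[OF st(1), of i] integrable_coordinate[OF st(2), of i]
  have lim: "(\<lambda>j. \<integral>w. indicator A w * (clip (real j) (w t $ i) - clip (real j) (w s $ i)) \<partial>Q)
      \<longlonglongrightarrow> (\<integral>w. indicator A w * (w t $ i - w s $ i) \<partial>Q)"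
  proof (rule integral_dominated_convergence[where w = "\<lambda>w. \<bar>w t $ i\<bar> + \<bar>w s $ i\<bar>"])
    show "AE w in Q. (\<lambda>j. indicator A w * (clip (real j) (w t $ i) - clip (real j) (w s $ i)))
        \<longlonglongrightarrow> indicator A w * (w t $ i - w s $ i)"
      by (intro AE_I2 tendsto_intros clip_tendsto)
    have "\<bar>clip (real j) y - clip (real j) z\<bar> \<le> \<bar>y\<bar> + \<bar>z\<bar>" for j y z
      using abs_clip_le_abs[of "real j" y] abs_clip_le_abs[of "real j" z] by linarith
    then show "AE w in Q. norm (indicator A w * (clip (real j) (w t $ i) - clip (real j) (w s $ i))) \<le> \<bar>w t $ i\<bar> + \<bar>w s $ i\<bar>" for j
      by (intro AE_I2) (auto simp: indicator_def)
  qed (intro Bochner_Integration.integrable_add integrable_abs int borel_measurable_times borel_measurable_diff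
      borel_measurable_indicator AQ clip_measurable_Q coordinate_measurable_Q st)+
  obtain j0 where j0: "c \<le> real j0" using real_arch_simple by blast
  have "(\<integral>w. indicator A w * (clip (real j) (w t $ i) - clip (real j) (w s $ i)) \<partial>Q) \<le> 2 * (e / 2)" if j: "j0 \<le> j" for j
  proof (rule clip_difference_bound[OF st z(1) _ _ _ A])
    show "r \<le> z" if "r \<in> I" "r \<le> t + ereal (1 / real (Suc n))" for n r by (rule z(2)[OF that])
    fix P assume P: "P \<in> \<M>"
    interpret P: prob_space P by (rule members(1)[OF P])
    note X = members(4)[OF P z(1), of i]
    have "(\<integral>w. max 0 (- (w z $ i) - real j) \<partial>P) \<le> (\<integral>w. max 0 (- (w z $ i) - c) \<partial>P)"
    proof (rule integral_mono)
      show "integrable P (\<lambda>w. max 0 (- (w z $ i) - real j))" "integrable P (\<lambda>w. max 0 (- (w z $ i) - c))"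
        using X by (intro Bochner_Integration.integrable_max Bochner_Integration.integrable_diff; simp)+
      have "c \<le> real j" using j0 j by linarith
      then show "max 0 (- (w z $ i) - real j) \<le> max 0 (- (w z $ i) - c)" for w :: "'d path" by (auto simp: max_def)
    qed
    also have "\<dots> \<le> e / 2" by (rule c[OF P])
    finally show "(\<integral>w. max 0 (- (w z $ i) - real j) \<partial>P) \<le> e / 2" .
  qed simp
  then have "(\<integral>w. indicator A w * (w t $ i - w s $ i) \<partial>Q) \<le> 2 * (e / 2)"
    by (intro LIMSEQ_le_const2[OF lim]) blast
  then show "(\<integral>w. indicator A w * (w t $ i - w s $ i) \<partial>Q) \<le> 0 + e" by simp
qed

theorem limit_supermartingale_measure: "supermartingale_measure I Q"
proof -
  have adapted: "(\<lambda>w. w t $ i) \<in> borel_measurable (rc_filtration I t :: 'd path measure)" if "t \<in> I" for t i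
    by (rule measurable_from_subset[OF coordinate_measurable[OF that order_refl] raw_filtration_subset_rc]) simp
  have "AE w in Q. real_cond_exp Q (rc_filtration I s) (\<lambda>w. w t $ i) w \<le> w s $ i"
    if st: "s \<in> I" "t \<in> I" "s \<le> t" for s t i
  proof -
    have sub: "subalgebra Q (rc_filtration I s)" by (rule subalgebra_rc_filtration[OF sets_Q])
    interpret finite_measure_subalgebra Q "rc_filtration I s" by standard (rule sub)
    let ?E = "real_cond_exp Q (rc_filtration I s) (\<lambda>w. w t $ i)"
    note int = integrable_coordinate[OF st(1), of i] integrable_coordinate[OF st(2), of i]
    show ?thesis
    proof (cases "s = t")
      case True
      have "AE w in Q. ?E w = w t $ i"
        using int(2) adapted[OF st(2)] True by (intro real_cond_exp_F_meas) auto
      then show ?thesis by (rule eventually_mono) (simp add: True)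
    next
      case False
      then have "s < t" using st(3) by simp
      note [measurable] = adapted[OF st(1), of i]
      \<comment> \<open>The event on which the inequality fails: it is known at \<open>s\<close>, so
        the nonpositive expected difference forces it to be null.\<close>
      define A where "A = {w \<in> space (rc_filtration I s). w s $ i < ?E w}"
      have A: "A \<in> sets (rc_filtration I s)" unfolding A_def by measurable
      then have AQ: "A \<in> sets Q" using sub by (auto simp: subalgebra_def)
      note E = real_cond_exp_int[OF int(2)]
      have ind: "integrable Q (\<lambda>w. indicator A w * f w)" if "integrable Q f" for f :: "'d path \<Rightarrow> real"
        using integrable_mult_indicator[OF AQ that] by simp
      let ?f = "\<lambda>w. indicator A w * ?E w - indicator A w * (w s $ i)"
      have pos: "0 \<le> ?f w" if "w \<in> space Q" for w by (auto simp: A_def indicator_def)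
      have f: "integrable Q ?f" by (intro Bochner_Integration.integrable_diff ind E(1) int(1))
      have "(\<integral>w. indicator A w * ?E w \<partial>Q) = (\<integral>w. indicator A w * (w t $ i) \<partial>Q)"
        using A by (intro real_cond_exp_intg(2) ind int(2) borel_measurable_indicator borel_measurable_integrable)
      then have "(\<integral>w. ?f w \<partial>Q) = (\<integral>w. indicator A w * (w t $ i - w s $ i) \<partial>Q)"
        using ind[OF E(1)] ind[OF int(1)] ind[OF int(2)] by (simp add: right_diff_distrib)
      then have "(\<integral>w. ?f w \<partial>Q) \<le> 0" using coordinate_difference_nonpos[OF st(1,2) \<open>s < t\<close> A, of i] by simp
      moreover have "0 \<le> (\<integral>w. ?f w \<partial>Q)" by (rule integral_nonneg_AE[OF AE_I2[OF pos]])
      ultimately have "(\<integral>w. ?f w \<partial>Q) = 0" by simp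
      then have "AE w in Q. ?f w = 0"
        by (subst (asm) integral_nonneg_eq_0_iff_AE[OF f]) (rule AE_I2[OF pos])
      moreover have "AE w in Q. w \<in> space (rc_filtration I s)" by (rule AE_I2) (simp add: space_Q)
      ultimately show ?thesis
        by eventually_elim (auto simp: A_def indicator_def split: if_splits)
    qed
  qed
  then show ?thesis
    unfolding supermartingale_measure_def supermartingale_def
    using prob_Q space_Q sets_Q adapted integrable_coordinate by blast
qed

end

section \<open>The condition (UI)\<close>

text \<open>The condition bounds a sum of two terms. The zero integrand isolates the first moment,
  and nonnegativity of the first moment isolates the integral.\<close>

lemma UI_condition_bound:
  assumes "UI_condition I \<M>" "0 \<in> I"
  obtains K where "0 \<le> K"
    and "\<And>Q t. Q \<in> \<M> \<Longrightarrow> t \<in> I \<Longrightarrow> (\<integral>w. l1_norm (w t) \<partial>Q) \<le> K"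
    and "\<And>Q t H. Q \<in> \<M> \<Longrightarrow> t \<in> I \<Longrightarrow> H \<in> elementary_integrands I Q \<Longrightarrow> (\<integral>w. elementary_integral H t w \<partial>Q) \<le> K"
proof -
  let ?E = "\<lambda>Q t. SUP H\<in>elementary_integrands I Q. ereal (\<integral>w. elementary_integral H t w \<partial>Q)"
  define S where "S = (SUP Q\<in>\<M>. SUP t\<in>I. ereal (\<integral>w. l1_norm (w t) \<partial>Q) + ?E Q t)"
  have "S < \<infinity>" using assms(1) unfolding UI_condition_def S_def by blast
  \<comment> \<open>\<open>max 0\<close> also covers an empty family, whose supremum is minus
    infinity.\<close>
  define K where "K = max 0 (real_of_ereal S)"
  have SK: "S \<le> ereal K" using \<open>S < \<infinity>\<close> unfolding K_def by (cases S) auto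
  have le: "(\<integral>w. l1_norm (w t) \<partial>Q) + (\<integral>w. elementary_integral H t w \<partial>Q) \<le> K"
    if "Q \<in> \<M>" "t \<in> I" "H \<in> elementary_integrands I Q" for Q t H
  proof -
    have "ereal (\<integral>w. l1_norm (w t) \<partial>Q) + ereal (\<integral>w. elementary_integral H t w \<partial>Q)
        \<le> ereal (\<integral>w. l1_norm (w t) \<partial>Q) + ?E Q t"
      by (intro add_left_mono SUP_upper that)
    also have "\<dots> \<le> (SUP t\<in>I. ereal (\<integral>w. l1_norm (w t) \<partial>Q) + ?E Q t)" by (rule SUP_upper[OF that(2)])
    also have "\<dots> \<le> S" unfolding S_def by (rule SUP_upper[OF that(1)])
    also note SK
    finally show ?thesis by simp
  qed
  have zero: "(0, \<lambda>_ _. 0, \<lambda>_ _ _. 0) \<in> elementary_integrands I Q" for Q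
    using assms(2) by (simp add: elementary_integrands_def)
  have zero': "elementary_integral (0, \<lambda>_ _. 0, \<lambda>_ _ _. 0) t w = 0" for t and w :: "'a path"
    by (simp add: elementary_integral_def)
  have nonneg: "0 \<le> (\<integral>w. l1_norm (w t) \<partial>Q)" for t and Q :: "'a path measure"
    by (rule integral_nonneg_AE) (simp add: l1_norm_def sum_nonneg)
  show ?thesis
  proof (rule that[of K])
    show "0 \<le> K" by (simp add: K_def)
    show "(\<integral>w. l1_norm (w t) \<partial>Q) \<le> K" if "Q \<in> \<M>" "t \<in> I" for Q t
      using le[OF that zero] unfolding zero' by simp
    show "(\<integral>w. elementary_integral H t w \<partial>Q) \<le> K" if "Q \<in> \<M>" "t \<in> I" "H \<in> elementary_integrands I Q" for Q t H
      using le[OF that] nonneg[of Q t] by linarith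
  qed
qed

lemma neg_component_le_neg_part: "- (x $ i) \<le> neg_part x"
proof -
  have "- (x $ i) \<le> - min (x $ i) 0" by simp
  also have "\<dots> \<le> neg_part x" unfolding neg_part_def by (rule member_le_sum) auto
  finally show ?thesis .
qed

lemma UI_condition_excess:
  assumes UI: "UI_condition I \<M>" and super: "\<And>Q. Q \<in> \<M> \<Longrightarrow> supermartingale_measure I Q"
    and t: "t \<in> I" and \<eta>: "0 < \<eta>"
  shows "\<exists>c. \<forall>Q\<in>\<M>. (\<integral>w. max 0 (- (w t $ i) - c) \<partial>Q) \<le> \<eta>"
proof -
  let ?N = "\<lambda>c Q. \<integral>\<^sup>+w. ennreal (neg_part (w t) * indicator {w. neg_part (w t) > c} w) \<partial>Q"
  have "((\<lambda>c. SUP Q\<in>\<M>. ?N c Q) \<longlongrightarrow> 0) at_top"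
    using UI t unfolding UI_condition_def by blast
  then have "\<forall>\<^sub>F c in at_top. (SUP Q\<in>\<M>. ?N c Q) < ennreal \<eta>"
    using \<eta> by (intro order_tendstoD(2)) auto
  then have "\<forall>\<^sub>F c in at_top. 0 \<le> c \<and> (SUP Q\<in>\<M>. ?N c Q) < ennreal \<eta>"
    by (intro eventually_conj eventually_ge_at_top)
  then obtain c where c: "0 \<le> c" "(SUP Q\<in>\<M>. ?N c Q) < ennreal \<eta>"
    by (auto simp: eventually_at_top_linorder)
  have "(\<integral>w. max 0 (- (w t $ i) - c) \<partial>Q) \<le> \<eta>" if Q: "Q \<in> \<M>" for Q
  proof -
    interpret prob_space Q using super[OF Q] by (simp add: supermartingale_measure_def)
    have X: "integrable Q (\<lambda>w. w t $ i)"
      using super[OF Q] t by (simp add: supermartingale_measure_def supermartingale_def)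
    have int: "integrable Q (\<lambda>w. max 0 (- (w t $ i) - c))"
      by (intro Bochner_Integration.integrable_max Bochner_Integration.integrable_diff Bochner_Integration.integrable_minus X) simp_all
    \<comment> \<open>A positive left side forces \<open>neg_part (w t) > c\<close>, so the tail in
      the condition dominates the excess.\<close>
    have "max 0 (- (w t $ i) - c) \<le> neg_part (w t) * indicator {w. neg_part (w t) > c} w" for w
      using neg_component_le_neg_part[of "w t" i] c(1) by (auto simp: indicator_def max_def)
    then have "ennreal (max 0 (- (w t $ i) - c)) \<le> ennreal (neg_part (w t) * indicator {w. neg_part (w t) > c} w)" for w
      by (rule ennreal_leI)
    then have "(\<integral>\<^sup>+w. ennreal (max 0 (- (w t $ i) - c)) \<partial>Q) \<le> ?N c Q"
      by (intro nn_integral_mono)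
    also have "\<dots> \<le> (SUP Q\<in>\<M>. ?N c Q)" by (rule SUP_upper[OF Q])
    also have "\<dots> \<le> ennreal \<eta>" using c(2) by simp
    finally show ?thesis using \<eta> by (subst (asm) nn_integral_eq_integral[OF int]) auto
  qed
  then show ?thesis by blast
qed

lemma UI_family_if_UI_condition:
  assumes I: "time_interval I" and super: "\<And>Q. Q \<in> \<M> \<Longrightarrow> supermartingale_measure I Q" and UI: "UI_condition I \<M>"
  obtains K where "UI_family I \<M> K"
proof -
  interpret time_line I by standard (rule I)
  obtain K where K: "0 \<le> K"
    "\<And>Q t. Q \<in> \<M> \<Longrightarrow> t \<in> I \<Longrightarrow> (\<integral>w. l1_norm (w t) \<partial>Q) \<le> K"
    "\<And>Q t H. Q \<in> \<M> \<Longrightarrow> t \<in> I \<Longrightarrow> H \<in> elementary_integrands I Q \<Longrightarrow> (\<integral>w. elementary_integral H t w \<partial>Q) \<le> K"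
    by (rule UI_condition_bound[OF UI zero_in_I]) blast
  have "UI_family I \<M> K"
    by unfold_locales (fact super K | rule UI_condition_excess[OF UI super]; assumption)+
  then show ?thesis by (rule that)
qed

theorem corollary3p4:
  fixes I :: "ereal set"
    and \<tau> :: "('d::finite) path topology"
    and \<M> :: "'d path measure set"
  assumes "time_interval I"
    and "topspace \<tau> = cadlag_paths I"
    and "Hausdorff_space \<tau>" and "regular_space \<tau>"
    and "weaker_topology \<tau> (S_topology I)"
    and "weaker_topology (MZ_topology I) \<tau>"
    and "\<M> \<subseteq> {Q. supermartingale_measure I Q}"
    and "UI_condition I \<M>"
  shows "seq_closure (weak_star \<tau>) (measure ` \<M>) \<subseteq> measure ` {Q. supermartingale_measure I Q}
       \<and> compactin (weak_star \<tau>) (seq_closure (weak_star \<tau>) (measure ` \<M>))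
       \<and> seq_compactin (weak_star \<tau>) (seq_closure (weak_star \<tau>) (measure ` \<M>))"
proof -
  have super: "supermartingale_measure I Q" if "Q \<in> \<M>" for Q using assms(7) that by blast
  obtain K where K: "UI_family I \<M> K"
    by (rule UI_family_if_UI_condition[OF assms(1) super assms(8)])
  interpret UI_family I \<M> K by (rule K)
  interpret countably_tested_space \<tau> "terminal_sigma I" test good_set
    by (rule tests_instance[OF assms(2,5,6)])
  have "\<exists>\<phi>. \<M> \<subseteq> tight_family \<phi>"
  proof (rule tight_family_if_uniform)
    fix l and \<eta> :: real assume \<eta>: "0 < \<eta>"
    obtain i r m where G: "\<And>k. (good_set l k :: 'd path set) = good i r m k" by (rule good_set_cases) blast
    show "\<exists>k. \<forall>Q\<in>\<M>. measure Q (topspace \<tau> - good_set l k) \<le> \<eta>"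
      unfolding G assms(2) by (rule uniformly_good[OF \<eta>])
  qed (use members in auto)
  then obtain \<phi> where \<phi>: "\<M> \<subseteq> tight_family \<phi>" by blast
  note closure = weak_star_seq_closure_tight[OF \<phi>]
  have "\<mu> \<in> measure ` {Q. supermartingale_measure I Q}"
    if \<mu>: "\<mu> \<in> seq_closure (weak_star \<tau>) (measure ` \<M>)" for \<mu>
  proof -
    obtain Q q where Q: "Q \<in> tight_family \<phi>" "\<mu> = measure Q" "range q \<subseteq> \<M>"
      and conv: "\<forall>f. f \<in> borel_measurable (terminal_sigma I) \<longrightarrow> seq_continuous \<tau> f \<longrightarrow>
         (\<exists>B. \<forall>w\<in>topspace \<tau>. \<bar>f w\<bar> \<le> B) \<longrightarrow> (\<lambda>n. \<integral>w. f w \<partial>q n) \<longlonglongrightarrow> (\<integral>w. f w \<partial>Q)"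
      using closure(3)[OF \<mu>] by (elim exE conjE) (rule that)
    interpret UI_limit I \<M> K q Q
    proof (intro UI_limit.intro UI_limit_axioms.intro K)
      show "q n \<in> \<M>" for n using Q(3) by blast
      show "prob_space Q" "sets Q = sets (terminal_sigma I)" using Q(1) by (auto simp: tight_family_def)
      fix f :: "'d path \<Rightarrow> real" and B
      assume f: "f \<in> borel_measurable (terminal_sigma I)" "continuous_map (MZ_topology I) euclideanreal f"
        "\<And>w. w \<in> cadlag_paths I \<Longrightarrow> \<bar>f w\<bar> \<le> B"
      \<comment> \<open>The topology is at least as fine as the Meyer-Zheng topology, so
        \<open>f\<close> is among the functions along which the approximating sequence
        converges.\<close>
      have "continuous_map \<tau> euclideanreal f"
        using f(2) assms(6) unfolding weaker_topology_def continuous_map_def by auto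
      then have "seq_continuous \<tau> f" by (rule continuous_map_imp_seq_continuous)
      moreover have "\<exists>B. \<forall>w\<in>topspace \<tau>. \<bar>f w\<bar> \<le> B" using f(3) assms(2) by auto
      ultimately show "(\<lambda>n. \<integral>w. f w \<partial>q n) \<longlonglongrightarrow> (\<integral>w. f w \<partial>Q)" using conv f(1) by blast
    qed
    show ?thesis using limit_supermartingale_measure Q(2) by blast
  qed
  then show ?thesis using closure(1,2) by blast
qed

end
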